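(* Let $\mathscr{C}$ be a small category and $\mathcal{A}$ an AB4-category. Then for every functor $F:\mathscr{C}^{op}\to\mathcal{A}$ the cubical homology objects $H_n(B^{\Box}\mathscr{C},F\circ\partial^{op})$ are isomorphic to $\varinjlim_n^{\mathscr{C}^{op}}F$, for all $n\ge0$.
   Context: **AB4-category.** An Abelian category with all small coproducts in which coproducts are exact (Grothendieck's axioms AB3, AB4). **Satellites of the colimit.** For a small category $\mathscr{D}$ and an AB4-category $\mathcal{A}$, $\varinjlim^{\mathscr{D}}_n:\mathcal{A}^{\mathscr{D}}\to\mathcal{A}$, $n\ge 0$, denote the left satellites (universal homological $\partial$-functor) of $\varinjlim^{\mathscr{D}}$. It is known that $\varinjlim^{\mathscr{D}}_nF$ is naturally isomorphic to the $n$-th homology of the complex $\bigoplus_{c_0\to\cdots\to c_n}F(c_0)$ with the usual alternating-sum differentials. **Cube category.** $\Box$ has objects $\mathbb{I}^n=\{0,1\}^n$, $n\ge 0$ (with the product order); its morphisms are all compositions of the maps $\delta_i^{k,\varepsilon}:\mathbb{I}^{k-1}\to\mathbb{I}^k$, $\delta_i^{k,\varepsilon}(x_1,\dots,x_{k-1})=(x_1,\dots,x_{i-1},\varepsilon,x_i,\dots,x_{k-1})$ and $\sigma_i^k:\mathbb{I}^k\to\mathbb{I}^{k-1}$, $\sigma^k_i(x_1,\dots,x_k)=(x_1,\dots,x_{i-1},x_{i+1},\dots,x_k)$ ($k\ge1$, $1\le i\le k$, $\varepsilon\in\{0,1\}$) (and identities). A cubical set is a functor $X:\Box^{op}\to\mathrm{Set}$,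 $X_n=X(\mathbb{I}^n)$. **Category $\Box/X$.** Objects: elements $x\in\coprod_n X_n$. For $y\in X_m$, $x\in X_n$, morphisms $y\to x$ are the $\alpha\in\Box(\mathbb{I}^m,\mathbb{I}^n)$ with $X(\alpha)(x)=y$. So $G:(\Box/X)^{op}\to\mathcal{A}$ gives morphisms $G(\alpha):G(x)\to G(X(\alpha)x)$. **Homology $H_n(X,G)$.** Put $C_n(X,G)=\bigoplus_{x\in X_n}G(x)$ with injections $in_x$. Define $d_i^{n,\varepsilon}:C_n(X,G)\to C_{n-1}(X,G)$ by $d_i^{n,\varepsilon}\circ in_x=in_{X(\delta_i^{n,\varepsilon})x}\circ G(\delta_i^{n,\varepsilon})$, and $s_i^n:C_{n-1}(X,G)\to C_n(X,G)$ by $s_i^n\circ in_x=in_{X(\sigma_i^n)x}\circ G(\sigma_i^n)$. Let $C^{N}_n(X,G)=\mathrm{Coker}\big((s_1^n,\dots,s_n^n):C_{n-1}(X,G)^{\oplus n}\to C_n(X,G)\big)$, with differentials induced by $\sum_{i=1}^n(-1)^i(d_i^{n,0}-d_i^{n,1})$. Then $H_n(X,G)$ is the $n$-th homology object of $C^N_*(X,G)$. **Cubical nerve.** $B^{\Box}\mathscr{C}$ is the cubical set with $B^\Box_n\mathscr{C}=\mathrm{Cat}(\mathbb{I}^n,\mathscr{C})$ (functors from the poset $\mathbb{I}^n$), with $\Box$ acting by precomposition. $\Box/B^\Box\mathscr{C}$ is identified with the category $\Box/\mathscr{C}$ whose objects are functors $x:\mathbb{I}^n\to\mathscr{C}$ and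 whose morphisms from $f:\mathbb{I}^m\to\mathscr{C}$ to $g:\mathbb{I}^n\to\mathscr{C}$ are $\theta\in\Box(\mathbb{I}^m,\mathbb{I}^n)$ with $g\theta=f$. The functor $\partial:\Box/\mathscr{C}\to\mathscr{C}$ sends $x:\mathbb{I}^n\to\mathscr{C}$ to $x(1,\dots,1)$, and $\theta:f\to g$ to $g(\theta(1,\dots,1)\le(1,\dots,1)):f(1,\dots,1)\to g(1,\dots,1)$. *)

theory Defs
  imports "HOL-Algebra.FiniteProduct" "HOL-Library.FuncSet" "HOL-Library.Infinite_Typeclass"
begin

section \<open>Categories and functors\<close>

record ('o, 'm) cat =
  Obj :: "'o set"
  Arr :: "'m set"
  Dom :: "'m \<Rightarrow> 'o"
  Cod :: "'m \<Rightarrow> 'o"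
  Ident :: "'o \<Rightarrow> 'm"
  Comp :: "'m \<Rightarrow> 'm \<Rightarrow> 'm"  \<comment> \<open>\<open>Comp C g f\<close> is "\<open>g\<close> after \<open>f\<close>"\<close>

definition Hom :: "('o, 'm, 'z) cat_scheme \<Rightarrow> 'o \<Rightarrow> 'o \<Rightarrow> 'm set" where
  "Hom C x y = {f \<in> Arr C. Dom C f = x \<and> Cod C f = y}"

locale category =
  fixes C :: "('o, 'm, 'z) cat_scheme"
  assumes Dom_Obj: "f \<in> Arr C \<Longrightarrow> Dom C f \<in> Obj C"
    and Cod_Obj: "f \<in> Arr C \<Longrightarrow> Cod C f \<in> Obj C"
    and Ident_Hom: "x \<in> Obj C \<Longrightarrow> Ident C x \<in> Hom C x x"
    and Comp_Hom: "\<lbrakk>f \<in> Hom C x y; g \<in> Hom C y z\<rbrakk> \<Longrightarrow> Comp C g f \<in> Hom C x z"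
    and Comp_Ident_right: "f \<in> Hom C x y \<Longrightarrow> Comp C f (Ident C x) = f"
    and Comp_Ident_left: "f \<in> Hom C x y \<Longrightarrow> Comp C (Ident C y) f = f"
    and Comp_assoc: "\<lbrakk>f \<in> Hom C w x; g \<in> Hom C x y; h \<in> Hom C y z\<rbrakk>
      \<Longrightarrow> Comp C h (Comp C g f) = Comp C (Comp C h g) f"

text \<open>
  HOL has no type of all small sets, so smallness is relative to a type \<open>'u\<close>, which plays the
  role of the universe: a set is small if it embeds into \<open>'u\<close>, and every small coproduct is,
  up to reindexing, indexed by a subset of \<open>'u\<close>. Theorems are stated for every
  infinite type \<open>'u\<close>.
\<close>

definition small :: "'u itself \<Rightarrow> 'x set \<Rightarrow> bool" where
  "small U S \<longleftrightarrow> (\<exists>f :: 'x \<Rightarrow> 'u. inj_on f S)"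

definition small_category :: "'u itself \<Rightarrow> ('o, 'm, 'z) cat_scheme \<Rightarrow> bool" where
  "small_category U C \<longleftrightarrow> category C \<and> small U (Obj C) \<and> small U (Arr C)"

definition op_cat :: "('o, 'm, 'z) cat_scheme \<Rightarrow> ('o, 'm) cat" where
  "op_cat C = \<lparr>Obj = Obj C, Arr = Arr C, Dom = Cod C, Cod = Dom C, Ident = Ident C,
    Comp = (\<lambda>g f. Comp C f g)\<rparr>"

record ('o, 'm, 'p, 'n) cfunctor =
  FObj :: "'o \<Rightarrow> 'p"
  FArr :: "'m \<Rightarrow> 'n"

text \<open>
  Both components of a functor are required to be extensional, so that equality in HOL is equality
  of functors. The opposite of a functor is given by the same pair of maps.
\<close>

definition is_functor ::
  "('o, 'm, 'y) cat_scheme \<Rightarrow> ('p, 'n, 'z) cat_scheme \<Rightarrow> ('o, 'm, 'p, 'n) cfunctor \<Rightarrow> bool" where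
  "is_functor C D F \<longleftrightarrow>
     FObj F \<in> Obj C \<rightarrow>\<^sub>E Obj D \<and> FArr F \<in> extensional (Arr C) \<and>
     (\<forall>f\<in>Arr C. FArr F f \<in> Hom D (FObj F (Dom C f)) (FObj F (Cod C f))) \<and>
     (\<forall>x\<in>Obj C. FArr F (Ident C x) = Ident D (FObj F x)) \<and>
     (\<forall>f\<in>Arr C. \<forall>g\<in>Arr C. Cod C f = Dom C g \<longrightarrow>
        FArr F (Comp C g f) = Comp D (FArr F g) (FArr F f))"

text \<open>The first argument is the domain of \<open>F\<close>, needed for extensionality.\<close>

definition functor_comp :: "('o, 'm, 'z) cat_scheme \<Rightarrow> ('p, 'n, 'q, 'l) cfunctor
    \<Rightarrow> ('o, 'm, 'p, 'n) cfunctor \<Rightarrow> ('o, 'm, 'q, 'l) cfunctor" where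
  "functor_comp C G F =
     \<lparr>FObj = (\<lambda>x\<in>Obj C. FObj G (FObj F x)), FArr = (\<lambda>f\<in>Arr C. FArr G (FArr F f))\<rparr>"

definition isomorphic :: "('o, 'm, 'z) cat_scheme \<Rightarrow> 'o \<Rightarrow> 'o \<Rightarrow> bool" where
  "isomorphic C x y \<longleftrightarrow> (\<exists>f\<in>Hom C x y. \<exists>g\<in>Hom C y x.
     Comp C g f = Ident C x \<and> Comp C f g = Ident C y)"

definition is_mono :: "('o, 'm, 'z) cat_scheme \<Rightarrow> 'm \<Rightarrow> bool" where
  "is_mono C f \<longleftrightarrow> f \<in> Arr C \<and>
     (\<forall>w\<in>Obj C. \<forall>g\<in>Hom C w (Dom C f). \<forall>h\<in>Hom C w (Dom C f). Comp C f g = Comp C f h \<longrightarrow> g = h)"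

definition is_epi :: "('o, 'm, 'z) cat_scheme \<Rightarrow> 'm \<Rightarrow> bool" where
  "is_epi C f \<longleftrightarrow> f \<in> Arr C \<and>
     (\<forall>w\<in>Obj C. \<forall>g\<in>Hom C (Cod C f) w. \<forall>h\<in>Hom C (Cod C f) w. Comp C g f = Comp C h f \<longrightarrow> g = h)"

definition is_coproduct ::
  "('o, 'm, 'z) cat_scheme \<Rightarrow> 'i set \<Rightarrow> ('i \<Rightarrow> 'o) \<Rightarrow> 'o \<Rightarrow> ('i \<Rightarrow> 'm) \<Rightarrow> bool" where
  "is_coproduct C I X P \<iota> \<longleftrightarrow>
     P \<in> Obj C \<and> (\<forall>i\<in>I. X i \<in> Obj C \<and> \<iota> i \<in> Hom C (X i) P) \<and>
     (\<forall>Y\<in>Obj C. \<forall>g. (\<forall>i\<in>I. g i \<in> Hom C (X i) Y) \<longrightarrow>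
        (\<exists>!h. h \<in> Hom C P Y \<and> (\<forall>i\<in>I. Comp C h (\<iota> i) = g i)))"

definition is_colimit :: "('d, 'e, 'y) cat_scheme \<Rightarrow> ('o, 'm, 'z) cat_scheme
    \<Rightarrow> ('d, 'e, 'o, 'm) cfunctor \<Rightarrow> 'o \<Rightarrow> ('d \<Rightarrow> 'm) \<Rightarrow> bool" where
  "is_colimit D A F L \<iota> \<longleftrightarrow>
     L \<in> Obj A \<and> (\<forall>d\<in>Obj D. \<iota> d \<in> Hom A (FObj F d) L) \<and>
     (\<forall>e\<in>Arr D. Comp A (\<iota> (Cod D e)) (FArr F e) = \<iota> (Dom D e)) \<and>
     (\<forall>Y\<in>Obj A. \<forall>g. (\<forall>d\<in>Obj D. g d \<in> Hom A (FObj F d) Y) \<and>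
          (\<forall>e\<in>Arr D. Comp A (g (Cod D e)) (FArr F e) = g (Dom D e)) \<longrightarrow>
        (\<exists>!h. h \<in> Hom A L Y \<and> (\<forall>d\<in>Obj D. Comp A h (\<iota> d) = g d)))"

section \<open>Abelian categories and AB4\<close>

record ('o, 'm) abcat = "('o, 'm) cat" +
  Add :: "'m \<Rightarrow> 'm \<Rightarrow> 'm"
  Zro :: "'o \<Rightarrow> 'o \<Rightarrow> 'm"

text \<open>
  The abelian groups of morphisms, as structures of \<open>HOL-Algebra\<close>; these are written
  multiplicatively there.
\<close>

definition hom_group :: "('o, 'm, 'z) abcat_scheme \<Rightarrow> 'o \<Rightarrow> 'o \<Rightarrow> 'm monoid" where
  "hom_group A x y = \<lparr>carrier = Hom A x y, mult = Add A, one = Zro A x y\<rparr>"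

locale preadditive_category = category A for A :: "('o, 'm, 'z) abcat_scheme" +
  assumes hom_comm_group: "\<lbrakk>x \<in> Obj A; y \<in> Obj A\<rbrakk> \<Longrightarrow> comm_group (hom_group A x y)"
    and Comp_Add_left: "\<lbrakk>f \<in> Hom A x y; g \<in> Hom A y z; h \<in> Hom A y z\<rbrakk>
      \<Longrightarrow> Comp A (Add A g h) f = Add A (Comp A g f) (Comp A h f)"
    and Comp_Add_right: "\<lbrakk>f \<in> Hom A x y; g \<in> Hom A x y; h \<in> Hom A y z\<rbrakk>
      \<Longrightarrow> Comp A h (Add A f g) = Add A (Comp A h f) (Comp A h g)"

definition is_zero_object :: "('o, 'm, 'z) cat_scheme \<Rightarrow> 'o \<Rightarrow> bool" where
  "is_zero_object A z \<longleftrightarrow>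
     z \<in> Obj A \<and> (\<forall>x\<in>Obj A. (\<exists>!f. f \<in> Hom A x z) \<and> (\<exists>!f. f \<in> Hom A z x))"

definition is_biproduct ::
  "('o, 'm, 'z) abcat_scheme \<Rightarrow> 'o \<Rightarrow> 'o \<Rightarrow> 'o \<Rightarrow> 'm \<Rightarrow> 'm \<Rightarrow> 'm \<Rightarrow> 'm \<Rightarrow> bool" where
  "is_biproduct A x y b i j p q \<longleftrightarrow>
     b \<in> Obj A \<and> i \<in> Hom A x b \<and> j \<in> Hom A y b \<and> p \<in> Hom A b x \<and> q \<in> Hom A b y \<and>
     Comp A p i = Ident A x \<and> Comp A q j = Ident A y \<and>
     Add A (Comp A i p) (Comp A j q) = Ident A b"

definition is_kernel :: "('o, 'm, 'z) abcat_scheme \<Rightarrow> 'm \<Rightarrow> 'm \<Rightarrow> bool" where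
  "is_kernel A f k \<longleftrightarrow> f \<in> Arr A \<and> k \<in> Arr A \<and> Cod A k = Dom A f \<and>
     Comp A f k = Zro A (Dom A k) (Cod A f) \<and>
     (\<forall>w\<in>Obj A. \<forall>h\<in>Hom A w (Dom A f). Comp A f h = Zro A w (Cod A f) \<longrightarrow>
        (\<exists>!h'. h' \<in> Hom A w (Dom A k) \<and> Comp A k h' = h))"

definition is_cokernel :: "('o, 'm, 'z) abcat_scheme \<Rightarrow> 'm \<Rightarrow> 'm \<Rightarrow> bool" where
  "is_cokernel A f q \<longleftrightarrow> f \<in> Arr A \<and> q \<in> Arr A \<and> Dom A q = Cod A f \<and>
     Comp A q f = Zro A (Dom A f) (Cod A q) \<and>
     (\<forall>w\<in>Obj A. \<forall>h\<in>Hom A (Cod A f) w. Comp A h f = Zro A (Dom A f) w \<longrightarrow>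
        (\<exists>!h'. h' \<in> Hom A (Cod A q) w \<and> Comp A h' q = h))"

locale abelian_category = preadditive_category A for A :: "('o, 'm, 'z) abcat_scheme" +
  assumes ex_zero_object: "\<exists>z. is_zero_object A z"
    and ex_biproduct: "\<lbrakk>x \<in> Obj A; y \<in> Obj A\<rbrakk> \<Longrightarrow> \<exists>b i j p q. is_biproduct A x y b i j p q"
    and ex_kernel: "f \<in> Arr A \<Longrightarrow> \<exists>k. is_kernel A f k"
    and ex_cokernel: "f \<in> Arr A \<Longrightarrow> \<exists>q. is_cokernel A f q"
    and mono_is_kernel: "is_mono A f \<Longrightarrow> \<exists>g. is_kernel A g f"
    and epi_is_cokernel: "is_epi A f \<Longrightarrow> \<exists>g. is_cokernel A g f"

definition short_exact :: "('o, 'm, 'z) abcat_scheme \<Rightarrow> 'm \<Rightarrow> 'm \<Rightarrow> bool" where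
  "short_exact A f g \<longleftrightarrow> is_kernel A g f \<and> is_cokernel A f g"

text \<open>The image of \<open>f\<close> is the kernel of the cokernel of \<open>f\<close>.\<close>

definition is_image :: "('o, 'm, 'z) abcat_scheme \<Rightarrow> 'm \<Rightarrow> 'm \<Rightarrow> bool" where
  "is_image A f m \<longleftrightarrow> (\<exists>q. is_cokernel A f q \<and> is_kernel A q m)"

definition exact :: "('o, 'm, 'z) abcat_scheme \<Rightarrow> 'm \<Rightarrow> 'm \<Rightarrow> bool" where
  "exact A f g \<longleftrightarrow> f \<in> Arr A \<and> g \<in> Arr A \<and> Cod A f = Dom A g \<and>
     (\<exists>m. is_image A f m \<and> is_kernel A g m)"

definition has_small_coproducts :: "'u itself \<Rightarrow> ('o, 'm, 'z) cat_scheme \<Rightarrow> bool" where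
  "has_small_coproducts U A \<longleftrightarrow>
     (\<forall>(I :: 'u set) X. (\<forall>i\<in>I. X i \<in> Obj A) \<longrightarrow> (\<exists>P \<iota>. is_coproduct A I X P \<iota>))"

definition small_coproducts_exact :: "'u itself \<Rightarrow> ('o, 'm, 'z) abcat_scheme \<Rightarrow> bool" where
  "small_coproducts_exact U A \<longleftrightarrow>
     (\<forall>(I :: 'u set) X Y Z f g P \<iota> Q \<kappa> R \<mu> p q.
        (\<forall>i\<in>I. f i \<in> Hom A (X i) (Y i) \<and> g i \<in> Hom A (Y i) (Z i) \<and> short_exact A (f i) (g i)) \<and>
        is_coproduct A I X P \<iota> \<and> is_coproduct A I Y Q \<kappa> \<and> is_coproduct A I Z R \<mu> \<and>
        p \<in> Hom A P Q \<and> (\<forall>i\<in>I. Comp A p (\<iota> i) = Comp A (\<kappa> i) (f i)) \<and>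
        q \<in> Hom A Q R \<and> (\<forall>i\<in>I. Comp A q (\<kappa> i) = Comp A (\<mu> i) (g i)) \<longrightarrow>
        short_exact A p q)"

definition AB4_category :: "'u itself \<Rightarrow> ('o, 'm, 'z) abcat_scheme \<Rightarrow> bool" where
  "AB4_category U A \<longleftrightarrow>
     abelian_category A \<and> has_small_coproducts U A \<and> small_coproducts_exact U A"

section \<open>Functor categories, homological \<open>\<partial>\<close>-functors and satellites of the colimit\<close>

text \<open>
  In several concrete categories below a morphism is a triple of its domain, the underlying data,
  and its codomain.
\<close>

type_synonym ('o, 'd) arrow = "'o \<times> 'd \<times> 'o"

type_synonym ('d, 'e, 'o, 'm) nat_trans = "(('d, 'e, 'o, 'm) cfunctor, 'd \<Rightarrow> 'm) arrow"

definition component :: "('d, 'e, 'o, 'm) nat_trans \<Rightarrow> 'd \<Rightarrow> 'm" where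
  "component = (\<lambda>(F, \<eta>, G). \<eta>)"

definition is_nat_trans :: "('d, 'e, 'y) cat_scheme \<Rightarrow> ('o, 'm, 'z) cat_scheme
    \<Rightarrow> ('d, 'e, 'o, 'm) nat_trans \<Rightarrow> bool" where
  "is_nat_trans D A = (\<lambda>(F, \<eta>, G).
     is_functor D A F \<and> is_functor D A G \<and> \<eta> \<in> extensional (Obj D) \<and>
     (\<forall>d\<in>Obj D. \<eta> d \<in> Hom A (FObj F d) (FObj G d)) \<and>
     (\<forall>e\<in>Arr D. Comp A (\<eta> (Cod D e)) (FArr F e) = Comp A (FArr G e) (\<eta> (Dom D e))))"

definition functor_category :: "('d, 'e, 'y) cat_scheme \<Rightarrow> ('o, 'm, 'z) abcat_scheme
    \<Rightarrow> (('d, 'e, 'o, 'm) cfunctor, ('d, 'e, 'o, 'm) nat_trans) abcat" where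
  "functor_category D A =
     \<lparr>Obj = {F. is_functor D A F},
      Arr = {\<alpha>. is_nat_trans D A \<alpha>},
      Dom = (\<lambda>(F, \<eta>, G). F),
      Cod = (\<lambda>(F, \<eta>, G). G),
      Ident = (\<lambda>F. (F, \<lambda>d\<in>Obj D. Ident A (FObj F d), F)),
      Comp = (\<lambda>(_, \<theta>, H) (F, \<eta>, _). (F, \<lambda>d\<in>Obj D. Comp A (\<theta> d) (\<eta> d), H)),
      Add = (\<lambda>(F, \<eta>, G) (_, \<theta>, _). (F, \<lambda>d\<in>Obj D. Add A (\<eta> d) (\<theta> d), G)),
      Zro = (\<lambda>F G. (F, \<lambda>d\<in>Obj D. Zro A (FObj F d) (FObj G d), G))\<rparr>"

definition is_additive_functor :: "('k, 'l, 'y) abcat_scheme \<Rightarrow> ('o, 'm, 'z) abcat_scheme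
    \<Rightarrow> ('k, 'l, 'o, 'm) cfunctor \<Rightarrow> bool" where
  "is_additive_functor K A T \<longleftrightarrow> is_functor K A T \<and>
     (\<forall>x\<in>Obj K. \<forall>y\<in>Obj K. \<forall>f\<in>Hom K x y. \<forall>g\<in>Hom K x y.
        FArr T (Add K f g) = Add A (FArr T f) (FArr T g))"

text \<open>
  A homological \<open>\<partial>\<close>-functor assigns to every short exact sequence
  \<open>0 \<rightarrow> X \<rightarrow> Y \<rightarrow> Z \<rightarrow> 0\<close>, given by \<open>f : X \<rightarrow> Y\<close> and \<open>g : Y \<rightarrow> Z\<close>, connecting morphisms
  \<open>\<delta> n f g : T (n+1) Z \<rightarrow> T n X\<close>, natural in the sequence, such that the long sequence, ending in
  \<open>T 0 Y \<rightarrow> T 0 Z \<rightarrow> 0\<close>, is exact.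
\<close>

definition homological_partial_functor ::
  "('k, 'l, 'y) abcat_scheme \<Rightarrow> ('o, 'm, 'z) abcat_scheme
    \<Rightarrow> (nat \<Rightarrow> ('k, 'l, 'o, 'm) cfunctor) \<Rightarrow> (nat \<Rightarrow> 'l \<Rightarrow> 'l \<Rightarrow> 'm) \<Rightarrow> bool" where
  "homological_partial_functor K A T \<delta> \<longleftrightarrow>
     (\<forall>n. is_additive_functor K A (T n)) \<and>
     (\<forall>f g. short_exact K f g \<longrightarrow>
        (\<forall>n. \<delta> n f g \<in> Hom A (FObj (T (Suc n)) (Cod K g)) (FObj (T n) (Dom K f))) \<and>
        (\<forall>n. exact A (FArr (T n) f) (FArr (T n) g)) \<and>
        (\<forall>n. exact A (FArr (T (Suc n)) g) (\<delta> n f g)) \<and>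
        (\<forall>n. exact A (\<delta> n f g) (FArr (T n) f)) \<and>
        is_epi A (FArr (T 0) g)) \<and>
     (\<forall>f g f' g' a b c. short_exact K f g \<and> short_exact K f' g' \<and>
        a \<in> Hom K (Dom K f) (Dom K f') \<and> b \<in> Hom K (Cod K f) (Cod K f') \<and>
        c \<in> Hom K (Cod K g) (Cod K g') \<and>
        Comp K b f = Comp K f' a \<and> Comp K c g = Comp K g' b \<longrightarrow>
        (\<forall>n. Comp A (\<delta> n f' g') (FArr (T (Suc n)) c) = Comp A (FArr (T n) a) (\<delta> n f g)))"

definition partial_functor_morphism ::
  "('k, 'l, 'y) abcat_scheme \<Rightarrow> ('o, 'm, 'z) abcat_scheme
    \<Rightarrow> (nat \<Rightarrow> ('k, 'l, 'o, 'm) cfunctor) \<Rightarrow> (nat \<Rightarrow> 'l \<Rightarrow> 'l \<Rightarrow> 'm)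
    \<Rightarrow> (nat \<Rightarrow> ('k, 'l, 'o, 'm) cfunctor) \<Rightarrow> (nat \<Rightarrow> 'l \<Rightarrow> 'l \<Rightarrow> 'm)
    \<Rightarrow> (nat \<Rightarrow> ('k, 'l, 'o, 'm) nat_trans) \<Rightarrow> bool" where
  "partial_functor_morphism K A S \<epsilon> T \<delta> \<phi> \<longleftrightarrow>
     (\<forall>n. \<phi> n \<in> Hom (functor_category K A) (S n) (T n)) \<and>
     (\<forall>f g n. short_exact K f g \<longrightarrow>
        Comp A (\<delta> n f g) (component (\<phi> (Suc n)) (Cod K g)) =
        Comp A (component (\<phi> n) (Dom K f)) (\<epsilon> n f g))"

definition universal_homological_partial_functor ::
  "('k, 'l, 'y) abcat_scheme \<Rightarrow> ('o, 'm, 'z) abcat_scheme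
    \<Rightarrow> (nat \<Rightarrow> ('k, 'l, 'o, 'm) cfunctor) \<Rightarrow> (nat \<Rightarrow> 'l \<Rightarrow> 'l \<Rightarrow> 'm) \<Rightarrow> bool" where
  "universal_homological_partial_functor K A T \<delta> \<longleftrightarrow>
     homological_partial_functor K A T \<delta> \<and>
     (\<forall>S \<epsilon> \<alpha>. homological_partial_functor K A S \<epsilon> \<and>
        \<alpha> \<in> Hom (functor_category K A) (S 0) (T 0) \<longrightarrow>
        (\<exists>!\<phi>. partial_functor_morphism K A S \<epsilon> T \<delta> \<phi> \<and> \<phi> 0 = \<alpha>))"

definition is_colimit_functor :: "('d, 'e, 'y) cat_scheme \<Rightarrow> ('o, 'm, 'z) abcat_scheme
    \<Rightarrow> (('d, 'e, 'o, 'm) cfunctor, ('d, 'e, 'o, 'm) nat_trans, 'o, 'm) cfunctor \<Rightarrow> bool" where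
  "is_colimit_functor D A L \<longleftrightarrow> is_functor (functor_category D A) A L \<and>
     (\<exists>\<iota>. (\<forall>F. is_functor D A F \<longrightarrow> is_colimit D A F (FObj L F) (\<iota> F)) \<and>
        (\<forall>F \<eta> G. is_nat_trans D A (F, \<eta>, G) \<longrightarrow>
           (\<forall>d\<in>Obj D. Comp A (FArr L (F, \<eta>, G)) (\<iota> F d) = Comp A (\<iota> G d) (\<eta> d))))"

text \<open>
  \<open>T n\<close> is the \<open>n\<close>-th left satellite of the colimit functor \<open>A\<^sup>D \<rightarrow> A\<close>; the family
  is determined up to a unique isomorphism of \<open>\<partial>\<close>-functors over the colimit functor.
\<close>

definition left_satellites_of_colimit :: "('d, 'e, 'y) cat_scheme \<Rightarrow> ('o, 'm, 'z) abcat_scheme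
    \<Rightarrow> (nat \<Rightarrow> (('d, 'e, 'o, 'm) cfunctor, ('d, 'e, 'o, 'm) nat_trans, 'o, 'm) cfunctor)
    \<Rightarrow> (nat \<Rightarrow> ('d, 'e, 'o, 'm) nat_trans \<Rightarrow> ('d, 'e, 'o, 'm) nat_trans \<Rightarrow> 'm) \<Rightarrow> bool" where
  "left_satellites_of_colimit D A T \<delta> \<longleftrightarrow>
     universal_homological_partial_functor (functor_category D A) A T \<delta> \<and>
     is_colimit_functor D A (T 0)"

section \<open>The cube category and cubical sets\<close>

text \<open>The coordinates 0 and 1 are the Booleans \<open>False\<close> and \<open>True\<close>.\<close>

definition cube :: "nat \<Rightarrow> bool list set" where
  "cube n = {x. length x = n}"

definition cube_poset :: "nat \<Rightarrow> (bool list, bool list \<times> bool list) cat" where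
  "cube_poset n =
     \<lparr>Obj = cube n,
      Arr = {(x, y). x \<in> cube n \<and> y \<in> cube n \<and> list_all2 (\<le>) x y},
      Dom = (\<lambda>(x, y). x),
      Cod = (\<lambda>(x, y). y),
      Ident = (\<lambda>x. (x, x)),
      Comp = (\<lambda>(_, z) (x, _). (x, z))\<rparr>"

type_synonym cube_map = "(nat, bool list \<Rightarrow> bool list) arrow"

definition face_map :: "nat \<Rightarrow> nat \<Rightarrow> bool \<Rightarrow> cube_map" where
  "face_map k i \<epsilon> = (k - 1, \<lambda>x\<in>cube (k - 1). take (i - 1) x @ \<epsilon> # drop (i - 1) x, k)"

definition degeneracy_map :: "nat \<Rightarrow> nat \<Rightarrow> cube_map" where
  "degeneracy_map k i = (k, \<lambda>x\<in>cube k. take (i - 1) x @ drop i x, k - 1)"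

inductive_set cube_maps :: "cube_map set" where
  ident: "(n, \<lambda>x\<in>cube n. x, n) \<in> cube_maps"
| face: "\<lbrakk>1 \<le> i; i \<le> k\<rbrakk> \<Longrightarrow> face_map k i \<epsilon> \<in> cube_maps"
| degeneracy: "\<lbrakk>1 \<le> i; i \<le> k\<rbrakk> \<Longrightarrow> degeneracy_map k i \<in> cube_maps"
| comp: "\<lbrakk>(l, f, m) \<in> cube_maps; (m, g, n) \<in> cube_maps\<rbrakk>
    \<Longrightarrow> (l, compose (cube l) g f, n) \<in> cube_maps"

definition cube_category :: "(nat, cube_map) cat" where
  "cube_category =
     \<lparr>Obj = UNIV,
      Arr = cube_maps,
      Dom = (\<lambda>(m, f, n). m),
      Cod = (\<lambda>(m, f, n). n),
      Ident = (\<lambda>n. (n, \<lambda>x\<in>cube n. x, n)),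
      Comp = (\<lambda>(_, g, n) (l, f, _). (l, compose (cube l) g f, n))\<rparr>"

definition set_category :: "('x set, ('x set, 'x \<Rightarrow> 'x) arrow) cat" where
  "set_category =
     \<lparr>Obj = UNIV,
      Arr = {(S, f, T). f \<in> S \<rightarrow>\<^sub>E T},
      Dom = (\<lambda>(S, f, T). S),
      Cod = (\<lambda>(S, f, T). T),
      Ident = (\<lambda>S. (S, \<lambda>x\<in>S. x, S)),
      Comp = (\<lambda>(_, g, T) (R, f, _). (R, compose R g f, T))\<rparr>"

type_synonym 'x cubical_set = "(nat, cube_map, 'x set, ('x set, 'x \<Rightarrow> 'x) arrow) cfunctor"

definition is_cubical_set :: "'x cubical_set \<Rightarrow> bool" where
  "is_cubical_set X \<longleftrightarrow> is_functor (op_cat cube_category) set_category X"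

abbreviation cells :: "'x cubical_set \<Rightarrow> nat \<Rightarrow> 'x set" where
  "cells X n \<equiv> FObj X n"

definition act :: "'x cubical_set \<Rightarrow> cube_map \<Rightarrow> 'x \<Rightarrow> 'x" where
  "act X \<alpha> = (case FArr X \<alpha> of (S, f, T) \<Rightarrow> f)"

text \<open>The category \<open>\<box>/X\<close> of cubes of \<open>X\<close>.\<close>

definition cubes_over ::
  "'x cubical_set \<Rightarrow> (nat \<times> 'x, (nat \<times> 'x, cube_map) arrow) cat" where
  "cubes_over X =
     \<lparr>Obj = (SIGMA n:UNIV. cells X n),
      Arr = {((m, y), \<alpha>, (n, x)) | m y \<alpha> n x.
               y \<in> cells X m \<and> x \<in> cells X n \<and> \<alpha> \<in> Hom cube_category m n \<and> act X \<alpha> x = y},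
      Dom = (\<lambda>(w, \<alpha>, z). w),
      Cod = (\<lambda>(w, \<alpha>, z). z),
      Ident = (\<lambda>(n, x). ((n, x), Ident cube_category n, (n, x))),
      Comp = (\<lambda>(_, \<beta>, z) (w, \<alpha>, _). (w, Comp cube_category \<beta> \<alpha>, z))\<rparr>"

text \<open>The morphism \<open>\<alpha> : X(\<alpha>)x \<rightarrow> x\<close> of \<open>\<box>/X\<close>.\<close>

definition arrow_over :: "'x cubical_set \<Rightarrow> cube_map \<Rightarrow> 'x \<Rightarrow> (nat \<times> 'x, cube_map) arrow" where
  "arrow_over X \<alpha> x =
     ((Dom cube_category \<alpha>, act X \<alpha> x), \<alpha>, (Cod cube_category \<alpha>, x))"

section \<open>Homology of a cubical set with coefficients\<close>

text \<open>
  Coproducts, kernels and cokernels are chosen by Hilbert choice; the choices are meaningful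
  whenever such objects exist.
\<close>

definition coproduct ::
  "('o, 'm, 'z) cat_scheme \<Rightarrow> 'i set \<Rightarrow> ('i \<Rightarrow> 'o) \<Rightarrow> 'o \<times> ('i \<Rightarrow> 'm)" where
  "coproduct A I X = (SOME (P, \<iota>). is_coproduct A I X P \<iota>)"

definition coproduct_ob :: "('o, 'm, 'z) cat_scheme \<Rightarrow> 'i set \<Rightarrow> ('i \<Rightarrow> 'o) \<Rightarrow> 'o" where
  "coproduct_ob A I X = fst (coproduct A I X)"

definition coproduct_in :: "('o, 'm, 'z) cat_scheme \<Rightarrow> 'i set \<Rightarrow> ('i \<Rightarrow> 'o) \<Rightarrow> 'i \<Rightarrow> 'm" where
  "coproduct_in A I X = snd (coproduct A I X)"

definition cotuple ::
  "('o, 'm, 'z) cat_scheme \<Rightarrow> 'i set \<Rightarrow> ('i \<Rightarrow> 'o) \<Rightarrow> 'o \<Rightarrow> ('i \<Rightarrow> 'm) \<Rightarrow> 'm" where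
  "cotuple A I X Y g = (THE h. h \<in> Hom A (coproduct_ob A I X) Y \<and>
     (\<forall>i\<in>I. Comp A h (coproduct_in A I X i) = g i))"

definition ker :: "('o, 'm, 'z) abcat_scheme \<Rightarrow> 'm \<Rightarrow> 'm" where
  "ker A f = (SOME k. is_kernel A f k)"

definition coker :: "('o, 'm, 'z) abcat_scheme \<Rightarrow> 'm \<Rightarrow> 'm" where
  "coker A f = (SOME q. is_cokernel A f q)"

text \<open>The homology of \<open>f : X \<rightarrow> Y\<close>, \<open>g : Y \<rightarrow> Z\<close> with \<open>g f = 0\<close> is \<open>Coker (X \<rightarrow> Ker g)\<close>.\<close>

definition homology_ob :: "('o, 'm, 'z) abcat_scheme \<Rightarrow> 'm \<Rightarrow> 'm \<Rightarrow> 'o" where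
  "homology_ob A f g =
     Cod A (coker A (THE h. h \<in> Hom A (Dom A f) (Dom A (ker A g)) \<and> Comp A (ker A g) h = f))"

text \<open>
  Below, \<open>A\<close> is an abelian category, \<open>X\<close> a cubical set and \<open>G : (\<box>/X)\<^sup>o\<^sup>p \<rightarrow> A\<close> a functor.
\<close>

definition chain_ob :: "('o, 'm, 'z) abcat_scheme \<Rightarrow> 'x cubical_set
    \<Rightarrow> (nat \<times> 'x, (nat \<times> 'x, cube_map) arrow, 'o, 'm) cfunctor \<Rightarrow> nat \<Rightarrow> 'o" where
  "chain_ob A X G n = coproduct_ob A (cells X n) (\<lambda>x. FObj G (n, x))"

definition chain_in :: "('o, 'm, 'z) abcat_scheme \<Rightarrow> 'x cubical_set
    \<Rightarrow> (nat \<times> 'x, (nat \<times> 'x, cube_map) arrow, 'o, 'm) cfunctor \<Rightarrow> nat \<Rightarrow> 'x \<Rightarrow> 'm" where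
  "chain_in A X G n = coproduct_in A (cells X n) (\<lambda>x. FObj G (n, x))"

text \<open>
  A cube map \<open>\<alpha> : I\<^sup>m \<rightarrow> I\<^sup>n\<close> induces \<open>C\<^sub>n(X,G) \<rightarrow> C\<^sub>m(X,G)\<close>; the
  morphisms \<open>d\<close> and \<open>s\<close> are the cases of face and degeneracy maps.
\<close>

definition chain_map :: "('o, 'm, 'z) abcat_scheme \<Rightarrow> 'x cubical_set
    \<Rightarrow> (nat \<times> 'x, (nat \<times> 'x, cube_map) arrow, 'o, 'm) cfunctor \<Rightarrow> cube_map \<Rightarrow> 'm" where
  "chain_map A X G \<alpha> = (let m = Dom cube_category \<alpha>; n = Cod cube_category \<alpha> in
     cotuple A (cells X n) (\<lambda>x. FObj G (n, x)) (chain_ob A X G m)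
       (\<lambda>x. Comp A (chain_in A X G m (act X \<alpha> x)) (FArr G (arrow_over X \<alpha> x))))"

definition chain_face :: "('o, 'm, 'z) abcat_scheme \<Rightarrow> 'x cubical_set
    \<Rightarrow> (nat \<times> 'x, (nat \<times> 'x, cube_map) arrow, 'o, 'm) cfunctor
    \<Rightarrow> nat \<Rightarrow> nat \<Rightarrow> bool \<Rightarrow> 'm" where
  "chain_face A X G n i \<epsilon> = chain_map A X G (face_map n i \<epsilon>)"

definition chain_degeneracy :: "('o, 'm, 'z) abcat_scheme \<Rightarrow> 'x cubical_set
    \<Rightarrow> (nat \<times> 'x, (nat \<times> 'x, cube_map) arrow, 'o, 'm) cfunctor \<Rightarrow> nat \<Rightarrow> nat \<Rightarrow> 'm" where
  "chain_degeneracy A X G n i = chain_map A X G (degeneracy_map n i)"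

text \<open>
  The quotient morphism from \<open>C\<^sub>n(X,G)\<close> onto its normalization. For \<open>n = 0\<close> the cotuple is
  the morphism from the empty coproduct, so that nothing is divided out.
\<close>

definition normalization :: "('o, 'm, 'z) abcat_scheme \<Rightarrow> 'x cubical_set
    \<Rightarrow> (nat \<times> 'x, (nat \<times> 'x, cube_map) arrow, 'o, 'm) cfunctor \<Rightarrow> nat \<Rightarrow> 'm" where
  "normalization A X G n =
     coker A (cotuple A {1..n} (\<lambda>_. chain_ob A X G (n - 1)) (chain_ob A X G n)
       (chain_degeneracy A X G n))"

definition normalized_chain_ob :: "('o, 'm, 'z) abcat_scheme \<Rightarrow> 'x cubical_set
    \<Rightarrow> (nat \<times> 'x, (nat \<times> 'x, cube_map) arrow, 'o, 'm) cfunctor \<Rightarrow> nat \<Rightarrow> 'o" where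
  "normalized_chain_ob A X G n = Cod A (normalization A X G n)"

text \<open>
  The alternating sum \<open>\<Sum>i=1..n. (-1)^i (d\<^sub>i\<^sup>0 - d\<^sub>i\<^sup>1)\<close>, in multiplicative notation. For \<open>n = 0\<close> it is the
  zero endomorphism of \<open>C\<^sub>0(X,G)\<close> (as \<open>0 - 1 = 0\<close>), which serves as the differential out of
  degree 0: only its kernel matters for the homology.
\<close>

definition chain_differential :: "('o, 'm, 'z) abcat_scheme \<Rightarrow> 'x cubical_set
    \<Rightarrow> (nat \<times> 'x, (nat \<times> 'x, cube_map) arrow, 'o, 'm) cfunctor \<Rightarrow> nat \<Rightarrow> 'm" where
  "chain_differential A X G n =
     (let H = hom_group A (chain_ob A X G n) (chain_ob A X G (n - 1)) in
       finprod H (\<lambda>i.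
         (chain_face A X G n i False \<otimes>\<^bsub>H\<^esub> inv\<^bsub>H\<^esub> chain_face A X G n i True) [^]\<^bsub>H\<^esub> ((-1 :: int) ^ i))
         {1..n})"

definition normalized_differential :: "('o, 'm, 'z) abcat_scheme \<Rightarrow> 'x cubical_set
    \<Rightarrow> (nat \<times> 'x, (nat \<times> 'x, cube_map) arrow, 'o, 'm) cfunctor \<Rightarrow> nat \<Rightarrow> 'm" where
  "normalized_differential A X G n =
     (THE d. d \<in> Hom A (normalized_chain_ob A X G n) (normalized_chain_ob A X G (n - 1)) \<and>
        Comp A d (normalization A X G n) =
        Comp A (normalization A X G (n - 1)) (chain_differential A X G n))"

definition cubical_homology :: "('o, 'm, 'z) abcat_scheme \<Rightarrow> 'x cubical_set
    \<Rightarrow> (nat \<times> 'x, (nat \<times> 'x, cube_map) arrow, 'o, 'm) cfunctor \<Rightarrow> nat \<Rightarrow> 'o" where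
  "cubical_homology A X G n =
     homology_ob A (normalized_differential A X G (Suc n)) (normalized_differential A X G n)"

section \<open>The cubical nerve\<close>

type_synonym ('o, 'm) cube_diagram = "(bool list, bool list \<times> bool list, 'o, 'm) cfunctor"

definition cube_functor ::
  "cube_map \<Rightarrow> (bool list, bool list \<times> bool list, bool list, bool list \<times> bool list) cfunctor" where
  "cube_functor = (\<lambda>(m, f, n).
     \<lparr>FObj = f, FArr = (\<lambda>(x, y)\<in>Arr (cube_poset m). (f x, f y))\<rparr>)"

definition cubical_nerve :: "('o, 'm, 'z) cat_scheme \<Rightarrow> ('o, 'm) cube_diagram cubical_set" where
  "cubical_nerve C = (let N = \<lambda>n. {x. is_functor (cube_poset n) C x} in
     \<lparr>FObj = N,
      FArr = (\<lambda>\<alpha>\<in>Arr cube_category.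
        let m = Dom cube_category \<alpha>; n = Cod cube_category \<alpha> in
          (N n, \<lambda>x\<in>N n. functor_comp (cube_poset m) x (cube_functor \<alpha>), N m))\<rparr>)"

definition top_vertex :: "nat \<Rightarrow> bool list" where
  "top_vertex n = replicate n True"

text \<open>The functor \<open>\<partial> : \<box>/C \<rightarrow> C\<close>.\<close>

definition boundary_functor :: "('o, 'm, 'z) cat_scheme
    \<Rightarrow> (nat \<times> ('o, 'm) cube_diagram, (nat \<times> ('o, 'm) cube_diagram, cube_map) arrow, 'o, 'm) cfunctor"
  where
  "boundary_functor C =
     \<lparr>FObj = (\<lambda>(n, x)\<in>Obj (cubes_over (cubical_nerve C)). FObj x (top_vertex n)),
      FArr = (\<lambda>((m, x), (_, \<theta>, _), (n, y))\<in>Arr (cubes_over (cubical_nerve C)).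
        FArr y (\<theta> (top_vertex m), top_vertex n))\<rparr>"

end

theory Submission
  imports Defs
begin

text \<open>
  A homological \<open>\<partial>\<close>-functor whose higher terms vanish on a functorial supply of covers is
  universal, so it suffices to exhibit cubical homology \<open>F \<mapsto> H\<^sub>n(B C, F \<partial>)\<close> as such a functor extending
  the colimit.

  A degeneracy \<open>\<sigma>\<close> preserves the top vertex, so it acts on coefficients by an identity. Hence the
  normalized chains are the coproduct of the objects \<open>F(x(1,\<dots>,1))\<close> over the nondegenerate cubes \<open>x\<close>, which is
  exact in \<open>F\<close> by AB4; this gives the long exact sequences. In degree 0 the homology is the colimit. The
  functor \<open>P F(c) = \<Coprod> F(c')\<close>, the coproduct over all \<open>f : c \<rightarrow> c'\<close>, covers \<open>F\<close> and has no
  higher homology: a cube \<open>x\<close> with an arrow \<open>f : x(1,\<dots>,1) \<rightarrow> c'\<close> is the face of a cube with one more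
  coordinate whose opposite face is constant at \<open>c'\<close>, hence degenerate, and this contracts the chains.
\<close>

section \<open>Categories and abelian categories\<close>

text \<open>\<open>T\<close> is known only through its universal property, and an AB4-category need
  not have enough projectives, so the comparison has to be made between partial functors and not by
  resolutions. Universality supplies morphisms into \<open>T\<close> only. A morphism out of
  \<open>T\<close> is built by hand, using that the connecting morphisms of the canonical sequences
  are monomorphisms, their middle terms being acyclic. The cover is the left Kan extension of the
  restriction of \<open>F\<close> to the discrete category of objects. A cube \<open>x\<close> with
  an arrow from its top vertex to c' is the same as a cube of the slice over c', because the top
  vertex is terminal in the cube poset. So the chains of the cover split over c' into chains of
  slices with constant coefficients, and a slice contracts to its terminal object. The new
  coordinate is put last, so that the old faces keep their indices and signs. The argument stops at
  degree 1, since a constant cube is degenerate in positive dimension only; degree 0 survives as the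
  colimit.\<close>

lemma in_Hom: "f \<in> Hom C x y \<longleftrightarrow> f \<in> Arr C \<and> Dom C f = x \<and> Cod C f = y"
  by (simp add: Hom_def)

context category
begin

abbreviation comp (infixr "\<cdot>" 70) where "g \<cdot> f \<equiv> Comp C g f"

declare Dom_Obj [simp] Cod_Obj [simp]

text \<open>Typing is restated as equations on \<open>Dom\<close> and \<open>Cod\<close>: in this
  form the simplifier discharges the side conditions, whereas the \<open>Hom\<close> form would
  leave intermediate objects to be guessed.\<close>

lemma Comp_arr [simp]:
  assumes "f \<in> Arr C" "g \<in> Arr C" "Cod C f = Dom C g"
  shows "g \<cdot> f \<in> Arr C" "Dom C (g \<cdot> f) = Dom C f" "Cod C (g \<cdot> f) = Cod C g"
  using Comp_Hom[of f "Dom C f" "Cod C f" g "Cod C g"] assms by (auto simp: in_Hom)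

lemma Comp_assoc' [simp]:
  assumes "f \<in> Arr C" "g \<in> Arr C" "h \<in> Arr C" "Cod C f = Dom C g" "Cod C g = Dom C h"
  shows "(h \<cdot> g) \<cdot> f = h \<cdot> g \<cdot> f"
  using Comp_assoc[of f "Dom C f" "Cod C f" g "Cod C g" h "Cod C h"] assms by (auto simp: in_Hom)

lemma Ident_arr [simp]:
  assumes "x \<in> Obj C"
  shows "Ident C x \<in> Arr C" "Dom C (Ident C x) = x" "Cod C (Ident C x) = x"
  using Ident_Hom[OF assms] by (auto simp: in_Hom)

lemma Comp_Ident [simp]:
  "f \<in> Arr C \<Longrightarrow> Dom C f = x \<Longrightarrow> f \<cdot> Ident C x = f"
  "f \<in> Arr C \<Longrightarrow> Cod C f = x \<Longrightarrow> Ident C x \<cdot> f = f"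
  using Comp_Ident_right[of f "Dom C f" "Cod C f"] Comp_Ident_left[of f "Dom C f" "Cod C f"]
  by (auto simp: in_Hom)

text \<open>Composites are normalised by associating to the right, so an equation for
  \<open>g \<cdot> f\<close> no longer matches inside \<open>g \<cdot> f \<cdot> k\<close>. This
  rule and \<open>square_extend\<close> carry such an equation past a further arrow.\<close>

lemma Comp_eq_extend:
  assumes "g \<cdot> f = h" "f \<in> Arr C" "g \<in> Arr C" "k \<in> Arr C" "Cod C k = Dom C f" "Cod C f = Dom C g"
  shows "g \<cdot> f \<cdot> k = h \<cdot> k"
  using assms by (simp flip: assms(1))

lemma square_extend:
  assumes "g \<cdot> f = g' \<cdot> f'" "f \<in> Arr C" "g \<in> Arr C" "f' \<in> Arr C" "g' \<in> Arr C" "k \<in> Arr C"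
    "Cod C k = Dom C f" "Cod C f = Dom C g" "Dom C f' = Dom C f" "Cod C f' = Dom C g'"
  shows "g \<cdot> f \<cdot> k = g' \<cdot> f' \<cdot> k"
  using Comp_assoc'[of k f g] Comp_assoc'[of k f' g'] assms by simp

lemma is_monoD:
  assumes "is_mono C f" "g \<in> Arr C" "h \<in> Arr C" "Dom C g = Dom C h" "Cod C g = Dom C f"
    "Cod C h = Dom C f" "f \<cdot> g = f \<cdot> h"
  shows "g = h"
proof -
  have "Dom C h \<in> Obj C" "g \<in> Hom C (Dom C h) (Dom C f)" "h \<in> Hom C (Dom C h) (Dom C f)"
    using assms by (auto simp: in_Hom)
  then show ?thesis using assms(1,7) unfolding is_mono_def by blast
qed

lemma is_epiD:
  assumes "is_epi C f" "g \<in> Arr C" "h \<in> Arr C" "Cod C g = Cod C h" "Dom C g = Cod C f"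
    "Dom C h = Cod C f" "g \<cdot> f = h \<cdot> f"
  shows "g = h"
proof -
  have "Cod C h \<in> Obj C" "g \<in> Hom C (Cod C f) (Cod C h)" "h \<in> Hom C (Cod C f) (Cod C h)"
    using assms by (auto simp: in_Hom)
  then show ?thesis using assms(1,7) unfolding is_epi_def by blast
qed

lemma is_mono_arr: "is_mono C f \<Longrightarrow> f \<in> Arr C" by (simp add: is_mono_def)

lemma is_epi_arr: "is_epi C f \<Longrightarrow> f \<in> Arr C" by (simp add: is_epi_def)

lemma epi_Ident: "x \<in> Obj C \<Longrightarrow> is_epi C (Ident C x)"
  by (auto simp: is_epi_def in_Hom)

lemma epi_Comp:
  assumes "is_epi C f" "is_epi C g" "Cod C f = Dom C g"
  shows "is_epi C (g \<cdot> f)"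
proof -
  have a: "f \<in> Arr C" "g \<in> Arr C" using assms is_epi_arr by auto
  show ?thesis
    unfolding is_epi_def
  proof (intro conjI ballI impI)
    fix w h k assume h: "w \<in> Obj C" "h \<in> Hom C (Cod C (g \<cdot> f)) w" "k \<in> Hom C (Cod C (g \<cdot> f)) w"
      "h \<cdot> g \<cdot> f = k \<cdot> g \<cdot> f"
    have e: "h \<cdot> g = k \<cdot> g"
      by (rule is_epiD[OF assms(1)]) (use h a assms in \<open>auto simp: in_Hom\<close>)
    show "h = k"
      by (rule is_epiD[OF assms(2)]) (use e h a assms in \<open>auto simp: in_Hom\<close>)
  qed (use a assms in simp)
qed

lemma epi_right_factor:
  assumes "is_epi C (g \<cdot> f)" "f \<in> Arr C" "g \<in> Arr C" "Cod C f = Dom C g"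
  shows "is_epi C g"
  unfolding is_epi_def
proof (intro conjI ballI impI)
  fix w h k assume h: "w \<in> Obj C" "h \<in> Hom C (Cod C g) w" "k \<in> Hom C (Cod C g) w" "h \<cdot> g = k \<cdot> g"
  show "h = k"
  proof (rule is_epiD[OF assms(1)])
    show "h \<cdot> g \<cdot> f = k \<cdot> g \<cdot> f"
      by (rule square_extend[OF h(4)]) (use h assms in \<open>auto simp: in_Hom\<close>)
  qed (use h assms in \<open>auto simp: in_Hom\<close>)
qed (use assms in simp)

lemma mono_Comp:
  assumes "is_mono C f" "is_mono C g" "Cod C f = Dom C g"
  shows "is_mono C (g \<cdot> f)"
proof -
  have a: "f \<in> Arr C" "g \<in> Arr C" using assms is_mono_arr by auto
  show ?thesis
    unfolding is_mono_def
  proof (intro conjI ballI impI)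
    fix w h k assume h: "w \<in> Obj C" "h \<in> Hom C w (Dom C (g \<cdot> f))" "k \<in> Hom C w (Dom C (g \<cdot> f))"
      "(g \<cdot> f) \<cdot> h = (g \<cdot> f) \<cdot> k"
    have e: "f \<cdot> h = f \<cdot> k"
      by (rule is_monoD[OF assms(2)]) (use h a assms in \<open>auto simp: in_Hom\<close>)
    show "h = k"
      by (rule is_monoD[OF assms(1)]) (use e h a assms in \<open>auto simp: in_Hom\<close>)
  qed (use a assms in simp)
qed

end

section \<open>Additive calculus, kernels and cokernels\<close>

context preadditive_category
begin

notation comp (infixr "\<cdot>" 70)

text \<open>The inverse is taken in the group given by the arrow's own domain and codomain, so that
  no objects have to be passed along.\<close>

definition neg :: "'m \<Rightarrow> 'm" where
  "neg f = inv\<^bsub>hom_group A (Dom A f) (Cod A f)\<^esub> f"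

abbreviation sub :: "'m \<Rightarrow> 'm \<Rightarrow> 'm" where
  "sub f g \<equiv> Add A f (neg g)"

lemma hom_group_simps [simp]:
  "carrier (hom_group A x y) = Hom A x y" "mult (hom_group A x y) = Add A"
  "one (hom_group A x y) = Zro A x y"
  by (simp_all add: hom_group_def)

lemma Zro_arr [simp]:
  assumes "x \<in> Obj A" "y \<in> Obj A"
  shows "Zro A x y \<in> Arr A" "Dom A (Zro A x y) = x" "Cod A (Zro A x y) = y"
proof -
  interpret comm_group "hom_group A x y" using hom_comm_group assms by simp
  from one_closed show "Zro A x y \<in> Arr A" "Dom A (Zro A x y) = x" "Cod A (Zro A x y) = y"
    by (auto simp: in_Hom)
qed

lemma Add_arr [simp]:
  assumes "f \<in> Arr A" "g \<in> Arr A" "Dom A f = Dom A g" "Cod A f = Cod A g"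
  shows "Add A f g \<in> Arr A" "Dom A (Add A f g) = Dom A g" "Cod A (Add A f g) = Cod A g"
proof -
  interpret comm_group "hom_group A (Dom A g) (Cod A g)" using hom_comm_group assms by simp
  from m_closed[of f g] assms
  show "Add A f g \<in> Arr A" "Dom A (Add A f g) = Dom A g" "Cod A (Add A f g) = Cod A g"
    by (auto simp: in_Hom)
qed

lemma neg_arr [simp]:
  assumes "f \<in> Arr A"
  shows "neg f \<in> Arr A" "Dom A (neg f) = Dom A f" "Cod A (neg f) = Cod A f"
proof -
  interpret comm_group "hom_group A (Dom A f) (Cod A f)" using hom_comm_group assms by simp
  from inv_closed[of f] assms
  show "neg f \<in> Arr A" "Dom A (neg f) = Dom A f" "Cod A (neg f) = Cod A f"
    by (auto simp: in_Hom neg_def)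
qed

lemma Add_commute:
  assumes "f \<in> Arr A" "g \<in> Arr A" "Dom A f = Dom A g" "Cod A f = Cod A g"
  shows "Add A f g = Add A g f"
proof -
  interpret comm_group "hom_group A (Dom A g) (Cod A g)" using hom_comm_group assms by simp
  from m_comm[of f g] assms show ?thesis by (auto simp: in_Hom)
qed

lemma Add_assoc:
  assumes "f \<in> Arr A" "g \<in> Arr A" "h \<in> Arr A" "Dom A f = Dom A g" "Cod A f = Cod A g"
    "Dom A h = Dom A g" "Cod A h = Cod A g"
  shows "Add A (Add A f g) h = Add A f (Add A g h)"
proof -
  interpret comm_group "hom_group A (Dom A g) (Cod A g)" using hom_comm_group assms by simp
  from m_assoc[of f g h] assms show ?thesis by (auto simp: in_Hom)
qed

lemma Add_Zro [simp]:
  assumes "f \<in> Arr A" "Dom A f = x" "Cod A f = y"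
  shows "Add A f (Zro A x y) = f" "Add A (Zro A x y) f = f"
proof -
  interpret comm_group "hom_group A (Dom A f) (Cod A f)" using hom_comm_group assms(1) by simp
  from r_one[of f] l_one[of f] assms show "Add A f (Zro A x y) = f" "Add A (Zro A x y) f = f"
    by (auto simp: in_Hom)
qed

lemma sub_self [simp]:
  assumes "f \<in> Arr A" shows "sub f f = Zro A (Dom A f) (Cod A f)"
    "Add A (neg f) f = Zro A (Dom A f) (Cod A f)"
proof -
  interpret comm_group "hom_group A (Dom A f) (Cod A f)" using hom_comm_group assms by simp
  from r_inv[of f] l_inv[of f] assms show "sub f f = Zro A (Dom A f) (Cod A f)"
    "Add A (neg f) f = Zro A (Dom A f) (Cod A f)" by (auto simp: in_Hom neg_def)
qed

lemma sub_Add_cancel [simp]: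
  assumes "f \<in> Arr A" "g \<in> Arr A" "Dom A f = Dom A g" "Cod A f = Cod A g"
  shows "Add A (sub f g) g = f"
  using assms by (simp add: Add_assoc)

lemma Add_right_imp_eq:
  assumes "Add A f h = Add A g h" "f \<in> Arr A" "g \<in> Arr A" "h \<in> Arr A"
    "Dom A f = Dom A h" "Cod A f = Cod A h" "Dom A g = Dom A h" "Cod A g = Cod A h"
  shows "f = g"
proof -
  have "sub (Add A f h) h = sub (Add A g h) h" using assms(1) by simp
  then show ?thesis using assms(2-) by (simp add: Add_assoc)
qed

lemma sub_eq_Zro:
  assumes "sub f g = Zro A x y" "f \<in> Arr A" "g \<in> Arr A" "Dom A f = x" "Dom A g = x"
    "Cod A f = y" "Cod A g = y"
  shows "f = g"
  using sub_Add_cancel[of f g] assms by simp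

lemma Comp_Add [simp]:
  "\<lbrakk>f \<in> Arr A; g \<in> Arr A; h \<in> Arr A; Dom A g = Dom A h; Cod A g = Cod A h; Cod A f = Dom A h\<rbrakk>
    \<Longrightarrow> Add A g h \<cdot> f = Add A (g \<cdot> f) (h \<cdot> f)"
  "\<lbrakk>f \<in> Arr A; g \<in> Arr A; h \<in> Arr A; Dom A f = Dom A g; Cod A f = Cod A g; Cod A g = Dom A h\<rbrakk>
    \<Longrightarrow> h \<cdot> Add A f g = Add A (h \<cdot> f) (h \<cdot> g)"
  using Comp_Add_left[of f "Dom A f" "Cod A f" g "Cod A g" h]
    Comp_Add_right[of f "Dom A f" "Cod A f" g h "Cod A h"] by (auto simp: in_Hom)

lemma Comp_Zro [simp]:
  assumes "f \<in> Arr A" "x \<in> Obj A"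
  shows "Dom A f = y \<Longrightarrow> f \<cdot> Zro A x y = Zro A x (Cod A f)"
    "Cod A f = y \<Longrightarrow> Zro A y x \<cdot> f = Zro A (Dom A f) x"
proof -
  assume d: "Dom A f = y"
  let ?z = "Zro A x y"
  have z: "?z \<in> Arr A" "Dom A ?z = x" "Cod A ?z = y" using assms d by auto
  \<comment> \<open>\<open>?z\<close> is idempotent for addition, hence so is its composite with
    \<open>f\<close>, and an idempotent of a group is zero.\<close>
  have "Add A (f \<cdot> ?z) (f \<cdot> ?z) = f \<cdot> Add A ?z ?z"
    by (rule Comp_Add(2)[symmetric]) (use z assms d in simp_all)
  also have "\<dots> = Add A (Zro A x (Cod A f)) (f \<cdot> ?z)" using z assms d by simp
  finally show "f \<cdot> ?z = Zro A x (Cod A f)"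
    by (rule Add_right_imp_eq) (use z assms d in simp_all)
next
  assume d: "Cod A f = y"
  let ?z = "Zro A y x"
  have z: "?z \<in> Arr A" "Dom A ?z = y" "Cod A ?z = x" using assms d by auto
  have "Add A (?z \<cdot> f) (?z \<cdot> f) = Add A ?z ?z \<cdot> f" by (subst Comp_Add(1)) (use z assms d in simp_all)
  also have "\<dots> = Add A (Zro A (Dom A f) x) (?z \<cdot> f)" using z assms d by simp
  finally show "?z \<cdot> f = Zro A (Dom A f) x"
    by (rule Add_right_imp_eq) (use z assms d in simp_all)
qed

lemma neg_unique:
  assumes "Add A g f = Zro A x y" "f \<in> Arr A" "g \<in> Arr A" "Dom A f = x" "Dom A g = x"
    "Cod A f = y" "Cod A g = y"
  shows "g = neg f"
  by (rule Add_right_imp_eq[of _ f]) (use assms in simp_all)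

lemma Comp_neg [simp]:
  assumes "f \<in> Arr A" "g \<in> Arr A" "Cod A f = Dom A g"
  shows "g \<cdot> neg f = neg (g \<cdot> f)" "neg g \<cdot> f = neg (g \<cdot> f)"
proof -
  show "g \<cdot> neg f = neg (g \<cdot> f)"
    by (rule neg_unique[of _ _ "Dom A f" "Cod A g"]) (use assms in \<open>simp_all flip: Comp_Add(2)\<close>)
  show "neg g \<cdot> f = neg (g \<cdot> f)"
    by (rule neg_unique[of _ _ "Dom A f" "Cod A g"]) (use assms in \<open>simp_all flip: Comp_Add(1)\<close>)
qed

lemma neg_Zro [simp]:
  assumes "x \<in> Obj A" "y \<in> Obj A" shows "neg (Zro A x y) = Zro A x y"
  by (rule neg_unique[symmetric, of _ _ x y]) (use assms in simp_all)

text \<open>Two arrows with equal composites differ by an arrow that \<open>f\<close> kills, so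
  cancellation need only be tested against zero. The same holds for \<open>is_epiI\<close>.\<close>

lemma is_monoI:
  assumes "f \<in> Arr A"
    and "\<And>h. h \<in> Arr A \<Longrightarrow> Cod A h = Dom A f \<Longrightarrow> f \<cdot> h = Zro A (Dom A h) (Cod A f)
      \<Longrightarrow> h = Zro A (Dom A h) (Dom A f)"
  shows "is_mono A f"
  unfolding is_mono_def
proof (intro conjI ballI impI)
  fix w g h assume w: "w \<in> Obj A" "g \<in> Hom A w (Dom A f)" "h \<in> Hom A w (Dom A f)" "f \<cdot> g = f \<cdot> h"
  then have "sub g h = Zro A w (Dom A f)"
    using assms(2)[of "sub g h"] assms(1) by (auto simp: in_Hom)
  then show "g = h" by (rule sub_eq_Zro) (use w in \<open>auto simp: in_Hom\<close>)
qed (fact assms)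

lemma is_epiI:
  assumes "f \<in> Arr A"
    and "\<And>h. h \<in> Arr A \<Longrightarrow> Dom A h = Cod A f \<Longrightarrow> h \<cdot> f = Zro A (Dom A f) (Cod A h)
      \<Longrightarrow> h = Zro A (Cod A f) (Cod A h)"
  shows "is_epi A f"
  unfolding is_epi_def
proof (intro conjI ballI impI)
  fix w g h assume w: "w \<in> Obj A" "g \<in> Hom A (Cod A f) w" "h \<in> Hom A (Cod A f) w" "g \<cdot> f = h \<cdot> f"
  then have "sub g h = Zro A (Cod A f) w"
    using assms(2)[of "sub g h"] assms(1) by (auto simp: in_Hom)
  then show "g = h" by (rule sub_eq_Zro) (use w in \<open>auto simp: in_Hom\<close>)
qed (fact assms)

lemma mono_Zro:
  assumes "is_mono A f" "h \<in> Arr A" "Cod A h = Dom A f" "f \<cdot> h = Zro A (Dom A h) (Cod A f)"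
  shows "h = Zro A (Dom A h) (Dom A f)"
  by (rule is_monoD[OF assms(1)]) (use assms is_mono_arr[OF assms(1)] in auto)

lemma epi_Zro:
  assumes "is_epi A f" "h \<in> Arr A" "Dom A h = Cod A f" "h \<cdot> f = Zro A (Dom A f) (Cod A h)"
  shows "h = Zro A (Cod A f) (Cod A h)"
  by (rule is_epiD[OF assms(1)]) (use assms is_epi_arr[OF assms(1)] in auto)

lemma is_kernelD:
  assumes "is_kernel A f k"
  shows "f \<in> Arr A" "k \<in> Arr A" "Cod A k = Dom A f" "f \<cdot> k = Zro A (Dom A k) (Cod A f)"
  using assms by (auto simp: is_kernel_def)

lemma kernel_lift:
  assumes "is_kernel A f k" "h \<in> Arr A" "Cod A h = Dom A f" "f \<cdot> h = Zro A (Dom A h) (Cod A f)"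
  obtains h' where "h' \<in> Arr A" "Dom A h' = Dom A h" "Cod A h' = Dom A k" "k \<cdot> h' = h"
proof -
  have "\<exists>!h'. h' \<in> Hom A (Dom A h) (Dom A k) \<and> k \<cdot> h' = h"
    using assms unfolding is_kernel_def by (auto simp: in_Hom)
  then show ?thesis using that by (auto simp: in_Hom)
qed

lemma kernel_mono:
  assumes "is_kernel A f k" shows "is_mono A k"
proof (rule is_monoI)
  note k = is_kernelD[OF assms]
  fix h assume h: "h \<in> Arr A" "Cod A h = Dom A k" "k \<cdot> h = Zro A (Dom A h) (Cod A k)"
  have "\<exists>!h'. h' \<in> Hom A (Dom A h) (Dom A k) \<and> k \<cdot> h' = Zro A (Dom A h) (Dom A f)"
    using assms h k unfolding is_kernel_def by (simp add: in_Hom)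
  moreover have "h \<in> Hom A (Dom A h) (Dom A k)" "k \<cdot> h = Zro A (Dom A h) (Dom A f)"
    "Zro A (Dom A h) (Dom A k) \<in> Hom A (Dom A h) (Dom A k)"
    "k \<cdot> Zro A (Dom A h) (Dom A k) = Zro A (Dom A h) (Dom A f)"
    using h k by (auto simp: in_Hom)
  ultimately show "h = Zro A (Dom A h) (Dom A k)" by blast
qed (use is_kernelD[OF assms] in simp)

text \<open>With \<open>is_mono\<close> split off, only the existence of factorizations remains to
  be shown; their uniqueness is cancellation.\<close>

lemma is_kernelI:
  assumes "f \<in> Arr A" "is_mono A k" "Cod A k = Dom A f" "f \<cdot> k = Zro A (Dom A k) (Cod A f)"
    and "\<And>h. h \<in> Arr A \<Longrightarrow> Cod A h = Dom A f \<Longrightarrow> f \<cdot> h = Zro A (Dom A h) (Cod A f) \<Longrightarrow>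
      \<exists>h'. h' \<in> Arr A \<and> Dom A h' = Dom A h \<and> Cod A h' = Dom A k \<and> k \<cdot> h' = h"
  shows "is_kernel A f k"
  unfolding is_kernel_def
proof (intro conjI ballI impI)
  fix w h assume h: "w \<in> Obj A" "h \<in> Hom A w (Dom A f)" "f \<cdot> h = Zro A w (Cod A f)"
  then show "\<exists>!h'. h' \<in> Hom A w (Dom A k) \<and> k \<cdot> h' = h"
    using assms(5)[of h] is_monoD[OF assms(2)] by (fastforce simp: in_Hom)
qed (use assms is_mono_arr in auto)

lemma is_cokernelD:
  assumes "is_cokernel A f q"
  shows "f \<in> Arr A" "q \<in> Arr A" "Dom A q = Cod A f" "q \<cdot> f = Zro A (Dom A f) (Cod A q)"
  using assms by (auto simp: is_cokernel_def)

lemma cokernel_lift: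
  assumes "is_cokernel A f q" "h \<in> Arr A" "Dom A h = Cod A f" "h \<cdot> f = Zro A (Dom A f) (Cod A h)"
  obtains h' where "h' \<in> Arr A" "Dom A h' = Cod A q" "Cod A h' = Cod A h" "h' \<cdot> q = h"
proof -
  have "\<exists>!h'. h' \<in> Hom A (Cod A q) (Cod A h) \<and> h' \<cdot> q = h"
    using assms unfolding is_cokernel_def by (auto simp: in_Hom)
  then show ?thesis using that by (auto simp: in_Hom)
qed

lemma cokernel_epi:
  assumes "is_cokernel A f q" shows "is_epi A q"
proof (rule is_epiI)
  note q = is_cokernelD[OF assms]
  fix h assume h: "h \<in> Arr A" "Dom A h = Cod A q" "h \<cdot> q = Zro A (Dom A q) (Cod A h)"
  have "\<exists>!h'. h' \<in> Hom A (Cod A q) (Cod A h) \<and> h' \<cdot> q = Zro A (Cod A f) (Cod A h)"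
    using assms h q unfolding is_cokernel_def by (simp add: in_Hom)
  moreover have "h \<in> Hom A (Cod A q) (Cod A h)" "h \<cdot> q = Zro A (Cod A f) (Cod A h)"
    "Zro A (Cod A q) (Cod A h) \<in> Hom A (Cod A q) (Cod A h)"
    "Zro A (Cod A q) (Cod A h) \<cdot> q = Zro A (Cod A f) (Cod A h)"
    using h q by (auto simp: in_Hom)
  ultimately show "h = Zro A (Cod A q) (Cod A h)" by blast
qed (use is_cokernelD[OF assms] in simp)

lemma is_cokernelI:
  assumes "f \<in> Arr A" "is_epi A q" "Dom A q = Cod A f" "q \<cdot> f = Zro A (Dom A f) (Cod A q)"
    and "\<And>h. h \<in> Arr A \<Longrightarrow> Dom A h = Cod A f \<Longrightarrow> h \<cdot> f = Zro A (Dom A f) (Cod A h) \<Longrightarrow>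
      \<exists>h'. h' \<in> Arr A \<and> Dom A h' = Cod A q \<and> Cod A h' = Cod A h \<and> h' \<cdot> q = h"
  shows "is_cokernel A f q"
  unfolding is_cokernel_def
proof (intro conjI ballI impI)
  fix w h assume h: "w \<in> Obj A" "h \<in> Hom A (Cod A f) w" "h \<cdot> f = Zro A (Dom A f) w"
  then show "\<exists>!h'. h' \<in> Hom A (Cod A q) w \<and> h' \<cdot> q = h"
    using assms(5)[of h] is_epiD[OF assms(2)] by (fastforce simp: in_Hom)
qed (use assms is_epi_arr in auto)

end

section \<open>Abelian categories: images and pullbacks of epimorphisms\<close>

context abelian_category
begin

notation comp (infixr "\<cdot>" 70)

lemma ker_kernel: "f \<in> Arr A \<Longrightarrow> is_kernel A f (ker A f)"
  unfolding ker_def using someI_ex[OF ex_kernel] .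

lemma coker_cokernel: "f \<in> Arr A \<Longrightarrow> is_cokernel A f (coker A f)"
  unfolding coker_def using someI_ex[OF ex_cokernel] .

text \<open>\<open>m\<close> is the kernel of some \<open>g\<close>, and \<open>g\<close> factors
  through the cokernel \<open>q\<close> of \<open>m\<close>; so an arrow killed by \<open>q\<close>
  is killed by \<open>g\<close> and lifts along \<open>m\<close>.\<close>

lemma mono_kernel_of_cokernel:
  assumes "is_mono A m" "is_cokernel A m q"
  shows "is_kernel A q m"
proof -
  obtain g where g: "is_kernel A g m" using mono_is_kernel[OF assms(1)] by blast
  note gm = is_kernelD[OF g] and mq = is_cokernelD[OF assms(2)]
  obtain g' where g': "g' \<in> Arr A" "Dom A g' = Cod A q" "Cod A g' = Cod A g" "g' \<cdot> q = g"
    using cokernel_lift[OF assms(2), of g] gm by auto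
  show ?thesis
  proof (rule is_kernelI)
    fix h assume h: "h \<in> Arr A" "Cod A h = Dom A q" "q \<cdot> h = Zro A (Dom A h) (Cod A q)"
    have "g \<cdot> h = g' \<cdot> q \<cdot> h"
      by (rule Comp_eq_extend[OF g'(4), symmetric]) (use g' h mq in auto)
    also have "\<dots> = Zro A (Dom A h) (Cod A g)" using g' h mq by simp
    finally show "\<exists>h'. h' \<in> Arr A \<and> Dom A h' = Dom A h \<and> Cod A h' = Dom A m \<and> m \<cdot> h' = h"
      using kernel_lift[OF g, of h] h mq gm by metis
  qed (use mq gm assms in auto)
qed

lemma epi_cokernel_of_kernel:
  assumes "is_epi A q" "is_kernel A q k"
  shows "is_cokernel A k q"
proof -
  obtain g where g: "is_cokernel A g q" using epi_is_cokernel[OF assms(1)] by blast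
  note gq = is_cokernelD[OF g] and kq = is_kernelD[OF assms(2)]
  obtain g' where g': "g' \<in> Arr A" "Dom A g' = Dom A g" "Cod A g' = Dom A k" "k \<cdot> g' = g"
    using kernel_lift[OF assms(2), of g] gq by auto
  show ?thesis
  proof (rule is_cokernelI)
    fix h assume h: "h \<in> Arr A" "Dom A h = Cod A k" "h \<cdot> k = Zro A (Dom A k) (Cod A h)"
    have "h \<cdot> g = h \<cdot> k \<cdot> g'" using g' h kq by simp
    also have "\<dots> = (h \<cdot> k) \<cdot> g'" using g' h kq by (subst Comp_assoc') auto
    also have "\<dots> = Zro A (Dom A g) (Cod A h)" using g' h kq by simp
    finally show "\<exists>h'. h' \<in> Arr A \<and> Dom A h' = Cod A q \<and> Cod A h' = Cod A h \<and> h' \<cdot> q = h"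
      using cokernel_lift[OF g, of h] h kq gq by metis
  qed (use kq gq assms in auto)
qed

text \<open>If \<open>h\<close> kills \<open>e\<close>, then \<open>f\<close> already factors
  through the subobject \<open>ker A h\<close> of the image. That subobject is again a kernel, and
  the image is the smallest kernel through which \<open>f\<close> factors; so it is the whole image
  and \<open>h\<close> vanishes.\<close>

lemma image_epi:
  assumes q: "is_cokernel A f q" and m: "is_kernel A q m"
  obtains e where "is_epi A e" "Dom A e = Dom A f" "Cod A e = Dom A m" "m \<cdot> e = f"
proof -
  note fq = is_cokernelD[OF q] and qm = is_kernelD[OF m]
  obtain e where e: "e \<in> Arr A" "Dom A e = Dom A f" "Cod A e = Dom A m" "m \<cdot> e = f"
    using kernel_lift[OF m, of f] fq by auto
  have "is_epi A e"
  proof (rule is_epiI)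
    fix h assume h: "h \<in> Arr A" "Dom A h = Cod A e" "h \<cdot> e = Zro A (Dom A e) (Cod A h)"
    note k = ker_kernel[OF h(1)] is_kernelD[OF ker_kernel[OF h(1)]]
    let ?k = "ker A h"
    obtain e' where e': "e' \<in> Arr A" "Dom A e' = Dom A f" "Cod A e' = Dom A ?k" "?k \<cdot> e' = e"
      using kernel_lift[OF k(1), of e] e h by auto
    have mk: "is_mono A (m \<cdot> ?k)"
      using mono_Comp[OF kernel_mono[OF k(1)] kernel_mono[OF m]] k h e by simp
    \<comment> \<open>\<open>c\<close> kills \<open>f\<close>, hence factors through the cokernel
      \<open>q\<close>, hence kills all of \<open>m\<close>; so \<open>m\<close> lifts through its
      own subobject, which gives a section of \<open>?k\<close>.\<close>
    then obtain c where c: "is_kernel A c (m \<cdot> ?k)" using mono_is_kernel by blast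
    note cc = is_kernelD[OF c]
    have arr: "?k \<in> Arr A" "m \<in> Arr A" "Cod A ?k = Dom A m" using k h e qm by auto
    have c': "c \<in> Arr A" "Dom A c = Cod A m" "c \<cdot> m \<cdot> ?k = Zro A (Dom A ?k) (Cod A c)"
      using cc arr by auto
    have "c \<cdot> f = (c \<cdot> m \<cdot> ?k) \<cdot> e'"
      using c'(1,2) e' arr e by simp
    also have "\<dots> = Zro A (Dom A f) (Cod A c)" using c' e' by simp
    finally obtain c2 where c2: "c2 \<in> Arr A" "Dom A c2 = Cod A q" "c2 \<cdot> q = c" "Cod A c2 = Cod A c"
      using cokernel_lift[OF q, of c] c' qm fq by auto
    have "c \<cdot> m = c2 \<cdot> q \<cdot> m"
      by (rule Comp_eq_extend[OF c2(3), symmetric]) (use c2 qm fq in auto)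
    also have "\<dots> = Zro A (Dom A m) (Cod A c)" using c2 qm fq by simp
    finally obtain r where r: "r \<in> Arr A" "Dom A r = Dom A m" "Cod A r = Dom A ?k" "(m \<cdot> ?k) \<cdot> r = m"
      using kernel_lift[OF c, of m] c' arr by auto
    have "?k \<cdot> r = Ident A (Dom A m)"
      by (rule is_monoD[OF kernel_mono[OF m]]) (use r arr in auto)
    then have "h = h \<cdot> ?k \<cdot> r" using h e by simp
    also have "\<dots> = (h \<cdot> ?k) \<cdot> r" using r k h e arr by (subst Comp_assoc') auto
    also have "\<dots> = Zro A (Cod A e) (Cod A h)" using r k h e by simp
    finally show "h = Zro A (Cod A e) (Cod A h)" .
  qed (use e in auto)
  then show ?thesis using that e by auto
qed

text \<open>Epimorphisms are stable under pullback. The pullback of \<open>f\<close> along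
  \<open>y\<close> is the kernel of \<open>f \<cdot> p - y \<cdot> q\<close> on the biproduct, and
  its two projections are the required \<open>x\<close> and \<open>e\<close>.\<close>

lemma epi_cover:
  assumes f: "is_epi A f" and y: "y \<in> Arr A" "Cod A y = Cod A f"
  obtains e x where "is_epi A e" "Cod A e = Dom A y" "x \<in> Arr A" "Dom A x = Dom A e"
    "Cod A x = Dom A f" "f \<cdot> x = y \<cdot> e"
proof -
  have fa: "f \<in> Arr A" using f is_epi_arr by simp
  obtain b i j p q where bi: "is_biproduct A (Dom A f) (Dom A y) b i j p q"
    using ex_biproduct[of "Dom A f" "Dom A y"] fa y by auto
  then have b: "b \<in> Obj A" "i \<in> Arr A" "Dom A i = Dom A f" "Cod A i = b"
    "j \<in> Arr A" "Dom A j = Dom A y" "Cod A j = b" "p \<in> Arr A" "Dom A p = b" "Cod A p = Dom A f"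
    "q \<in> Arr A" "Dom A q = b" "Cod A q = Dom A y" "p \<cdot> i = Ident A (Dom A f)" "q \<cdot> j = Ident A (Dom A y)"
    "Add A (i \<cdot> p) (j \<cdot> q) = Ident A b"
    by (auto simp: is_biproduct_def in_Hom)
  \<comment> \<open>\<open>is_biproduct\<close> does not list the mixed composites. Composing the
    decomposition of the identity with \<open>q\<close> and \<open>i\<close> gives
    \<open>q \<cdot> i\<close> as twice itself, hence zero.\<close>
  have qi: "q \<cdot> i = Zro A (Dom A f) (Dom A y)"
  proof -
    have qjq: "q \<cdot> j \<cdot> q \<cdot> i = Ident A (Dom A y) \<cdot> q \<cdot> i"
      by (rule Comp_eq_extend[OF b(15)]) (use b in auto)
    have "q \<cdot> i = q \<cdot> Add A (i \<cdot> p) (j \<cdot> q) \<cdot> i"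
      using b by (simp only: b(16)) simp
    also have "\<dots> = Add A (q \<cdot> i) (q \<cdot> i)"
      using b(1-15) fa y qjq by simp
    finally have "Add A (q \<cdot> i) (q \<cdot> i) = Add A (Zro A (Dom A f) (Dom A y)) (q \<cdot> i)"
      using b fa y by simp
    then show ?thesis by (rule Add_right_imp_eq) (use b fa y in auto)
  qed
  let ?u = "sub (f \<cdot> p) (y \<cdot> q)"
  have u: "?u \<in> Arr A" "Dom A ?u = b" "Cod A ?u = Cod A f" using b fa y by auto
  have ui: "?u \<cdot> i = f"
    using b fa y qi by simp
  have "is_epi A ?u" by (rule epi_right_factor[of _ i]) (use ui f b u in auto)
  then have ck: "is_cokernel A (ker A ?u) ?u"
    using epi_cokernel_of_kernel ker_kernel u by blast
  let ?k = "ker A ?u"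
  have k: "?k \<in> Arr A" "Cod A ?k = b" "?u \<cdot> ?k = Zro A (Dom A ?k) (Cod A f)"
    using is_kernelD[OF ker_kernel[OF u(1)]] u by auto
  \<comment> \<open>If \<open>h\<close> kills the projection, then \<open>h \<cdot> q\<close>
    descends along the cokernel \<open>?u\<close> to some \<open>h'\<close>. Restricting along
    \<open>i\<close> shows that \<open>h' \<cdot> f\<close> vanishes, so \<open>h'\<close> vanishes,
    and restricting \<open>h \<cdot> q\<close> along \<open>j\<close> gives \<open>h\<close>
    back.\<close>
  have "is_epi A (q \<cdot> ?k)"
  proof (rule is_epiI)
    fix h assume h: "h \<in> Arr A" "Dom A h = Cod A (q \<cdot> ?k)"
      "h \<cdot> q \<cdot> ?k = Zro A (Dom A (q \<cdot> ?k)) (Cod A h)"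
    have d: "Dom A h = Dom A y" using h b k by simp
    obtain h' where h': "h' \<in> Arr A" "Dom A h' = Cod A f" "Cod A h' = Cod A h" "h' \<cdot> ?u = h \<cdot> q"
      using cokernel_lift[OF ck, of "h \<cdot> q"] h b k u by auto
    have "h' \<cdot> f = (h' \<cdot> ?u) \<cdot> i" using ui h' b u by (subst Comp_assoc') auto
    also have "\<dots> = Zro A (Dom A f) (Cod A h')" using h' qi b d h fa by simp
    finally have "h' = Zro A (Cod A f) (Cod A h)" using epi_Zro[OF f, of h'] h' by simp
    then have "h \<cdot> q = Zro A b (Cod A h)" using h'(4)[symmetric] u h by simp
    then have "(h \<cdot> q) \<cdot> j = Zro A (Dom A y) (Cod A h)" using b h by simp
    then show "h = Zro A (Cod A (q \<cdot> ?k)) (Cod A h)" using b h d by simp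
  qed (use b k in simp)
  moreover have "sub (f \<cdot> p \<cdot> ?k) (y \<cdot> q \<cdot> ?k) = Zro A (Dom A ?k) (Cod A f)"
    using k b fa y by simp
  then have "f \<cdot> p \<cdot> ?k = y \<cdot> q \<cdot> ?k"
    by (rule sub_eq_Zro) (use k b fa y in auto)
  ultimately show ?thesis using that[of "q \<cdot> ?k" "p \<cdot> ?k"] b k y fa by simp
qed

end

section \<open>Generalized elements and homology classes\<close>

context preadditive_category
begin

text \<open>
  Diagrams are chased with generalized elements, i.e. morphisms into an object: \<open>covered f y\<close> says
  that, after precomposition with an epimorphism, \<open>y\<close> lifts along \<open>f\<close>. For a cycle \<open>c\<close>, meaning
  \<open>g c = 0\<close>, the class \<open>cls f g c\<close> is its image in the homology of \<open>f\<close> and \<open>g\<close>.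
\<close>

definition covered :: "'m \<Rightarrow> 'm \<Rightarrow> bool" where
  "covered f y \<longleftrightarrow> (\<exists>e x. is_epi A e \<and> e \<in> Arr A \<and> Cod A e = Dom A y \<and>
     x \<in> Arr A \<and> Dom A x = Dom A e \<and> Cod A x = Dom A f \<and> f \<cdot> x = y \<cdot> e)"

definition cyc :: "'m \<Rightarrow> 'm \<Rightarrow> bool" where
  "cyc g c \<longleftrightarrow> g \<in> Arr A \<and> c \<in> Arr A \<and> Cod A c = Dom A g \<and> g \<cdot> c = Zro A (Dom A c) (Cod A g)"

definition klift :: "'m \<Rightarrow> 'm \<Rightarrow> 'm" where
  "klift g c = (THE h. h \<in> Hom A (Dom A c) (Dom A (ker A g)) \<and> ker A g \<cdot> h = c)"

definition cls :: "'m \<Rightarrow> 'm \<Rightarrow> 'm \<Rightarrow> 'm" where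
  "cls f g c = coker A (klift g f) \<cdot> klift g c"

lemma coveredE:
  assumes "covered f y"
  obtains e x where "is_epi A e" "e \<in> Arr A" "Cod A e = Dom A y" "x \<in> Arr A" "Dom A x = Dom A e"
    "Cod A x = Dom A f" "f \<cdot> x = y \<cdot> e"
  using assms unfolding covered_def by blast

lemma coveredI:
  assumes "is_epi A e" "Cod A e = Dom A y" "x \<in> Arr A" "Dom A x = Dom A e"
    "Cod A x = Dom A f" "f \<cdot> x = y \<cdot> e"
  shows "covered f y"
  using assms is_epi_arr unfolding covered_def by blast

lemma coveredI':
  assumes "y \<in> Arr A" "x \<in> Arr A" "Dom A x = Dom A y" "Cod A x = Dom A f" "f \<cdot> x = y"
  shows "covered f y"
  using assms by (intro coveredI[of "Ident A (Dom A y)" y x f]) (auto simp: epi_Ident)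

lemma cycD:
  assumes "cyc g c"
  shows "g \<in> Arr A" "c \<in> Arr A" "Cod A c = Dom A g" "g \<cdot> c = Zro A (Dom A c) (Cod A g)"
  using assms by (auto simp: cyc_def)

lemma cyc_Comp:
  assumes "cyc g c" "u \<in> Arr A" "Cod A u = Dom A c"
  shows "cyc g (c \<cdot> u)"
  unfolding cyc_def
proof (intro conjI)
  note c = cycD[OF assms(1)]
  have "g \<cdot> c \<cdot> u = Zro A (Dom A c) (Cod A g) \<cdot> u"
    by (rule Comp_eq_extend[OF c(4)]) (use c assms in auto)
  then show "g \<cdot> c \<cdot> u = Zro A (Dom A (c \<cdot> u)) (Cod A g)" using c assms by simp
qed (use cycD[OF assms(1)] assms in auto)

lemma cyc_Add:
  assumes "cyc g c" "cyc g c'" "Dom A c = Dom A c'"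
  shows "cyc g (Add A c c')"
  using assms by (auto simp: cyc_def)

lemma cyc_neg:
  assumes "cyc g c" shows "cyc g (neg c)"
  using assms by (auto simp: cyc_def)

end

section \<open>Exactness and homology by generalized elements\<close>

context abelian_category
begin

lemma epi_covered:
  assumes "is_epi A f" "y \<in> Arr A" "Cod A y = Cod A f"
  shows "covered f y"
  using epi_cover[OF assms] coveredI by metis

text \<open>The cover \<open>e\<close> of the identity factors as \<open>f \<cdot> x\<close>, and
  the last factor of an epimorphism is an epimorphism. So being epimorphic can be proved by chasing
  the universal element.\<close>

lemma covered_epi:
  assumes "f \<in> Arr A" "covered f (Ident A (Cod A f))"
  shows "is_epi A f"
proof -
  obtain e x where e: "is_epi A e" "e \<in> Arr A" "Cod A e = Cod A f" "x \<in> Arr A" "Dom A x = Dom A e"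
    "Cod A x = Dom A f" "f \<cdot> x = e"
    using coveredE[OF assms(2)] assms(1) by (metis Cod_Obj Comp_Ident(2) Ident_arr(2))
  show ?thesis by (rule epi_right_factor[of _ x]) (use e assms in auto)
qed

text \<open>\<open>f\<close> is an epimorphism onto the kernel of \<open>g\<close>; the cycle
  \<open>y\<close> lifts to that kernel, and from there to \<open>f\<close> by pulling back the
  epimorphism.\<close>

lemma exactD_covered:
  assumes "exact A f g" "y \<in> Arr A" "Cod A y = Dom A g" "g \<cdot> y = Zro A (Dom A y) (Cod A g)"
  shows "covered f y"
proof -
  obtain m q where mq: "is_cokernel A f q" "is_kernel A q m" "is_kernel A g m"
    using assms(1) unfolding exact_def is_image_def by blast
  obtain e where e: "is_epi A e" "Dom A e = Dom A f" "Cod A e = Dom A m" "m \<cdot> e = f"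
    using image_epi[OF mq(1,2)] .
  obtain y' where y': "y' \<in> Arr A" "Dom A y' = Dom A y" "Cod A y' = Dom A m" "m \<cdot> y' = y"
    using kernel_lift[OF mq(3) assms(2-4)] .
  note m = is_kernelD[OF mq(3)]
  have ea: "e \<in> Arr A" using e is_epi_arr by simp
  have "covered e y'" using epi_covered[OF e(1)] y' e by simp
  then obtain e1 x where x: "is_epi A e1" "e1 \<in> Arr A" "Cod A e1 = Dom A y'" "x \<in> Arr A"
    "Dom A x = Dom A e1" "Cod A x = Dom A e" "e \<cdot> x = y' \<cdot> e1" by (rule coveredE)
  have "f \<cdot> x = m \<cdot> e \<cdot> x"
    by (rule Comp_eq_extend[OF e(4), symmetric]) (use m e ea x in auto)
  also have "\<dots> = m \<cdot> y' \<cdot> e1" using x by simp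
  also have "\<dots> = y \<cdot> e1"
    by (rule Comp_eq_extend[OF y'(4)]) (use m y' x in auto)
  finally show ?thesis using coveredI[OF x(1)] x y' e by simp
qed

lemma exactD:
  assumes "exact A f g"
  shows "f \<in> Arr A" "g \<in> Arr A" "Cod A f = Dom A g" "g \<cdot> f = Zro A (Dom A f) (Cod A g)"
proof -
  show fg: "f \<in> Arr A" "g \<in> Arr A" "Cod A f = Dom A g" using assms by (auto simp: exact_def)
  obtain m q where mq: "is_cokernel A f q" "is_kernel A q m" "is_kernel A g m"
    using assms(1) unfolding exact_def is_image_def by blast
  obtain e where e: "is_epi A e" "Dom A e = Dom A f" "Cod A e = Dom A m" "m \<cdot> e = f"
    using image_epi[OF mq(1,2)] .
  note m = is_kernelD[OF mq(3)]
  have ea: "e \<in> Arr A" using e is_epi_arr by simp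
  have "g \<cdot> m \<cdot> e = Zro A (Dom A m) (Cod A g) \<cdot> e"
    by (rule Comp_eq_extend[OF m(4)]) (use m e ea in auto)
  then show "g \<cdot> f = Zro A (Dom A f) (Cod A g)" using e ea fg by simp
qed

text \<open>If \<open>y\<close> is covered by \<open>f\<close>, the cokernel of \<open>f\<close>
  kills \<open>y\<close> after an epimorphism, hence kills \<open>y\<close> itself. Thus the image
  of \<open>f\<close> has the universal property of the kernel of \<open>g\<close>.\<close>

lemma exactI_covered:
  assumes fg: "f \<in> Arr A" "g \<in> Arr A" "Cod A f = Dom A g" "g \<cdot> f = Zro A (Dom A f) (Cod A g)"
    and cov: "\<And>y. y \<in> Arr A \<Longrightarrow> Cod A y = Dom A g \<Longrightarrow> g \<cdot> y = Zro A (Dom A y) (Cod A g)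
      \<Longrightarrow> covered f y"
  shows "exact A f g"
proof -
  let ?q = "coker A f" let ?m = "ker A ?q"
  note q = coker_cokernel[OF fg(1)] is_cokernelD[OF coker_cokernel[OF fg(1)]]
  note m = ker_kernel[OF q(3)] is_kernelD[OF ker_kernel[OF q(3)]]
  obtain e where e: "is_epi A e" "Dom A e = Dom A f" "Cod A e = Dom A ?m" "?m \<cdot> e = f"
    using image_epi[OF q(1) m(1)] .
  have ea: "e \<in> Arr A" using e is_epi_arr by simp
  have gm: "g \<cdot> ?m = Zro A (Dom A ?m) (Cod A g)"
  proof -
    have "(g \<cdot> ?m) \<cdot> e = Zro A (Dom A e) (Cod A g)" using m q e ea fg by simp
    then show ?thesis using epi_Zro[OF e(1), of "g \<cdot> ?m"] m q e fg by simp
  qed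
  have "is_kernel A g ?m"
  proof (rule is_kernelI)
    fix y assume y: "y \<in> Arr A" "Cod A y = Dom A g" "g \<cdot> y = Zro A (Dom A y) (Cod A g)"
    obtain e1 x where x: "is_epi A e1" "e1 \<in> Arr A" "Cod A e1 = Dom A y" "x \<in> Arr A"
      "Dom A x = Dom A e1" "Cod A x = Dom A f" "f \<cdot> x = y \<cdot> e1" using coveredE[OF cov[OF y]] .
    have "(?q \<cdot> y) \<cdot> e1 = ?q \<cdot> f \<cdot> x" using q x y fg by simp
    also have "\<dots> = Zro A (Dom A f) (Cod A ?q) \<cdot> x"
      by (rule Comp_eq_extend[OF q(5)]) (use q x y fg in auto)
    also have "\<dots> = Zro A (Dom A e1) (Cod A ?q)" using q x fg by simp
    finally have "?q \<cdot> y = Zro A (Dom A y) (Cod A ?q)"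
      using epi_Zro[OF x(1), of "?q \<cdot> y"] q x y fg by simp
    then show "\<exists>h'. h' \<in> Arr A \<and> Dom A h' = Dom A y \<and> Cod A h' = Dom A ?m \<and> ?m \<cdot> h' = y"
      using kernel_lift[OF m(1), of y] y q fg by metis
  qed (use kernel_mono[OF m(1)] fg gm m q in auto)
  then show ?thesis using fg q(1) m(1) unfolding exact_def is_image_def by blast
qed

lemma klift:
  assumes "cyc g c"
  shows "klift g c \<in> Arr A" "Dom A (klift g c) = Dom A c" "Cod A (klift g c) = Dom A (ker A g)"
    "ker A g \<cdot> klift g c = c"
proof -
  note c = cycD[OF assms]
  note k = ker_kernel[OF c(1)]
  have "\<exists>!h. h \<in> Hom A (Dom A c) (Dom A (ker A g)) \<and> ker A g \<cdot> h = c"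
    using c k unfolding is_kernel_def by (simp add: in_Hom)
  from theI'[OF this]
  show "klift g c \<in> Arr A" "Dom A (klift g c) = Dom A c" "Cod A (klift g c) = Dom A (ker A g)"
    "ker A g \<cdot> klift g c = c"
    unfolding klift_def by (auto simp: in_Hom)
qed

lemma klift_unique:
  assumes "cyc g c" "h \<in> Arr A" "Cod A h = Dom A (ker A g)" "ker A g \<cdot> h = c" "Dom A h = Dom A c"
  shows "klift g c = h"
  by (rule is_monoD[OF kernel_mono[OF ker_kernel[OF cycD(1)[OF assms(1)]]]])
    (use klift[OF assms(1)] assms in auto)

lemma ker_arr [simp]:
  assumes "g \<in> Arr A"
  shows "ker A g \<in> Arr A" "Cod A (ker A g) = Dom A g" "cyc g (ker A g)"
  using is_kernelD[OF ker_kernel[OF assms]] by (auto simp: cyc_def)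

text \<open>The description operator in \<open>homology_ob\<close> is literally the body of
  \<open>klift\<close>; this makes the given homology object the codomain of every class
  \<open>cls\<close>.\<close>

lemma homology_ob_eq: "homology_ob A f g = Cod A (coker A (klift g f))"
  by (simp add: homology_ob_def klift_def)

context
  fixes f g
  assumes fg: "cyc g f"
begin

lemma hq:
  "is_cokernel A (klift g f) (coker A (klift g f))" "coker A (klift g f) \<in> Arr A"
  "Dom A (coker A (klift g f)) = Dom A (ker A g)"
  "Cod A (coker A (klift g f)) = homology_ob A f g"
  "coker A (klift g f) \<cdot> klift g f = Zro A (Dom A f) (homology_ob A f g)"
  using coker_cokernel[OF klift(1)[OF fg]] is_cokernelD[OF coker_cokernel[OF klift(1)[OF fg]]]
    klift[OF fg] by (auto simp: homology_ob_eq)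

lemma homology_ob_Obj [simp]: "homology_ob A f g \<in> Obj A"
  using hq Cod_Obj by metis

lemma cls_arr:
  assumes "cyc g c"
  shows "cls f g c \<in> Arr A" "Dom A (cls f g c) = Dom A c" "Cod A (cls f g c) = homology_ob A f g"
  using klift[OF assms] hq by (auto simp: cls_def)

lemma cls_Comp:
  assumes "cyc g c" "u \<in> Arr A" "Cod A u = Dom A c"
  shows "cls f g c \<cdot> u = cls f g (c \<cdot> u)"
proof -
  note c = cycD[OF assms(1)]
  have "ker A g \<cdot> klift g c \<cdot> u = c \<cdot> u"
    by (rule Comp_eq_extend[OF klift(4)[OF assms(1)]]) (use klift[OF assms(1)] assms c in auto)
  then have "klift g (c \<cdot> u) = klift g c \<cdot> u"
    by (intro klift_unique) (use klift[OF assms(1)] assms cyc_Comp[OF assms] c in auto)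
  then show ?thesis unfolding cls_def using hq klift[OF assms(1)] assms by simp
qed

lemma cls_Add:
  assumes "cyc g c" "cyc g c'" "Dom A c = Dom A c'"
  shows "cls f g (Add A c c') = Add A (cls f g c) (cls f g c')"
proof -
  note k = klift[OF assms(1)] klift[OF assms(2)] and g = cycD[OF assms(1)] cycD[OF assms(2)]
  have "klift g (Add A c c') = Add A (klift g c) (klift g c')"
    by (rule klift_unique) (use k g assms(3) cyc_Add[OF assms] in auto)
  then show ?thesis unfolding cls_def using hq k assms by simp
qed

lemma cls_Zro:
  assumes "cyc g (Zro A x y)" "x \<in> Obj A" "y \<in> Obj A"
  shows "cls f g (Zro A x y) = Zro A x (homology_ob A f g)"
proof -
  have y: "y = Dom A g" "g \<in> Arr A" using cycD[OF assms(1)] assms by auto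
  have "klift g (Zro A x y) = Zro A x (Dom A (ker A g))"
    by (rule klift_unique) (use y assms in auto)
  then show ?thesis using hq assms y by (simp add: cls_def)
qed

text \<open>The lift of \<open>f\<close> to the kernel and its cokernel form an exact pair, so a
  vanishing class makes the lift of \<open>c\<close> covered; composing with the kernel removes the
  lifts. Conversely, the class vanishes after the cover, and the cover is cancelled.\<close>

lemma cls_Zro_iff:
  assumes "cyc g c"
  shows "cls f g c = Zro A (Dom A c) (homology_ob A f g) \<longleftrightarrow> covered f c"
proof
  note c = cycD[OF assms] klift[OF assms] and f = cycD[OF fg] klift[OF fg]
  let ?q = "coker A (klift g f)"
  assume "cls f g c = Zro A (Dom A c) (homology_ob A f g)"
  then have z: "?q \<cdot> klift g c = Zro A (Dom A c) (homology_ob A f g)" by (simp add: cls_def)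
  have "exact A (klift g f) ?q"
    unfolding exact_def is_image_def using hq f ker_kernel[OF hq(2)] is_cokernelD[OF hq(1)] by auto
  then have "covered (klift g f) (klift g c)"
    by (rule exactD_covered) (use c hq z in auto)
  then obtain e x where e: "is_epi A e" "e \<in> Arr A" "Cod A e = Dom A (klift g c)" "x \<in> Arr A"
    "Dom A x = Dom A e" "Cod A x = Dom A (klift g f)" "klift g f \<cdot> x = klift g c \<cdot> e"
    by (rule coveredE)
  have "f \<cdot> x = ker A g \<cdot> klift g f \<cdot> x"
    by (rule Comp_eq_extend[OF f(8), symmetric]) (use f e c in auto)
  also have "\<dots> = ker A g \<cdot> klift g c \<cdot> e" using e by simp
  also have "\<dots> = c \<cdot> e"
    by (rule Comp_eq_extend[OF c(8)]) (use c e in auto)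
  finally show "covered f c" using e c f by (intro coveredI[of e c x f]) auto
next
  note c = cycD[OF assms] klift[OF assms] and f = cycD[OF fg] klift[OF fg]
  let ?q = "coker A (klift g f)"
  assume "covered f c"
  then obtain e x where e: "is_epi A e" "e \<in> Arr A" "Cod A e = Dom A c" "x \<in> Arr A"
    "Dom A x = Dom A e" "Cod A x = Dom A f" "f \<cdot> x = c \<cdot> e"
    by (rule coveredE)
  have "ker A g \<cdot> klift g f \<cdot> x = f \<cdot> x"
    by (rule Comp_eq_extend[OF f(8)]) (use f e c in auto)
  then have "klift g (c \<cdot> e) = klift g f \<cdot> x"
    by (intro klift_unique) (use c e f cyc_Comp[OF assms, of e] in auto)
  then have "cls f g c \<cdot> e = ?q \<cdot> klift g f \<cdot> x"
    using cls_Comp[OF assms, of e] e c by (simp add: cls_def)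
  also have "\<dots> = Zro A (Dom A f) (homology_ob A f g) \<cdot> x"
    by (rule Comp_eq_extend[OF hq(5)]) (use f e hq in auto)
  also have "\<dots> = Zro A (Dom A e) (homology_ob A f g)" using e by simp
  finally show "cls f g c = Zro A (Dom A c) (homology_ob A f g)"
    using epi_Zro[OF e(1), of "cls f g c"] cls_arr[OF assms] e by simp
qed

text \<open>The kernel is the universal cycle: its class is the quotient map onto homology, and the
  class of any cycle is a restriction of this one.\<close>

lemma cls_ker: "cls f g (ker A g) = coker A (klift g f)"
proof -
  note f = cycD[OF fg]
  have "klift g (ker A g) = Ident A (Dom A (ker A g))"
    by (rule klift_unique) (use f in auto)
  then show ?thesis using hq f by (simp add: cls_def)
qed

lemma cls_ker_epi: "is_epi A (cls f g (ker A g))"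
  unfolding cls_ker by (rule cokernel_epi[OF hq(1)])

text \<open>Pulling back along the quotient map represents an element of homology by a cycle, at the
  price of a cover. This is the entry point of every diagram chase in homology.\<close>

lemma cls_cover:
  assumes "a \<in> Arr A" "Cod A a = homology_ob A f g"
  obtains e c where "is_epi A e" "e \<in> Arr A" "Cod A e = Dom A a" "cyc g c" "Dom A c = Dom A e"
    "cls f g c = a \<cdot> e"
proof -
  note f = cycD[OF fg]
  let ?q = "cls f g (ker A g)"
  have "covered ?q a" by (rule epi_covered[OF cls_ker_epi]) (use assms hq cls_ker in auto)
  then obtain e x where e: "is_epi A e" "e \<in> Arr A" "Cod A e = Dom A a" "x \<in> Arr A"
    "Dom A x = Dom A e" "Cod A x = Dom A ?q" "?q \<cdot> x = a \<cdot> e"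
    by (rule coveredE)
  have d: "Cod A x = Dom A (ker A g)" using e cls_ker hq by simp
  show ?thesis
    by (rule that[OF e(1,2,3), of "ker A g \<cdot> x"])
      (use e f d cyc_Comp[of g "ker A g" x] cls_Comp[of "ker A g" x] in auto)
qed

lemma homology_ext:
  assumes "h \<in> Arr A" "h' \<in> Arr A" "Dom A h = homology_ob A f g" "Dom A h' = homology_ob A f g"
    "Cod A h = Cod A h'" "\<And>c. cyc g c \<Longrightarrow> h \<cdot> cls f g c = h' \<cdot> cls f g c"
  shows "h = h'"
  by (rule is_epiD[OF cls_ker_epi])
    (use assms cls_arr[of "ker A g"] cycD[OF fg] in auto)

lemma homology_desc:
  assumes "cyc g c" "is_epi A (cls f g c)" "t \<in> Arr A" "Dom A t = Dom A c"
    and "\<And>v. v \<in> Arr A \<Longrightarrow> Cod A v = Dom A c \<Longrightarrow> covered f (c \<cdot> v) \<Longrightarrow>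
      t \<cdot> v = Zro A (Dom A v) (Cod A t)"
  obtains h where "h \<in> Arr A" "Dom A h = homology_ob A f g" "Cod A h = Cod A t" "h \<cdot> cls f g c = t"
proof -
  note c = cycD[OF assms(1)] cls_arr[OF assms(1)]
  let ?k = "ker A (cls f g c)"
  have k: "?k \<in> Arr A" "Cod A ?k = Dom A c" "cls f g c \<cdot> ?k = Zro A (Dom A ?k) (homology_ob A f g)"
    using is_kernelD[OF ker_kernel[OF c(5)]] c by auto
  have ck: "is_cokernel A ?k (cls f g c)"
    by (rule epi_cokernel_of_kernel[OF assms(2) ker_kernel[OF c(5)]])
  have "cls f g (c \<cdot> ?k) = Zro A (Dom A (c \<cdot> ?k)) (homology_ob A f g)"
    using cls_Comp[OF assms(1), of ?k] k c by simp
  then have "covered f (c \<cdot> ?k)" using cls_Zro_iff cyc_Comp[OF assms(1)] k by blast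
  then have "t \<cdot> ?k = Zro A (Dom A ?k) (Cod A t)" using assms(5) k by blast
  then obtain h where "h \<in> Arr A" "Dom A h = Cod A (cls f g c)" "Cod A h = Cod A t"
    "h \<cdot> cls f g c = t"
    using cokernel_lift[OF ck, of t] assms c k by metis
  then show ?thesis using that c by simp
qed

lemma cls_eqI:
  assumes "cyc g c" "cyc g c'" "Dom A c = Dom A c'" "covered f (sub c c')"
  shows "cls f g c = cls f g c'"
proof -
  note c = cycD[OF assms(1)] cycD[OF assms(2)]
  have d: "cyc g (sub c c')" using cyc_Add[OF assms(1) cyc_neg[OF assms(2)]] assms c by simp
  have "Add A (cls f g (sub c c')) (cls f g c') = cls f g c"
    using cls_Add[OF d assms(2)] c assms by simp
  moreover have "cls f g (sub c c') = Zro A (Dom A c') (homology_ob A f g)"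
    using cls_Zro_iff[OF d] assms c by simp
  ultimately show ?thesis using cls_arr[OF assms(2)] by simp
qed

end

definition hmap :: "'m \<Rightarrow> 'm \<Rightarrow> 'm \<Rightarrow> 'm \<Rightarrow> 'm \<Rightarrow> 'm" where
  "hmap f g f' g' b = (THE h. h \<in> Hom A (homology_ob A f g) (homology_ob A f' g') \<and>
     (\<forall>c. cyc g c \<longrightarrow> h \<cdot> cls f g c = cls f' g' (b \<cdot> c)))"

lemma cyc_map:
  assumes "cyc g c" "b \<in> Arr A" "Dom A b = Dom A g" "Cod A b = Dom A g'" "r \<in> Arr A"
    "Dom A r = Cod A g" "g' \<in> Arr A" "Cod A r = Cod A g'" "g' \<cdot> b = r \<cdot> g"
  shows "cyc g' (b \<cdot> c)"
proof -
  note c = cycD[OF assms(1)]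
  have "g' \<cdot> b \<cdot> c = r \<cdot> g \<cdot> c" by (rule square_extend[OF assms(9)]) (use assms c in auto)
  then show ?thesis using assms c by (auto simp: cyc_def)
qed

text \<open>\<open>r\<close> and \<open>l\<close> are the components in the neighbouring degrees:
  \<open>r\<close> makes \<open>b\<close> preserve cycles, \<open>l\<close> makes it preserve
  boundaries. The induced morphism itself is determined by \<open>b\<close>.\<close>

lemma hmap:
  assumes fg: "cyc g f" and fg': "cyc g' f'"
    and b: "b \<in> Arr A" "Dom A b = Dom A g" "Cod A b = Dom A g'"
    and r: "r \<in> Arr A" "Dom A r = Cod A g" "Cod A r = Cod A g'" "g' \<cdot> b = r \<cdot> g"
    and l: "l \<in> Arr A" "Dom A l = Dom A f" "Cod A l = Dom A f'" "b \<cdot> f = f' \<cdot> l"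
  shows "hmap f g f' g' b \<in> Arr A" "Dom A (hmap f g f' g' b) = homology_ob A f g"
    "Cod A (hmap f g f' g' b) = homology_ob A f' g'"
    "\<And>c. cyc g c \<Longrightarrow> hmap f g f' g' b \<cdot> cls f g c = cls f' g' (b \<cdot> c)"
proof -
  note f = cycD[OF fg] and f' = cycD[OF fg']
  have bc: "cyc g' (b \<cdot> c)" if "cyc g c" for c
    by (rule cyc_map[OF that]) (use b r f f' in auto)
  let ?k = "ker A g"
  have k: "?k \<in> Arr A" "cyc g ?k" "Cod A ?k = Dom A g" using f by auto
  note cl = cls_arr[OF fg' bc[OF k(2)]]
  obtain h where h: "h \<in> Arr A" "Dom A h = homology_ob A f g"
    "Cod A h = Cod A (cls f' g' (b \<cdot> ?k))" "h \<cdot> cls f g ?k = cls f' g' (b \<cdot> ?k)"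
  proof (rule homology_desc[OF fg k(2) cls_ker_epi[OF fg]])
    show "cls f' g' (b \<cdot> ?k) \<in> Arr A" "Dom A (cls f' g' (b \<cdot> ?k)) = Dom A ?k" using cl b k by auto
    fix v assume v: "v \<in> Arr A" "Cod A v = Dom A ?k" "covered f (?k \<cdot> v)"
    from v(3) obtain e x where e: "is_epi A e" "e \<in> Arr A" "Cod A e = Dom A (?k \<cdot> v)" "x \<in> Arr A"
      "Dom A x = Dom A e" "Cod A x = Dom A f" "f \<cdot> x = (?k \<cdot> v) \<cdot> e" by (rule coveredE)
    have "f' \<cdot> l \<cdot> x = b \<cdot> f \<cdot> x"
      by (rule square_extend[OF l(4), symmetric]) (use b l e f f' in auto)
    also have "\<dots> = (b \<cdot> ?k \<cdot> v) \<cdot> e" using e b k v by simp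
    finally have "covered f' (b \<cdot> ?k \<cdot> v)"
      using e b k v l by (intro coveredI[of e _ "l \<cdot> x"]) auto
    then show "cls f' g' (b \<cdot> ?k) \<cdot> v = Zro A (Dom A v) (Cod A (cls f' g' (b \<cdot> ?k)))"
      using cls_Zro_iff[OF fg' bc[OF cyc_Comp[OF k(2) v(1,2)]]] cls_Comp[OF fg' bc[OF k(2)], of v]
        b k v cl by simp
  qed
  have hc: "h \<cdot> cls f g c = cls f' g' (b \<cdot> c)" if "cyc g c" for c
  proof -
    note kl = klift[OF that]
    have "cls f g c = cls f g ?k \<cdot> klift g c"
      using cls_Comp[OF fg k(2) kl(1,3)] kl by simp
    moreover have "h \<cdot> cls f g ?k \<cdot> klift g c = cls f' g' (b \<cdot> ?k) \<cdot> klift g c"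
      by (rule Comp_eq_extend[OF h(4)]) (use h kl cls_arr[OF fg k(2)] in auto)
    ultimately have "h \<cdot> cls f g c = cls f' g' (b \<cdot> ?k) \<cdot> klift g c" by simp
    also have "\<dots> = cls f' g' (b \<cdot> ?k \<cdot> klift g c)"
      using h(4) kl k b cls_Comp[OF fg' bc[OF k(2)], of "klift g c"] by simp
    finally show ?thesis using kl by simp
  qed
  have "\<exists>!h. h \<in> Hom A (homology_ob A f g) (homology_ob A f' g') \<and>
     (\<forall>c. cyc g c \<longrightarrow> h \<cdot> cls f g c = cls f' g' (b \<cdot> c))"
  proof (rule ex1I[of _ h])
    fix h' assume h': "h' \<in> Hom A (homology_ob A f g) (homology_ob A f' g') \<and>
     (\<forall>c. cyc g c \<longrightarrow> h' \<cdot> cls f g c = cls f' g' (b \<cdot> c))"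
    show "h' = h"
      by (rule homology_ext[OF fg]) (use h' h hc cl in \<open>auto simp: in_Hom\<close>)
  qed (use h hc cl in \<open>auto simp: in_Hom\<close>)
  from theI'[OF this] show "hmap f g f' g' b \<in> Arr A"
    "Dom A (hmap f g f' g' b) = homology_ob A f g"
    "Cod A (hmap f g f' g' b) = homology_ob A f' g'"
    "\<And>c. cyc g c \<Longrightarrow> hmap f g f' g' b \<cdot> cls f g c = cls f' g' (b \<cdot> c)"
    unfolding hmap_def by (auto simp: in_Hom)
qed

end

section \<open>The long exact homology sequence\<close>

\<comment> \<open>Indices \<open>n - 1\<close> must not be rewritten to \<open>n - Suc 0\<close>.\<close>
declare One_nat_def [simp del]

section \<open>Chain complexes and chain maps\<close>

context preadditive_category
begin

lemma sub_sub_self: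
  assumes a: "a \<in> Arr A" and b: "b \<in> Arr A" and d: "Dom A a = Dom A b" and c: "Cod A a = Cod A b"
  shows "sub a (sub a b) = b"
proof (rule Add_right_imp_eq[of _ "sub a b"])
  have "Add A b (sub a b) = Add A (sub a b) b" using a b c d by (intro Add_commute) auto
  then show "Add A (sub a (sub a b)) (sub a b) = Add A b (sub a b)"
    using a b c d sub_Add_cancel[of a "sub a b"] sub_Add_cancel[of a b] by simp
qed (use a b c d in auto)

text \<open>
  The index of the target of \<open>d 0\<close> is \<open>0 - 1 = 0\<close>, so \<open>d 0\<close> is a zero endomorphism and every
  element of degree 0 is a cycle.
\<close>

definition cplx :: "(nat \<Rightarrow> 'm) \<Rightarrow> bool" where
  "cplx d \<longleftrightarrow> (\<forall>n. Cod A (d n) = Dom A (d (n - 1)) \<and> cyc (d n) (d (Suc n))) \<and>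
     d 0 = Zro A (Dom A (d 0)) (Dom A (d 0))"

text \<open>With truncated subtraction the square in degree 0 relates the zero endomorphisms of the
  two complexes, so that one formula serves all degrees.\<close>

definition cmap :: "(nat \<Rightarrow> 'm) \<Rightarrow> (nat \<Rightarrow> 'm) \<Rightarrow> (nat \<Rightarrow> 'm) \<Rightarrow> bool" where
  "cmap d d' f \<longleftrightarrow> (\<forall>n. f n \<in> Arr A \<and> Dom A (f n) = Dom A (d n) \<and> Cod A (f n) = Dom A (d' n) \<and>
     d' n \<cdot> f n = f (n - 1) \<cdot> d n)"

abbreviation Hob :: "(nat \<Rightarrow> 'm) \<Rightarrow> nat \<Rightarrow> 'o" where
  "Hob d n \<equiv> homology_ob A (d (Suc n)) (d n)"

abbreviation hcl :: "(nat \<Rightarrow> 'm) \<Rightarrow> nat \<Rightarrow> 'm \<Rightarrow> 'm" where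
  "hcl d n c \<equiv> cls (d (Suc n)) (d n) c"

lemma cplxD:
  assumes "cplx d"
  shows "d n \<in> Arr A" "Cod A (d n) = Dom A (d (n - 1))" "cyc (d n) (d (Suc n))"
    "d n \<cdot> d (Suc n) = Zro A (Dom A (d (Suc n))) (Dom A (d (n - 1)))"
  using assms cycD[of "d n" "d (Suc n)"] unfolding cplx_def by auto

lemma cplx_0: "cplx d \<Longrightarrow> d 0 = Zro A (Dom A (d 0)) (Dom A (d 0))"
  by (simp add: cplx_def)

lemma cmapD:
  assumes "cmap d d' f"
  shows "f n \<in> Arr A" "Dom A (f n) = Dom A (d n)" "Cod A (f n) = Dom A (d' n)"
    "d' n \<cdot> f n = f (n - 1) \<cdot> d n" "d' (Suc n) \<cdot> f (Suc n) = f n \<cdot> d (Suc n)"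
  using assms unfolding cmap_def by (auto dest: spec[of _ "Suc n"])

lemma cyc_cplxI:
  assumes "cplx d" "c \<in> Arr A" "Cod A c = Dom A (d n)"
    "d n \<cdot> c = Zro A (Dom A c) (Dom A (d (n - 1)))"
  shows "cyc (d n) c"
  using cplxD[OF assms(1), of n] assms by (simp add: cyc_def)

lemma cyc_cplx0:
  assumes "cplx d" "c \<in> Arr A" "Cod A c = Dom A (d 0)"
  shows "cyc (d 0) c"
proof -
  have "Zro A (Dom A (d 0)) (Dom A (d 0)) \<cdot> c = Zro A (Dom A c) (Dom A (d 0))"
    using assms cplxD(1)[OF assms(1), of 0] by simp
  then show ?thesis
    using cplx_0[OF assms(1)] by (intro cyc_cplxI[OF assms(1-3)]) simp
qed

end

context abelian_category
begin

abbreviation Hmap :: "(nat \<Rightarrow> 'm) \<Rightarrow> (nat \<Rightarrow> 'm) \<Rightarrow> (nat \<Rightarrow> 'm) \<Rightarrow> nat \<Rightarrow> 'm" where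
  "Hmap d d' f n \<equiv> hmap (d (Suc n)) (d n) (d' (Suc n)) (d' n) (f n)"

lemma Hmap:
  assumes d: "cplx d" and d': "cplx d'" and f: "cmap d d' f"
  shows "Hmap d d' f n \<in> Arr A" "Dom A (Hmap d d' f n) = Hob d n" "Cod A (Hmap d d' f n) = Hob d' n"
    "\<And>c. cyc (d n) c \<Longrightarrow> Hmap d d' f n \<cdot> hcl d n c = hcl d' n (f n \<cdot> c)"
  by (rule hmap[where r = "f (n - 1)" and l = "f (Suc n)"];
      simp add: cplxD[OF d] cplxD[OF d'] cmapD[OF f])+

lemma cyc_cmap:
  assumes "cplx d" "cplx d'" "cmap d d' f" "cyc (d n) c"
  shows "cyc (d' n) (f n \<cdot> c)"
  by (rule cyc_map[OF assms(4), where r = "f (n - 1)"])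
    (simp_all add: cplxD[OF assms(1)] cplxD[OF assms(2)] cmapD[OF assms(3)])

text \<open>The condition prescribes the values on classes by the snake relation. It is written out
  for explicit complexes so that the connecting morphism is a total function of them, as the data of
  a partial functor require.\<close>

definition connecting :: "(nat \<Rightarrow> 'm) \<Rightarrow> (nat \<Rightarrow> 'm) \<Rightarrow> (nat \<Rightarrow> 'm) \<Rightarrow> (nat \<Rightarrow> 'm) \<Rightarrow>
    (nat \<Rightarrow> 'm) \<Rightarrow> nat \<Rightarrow> 'm" where
  "connecting dX dY dZ f g n = (THE h. h \<in> Hom A (Hob dZ (Suc n)) (Hob dX n) \<and>
     (\<forall>y x. y \<in> Arr A \<and> Cod A y = Dom A (dY (Suc n)) \<and> x \<in> Arr A \<and> Cod A x = Dom A (dX n) \<and>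
        Dom A x = Dom A y \<and> f n \<cdot> x = dY (Suc n) \<cdot> y \<longrightarrow>
        h \<cdot> hcl dZ (Suc n) (g (Suc n) \<cdot> y) = hcl dX n x))"

end

section \<open>The long exact sequence of a short exact sequence of complexes\<close>

locale short_exact_complexes = abelian_category A for A :: "('o, 'm, 'z) abcat_scheme" +
  fixes dX dY dZ f g :: "nat \<Rightarrow> 'm"
  assumes X: "cplx dX" and Y: "cplx dY" and Z: "cplx dZ"
    and f: "cmap dX dY f" and g: "cmap dY dZ g"
    and ses: "short_exact A (f n) (g n)"
begin

notation comp (infixr "\<cdot>" 70)

lemmas XD = cplxD[OF X] and YD = cplxD[OF Y] and ZD = cplxD[OF Z]
lemmas fD = cmapD[OF f] and gD = cmapD[OF g]

lemma kf: "is_kernel A (g n) (f n)" and cg: "is_cokernel A (f n) (g n)"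
  using ses unfolding short_exact_def by auto

lemma g_epi: "is_epi A (g n)" by (rule cokernel_epi[OF cg])

lemma f_mono: "is_mono A (f n)" by (rule kernel_mono[OF kf])

lemma gf: "g n \<cdot> f n = Zro A (Dom A (dX n)) (Dom A (dZ n))"
  using is_kernelD[OF kf[of n]] fD gD by simp

lemma gf': "x \<in> Arr A \<Longrightarrow> Cod A x = Dom A (dX n) \<Longrightarrow>
    g n \<cdot> f n \<cdot> x = Zro A (Dom A x) (Dom A (dZ n))"
  using Comp_eq_extend[OF gf[of n], of x] XD[of n] ZD[of n] fD[of n] gD[of n] by simp

lemma dY_f: "x \<in> Arr A \<Longrightarrow> Cod A x = Dom A (dX n) \<Longrightarrow> dY n \<cdot> f n \<cdot> x = f (n - 1) \<cdot> dX n \<cdot> x"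
  by (rule square_extend[OF fD(4)[of n]]) (use XD YD fD in auto)

lemma dZ_g: "x \<in> Arr A \<Longrightarrow> Cod A x = Dom A (dY n) \<Longrightarrow> dZ n \<cdot> g n \<cdot> x = g (n - 1) \<cdot> dY n \<cdot> x"
  by (rule square_extend[OF gD(4)[of n]]) (use YD ZD gD in auto)

lemma dY_dY: "x \<in> Arr A \<Longrightarrow> Cod A x = Dom A (dY (Suc n)) \<Longrightarrow>
    dY n \<cdot> dY (Suc n) \<cdot> x = Zro A (Dom A x) (Dom A (dY (n - 1)))"
  using Comp_eq_extend[OF YD(4)[of n], of x] YD(1,2)[of n] YD(1,2)[of "Suc n"] YD(1)[of "n - 1"] by simp

lemma f_lift:
  assumes "y \<in> Arr A" "Cod A y = Dom A (dY n)" "g n \<cdot> y = Zro A (Dom A y) (Dom A (dZ n))"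
  obtains x where "x \<in> Arr A" "Dom A x = Dom A y" "Cod A x = Dom A (dX n)" "f n \<cdot> x = y"
  using kernel_lift[OF kf[of n], of y] assms gD fD by metis

lemma f_cancel:
  assumes "f n \<cdot> x = f n \<cdot> x'" "x \<in> Arr A" "x' \<in> Arr A" "Dom A x = Dom A x'"
    "Cod A x = Dom A (dX n)" "Cod A x' = Dom A (dX n)"
  shows "x = x'"
  by (rule is_monoD[OF f_mono]) (use assms fD in auto)

lemma g_covered:
  assumes "z \<in> Arr A" "Cod A z = Dom A (dZ n)"
  obtains e y where "is_epi A e" "e \<in> Arr A" "Cod A e = Dom A z" "y \<in> Arr A" "Dom A y = Dom A e"
    "Cod A y = Dom A (dY n)" "g n \<cdot> y = z \<cdot> e"
proof -
  have "covered (g n) z" by (rule epi_covered[OF g_epi]) (use assms gD in auto)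
  then show ?thesis using that gD by (elim coveredE) auto
qed

text \<open>The relation \<open>snake n y x\<close> on generalized elements is the graph of the connecting morphism.\<close>

definition snake :: "nat \<Rightarrow> 'm \<Rightarrow> 'm \<Rightarrow> bool" where
  "snake n y x \<longleftrightarrow> y \<in> Arr A \<and> Cod A y = Dom A (dY (Suc n)) \<and> x \<in> Arr A \<and>
     Cod A x = Dom A (dX n) \<and> Dom A x = Dom A y \<and> f n \<cdot> x = dY (Suc n) \<cdot> y"

text \<open>The relation lives on cycles: the monomorphism \<open>f (n - 1)\<close> sends the
  boundary of \<open>x\<close> to a double boundary, and the boundary of
  \<open>g (Suc n) \<cdot> y\<close> is \<open>g n \<cdot> f n \<cdot> x\<close>, so both
  vanish.\<close>

lemma snakeD:
  assumes "snake n y x"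
  shows "y \<in> Arr A" "Cod A y = Dom A (dY (Suc n))" "x \<in> Arr A" "Cod A x = Dom A (dX n)"
    "Dom A x = Dom A y" "f n \<cdot> x = dY (Suc n) \<cdot> y" "cyc (dX n) x"
    "cyc (dZ (Suc n)) (g (Suc n) \<cdot> y)"
proof -
  show s: "y \<in> Arr A" "Cod A y = Dom A (dY (Suc n))" "x \<in> Arr A" "Cod A x = Dom A (dX n)"
    "Dom A x = Dom A y" "f n \<cdot> x = dY (Suc n) \<cdot> y" using assms by (auto simp: snake_def)
  have "f (n - 1) \<cdot> dX n \<cdot> x = dY n \<cdot> f n \<cdot> x"
      by (rule dY_f[symmetric]) (use s in auto)
  also have "\<dots> = dY n \<cdot> dY (Suc n) \<cdot> y" using s by simp
  also have "\<dots> = f (n - 1) \<cdot> Zro A (Dom A y) (Dom A (dX (n - 1)))"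
    using dY_dY s XD(1)[of "n - 1"] fD[of "n - 1"] by simp
  finally have "dX n \<cdot> x = Zro A (Dom A y) (Dom A (dX (n - 1)))"
    by (rule f_cancel) (use s XD[of n] XD(1)[of "n - 1"] in auto)
  then show "cyc (dX n) x" using cyc_cplxI[OF X] s by simp
  have "dZ (Suc n) \<cdot> g (Suc n) \<cdot> y = g n \<cdot> dY (Suc n) \<cdot> y"
    using dZ_g[of y "Suc n"] s by simp
  also have "\<dots> = g n \<cdot> f n \<cdot> x" using s by simp
  also have "\<dots> = Zro A (Dom A y) (Dom A (dZ n))" using gf'[OF s(3,4)] s(5) by simp
  finally show "cyc (dZ (Suc n)) (g (Suc n) \<cdot> y)"
    by (intro cyc_cplxI[OF Z]) (use s gD in auto)
qed

lemma snake_Comp: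
  assumes "snake n y x" "u \<in> Arr A" "Cod A u = Dom A y"
  shows "snake n (y \<cdot> u) (x \<cdot> u)"
proof -
  note s = snakeD[OF assms(1)]
  have "f n \<cdot> x \<cdot> u = dY (Suc n) \<cdot> y \<cdot> u"
    by (rule square_extend[OF s(6)]) (use s assms YD(1,2)[of "Suc n"] fD[of n] in auto)
  then show ?thesis using s assms by (auto simp: snake_def)
qed

lemma snake_sub:
  assumes "snake n y x" "snake n y' x'" "Dom A y = Dom A y'"
  shows "snake n (sub y y') (sub x x')"
  using snakeD[OF assms(1)] snakeD[OF assms(2)] assms(3) fD[of n] YD(1,2)[of "Suc n"]
  by (auto simp: snake_def)

text \<open>Lift \<open>z\<close> along the epimorphism \<open>g (Suc n)\<close> on a cover; the
  boundary of the lift dies in the quotient complex, so it comes from the subcomplex.\<close>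

lemma snake_ex:
  assumes "cyc (dZ (Suc n)) z"
  obtains e y x where "is_epi A e" "e \<in> Arr A" "Cod A e = Dom A z" "snake n y x" "Dom A y = Dom A e"
    "g (Suc n) \<cdot> y = z \<cdot> e"
proof -
  note z = cycD[OF assms]
  obtain e y where e: "is_epi A e" "e \<in> Arr A" "Cod A e = Dom A z" "y \<in> Arr A" "Dom A y = Dom A e"
    "Cod A y = Dom A (dY (Suc n))" "g (Suc n) \<cdot> y = z \<cdot> e" using g_covered[OF z(2,3)] .
  have "g n \<cdot> dY (Suc n) \<cdot> y = dZ (Suc n) \<cdot> g (Suc n) \<cdot> y" using dZ_g[of y "Suc n"] e by simp
  also have "\<dots> = dZ (Suc n) \<cdot> z \<cdot> e" using e by simp
  also have "\<dots> = Zro A (Dom A y) (Dom A (dZ n))"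
    using cycD(4)[OF cyc_Comp[OF assms e(2,3)]] e z ZD[of "Suc n"] by simp
  finally obtain x where x: "x \<in> Arr A" "Dom A x = Dom A y" "Cod A x = Dom A (dX n)"
    "f n \<cdot> x = dY (Suc n) \<cdot> y"
    using f_lift[of "dY (Suc n) \<cdot> y" n] e YD[of "Suc n"] by auto
  show ?thesis by (rule that[OF e(1,2,3) _ e(5,7), of x]) (use x e in \<open>auto simp: snake_def\<close>)
qed

text \<open>The reason for well-definedness: a chain whose boundary is
  \<open>g (Suc n) \<cdot> y\<close> lifts to some \<open>y'\<close>; subtracting the boundary of
  \<open>y'\<close> from \<open>y\<close> leaves a chain of the subcomplex, and its boundary there
  is \<open>x\<close>.\<close>

lemma snake_boundary:
  assumes "snake n y x" "covered (dZ (Suc (Suc n))) (g (Suc n) \<cdot> y)"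
  shows "covered (dX (Suc n)) x"
proof -
  note s = snakeD[OF assms(1)] and gn = gD[of "Suc n"] and Yn = YD(1,2)[of "Suc n"] YD(1,2)[of "Suc (Suc n)"]
    and Zn = ZD(1,2)[of "Suc (Suc n)"] and Xn = XD(1,2)[of "Suc n"]
  obtain e z where e: "is_epi A e" "e \<in> Arr A" "Cod A e = Dom A (g (Suc n) \<cdot> y)" "z \<in> Arr A"
    "Dom A z = Dom A e" "Cod A z = Dom A (dZ (Suc (Suc n)))"
    "dZ (Suc (Suc n)) \<cdot> z = (g (Suc n) \<cdot> y) \<cdot> e" using coveredE[OF assms(2)] .
  obtain e' y' where e': "is_epi A e'" "e' \<in> Arr A" "Cod A e' = Dom A z" "y' \<in> Arr A"
    "Dom A y' = Dom A e'" "Cod A y' = Dom A (dY (Suc (Suc n)))" "g (Suc (Suc n)) \<cdot> y' = z \<cdot> e'"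
    using g_covered[OF e(4,6)] .
  have ce: "Cod A e = Dom A y" using e s gn by simp
  let ?w = "sub (y \<cdot> e \<cdot> e') (dY (Suc (Suc n)) \<cdot> y')"
  have w: "?w \<in> Arr A" "Dom A ?w = Dom A e'" "Cod A ?w = Dom A (dY (Suc n))"
    using s e e' ce Yn by auto
  have "g (Suc n) \<cdot> dY (Suc (Suc n)) \<cdot> y' = dZ (Suc (Suc n)) \<cdot> g (Suc (Suc n)) \<cdot> y'"
    using dZ_g[of y' "Suc (Suc n)"] e' by simp
  also have "\<dots> = dZ (Suc (Suc n)) \<cdot> z \<cdot> e'" using e' by simp
  also have "\<dots> = ((g (Suc n) \<cdot> y) \<cdot> e) \<cdot> e'"
    by (rule Comp_eq_extend[OF e(7)]) (use e e' Zn in auto)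
  also have "\<dots> = g (Suc n) \<cdot> y \<cdot> e \<cdot> e'" using s e e' ce gn by simp
  finally have "g (Suc n) \<cdot> ?w = Zro A (Dom A ?w) (Dom A (dZ (Suc n)))"
    using s e e' ce gn Yn by simp
  then obtain x1 where x1: "x1 \<in> Arr A" "Dom A x1 = Dom A ?w" "Cod A x1 = Dom A (dX (Suc n))"
    "f (Suc n) \<cdot> x1 = ?w" using f_lift[OF w(1,3)] by blast
  have "f n \<cdot> dX (Suc n) \<cdot> x1 = dY (Suc n) \<cdot> ?w" using dY_f[of x1 "Suc n"] x1 by simp
  also have "\<dots> = dY (Suc n) \<cdot> y \<cdot> e \<cdot> e'"
    using dY_dY[of y' "Suc n"] s e e' ce Yn YD(1)[of n] by simp
  also have "\<dots> = f n \<cdot> x \<cdot> e \<cdot> e'"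
    by (rule square_extend[OF s(6), symmetric]) (use s e e' ce Yn fD[of n] in auto)
  finally have "dX (Suc n) \<cdot> x1 = x \<cdot> e \<cdot> e'"
    by (rule f_cancel) (use s e e' ce w x1 Xn in auto)
  then show ?thesis
    by (intro coveredI[OF epi_Comp[OF e'(1) e(1)], of x x1]) (use s e e' ce w x1 Xn in auto)
qed

text \<open>The universal cycle of the quotient complex need not lift, but its restriction to the
  cover \<open>e\<close> does. The class of that restriction is still an epimorphism, so this one
  snake pair determines the morphism.\<close>

lemma connecting:
  shows "connecting dX dY dZ f g n \<in> Arr A"
    "Dom A (connecting dX dY dZ f g n) = Hob dZ (Suc n)"
    "Cod A (connecting dX dY dZ f g n) = Hob dX n"
    "\<And>y x. snake n y x \<Longrightarrow>
       connecting dX dY dZ f g n \<cdot> hcl dZ (Suc n) (g (Suc n) \<cdot> y) = hcl dX n x"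
proof -
  let ?z = "ker A (dZ (Suc n))"
  note Zc = ZD(3)[of "Suc n"] and Xc = XD(3)[of n]
  have z: "?z \<in> Arr A" "Cod A ?z = Dom A (dZ (Suc n))" "cyc (dZ (Suc n)) ?z"
    using ZD(1)[of "Suc n"] by auto
  obtain e y x where e: "is_epi A e" "e \<in> Arr A" "Cod A e = Dom A ?z" "snake n y x"
    "Dom A y = Dom A e" "g (Suc n) \<cdot> y = ?z \<cdot> e" using snake_ex[OF z(3)] .
  note s = snakeD[OF e(4)]
  have ze: "cyc (dZ (Suc n)) (?z \<cdot> e)" using cyc_Comp[OF z(3) e(2,3)] .
  have ep: "is_epi A (hcl dZ (Suc n) (?z \<cdot> e))"
    using epi_Comp[OF e(1) cls_ker_epi[OF Zc]] cls_Comp[OF Zc z(3) e(2,3)] cls_arr[OF Zc z(3)] e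
    by simp
  obtain h where h: "h \<in> Arr A" "Dom A h = Hob dZ (Suc n)" "Cod A h = Hob dX n"
    "h \<cdot> hcl dZ (Suc n) (?z \<cdot> e) = hcl dX n x"
  proof (rule homology_desc[OF Zc ze ep])
    show "hcl dX n x \<in> Arr A" "Dom A (hcl dX n x) = Dom A (?z \<cdot> e)"
      using cls_arr[OF Xc s(7)] s e z by auto
    fix v assume v: "v \<in> Arr A" "Cod A v = Dom A (?z \<cdot> e)" "covered (dZ (Suc (Suc n))) ((?z \<cdot> e) \<cdot> v)"
    have cv: "Cod A v = Dom A y" using v z e by simp
    have "g (Suc n) \<cdot> y \<cdot> v = (?z \<cdot> e) \<cdot> v"
      by (rule Comp_eq_extend[OF e(6)]) (use s v cv gD in auto)
    then have "covered (dX (Suc n)) (x \<cdot> v)"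
      using snake_boundary[OF snake_Comp[OF e(4) v(1) cv]] v by simp
    then show "hcl dX n x \<cdot> v = Zro A (Dom A v) (Cod A (hcl dX n x))"
      using cls_Zro_iff[OF Xc cyc_Comp[OF s(7) v(1)]] cls_Comp[OF Xc s(7) v(1)] cls_arr[OF Xc s(7)] s cv v
      by simp
  qed (use that cls_arr[OF Xc s(7)] in auto)
  \<comment> \<open>An arbitrary pair is compared with the chosen one on a common cover: there both
    lie over the same cycle, so their difference lies over zero and its second component must be a
    boundary.\<close>
  have hh: "h \<cdot> hcl dZ (Suc n) (g (Suc n) \<cdot> y') = hcl dX n x'" if s': "snake n y' x'" for y' x'
  proof -
    note t = snakeD[OF s']
    let ?k = "klift (dZ (Suc n)) (g (Suc n) \<cdot> y')"
    note k = klift[OF t(8)]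
    have dk: "Dom A ?k = Dom A y'" using k t gD by simp
    have "covered e ?k" by (rule epi_covered[OF e(1)]) (use k e in auto)
    then obtain e1 u where u: "is_epi A e1" "e1 \<in> Arr A" "Cod A e1 = Dom A ?k" "u \<in> Arr A"
      "Dom A u = Dom A e1" "Cod A u = Dom A e" "e \<cdot> u = ?k \<cdot> e1" by (rule coveredE)
    have "?z \<cdot> ?k \<cdot> e1 = (g (Suc n) \<cdot> y') \<cdot> e1"
      by (rule Comp_eq_extend[OF k(4)]) (use k u z in auto)
    then have "g (Suc n) \<cdot> y' \<cdot> e1 = ?z \<cdot> e \<cdot> u" using u t gD dk by simp
    then have gy: "g (Suc n) \<cdot> y' \<cdot> e1 = (?z \<cdot> e) \<cdot> u" using z u e by simp
    have gy2: "g (Suc n) \<cdot> y \<cdot> u = (?z \<cdot> e) \<cdot> u"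
      by (rule Comp_eq_extend[OF e(6)]) (use s u e gD in auto)
    have s1: "snake n (y' \<cdot> e1) (x' \<cdot> e1)" by (rule snake_Comp[OF s']) (use u dk in auto)
    have s2: "snake n (y \<cdot> u) (x \<cdot> u)" by (rule snake_Comp[OF e(4)]) (use u e in auto)
    note t1 = snakeD[OF s1] and t2 = snakeD[OF s2]
    have d: "Dom A (y' \<cdot> e1) = Dom A (y \<cdot> u)" using u s t dk e by simp
    have s3: "snake n (sub (y' \<cdot> e1) (y \<cdot> u)) (sub (x' \<cdot> e1) (x \<cdot> u))"
      by (rule snake_sub[OF s1 s2 d])
    have "g (Suc n) \<cdot> sub (y' \<cdot> e1) (y \<cdot> u) = sub (g (Suc n) \<cdot> y' \<cdot> e1) (g (Suc n) \<cdot> y \<cdot> u)"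
      using t1(1,2) t2(1,2) d gD[of "Suc n"] by (subst Comp_Add(2)) auto
    also have "\<dots> = Zro A (Dom A (y \<cdot> u)) (Dom A (dZ (Suc n)))"
      unfolding gy gy2 using z(1,2) u(2,4-6) e(2,3,5) s(1,2,5) by simp
    finally have g0: "g (Suc n) \<cdot> sub (y' \<cdot> e1) (y \<cdot> u) = Zro A (Dom A (y \<cdot> u)) (Dom A (dZ (Suc n)))" .
    \<comment> \<open>Zero is the boundary of the zero chain one degree up, which is what
      \<open>snake_boundary\<close> asks of the difference of the two pairs.\<close>
    have "covered (dX (Suc n)) (sub (x' \<cdot> e1) (x \<cdot> u))"
      by (rule snake_boundary[OF s3], unfold g0,
          rule coveredI'[of _ "Zro A (Dom A (y \<cdot> u)) (Dom A (dZ (Suc (Suc n))))"])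
        (use t2 ZD(1,2)[of "Suc (Suc n)"] ZD(1)[of "Suc n"] in auto)
    then have "hcl dX n (x' \<cdot> e1) = hcl dX n (x \<cdot> u)"
      by (intro cls_eqI[OF Xc t1(7) t2(7)]) (use d t1 t2 in auto)
    also have "\<dots> = hcl dX n x \<cdot> u" using cls_Comp[OF Xc s(7)] u s e by simp
    also have "\<dots> = (h \<cdot> hcl dZ (Suc n) (?z \<cdot> e)) \<cdot> u" using h by simp
    also have "\<dots> = h \<cdot> hcl dZ (Suc n) (?z \<cdot> e) \<cdot> u"
      using h cls_arr[OF Zc ze] u e z by (intro Comp_assoc') auto
    also have "\<dots> = h \<cdot> hcl dZ (Suc n) ((?z \<cdot> e) \<cdot> u)"
      using cls_Comp[OF Zc ze, of u] u z e by simp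
    also have "\<dots> = h \<cdot> hcl dZ (Suc n) ((g (Suc n) \<cdot> y') \<cdot> e1)"
      unfolding gy[symmetric] using t u dk gD[of "Suc n"] by simp
    also have "\<dots> = (h \<cdot> hcl dZ (Suc n) (g (Suc n) \<cdot> y')) \<cdot> e1"
      using cls_Comp[OF Zc t(8), of e1] cls_arr[OF Zc t(8)] u t dk gD[of "Suc n"] h by simp
    finally have "(h \<cdot> hcl dZ (Suc n) (g (Suc n) \<cdot> y')) \<cdot> e1 = hcl dX n x' \<cdot> e1"
      using cls_Comp[OF Xc t(7), of e1] u t dk by simp
    note eq = this
    show ?thesis
      by (rule is_epiD[OF u(1)])
        (use eq cls_arr[OF Zc t(8)] cls_arr[OF Xc t(7)] u t dk gD[of "Suc n"] h in auto)
  qed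
  have "\<exists>!h. h \<in> Hom A (Hob dZ (Suc n)) (Hob dX n) \<and> (\<forall>y x. snake n y x \<longrightarrow>
        h \<cdot> hcl dZ (Suc n) (g (Suc n) \<cdot> y) = hcl dX n x)"
  proof (rule ex1I[of _ h])
    fix h' assume h': "h' \<in> Hom A (Hob dZ (Suc n)) (Hob dX n) \<and> (\<forall>y x. snake n y x \<longrightarrow>
        h' \<cdot> hcl dZ (Suc n) (g (Suc n) \<cdot> y) = hcl dX n x)"
    then have eq: "h' \<cdot> hcl dZ (Suc n) (?z \<cdot> e) = hcl dX n x" using e by metis
    show "h' = h"
      by (rule is_epiD[OF ep]) (use eq h h' cls_arr[OF Zc ze] in \<open>auto simp: in_Hom\<close>)
  qed (use h hh in \<open>auto simp: in_Hom\<close>)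
  from theI'[OF this]
  show "connecting dX dY dZ f g n \<in> Arr A"
    "Dom A (connecting dX dY dZ f g n) = Hob dZ (Suc n)"
    "Cod A (connecting dX dY dZ f g n) = Hob dX n"
    "\<And>y x. snake n y x \<Longrightarrow>
       connecting dX dY dZ f g n \<cdot> hcl dZ (Suc n) (g (Suc n) \<cdot> y) = hcl dX n x"
    unfolding connecting_def snake_def[symmetric] by (auto simp: in_Hom)
qed

lemma Hf: "Hmap dX dY f n \<in> Arr A" "Dom A (Hmap dX dY f n) = Hob dX n" "Cod A (Hmap dX dY f n) = Hob dY n"
    "\<And>c. cyc (dX n) c \<Longrightarrow> Hmap dX dY f n \<cdot> hcl dX n c = hcl dY n (f n \<cdot> c)"
  by (rule Hmap[OF X Y f]; assumption?)+

lemma Hg: "Hmap dY dZ g n \<in> Arr A" "Dom A (Hmap dY dZ g n) = Hob dY n" "Cod A (Hmap dY dZ g n) = Hob dZ n"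
    "\<And>c. cyc (dY n) c \<Longrightarrow> Hmap dY dZ g n \<cdot> hcl dY n c = hcl dZ n (g n \<cdot> c)"
  by (rule Hmap[OF Y Z g]; assumption?)+

lemma Hob_Obj: "Hob dX n \<in> Obj A" "Hob dY n \<in> Obj A" "Hob dZ n \<in> Obj A"
  using homology_ob_Obj XD(3) YD(3) ZD(3) by auto

text \<open>Transfers a vanishing statement from an element \<open>a\<close> of homology to the
  cycle that represents \<open>a\<close> on the cover \<open>e\<close>.\<close>

lemma hcl_Comp_Zro:
  assumes "cplx d" "cyc (d n) c" "e \<in> Arr A" "Cod A e = Dom A a" "a \<in> Arr A" "hcl d n c = a \<cdot> e"
    "h \<in> Arr A" "Dom A h = Cod A a" "h \<cdot> a = Zro A (Dom A a) (Cod A h)"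
  shows "h \<cdot> hcl d n c = Zro A (Dom A c) (Cod A h)"
proof -
  have "h \<cdot> a \<cdot> e = Zro A (Dom A a) (Cod A h) \<cdot> e"
    by (rule Comp_eq_extend[OF assms(9)]) (use assms in auto)
  moreover have "Dom A c = Dom A e"
    using cls_arr(2)[OF cplxD(3)[OF assms(1)] assms(2)] assms by simp
  ultimately show ?thesis using assms by simp
qed

lemma exact_middle: "exact A (Hmap dX dY f n) (Hmap dY dZ g n)"
proof (rule exactI_covered)
  show "Hmap dY dZ g n \<cdot> Hmap dX dY f n = Zro A (Dom A (Hmap dX dY f n)) (Cod A (Hmap dY dZ g n))"
  proof (rule homology_ext[OF XD(3)[of n]])
    fix c assume c: "cyc (dX n) c"
    note fc = cyc_cmap[OF X Y f c] and cc = cycD[OF c]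
    have "(Hmap dY dZ g n \<cdot> Hmap dX dY f n) \<cdot> hcl dX n c = Hmap dY dZ g n \<cdot> Hmap dX dY f n \<cdot> hcl dX n c"
      using Hf Hg cls_arr[OF XD(3) c] by simp
    also have "\<dots> = hcl dZ n (g n \<cdot> f n \<cdot> c)" using Hf(4)[OF c] Hg(4)[OF fc] by simp
    also have "\<dots> = hcl dZ n (Zro A (Dom A c) (Dom A (dZ n)))" using gf'[OF cc(2,3)] by simp
    also have "\<dots> = Zro A (Dom A c) (Hob dZ n)"
      using cc ZD(1)[of n] ZD(2)[of n] ZD(1)[of "n - 1"]
      by (intro cls_Zro[OF ZD(3)]) (auto simp: cyc_def)
    finally show "(Hmap dY dZ g n \<cdot> Hmap dX dY f n) \<cdot> hcl dX n c =
      Zro A (Dom A (Hmap dX dY f n)) (Cod A (Hmap dY dZ g n)) \<cdot> hcl dX n c"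
      using Hf Hg Hob_Obj cls_arr[OF XD(3) c] by simp
  qed (use Hf Hg Hob_Obj in auto)
next
  fix a assume a: "a \<in> Arr A" "Cod A a = Dom A (Hmap dY dZ g n)"
    "Hmap dY dZ g n \<cdot> a = Zro A (Dom A a) (Cod A (Hmap dY dZ g n))"
  have ca: "Cod A a = Hob dY n" using a Hg by simp
  note Yn = YD(1,2)[of n] YD(1,2)[of "Suc n"] and Zn = ZD(1,2)[of n] ZD(1,2)[of "Suc n"]
  obtain e y where e: "is_epi A e" "e \<in> Arr A" "Cod A e = Dom A a" "cyc (dY n) y" "Dom A y = Dom A e"
    "hcl dY n y = a \<cdot> e" using cls_cover[OF YD(3) a(1) ca] .
  note y = cycD[OF e(4)] and gy = cyc_cmap[OF Y Z g e(4)]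
  have "Hmap dY dZ g n \<cdot> hcl dY n y = Zro A (Dom A y) (Cod A (Hmap dY dZ g n))"
    by (rule hcl_Comp_Zro[OF Y e(4,2,3) a(1) e(6) Hg(1) _ a(3)]) (use Hg ca in auto)
  then have "hcl dZ n (g n \<cdot> y) = Zro A (Dom A (g n \<cdot> y)) (Hob dZ n)"
    using Hg(3) Hg(4)[OF e(4)] y gD by simp
  then have "covered (dZ (Suc n)) (g n \<cdot> y)" using cls_Zro_iff[OF ZD(3) gy] by simp
  then obtain e1 z where z: "is_epi A e1" "e1 \<in> Arr A" "Cod A e1 = Dom A (g n \<cdot> y)" "z \<in> Arr A"
    "Dom A z = Dom A e1" "Cod A z = Dom A (dZ (Suc n))" "dZ (Suc n) \<cdot> z = (g n \<cdot> y) \<cdot> e1"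
    by (rule coveredE)
  obtain e2 y' where y': "is_epi A e2" "e2 \<in> Arr A" "Cod A e2 = Dom A z" "y' \<in> Arr A"
    "Dom A y' = Dom A e2" "Cod A y' = Dom A (dY (Suc n))" "g (Suc n) \<cdot> y' = z \<cdot> e2"
    using g_covered[OF z(4,6)] .
  have ce1: "Cod A e1 = Dom A y" using z y gD by simp
  \<comment> \<open>On a cover \<open>g n \<cdot> y\<close> is the boundary of \<open>z\<close>.
    Subtracting the boundary of a lift of \<open>z\<close> moves \<open>y\<close> into the image of
    \<open>f n\<close> without changing its class.\<close>
  let ?w = "sub (y \<cdot> e1 \<cdot> e2) (dY (Suc n) \<cdot> y')"
  have w: "?w \<in> Arr A" "Dom A ?w = Dom A e2" "Cod A ?w = Dom A (dY n)"
    using y y' z ce1 Yn by auto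
  have "g n \<cdot> dY (Suc n) \<cdot> y' = dZ (Suc n) \<cdot> g (Suc n) \<cdot> y'"
    using dZ_g[of y' "Suc n"] y' by simp
  also have "\<dots> = dZ (Suc n) \<cdot> z \<cdot> e2" using y' by simp
  also have "\<dots> = ((g n \<cdot> y) \<cdot> e1) \<cdot> e2"
    by (rule Comp_eq_extend[OF z(7)]) (use y' z Zn in auto)
  also have "\<dots> = g n \<cdot> y \<cdot> e1 \<cdot> e2" using y y' z ce1 gD by simp
  finally have "g n \<cdot> ?w = Zro A (Dom A ?w) (Dom A (dZ n))"
    using y y' z(1-6) ce1 gD[of n] Yn by simp
  then obtain x where x: "x \<in> Arr A" "Dom A x = Dom A ?w" "Cod A x = Dom A (dX n)"
    "f n \<cdot> x = ?w" using f_lift[OF w(1,3)] by blast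
  have "dY n \<cdot> y \<cdot> e1 \<cdot> e2 = Zro A (Dom A e2) (Dom A (dY (n - 1)))"
    using cycD(4)[OF cyc_Comp[OF e(4), of "e1 \<cdot> e2"]] y y' z ce1 Yn by simp
  then have "dY n \<cdot> ?w = Zro A (Dom A e2) (Dom A (dY (n - 1)))"
    using dY_dY[of y' n] y y' z(1-6) ce1 Yn YD(1)[of "n - 1"] by simp
  then have "f (n - 1) \<cdot> dX n \<cdot> x = f (n - 1) \<cdot> Zro A (Dom A e2) (Dom A (dX (n - 1)))"
    using dY_f[of x n] x fD[of "n - 1"] XD(1)[of "n - 1"] y' by simp
  then have "dX n \<cdot> x = Zro A (Dom A e2) (Dom A (dX (n - 1)))"
    by (rule f_cancel) (use x w y' XD(1,2)[of n] XD(1)[of "n - 1"] in auto)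
  then have xc: "cyc (dX n) x" by (intro cyc_cplxI[OF X]) (use x w in auto)
  have wc: "cyc (dY n) ?w" using cyc_cmap[OF X Y f xc] x by simp
  have yc: "cyc (dY n) (y \<cdot> e1 \<cdot> e2)" by (rule cyc_Comp[OF e(4)]) (use z y' ce1 in auto)
  have "hcl dY n (y \<cdot> e1 \<cdot> e2) = hcl dY n ?w"
  proof (rule cls_eqI[OF YD(3) yc wc])
    let ?b = "dY (Suc n) \<cdot> y'" and ?a = "y \<cdot> e1 \<cdot> e2"
    have ab: "?a \<in> Arr A" "?b \<in> Arr A" "Dom A ?a = Dom A ?b" "Cod A ?a = Cod A ?b"
      using y y' z ce1 Yn by auto
    have "sub ?a ?w = ?b" using ab by (rule sub_sub_self)
    then show "covered (dY (Suc n)) (sub ?a ?w)"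
      by (intro coveredI'[of _ y']) (use y' Yn in auto)
  qed (use y y' z ce1 w in auto)
  then have "Hmap dX dY f n \<cdot> hcl dX n x = hcl dY n (y \<cdot> e1 \<cdot> e2)"
    using Hf(4)[OF xc] x by simp
  also have "\<dots> = hcl dY n y \<cdot> e1 \<cdot> e2"
    using cls_Comp[OF YD(3) e(4), of "e1 \<cdot> e2"] z y' ce1 by simp
  also have "\<dots> = a \<cdot> e \<cdot> e1 \<cdot> e2" using e a ca z y' ce1 by simp
  finally show "covered (Hmap dX dY f n) a"
    by (intro coveredI[of "e \<cdot> e1 \<cdot> e2" a "hcl dX n x"] epi_Comp)
      (use e z y' ce1 a cls_arr[OF XD(3) xc] Hf x w in auto)
qed (use Hf Hg in auto)

lemma exact_connecting_left: "exact A (Hmap dY dZ g (Suc n)) (connecting dX dY dZ f g n)"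
proof (rule exactI_covered)
  let ?\<delta> = "connecting dX dY dZ f g n"
  show "?\<delta> \<cdot> Hmap dY dZ g (Suc n) = Zro A (Dom A (Hmap dY dZ g (Suc n))) (Cod A ?\<delta>)"
  proof (rule homology_ext[OF YD(3)[of "Suc n"]])
    fix c assume c: "cyc (dY (Suc n)) c"
    note cc = cycD[OF c] and Xn = XD(1,2)[of n] XD(1)[of "n - 1"]
    let ?z = "Zro A (Dom A c) (Dom A (dX n))"
    \<comment> \<open>A cycle of the middle complex has zero boundary, so the zero chain completes
      it to a snake pair.\<close>
    have s: "snake n c ?z" using cc fD[of n] YD[of "Suc n"] Xn by (auto simp: snake_def)
    have "(?\<delta> \<cdot> Hmap dY dZ g (Suc n)) \<cdot> hcl dY (Suc n) c = ?\<delta> \<cdot> Hmap dY dZ g (Suc n) \<cdot> hcl dY (Suc n) c"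
      using Hg[of "Suc n"] connecting[of n] cls_arr[OF YD(3) c] by simp
    also have "\<dots> = hcl dX n ?z" using Hg(4)[OF c] connecting(4)[OF s] by simp
    also have "\<dots> = Zro A (Dom A c) (Hob dX n)"
      using cc Xn by (intro cls_Zro[OF XD(3)]) (auto simp: cyc_def)
    finally show "(?\<delta> \<cdot> Hmap dY dZ g (Suc n)) \<cdot> hcl dY (Suc n) c =
      Zro A (Dom A (Hmap dY dZ g (Suc n))) (Cod A ?\<delta>) \<cdot> hcl dY (Suc n) c"
      using Hg connecting[of n] Hob_Obj cls_arr[OF YD(3) c] by simp
  qed (use Hg connecting[of n] Hob_Obj in auto)
next
  let ?\<delta> = "connecting dX dY dZ f g n"
  note D = connecting[of n]
  fix a assume a: "a \<in> Arr A" "Cod A a = Dom A ?\<delta>" "?\<delta> \<cdot> a = Zro A (Dom A a) (Cod A ?\<delta>)"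
  have ca: "Cod A a = Hob dZ (Suc n)" using a D by simp
  obtain e0 z where e0: "is_epi A e0" "e0 \<in> Arr A" "Cod A e0 = Dom A a" "cyc (dZ (Suc n)) z" "Dom A z = Dom A e0"
    "hcl dZ (Suc n) z = a \<cdot> e0" using cls_cover[OF ZD(3) a(1) ca] .
  obtain e y x where e: "is_epi A e" "e \<in> Arr A" "Cod A e = Dom A z" "snake n y x" "Dom A y = Dom A e"
    "g (Suc n) \<cdot> y = z \<cdot> e" using snake_ex[OF e0(4)] .
  note s = snakeD[OF e(4)] and z = cycD[OF e0(4)]
  have hz: "hcl dZ (Suc n) (g (Suc n) \<cdot> y) = a \<cdot> e0 \<cdot> e"
    using cls_Comp[OF ZD(3) e0(4) e(2,3)] e e0 a by simp
  have "?\<delta> \<cdot> hcl dZ (Suc n) (g (Suc n) \<cdot> y) = Zro A (Dom A (g (Suc n) \<cdot> y)) (Cod A ?\<delta>)"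
    by (rule hcl_Comp_Zro[OF Z s(8) _ _ a(1) _ D(1) _ a(3), of "e0 \<cdot> e"]) (use hz e e0 a in auto)
  then have "hcl dX n x = Zro A (Dom A x) (Hob dX n)" using D(3) D(4)[OF e(4)] s gD by simp
  then have "covered (dX (Suc n)) x" using cls_Zro_iff[OF XD(3) s(7)] by simp
  then obtain e1 x1 where x1: "is_epi A e1" "e1 \<in> Arr A" "Cod A e1 = Dom A x" "x1 \<in> Arr A"
    "Dom A x1 = Dom A e1" "Cod A x1 = Dom A (dX (Suc n))" "dX (Suc n) \<cdot> x1 = x \<cdot> e1"
    by (rule coveredE)
  \<comment> \<open>On a cover \<open>x\<close> is the boundary of \<open>x1\<close>; removing
    \<open>f (Suc n) \<cdot> x1\<close> from \<open>y\<close> leaves a cycle with the same image in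
    the quotient.\<close>
  let ?w = "sub (y \<cdot> e1) (f (Suc n) \<cdot> x1)"
  note Yn = YD(1,2)[of "Suc n"] and fn = fD(1-3)[of "Suc n"] and gn = gD(1-3)[of "Suc n"]
  have w: "?w \<in> Arr A" "Dom A ?w = Dom A e1" "Cod A ?w = Dom A (dY (Suc n))"
    using s x1 fn by auto
  have "dY (Suc n) \<cdot> y \<cdot> e1 = f n \<cdot> x \<cdot> e1"
    by (rule square_extend[OF s(6)[symmetric]]) (use s x1 Yn fD(1-3)[of n] in auto)
  also have "\<dots> = dY (Suc n) \<cdot> f (Suc n) \<cdot> x1" using dY_f[OF x1(4,6)] x1 by simp
  finally have "dY (Suc n) \<cdot> ?w = Zro A (Dom A ?w) (Dom A (dY n))"
    using s(1-5) x1(1-6) fn Yn w by simp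
  then have wc: "cyc (dY (Suc n)) ?w" by (intro cyc_cplxI[OF Y]) (use w in auto)
  have "g (Suc n) \<cdot> ?w = (g (Suc n) \<cdot> y) \<cdot> e1"
    using gf'[OF x1(4,6)] s(1-5) x1(1-6) fn gn ZD(1)[of "Suc n"] by simp
  then have "Hmap dY dZ g (Suc n) \<cdot> hcl dY (Suc n) ?w = hcl dZ (Suc n) (g (Suc n) \<cdot> y) \<cdot> e1"
    using Hg(4)[OF wc] cls_Comp[OF ZD(3) s(8), of e1] x1 s gn by simp
  also have "\<dots> = a \<cdot> e0 \<cdot> e \<cdot> e1" using hz e e0 a x1 s by simp
  finally show "covered (Hmap dY dZ g (Suc n)) a"
    by (intro coveredI[of "e0 \<cdot> e \<cdot> e1" a "hcl dY (Suc n) ?w"] epi_Comp)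
      (use e e0 x1 s a cls_arr[OF YD(3) wc] Hg w in auto)
qed (use Hg connecting[of n] in auto)

lemma exact_connecting_right: "exact A (connecting dX dY dZ f g n) (Hmap dX dY f n)"
proof (rule exactI_covered)
  let ?\<delta> = "connecting dX dY dZ f g n"
  note D = connecting[of n]
  show "Hmap dX dY f n \<cdot> ?\<delta> = Zro A (Dom A ?\<delta>) (Cod A (Hmap dX dY f n))"
  proof (rule homology_ext[OF ZD(3)[of "Suc n"]])
    fix c assume c: "cyc (dZ (Suc n)) c"
    obtain e y x where e: "is_epi A e" "e \<in> Arr A" "Cod A e = Dom A c" "snake n y x" "Dom A y = Dom A e"
      "g (Suc n) \<cdot> y = c \<cdot> e" using snake_ex[OF c] .
    note s = snakeD[OF e(4)] and cc = cls_arr[OF ZD(3) c]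
    note fx = cyc_cmap[OF X Y f s(7)]
    have "covered (dY (Suc n)) (f n \<cdot> x)"
      by (rule coveredI'[of _ y]) (use s fD YD[of "Suc n"] in auto)
    then have "hcl dY n (f n \<cdot> x) = Zro A (Dom A (f n \<cdot> x)) (Hob dY n)"
      using cls_Zro_iff[OF YD(3) fx] by simp
    then have 1: "Hmap dX dY f n \<cdot> ?\<delta> \<cdot> hcl dZ (Suc n) (g (Suc n) \<cdot> y) = Zro A (Dom A e) (Hob dY n)"
      using Hf(4)[OF s(7)] D(4)[OF e(4)] s e fD[of n] YD(1,2)[of "Suc n"] by simp
    have "((Hmap dX dY f n \<cdot> ?\<delta>) \<cdot> hcl dZ (Suc n) c) \<cdot> e
      = Hmap dX dY f n \<cdot> ?\<delta> \<cdot> hcl dZ (Suc n) c \<cdot> e" using Hf D cc e by simp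
    also have "\<dots> = Zro A (Dom A e) (Hob dY n)"
      using 1 cls_Comp[OF ZD(3) c e(2,3)] e by simp
    finally have "(Hmap dX dY f n \<cdot> ?\<delta>) \<cdot> hcl dZ (Suc n) c = Zro A (Dom A c) (Hob dY n)"
      using epi_Zro[OF e(1), of "(Hmap dX dY f n \<cdot> ?\<delta>) \<cdot> hcl dZ (Suc n) c"] Hf D(1-3) cc e by simp
    then show "(Hmap dX dY f n \<cdot> ?\<delta>) \<cdot> hcl dZ (Suc n) c =
      Zro A (Dom A ?\<delta>) (Cod A (Hmap dX dY f n)) \<cdot> hcl dZ (Suc n) c"
      using Hf D(1-3) Hob_Obj cc by simp
  qed (use Hf D(1-3) Hob_Obj in auto)
next
  let ?\<delta> = "connecting dX dY dZ f g n"
  note D = connecting[of n]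
  fix a assume a: "a \<in> Arr A" "Cod A a = Dom A (Hmap dX dY f n)"
    "Hmap dX dY f n \<cdot> a = Zro A (Dom A a) (Cod A (Hmap dX dY f n))"
  have ca: "Cod A a = Hob dX n" using a Hf by simp
  obtain e x where e: "is_epi A e" "e \<in> Arr A" "Cod A e = Dom A a" "cyc (dX n) x" "Dom A x = Dom A e"
    "hcl dX n x = a \<cdot> e" using cls_cover[OF XD(3) a(1) ca] .
  note x = cycD[OF e(4)] and fx = cyc_cmap[OF X Y f e(4)]
  have "Hmap dX dY f n \<cdot> hcl dX n x = Zro A (Dom A x) (Cod A (Hmap dX dY f n))"
    by (rule hcl_Comp_Zro[OF X e(4,2,3) a(1) e(6) Hf(1) _ a(3)]) (use Hf ca in auto)
  then have "hcl dY n (f n \<cdot> x) = Zro A (Dom A (f n \<cdot> x)) (Hob dY n)"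
    using Hf(3) Hf(4)[OF e(4)] x fD by simp
  then have "covered (dY (Suc n)) (f n \<cdot> x)" using cls_Zro_iff[OF YD(3) fx] by simp
  then obtain e1 y where y: "is_epi A e1" "e1 \<in> Arr A" "Cod A e1 = Dom A (f n \<cdot> x)" "y \<in> Arr A"
    "Dom A y = Dom A e1" "Cod A y = Dom A (dY (Suc n))" "dY (Suc n) \<cdot> y = (f n \<cdot> x) \<cdot> e1"
    by (rule coveredE)
  have ce1: "Cod A e1 = Dom A x" using y x fD by simp
  \<comment> \<open>A chain whose boundary comes from \<open>x\<close> is by definition the first
    half of a snake pair, so the class of \<open>x\<close> is a value of the connecting
    morphism.\<close>
  have s: "snake n y (x \<cdot> e1)" unfolding snake_def using y x ce1 fD[of n] by simp
  have "?\<delta> \<cdot> hcl dZ (Suc n) (g (Suc n) \<cdot> y) = a \<cdot> e \<cdot> e1"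
    using D(4)[OF s] cls_Comp[OF XD(3) e(4) y(2) ce1] e a y ce1 by simp
  then show "covered ?\<delta> a"
    by (intro coveredI[of "e \<cdot> e1" a "hcl dZ (Suc n) (g (Suc n) \<cdot> y)"] epi_Comp)
      (use e y ce1 a cls_arr[OF ZD(3) snakeD(8)[OF s]] D(1-3) gD(1-3)[of "Suc n"] in auto)
qed (use Hf connecting[of n] in auto)

text \<open>Every chain of degree 0 is a cycle, so lifting a representing chain along the
  epimorphism \<open>g 0\<close> already lifts its class.\<close>

lemma epi_degree_0: "is_epi A (Hmap dY dZ g 0)"
proof (rule covered_epi)
  let ?h = "Hmap dY dZ g 0" let ?i = "Ident A (Hob dZ 0)"
  have i: "?i \<in> Arr A" "Cod A ?i = Hob dZ 0" "Dom A ?i = Hob dZ 0" using Hob_Obj by auto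
  obtain e z where e: "is_epi A e" "e \<in> Arr A" "Cod A e = Dom A ?i" "cyc (dZ 0) z" "Dom A z = Dom A e"
    "hcl dZ 0 z = ?i \<cdot> e" using cls_cover[OF ZD(3) i(1,2)] .
  note z = cycD[OF e(4)]
  obtain e1 y where y: "is_epi A e1" "e1 \<in> Arr A" "Cod A e1 = Dom A z" "y \<in> Arr A"
    "Dom A y = Dom A e1" "Cod A y = Dom A (dY 0)" "g 0 \<cdot> y = z \<cdot> e1"
    using g_covered[OF z(2,3)] .
  have yc: "cyc (dY 0) y" by (rule cyc_cplx0[OF Y]) (use y in auto)
  have "?h \<cdot> hcl dY 0 y = e \<cdot> e1"
    using Hg(4)[OF yc] cls_Comp[OF ZD(3) e(4) y(2,3)] e y i by simp
  then show "covered ?h (Ident A (Cod A ?h))"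
    by (intro coveredI[of "e \<cdot> e1" _ "hcl dY 0 y"] epi_Comp)
      (use e y i cls_arr[OF YD(3) yc] Hg in auto)
qed (use Hg in auto)

end

section \<open>Naturality of the connecting morphism and functoriality of homology\<close>

context abelian_category
begin

text \<open>The components of \<open>b\<close> and \<open>a\<close> carry snake pairs to snake
  pairs. A given cycle has such a pair only on a cover, so the equation is checked there and the
  cover is cancelled.\<close>

lemma connecting_natural:
  assumes S: "short_exact_complexes A dX dY dZ f g" and S': "short_exact_complexes A dX' dY' dZ' f' g'"
    and a: "cmap dX dX' a" and b: "cmap dY dY' b" and c: "cmap dZ dZ' c"
    and bf: "\<And>n. b n \<cdot> f n = f' n \<cdot> a n" and cg: "\<And>n. c n \<cdot> g n = g' n \<cdot> b n"
  shows "connecting dX' dY' dZ' f' g' n \<cdot> Hmap dZ dZ' c (Suc n) = Hmap dX dX' a n \<cdot> connecting dX dY dZ f g n"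
proof -
  interpret S: short_exact_complexes A dX dY dZ f g by fact
  interpret S': short_exact_complexes A dX' dY' dZ' f' g' by fact
  note D = S.connecting[of n] and D' = S'.connecting[of n]
  note ha = Hmap[OF S.X S'.X a, of n] and hc = Hmap[OF S.Z S'.Z c, of "Suc n"]
  note aD = cmapD[OF a] and bD = cmapD[OF b] and cD = cmapD[OF c]
  show ?thesis
  proof (rule homology_ext[OF S.ZD(3)[of "Suc n"]])
    fix z assume z: "cyc (dZ (Suc n)) z"
    obtain e y x where e: "is_epi A e" "e \<in> Arr A" "Cod A e = Dom A z" "S.snake n y x" "Dom A y = Dom A e"
      "g (Suc n) \<cdot> y = z \<cdot> e" using S.snake_ex[OF z] .
    note s = S.snakeD[OF e(4)] and cz = cls_arr[OF S.ZD(3) z]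
    have s': "S'.snake n (b (Suc n) \<cdot> y) (a n \<cdot> x)"
    proof -
      have "f' n \<cdot> a n \<cdot> x = b n \<cdot> f n \<cdot> x"
        by (rule square_extend[OF bf[symmetric]]) (use s aD bD S.fD[of n] S'.fD[of n] in auto)
      also have "\<dots> = b n \<cdot> dY (Suc n) \<cdot> y" using s by simp
      also have "\<dots> = dY' (Suc n) \<cdot> b (Suc n) \<cdot> y"
        by (rule square_extend[OF bD(5)[symmetric]])
          (use s bD S.YD(1,2)[of "Suc n"] S'.YD(1,2)[of "Suc n"] in auto)
      finally show ?thesis using s aD bD by (auto simp: S'.snake_def)
    qed
    have g2: "g' (Suc n) \<cdot> b (Suc n) \<cdot> y = c (Suc n) \<cdot> g (Suc n) \<cdot> y"
      by (rule square_extend[OF cg[symmetric]]) (use s bD cD S.gD[of "Suc n"] S'.gD[of "Suc n"] in auto)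
    let ?u = "hcl dZ (Suc n) (g (Suc n) \<cdot> y)"
    note cu = cls_arr[OF S.ZD(3) s(8)]
    have "connecting dX' dY' dZ' f' g' n \<cdot> Hmap dZ dZ' c (Suc n) \<cdot> ?u = hcl dX' n (a n \<cdot> x)"
      using hc(4)[OF s(8)] D'(4)[OF s'] g2 by simp
    also have "\<dots> = Hmap dX dX' a n \<cdot> connecting dX dY dZ f g n \<cdot> ?u"
      using ha(4)[OF s(7)] D(4)[OF e(4)] by simp
    finally have eq: "connecting dX' dY' dZ' f' g' n \<cdot> Hmap dZ dZ' c (Suc n) \<cdot> ?u =
       Hmap dX dX' a n \<cdot> connecting dX dY dZ f g n \<cdot> ?u" .
    have u: "?u = hcl dZ (Suc n) z \<cdot> e" using cls_Comp[OF S.ZD(3) z e(2,3)] e by simp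
    show "(connecting dX' dY' dZ' f' g' n \<cdot> Hmap dZ dZ' c (Suc n)) \<cdot> hcl dZ (Suc n) z =
       (Hmap dX dX' a n \<cdot> connecting dX dY dZ f g n) \<cdot> hcl dZ (Suc n) z"
      by (rule is_epiD[OF e(1)]) (use eq[unfolded u] ha hc D(1-3) D'(1-3) cz e in auto)
  qed (use ha hc D(1-3) D'(1-3) in auto)
qed

lemma Hmap_Add:
  assumes d: "cplx d" and d': "cplx d'" and f: "cmap d d' f" and g: "cmap d d' g"
  shows "Hmap d d' (\<lambda>n. Add A (f n) (g n)) n = Add A (Hmap d d' f n) (Hmap d d' g n)"
proof -
  note fD = cmapD[OF f] and gD = cmapD[OF g] and hf = Hmap[OF d d' f, of n] and hg = Hmap[OF d d' g, of n]
  note dD = cplxD[OF d] and d'D = cplxD[OF d']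
  have fg: "cmap d d' (\<lambda>n. Add A (f n) (g n))"
    unfolding cmap_def using fD gD dD d'D by (auto simp: cmapD(4)[OF f] cmapD(4)[OF g])
  note h = Hmap[OF d d' fg, of n]
  show ?thesis
  proof (rule homology_ext[OF dD(3)[of n]])
    fix c assume c: "cyc (d n) c"
    have "Hmap d d' (\<lambda>n. Add A (f n) (g n)) n \<cdot> hcl d n c = hcl d' n (Add A (f n \<cdot> c) (g n \<cdot> c))"
      using h(4)[OF c] cycD[OF c] fD gD by simp
    also have "\<dots> = Add A (Hmap d d' f n) (Hmap d d' g n) \<cdot> hcl d n c"
      using cls_Add[OF d'D(3) cyc_cmap[OF d d' f c] cyc_cmap[OF d d' g c]] cycD[OF c] fD gD
        hf(4)[OF c] hg(4)[OF c] hf(1-3) hg(1-3) cls_arr[OF dD(3) c] by simp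
    finally show "Hmap d d' (\<lambda>n. Add A (f n) (g n)) n \<cdot> hcl d n c =
      Add A (Hmap d d' f n) (Hmap d d' g n) \<cdot> hcl d n c" .
  qed (use h hf hg in auto)
qed

lemma Hmap_Comp:
  assumes d: "cplx d" and d': "cplx d'" and d'': "cplx d''" and f: "cmap d d' f" and g: "cmap d' d'' g"
  shows "Hmap d d'' (\<lambda>n. g n \<cdot> f n) n = Hmap d' d'' g n \<cdot> Hmap d d' f n"
proof -
  note fD = cmapD[OF f] and gD = cmapD[OF g] and hf = Hmap[OF d d' f, of n] and hg = Hmap[OF d' d'' g, of n]
  note dD = cplxD[OF d] and d'D = cplxD[OF d'] and d''D = cplxD[OF d'']
  have "d'' n \<cdot> g n \<cdot> f n = (g (n - 1) \<cdot> f (n - 1)) \<cdot> d n" for n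
  proof -
    have "d'' n \<cdot> g n \<cdot> f n = g (n - 1) \<cdot> d' n \<cdot> f n"
      by (rule square_extend[OF gD(4)]) (use fD gD d''D(1,2)[of n] d'D(1,2)[of n] in auto)
    then show ?thesis using fD gD dD(1,2)[of n] by simp
  qed
  then have fg: "cmap d d'' (\<lambda>n. g n \<cdot> f n)" unfolding cmap_def using fD gD by auto
  note h = Hmap[OF d d'' fg, of n]
  show ?thesis
  proof (rule homology_ext[OF dD(3)[of n]])
    fix c assume c: "cyc (d n) c"
    show "Hmap d d'' (\<lambda>n. g n \<cdot> f n) n \<cdot> hcl d n c = (Hmap d' d'' g n \<cdot> Hmap d d' f n) \<cdot> hcl d n c"
      using h(4)[OF c] hf(4)[OF c] hg(4)[OF cyc_cmap[OF d d' f c]] hf(1-3) hg(1-3)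
        cls_arr[OF dD(3) c] cycD[OF c] fD gD by simp
  qed (use h hf hg in auto)
qed

lemma Hmap_Ident:
  assumes d: "cplx d"
  shows "Hmap d d (\<lambda>n. Ident A (Dom A (d n))) n = Ident A (Hob d n)"
proof -
  note dD = cplxD[OF d]
  have i: "cmap d d (\<lambda>n. Ident A (Dom A (d n)))" unfolding cmap_def using dD(1,2) by auto
  note h = Hmap[OF d d i, of n]
  show ?thesis
  proof (rule homology_ext[OF dD(3)[of n]])
    fix c assume c: "cyc (d n) c"
    show "Hmap d d (\<lambda>n. Ident A (Dom A (d n))) n \<cdot> hcl d n c = Ident A (Hob d n) \<cdot> hcl d n c"
      using h(4)[OF c] cls_arr[OF dD(3) c] cycD[OF c] by simp
  qed (use h homology_ob_Obj[OF dD(3)] in auto)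
qed

end

section \<open>Functor categories\<close>

text \<open>The source is an arbitrary category because the locale serves twice: for coefficient
  functors on \<open>op_cat C\<close>, and for functors on the resulting functor category, whose
  natural transformations are the components of morphisms of partial functors.\<close>

locale functors_into_abelian = D: category D + abelian_category A
  for D :: "('d, 'e, 'y) cat_scheme" and A :: "('o, 'm, 'z) abcat_scheme"
begin

notation comp (infixr "\<cdot>" 70)

abbreviation K :: "(('d, 'e, 'o, 'm) cfunctor, ('d, 'e, 'o, 'm) nat_trans) abcat" where
  "K \<equiv> functor_category D A"

abbreviation cp :: "('d, 'e, 'o, 'm) nat_trans \<Rightarrow> 'd \<Rightarrow> 'm" (infixl "$" 90) where
  "\<alpha> $ d \<equiv> component \<alpha> d"

lemma functorD:
  assumes "is_functor D A F"
  shows "d \<in> Obj D \<Longrightarrow> FObj F d \<in> Obj A"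
    "e \<in> Arr D \<Longrightarrow> FArr F e \<in> Arr A"
    "e \<in> Arr D \<Longrightarrow> Dom A (FArr F e) = FObj F (Dom D e)"
    "e \<in> Arr D \<Longrightarrow> Cod A (FArr F e) = FObj F (Cod D e)"
    "d \<in> Obj D \<Longrightarrow> FArr F (Ident D d) = Ident A (FObj F d)"
    "e \<in> Arr D \<Longrightarrow> e' \<in> Arr D \<Longrightarrow> Cod D e = Dom D e' \<Longrightarrow>
       FArr F (Comp D e' e) = FArr F e' \<cdot> FArr F e"
  using assms unfolding is_functor_def by (auto simp: in_Hom PiE_def)

lemma functorI:
  assumes "\<And>d. d \<in> Obj D \<Longrightarrow> fo d \<in> Obj A"
    "\<And>e. e \<in> Arr D \<Longrightarrow> fa e \<in> Arr A \<and> Dom A (fa e) = fo (Dom D e) \<and> Cod A (fa e) = fo (Cod D e)"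
    "\<And>d. d \<in> Obj D \<Longrightarrow> fa (Ident D d) = Ident A (fo d)"
    "\<And>e e'. e \<in> Arr D \<Longrightarrow> e' \<in> Arr D \<Longrightarrow> Cod D e = Dom D e' \<Longrightarrow>
       fa (Comp D e' e) = fa e' \<cdot> fa e"
  shows "is_functor D A \<lparr>FObj = restrict fo (Obj D), FArr = restrict fa (Arr D)\<rparr>"
  using assms unfolding is_functor_def by (auto simp: in_Hom)

lemma Obj_K [simp]: "F \<in> Obj K \<longleftrightarrow> is_functor D A F"
  by (simp add: functor_category_def)

lemma K_arrD:
  assumes "\<alpha> \<in> Arr K"
  shows "is_functor D A (Dom K \<alpha>)" "is_functor D A (Cod K \<alpha>)"
    "d \<in> Obj D \<Longrightarrow> \<alpha> $ d \<in> Arr A"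
    "d \<in> Obj D \<Longrightarrow> Dom A (\<alpha> $ d) = FObj (Dom K \<alpha>) d"
    "d \<in> Obj D \<Longrightarrow> Cod A (\<alpha> $ d) = FObj (Cod K \<alpha>) d"
    "e \<in> Arr D \<Longrightarrow> \<alpha> $ Cod D e \<cdot> FArr (Dom K \<alpha>) e = FArr (Cod K \<alpha>) e \<cdot> \<alpha> $ Dom D e"
  using assms by (auto simp: functor_category_def is_nat_trans_def component_def in_Hom split: prod.splits)

lemma K_arr_eqI:
  assumes "\<alpha> \<in> Arr K" "\<beta> \<in> Arr K" "Dom K \<alpha> = Dom K \<beta>" "Cod K \<alpha> = Cod K \<beta>"
    "\<And>d. d \<in> Obj D \<Longrightarrow> \<alpha> $ d = \<beta> $ d"
  shows "\<alpha> = \<beta>"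
proof -
  obtain F \<eta> G F' \<theta> G' where ab: "\<alpha> = (F, \<eta>, G)" "\<beta> = (F', \<theta>, G')" by (metis prod_cases3)
  have "\<eta> = \<theta>"
    by (rule extensionalityI[of _ "Obj D"])
      (use assms in \<open>auto simp: ab functor_category_def is_nat_trans_def component_def\<close>)
  then show ?thesis using assms by (simp add: ab functor_category_def)
qed

lemma K_arrI:
  assumes "is_functor D A F" "is_functor D A G"
    "\<And>d. d \<in> Obj D \<Longrightarrow> \<eta> d \<in> Arr A \<and> Dom A (\<eta> d) = FObj F d \<and> Cod A (\<eta> d) = FObj G d"
    "\<And>e. e \<in> Arr D \<Longrightarrow> \<eta> (Cod D e) \<cdot> FArr F e = FArr G e \<cdot> \<eta> (Dom D e)"
  shows "(F, restrict \<eta> (Obj D), G) \<in> Arr K"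
  using assms by (auto simp: functor_category_def is_nat_trans_def in_Hom)

lemma K_triple [simp]:
  "Dom K (F, \<eta>, G) = F" "Cod K (F, \<eta>, G) = G" "(F, \<eta>, G) $ d = \<eta> d"
  by (auto simp: functor_category_def component_def)

lemma K_arr_triple:
  "(F, \<eta>, G) \<in> Arr K \<longleftrightarrow> is_nat_trans D A (F, \<eta>, G)"
  by (simp add: functor_category_def)

lemma Comp_K:
  assumes "\<alpha> \<in> Arr K" "\<beta> \<in> Arr K" "Cod K \<alpha> = Dom K \<beta>"
  shows "Comp K \<beta> \<alpha> \<in> Arr K" "Dom K (Comp K \<beta> \<alpha>) = Dom K \<alpha>" "Cod K (Comp K \<beta> \<alpha>) = Cod K \<beta>"
    "d \<in> Obj D \<Longrightarrow> Comp K \<beta> \<alpha> $ d = \<beta> $ d \<cdot> \<alpha> $ d"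
proof -
  note a = K_arrD[OF assms(1)] and b = K_arrD[OF assms(2)]
  have eq: "Comp K \<beta> \<alpha> = (Dom K \<alpha>, \<lambda>d\<in>Obj D. \<beta> $ d \<cdot> \<alpha> $ d, Cod K \<beta>)"
    by (simp add: functor_category_def component_def split: prod.splits)
  show "Comp K \<beta> \<alpha> \<in> Arr K" unfolding eq
  proof (rule K_arrI)
    fix e assume e: "e \<in> Arr D"
    have ed: "Dom D e \<in> Obj D" "Cod D e \<in> Obj D" using e by auto
    note F = functorD[OF a(1)] functorD[OF a(2)] functorD[OF b(2)]
    have "\<beta> $ Cod D e \<cdot> \<alpha> $ Cod D e \<cdot> FArr (Dom K \<alpha>) e = \<beta> $ Cod D e \<cdot> FArr (Dom K \<beta>) e \<cdot> \<alpha> $ Dom D e"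
      using a(6)[OF e] assms by simp
    also have "\<dots> = FArr (Cod K \<beta>) e \<cdot> \<beta> $ Dom D e \<cdot> \<alpha> $ Dom D e"
      by (rule square_extend[OF b(6)[OF e]]) (use a(3-5) b(3-5) F(2-4,8-10,14-16) e ed assms in auto)
    finally show "(\<beta> $ Cod D e \<cdot> \<alpha> $ Cod D e) \<cdot> FArr (Dom K \<alpha>) e =
      FArr (Cod K \<beta>) e \<cdot> \<beta> $ Dom D e \<cdot> \<alpha> $ Dom D e"
      using a(3-5) b(3-5) F e ed assms by simp
  qed (use a b assms in auto)
qed (simp_all add: functor_category_def component_def split: prod.splits)

lemma Ident_K:
  assumes "is_functor D A F"
  shows "Ident K F \<in> Arr K" "Dom K (Ident K F) = F" "Cod K (Ident K F) = F"
    "d \<in> Obj D \<Longrightarrow> Ident K F $ d = Ident A (FObj F d)"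
proof -
  have eq: "Ident K F = (F, \<lambda>d\<in>Obj D. Ident A (FObj F d), F)" by (simp add: functor_category_def)
  show "Ident K F \<in> Arr K" unfolding eq
    by (rule K_arrI) (use assms functorD[OF assms] in auto)
qed (simp_all add: functor_category_def component_def)

lemma Zro_K:
  assumes "is_functor D A F" "is_functor D A G"
  shows "Zro K F G \<in> Arr K" "Dom K (Zro K F G) = F" "Cod K (Zro K F G) = G"
    "d \<in> Obj D \<Longrightarrow> Zro K F G $ d = Zro A (FObj F d) (FObj G d)"
proof -
  have eq: "Zro K F G = (F, \<lambda>d\<in>Obj D. Zro A (FObj F d) (FObj G d), G)" by (simp add: functor_category_def)
  show "Zro K F G \<in> Arr K" unfolding eq
    by (rule K_arrI) (use assms functorD[OF assms(1)] functorD[OF assms(2)] in auto)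
qed (simp_all add: functor_category_def component_def)

lemma Add_K:
  assumes "\<alpha> \<in> Arr K" "\<beta> \<in> Arr K" "Dom K \<alpha> = Dom K \<beta>" "Cod K \<alpha> = Cod K \<beta>"
  shows "Add K \<alpha> \<beta> \<in> Arr K" "Dom K (Add K \<alpha> \<beta>) = Dom K \<beta>" "Cod K (Add K \<alpha> \<beta>) = Cod K \<beta>"
    "d \<in> Obj D \<Longrightarrow> Add K \<alpha> \<beta> $ d = Add A (\<alpha> $ d) (\<beta> $ d)"
proof -
  note a = K_arrD[OF assms(1)] and b = K_arrD[OF assms(2)]
  have eq: "Add K \<alpha> \<beta> = (Dom K \<alpha>, \<lambda>d\<in>Obj D. Add A (\<alpha> $ d) (\<beta> $ d), Cod K \<alpha>)"
    by (simp add: functor_category_def component_def split: prod.splits)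
  show "Add K \<alpha> \<beta> \<in> Arr K" unfolding eq
    by (rule K_arrI) (use a b functorD[OF a(1)] functorD[OF a(2)] assms in auto)
  show "Dom K (Add K \<alpha> \<beta>) = Dom K \<beta>" "Cod K (Add K \<alpha> \<beta>) = Cod K \<beta>" "d \<in> Obj D \<Longrightarrow> Add K \<alpha> \<beta> $ d = Add A (\<alpha> $ d) (\<beta> $ d)"
    unfolding eq using assms by auto
qed

lemma neg_K:
  assumes "\<alpha> \<in> Arr K"
  shows "(Dom K \<alpha>, \<lambda>d\<in>Obj D. neg (\<alpha> $ d), Cod K \<alpha>) \<in> Arr K"
proof -
  note a = K_arrD[OF assms(1)]
  show ?thesis by (rule K_arrI) (use a functorD[OF a(1)] functorD[OF a(2)] assms in auto)
qed

text \<open>Kernels, cokernels and short exactness are meaningful at this level already; the kernels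
  and cokernels themselves are constructed objectwise afterwards.\<close>

sublocale K: preadditive_category K
proof (intro preadditive_category.intro category.intro preadditive_category_axioms.intro)
  fix \<alpha> assume "\<alpha> \<in> Arr K" then show "Dom K \<alpha> \<in> Obj K" "Cod K \<alpha> \<in> Obj K" using K_arrD by auto
next
  fix F assume "F \<in> Obj K" then show "Ident K F \<in> Hom K F F" using Ident_K by (auto simp: in_Hom)
next
  fix \<alpha> \<beta> F G H assume "\<alpha> \<in> Hom K F G" "\<beta> \<in> Hom K G H"
  then show "Comp K \<beta> \<alpha> \<in> Hom K F H" using Comp_K by (auto simp: in_Hom)
next
  fix \<alpha> F G assume a: "\<alpha> \<in> Hom K F G"
  then have t: "\<alpha> \<in> Arr K" "Dom K \<alpha> = F" "Cod K \<alpha> = G" by (auto simp: in_Hom)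
  have fg: "\<alpha> \<in> Arr K" "is_functor D A F" "is_functor D A G" "Dom K \<alpha> = F" "Cod K \<alpha> = G"
    using t K_arrD(1,2)[OF t(1)] by simp_all
  note i = Ident_K[OF fg(2)] Ident_K[OF fg(3)] and ar = K_arrD[OF fg(1)]
  show "Comp K \<alpha> (Ident K F) = \<alpha>"
    by (rule K_arr_eqI) (use i fg ar Comp_K[of "Ident K F" \<alpha>] functorD[OF fg(2)] in auto)
  show "Comp K (Ident K G) \<alpha> = \<alpha>"
    by (rule K_arr_eqI) (use i fg ar Comp_K[of \<alpha> "Ident K G"] functorD[OF fg(2)] in auto)
next
  fix \<alpha> \<beta> \<gamma> F G H I assume a: "\<alpha> \<in> Hom K F G" "\<beta> \<in> Hom K G H" "\<gamma> \<in> Hom K H I"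
  then have t: "\<alpha> \<in> Arr K" "\<beta> \<in> Arr K" "\<gamma> \<in> Arr K" "Cod K \<alpha> = Dom K \<beta>" "Cod K \<beta> = Dom K \<gamma>"
    by (auto simp: in_Hom)
  note c1 = Comp_K[OF t(1,2,4)] and c2 = Comp_K[OF t(2,3,5)]
  note c3 = Comp_K[OF c1(1) t(3)] and c4 = Comp_K[OF t(1) c2(1)]
  show "Comp K \<gamma> (Comp K \<beta> \<alpha>) = Comp K (Comp K \<gamma> \<beta>) \<alpha>"
    by (rule K_arr_eqI) (use t c1 c2 c3 c4 K_arrD(3-5)[OF t(1)] K_arrD(3-5)[OF t(2)] K_arrD(3-5)[OF t(3)] in auto)
next
  fix F G assume "F \<in> Obj K" "G \<in> Obj K"
  then have FG: "is_functor D A F" "is_functor D A G" by auto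
  show "comm_group (hom_group K F G)"
  proof (rule comm_groupI)
    fix \<alpha> \<beta> \<gamma> assume "\<alpha> \<in> carrier (hom_group K F G)" "\<beta> \<in> carrier (hom_group K F G)"
      "\<gamma> \<in> carrier (hom_group K F G)"
    then have t: "\<alpha> \<in> Arr K" "\<beta> \<in> Arr K" "\<gamma> \<in> Arr K" "Dom K \<alpha> = F" "Dom K \<beta> = F" "Dom K \<gamma> = F"
      "Cod K \<alpha> = G" "Cod K \<beta> = G" "Cod K \<gamma> = G" by (auto simp: in_Hom hom_group_def)
    note ab = Add_K[of \<alpha> \<beta>, unfolded t, OF t(1,2) refl refl] and
      bc = Add_K[of \<beta> \<gamma>, unfolded t, OF t(2,3) refl refl]
    note x = Add_K[of "Add K \<alpha> \<beta>" \<gamma>, unfolded t ab, OF ab(1) t(3) refl refl]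
      Add_K[of \<alpha> "Add K \<beta> \<gamma>", unfolded t bc, OF t(1) bc(1) refl refl]
    note aa = K_arrD(3-5)[OF t(1)] K_arrD(3-5)[OF t(2)] K_arrD(3-5)[OF t(3)]
    show "\<alpha> \<otimes>\<^bsub>hom_group K F G\<^esub> \<beta> \<otimes>\<^bsub>hom_group K F G\<^esub> \<gamma> =
      \<alpha> \<otimes>\<^bsub>hom_group K F G\<^esub> (\<beta> \<otimes>\<^bsub>hom_group K F G\<^esub> \<gamma>)"
      unfolding hom_group_def monoid.simps
      by (rule K_arr_eqI) (use x ab bc t aa in \<open>auto simp: Add_assoc\<close>)
  next
    fix \<alpha> \<beta> assume "\<alpha> \<in> carrier (hom_group K F G)" "\<beta> \<in> carrier (hom_group K F G)"
    then have t: "\<alpha> \<in> Arr K" "\<beta> \<in> Arr K" "Dom K \<alpha> = F" "Dom K \<beta> = F" "Cod K \<alpha> = G" "Cod K \<beta> = G"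
      by (auto simp: in_Hom hom_group_def)
    note ab = Add_K[of \<alpha> \<beta>, unfolded t, OF t(1,2) refl refl] Add_K[of \<beta> \<alpha>, unfolded t, OF t(2,1) refl refl]
    note aa = K_arrD(3-5)[OF t(1)] K_arrD(3-5)[OF t(2)]
    show "\<alpha> \<otimes>\<^bsub>hom_group K F G\<^esub> \<beta> \<in> carrier (hom_group K F G)"
      using ab by (simp add: hom_group_def in_Hom)
    show "\<alpha> \<otimes>\<^bsub>hom_group K F G\<^esub> \<beta> = \<beta> \<otimes>\<^bsub>hom_group K F G\<^esub> \<alpha>"
      unfolding hom_group_def monoid.simps
      by (rule K_arr_eqI) (use ab t aa in \<open>auto intro: Add_commute\<close>)
  next
    show "\<one>\<^bsub>hom_group K F G\<^esub> \<in> carrier (hom_group K F G)"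
      using Zro_K[OF FG] by (simp add: hom_group_def in_Hom)
  next
    fix \<alpha> assume "\<alpha> \<in> carrier (hom_group K F G)"
    then have t: "\<alpha> \<in> Arr K" "Dom K \<alpha> = F" "Cod K \<alpha> = G" by (auto simp: in_Hom hom_group_def)
    note z = Zro_K[OF FG] and aa = K_arrD(3-5)[OF t(1)]
    note za = Add_K[OF z(1) t(1), unfolded z t, OF refl refl]
    show "\<one>\<^bsub>hom_group K F G\<^esub> \<otimes>\<^bsub>hom_group K F G\<^esub> \<alpha> = \<alpha>"
      unfolding hom_group_def monoid.simps
      by (rule K_arr_eqI) (use z za t aa in auto)
    note n = neg_K[OF t(1), unfolded t]
    note na = Add_K[OF n t(1), unfolded t K_triple, OF refl refl]
    show "\<exists>\<beta>\<in>carrier (hom_group K F G). \<beta> \<otimes>\<^bsub>hom_group K F G\<^esub> \<alpha> = \<one>\<^bsub>hom_group K F G\<^esub>"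
    proof (rule bexI)
      show "(F, \<lambda>d\<in>Obj D. neg (\<alpha> $ d), G) \<otimes>\<^bsub>hom_group K F G\<^esub> \<alpha> = \<one>\<^bsub>hom_group K F G\<^esub>"
        unfolding hom_group_def monoid.simps
        by (rule K_arr_eqI) (use z na t aa in auto)
    qed (use n in \<open>simp add: hom_group_def in_Hom\<close>)
  qed
next
  fix \<alpha> \<beta> \<gamma> F G H assume "\<alpha> \<in> Hom K F G" "\<beta> \<in> Hom K G H" "\<gamma> \<in> Hom K G H"
  then have t: "\<alpha> \<in> Arr K" "\<beta> \<in> Arr K" "\<gamma> \<in> Arr K" "Dom K \<alpha> = F" "Dom K \<beta> = G" "Dom K \<gamma> = G"
      "Cod K \<alpha> = G" "Cod K \<beta> = H" "Cod K \<gamma> = H" by (auto simp: in_Hom hom_group_def)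
  note bc = Add_K[of \<beta> \<gamma>, unfolded t, OF t(2,3) refl refl] and
    ba = Comp_K[of \<alpha> \<beta>, unfolded t, OF t(1,2) refl] and ca = Comp_K[of \<alpha> \<gamma>, unfolded t, OF t(1,3) refl]
  note x = Comp_K[of \<alpha> "Add K \<beta> \<gamma>", unfolded t bc, OF t(1) bc(1) refl]
    Add_K[of "Comp K \<beta> \<alpha>" "Comp K \<gamma> \<alpha>", unfolded ba ca, OF ba(1) ca(1) refl refl]
  note aa = K_arrD(3-5)[OF t(1)] K_arrD(3-5)[OF t(2)] K_arrD(3-5)[OF t(3)]
  show "Comp K (Add K \<beta> \<gamma>) \<alpha> = Add K (Comp K \<beta> \<alpha>) (Comp K \<gamma> \<alpha>)"
    by (rule K_arr_eqI) (use x ba ca bc t aa in auto)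
next
  fix \<alpha> \<beta> \<gamma> F G H assume "\<alpha> \<in> Hom K F G" "\<beta> \<in> Hom K F G" "\<gamma> \<in> Hom K G H"
  then have t: "\<alpha> \<in> Arr K" "\<beta> \<in> Arr K" "\<gamma> \<in> Arr K" "Dom K \<alpha> = F" "Dom K \<beta> = F" "Dom K \<gamma> = G"
      "Cod K \<alpha> = G" "Cod K \<beta> = G" "Cod K \<gamma> = H" by (auto simp: in_Hom hom_group_def)
  note bc = Add_K[of \<alpha> \<beta>, unfolded t, OF t(1,2) refl refl] and
    ba = Comp_K[of \<alpha> \<gamma>, unfolded t, OF t(1,3) refl] and ca = Comp_K[of \<beta> \<gamma>, unfolded t, OF t(2,3) refl]
  note x = Comp_K[of "Add K \<alpha> \<beta>" \<gamma>, unfolded t bc, OF bc(1) t(3) refl]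
    Add_K[of "Comp K \<gamma> \<alpha>" "Comp K \<gamma> \<beta>", unfolded ba ca, OF ba(1) ca(1) refl refl]
  note aa = K_arrD(3-5)[OF t(1)] K_arrD(3-5)[OF t(2)] K_arrD(3-5)[OF t(3)]
  show "Comp K \<gamma> (Add K \<alpha> \<beta>) = Add K (Comp K \<gamma> \<alpha>) (Comp K \<gamma> \<beta>)"
    by (rule K_arr_eqI) (use x ba ca bc t aa in auto)
qed

text \<open>The objectwise lifts form a natural transformation because the kernel component at the
  codomain of an arrow is a monomorphism.\<close>

lemma pointwise_kernel:
  assumes a: "\<alpha> \<in> Arr K" and k: "\<kappa> \<in> Arr K" and kd: "Cod K \<kappa> = Dom K \<alpha>"
    and ker: "\<And>d. d \<in> Obj D \<Longrightarrow> is_kernel A (\<alpha> $ d) (\<kappa> $ d)"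
  shows "is_kernel K \<alpha> \<kappa>"
proof (rule K.is_kernelI)
  note aD = K_arrD[OF a] and kD = K_arrD[OF k]
  show "is_mono K \<kappa>" unfolding is_mono_def
  proof (intro conjI ballI impI)
    fix F \<beta> \<gamma> assume "F \<in> Obj K" "\<beta> \<in> Hom K F (Dom K \<kappa>)" "\<gamma> \<in> Hom K F (Dom K \<kappa>)"
      and eq: "Comp K \<kappa> \<beta> = Comp K \<kappa> \<gamma>"
    then have t: "\<beta> \<in> Arr K" "\<gamma> \<in> Arr K" "Dom K \<beta> = F" "Dom K \<gamma> = F" "Cod K \<beta> = Dom K \<kappa>"
      "Cod K \<gamma> = Dom K \<kappa>" by (auto simp: in_Hom)
    show "\<beta> = \<gamma>"
    proof (rule K_arr_eqI)
      fix d assume d: "d \<in> Obj D"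
      have "\<kappa> $ d \<cdot> \<beta> $ d = \<kappa> $ d \<cdot> \<gamma> $ d"
        using eq Comp_K(4)[OF t(1) k t(5) d] Comp_K(4)[OF t(2) k t(6) d] by simp
      then show "\<beta> $ d = \<gamma> $ d"
        using is_monoD[OF kernel_mono[OF ker[OF d]], of "\<beta> $ d" "\<gamma> $ d"] t kD d
          K_arrD(3-5)[OF t(1)] K_arrD(3-5)[OF t(2)] by simp
    qed (use t in auto)
  qed (use k in simp)
  show "Comp K \<alpha> \<kappa> = Zro K (Dom K \<kappa>) (Cod K \<alpha>)"
    by (rule K_arr_eqI) (use Comp_K[OF k a kd] Zro_K[OF kD(1) aD(2)] is_kernelD[OF ker] kd aD kD in auto)
  fix \<eta> assume h: "\<eta> \<in> Arr K" "Cod K \<eta> = Dom K \<alpha>" "Comp K \<alpha> \<eta> = Zro K (Dom K \<eta>) (Cod K \<alpha>)"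
  note hD = K_arrD[OF h(1)]
  have "\<exists>l. l \<in> Arr A \<and> Dom A l = FObj (Dom K \<eta>) d \<and> Cod A l = FObj (Dom K \<kappa>) d \<and> \<kappa> $ d \<cdot> l = \<eta> $ d"
    if d: "d \<in> Obj D" for d
  proof -
    have "\<alpha> $ d \<cdot> \<eta> $ d = Zro A (FObj (Dom K \<eta>) d) (FObj (Cod K \<alpha>) d)"
      using Comp_K(4)[OF h(1) a h(2) d] h(3) Zro_K(4)[OF hD(1) aD(2) d] by simp
    then show ?thesis
      using kernel_lift[OF ker[OF d], of "\<eta> $ d"] hD(3-5)[OF d] aD(3-5)[OF d] kD(3-5)[OF d] h(2) by metis
  qed
  then obtain l where l: "\<And>d. d \<in> Obj D \<Longrightarrow> l d \<in> Arr A \<and> Dom A (l d) = FObj (Dom K \<eta>) d \<and>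
      Cod A (l d) = FObj (Dom K \<kappa>) d \<and> \<kappa> $ d \<cdot> l d = \<eta> $ d" by metis
  let ?l = "(Dom K \<eta>, restrict l (Obj D), Dom K \<kappa>)"
  have lK: "?l \<in> Arr K"
  proof (rule K_arrI)
    fix e assume e: "e \<in> Arr D"
    have ed: "Dom D e \<in> Obj D" "Cod D e \<in> Obj D" using e by auto
    note E = functorD(2-4)[OF hD(1) e] functorD(2-4)[OF kD(1) e] functorD(2-4)[OF aD(1) e]
    note L = l[OF ed(1)] l[OF ed(2)] kD(3-5)[OF ed(1)] kD(3-5)[OF ed(2)] hD(3-5)[OF ed(1)] hD(3-5)[OF ed(2)]
    show "l (Cod D e) \<cdot> FArr (Dom K \<eta>) e = FArr (Dom K \<kappa>) e \<cdot> l (Dom D e)"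
    proof (rule is_monoD[OF kernel_mono[OF ker[OF ed(2)]]])
      have "\<kappa> $ Cod D e \<cdot> l (Cod D e) \<cdot> FArr (Dom K \<eta>) e = \<eta> $ Cod D e \<cdot> FArr (Dom K \<eta>) e"
        by (rule Comp_eq_extend) (use L E kd h in auto)
      also have "\<dots> = FArr (Dom K \<alpha>) e \<cdot> \<kappa> $ Dom D e \<cdot> l (Dom D e)"
        using hD(6)[OF e] h(2) L by simp
      also have "\<dots> = \<kappa> $ Cod D e \<cdot> FArr (Dom K \<kappa>) e \<cdot> l (Dom D e)"
        by (rule square_extend[OF kD(6)[OF e, symmetric, unfolded kd]]) (use L E kd h in auto)
      finally show "\<kappa> $ Cod D e \<cdot> l (Cod D e) \<cdot> FArr (Dom K \<eta>) e =
        \<kappa> $ Cod D e \<cdot> FArr (Dom K \<kappa>) e \<cdot> l (Dom D e)" .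
    qed (use L E in auto)
  qed (use hD kD l in auto)
  have "Comp K \<kappa> ?l = \<eta>"
    by (rule K_arr_eqI) (use Comp_K[OF lK k] h kd l in auto)
  then show "\<exists>h'. h' \<in> Arr K \<and> Dom K h' = Dom K \<eta> \<and> Cod K h' = Dom K \<kappa> \<and> Comp K \<kappa> h' = \<eta>"
    using lK by (intro exI[of _ ?l]) simp
qed (use assms in auto)

text \<open>Dually, naturality of the objectwise factorizations is checked after the epimorphic
  component at the domain of an arrow.\<close>

lemma pointwise_cokernel:
  assumes a: "\<alpha> \<in> Arr K" and k: "\<kappa> \<in> Arr K" and kd: "Dom K \<kappa> = Cod K \<alpha>"
    and coker: "\<And>d. d \<in> Obj D \<Longrightarrow> is_cokernel A (\<alpha> $ d) (\<kappa> $ d)"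
  shows "is_cokernel K \<alpha> \<kappa>"
proof (rule K.is_cokernelI)
  note aD = K_arrD[OF a] and kD = K_arrD[OF k]
  show "is_epi K \<kappa>" unfolding is_epi_def
  proof (intro conjI ballI impI)
    fix F \<beta> \<gamma> assume "F \<in> Obj K" "\<beta> \<in> Hom K (Cod K \<kappa>) F" "\<gamma> \<in> Hom K (Cod K \<kappa>) F"
      and eq: "Comp K \<beta> \<kappa> = Comp K \<gamma> \<kappa>"
    then have t: "\<beta> \<in> Arr K" "\<gamma> \<in> Arr K" "Cod K \<beta> = F" "Cod K \<gamma> = F" "Cod K \<kappa> = Dom K \<beta>"
      "Cod K \<kappa> = Dom K \<gamma>" by (auto simp: in_Hom)
    show "\<beta> = \<gamma>"
    proof (rule K_arr_eqI)
      fix d assume d: "d \<in> Obj D"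
      have "\<beta> $ d \<cdot> \<kappa> $ d = \<gamma> $ d \<cdot> \<kappa> $ d"
        using eq Comp_K(4)[OF k t(1) t(5) d] Comp_K(4)[OF k t(2) t(6) d] by simp
      then show "\<beta> $ d = \<gamma> $ d"
        using is_epiD[OF cokernel_epi[OF coker[OF d]], of "\<beta> $ d" "\<gamma> $ d"] t kD d
          K_arrD(3-5)[OF t(1)] K_arrD(3-5)[OF t(2)] by simp
    qed (use t in auto)
  qed (use k in simp)
  show "Comp K \<kappa> \<alpha> = Zro K (Dom K \<alpha>) (Cod K \<kappa>)"
    by (rule K_arr_eqI)
      (use Comp_K[OF a k kd[symmetric]] Zro_K[OF aD(1) kD(2)] is_cokernelD[OF coker] kd aD kD in auto)
  fix \<eta> assume h: "\<eta> \<in> Arr K" "Dom K \<eta> = Cod K \<alpha>" "Comp K \<eta> \<alpha> = Zro K (Dom K \<alpha>) (Cod K \<eta>)"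
  note hD = K_arrD[OF h(1)]
  have "\<exists>l. l \<in> Arr A \<and> Dom A l = FObj (Cod K \<kappa>) d \<and> Cod A l = FObj (Cod K \<eta>) d \<and> l \<cdot> \<kappa> $ d = \<eta> $ d"
    if d: "d \<in> Obj D" for d
  proof -
    have "\<eta> $ d \<cdot> \<alpha> $ d = Zro A (FObj (Dom K \<alpha>) d) (FObj (Cod K \<eta>) d)"
      using Comp_K(4)[OF a h(1) h(2)[symmetric] d] h(3) Zro_K(4)[OF aD(1) hD(2) d] by simp
    then show ?thesis
      using cokernel_lift[OF coker[OF d], of "\<eta> $ d"] hD(3-5)[OF d] aD(3-5)[OF d] kD(3-5)[OF d] h(2) by metis
  qed
  then obtain l where l: "\<And>d. d \<in> Obj D \<Longrightarrow> l d \<in> Arr A \<and> Dom A (l d) = FObj (Cod K \<kappa>) d \<and>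
      Cod A (l d) = FObj (Cod K \<eta>) d \<and> l d \<cdot> \<kappa> $ d = \<eta> $ d" by metis
  let ?l = "(Cod K \<kappa>, restrict l (Obj D), Cod K \<eta>)"
  have lK: "?l \<in> Arr K"
  proof (rule K_arrI)
    fix e assume e: "e \<in> Arr D"
    have ed: "Dom D e \<in> Obj D" "Cod D e \<in> Obj D" using e by auto
    note E = functorD(2-4)[OF hD(2) e] functorD(2-4)[OF kD(2) e] functorD(2-4)[OF kD(1) e]
    note L = l[OF ed(1)] l[OF ed(2)] kD(3-5)[OF ed(1)] kD(3-5)[OF ed(2)] hD(3-5)[OF ed(1)] hD(3-5)[OF ed(2)]
    show "l (Cod D e) \<cdot> FArr (Cod K \<kappa>) e = FArr (Cod K \<eta>) e \<cdot> l (Dom D e)"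
    proof (rule is_epiD[OF cokernel_epi[OF coker[OF ed(1)]]])
      have "l (Cod D e) \<cdot> FArr (Cod K \<kappa>) e \<cdot> \<kappa> $ Dom D e = l (Cod D e) \<cdot> \<kappa> $ Cod D e \<cdot> FArr (Dom K \<kappa>) e"
        using kD(6)[OF e] by simp
      also have "\<dots> = \<eta> $ Cod D e \<cdot> FArr (Dom K \<kappa>) e"
        by (rule Comp_eq_extend) (use L E kd h in auto)
      also have "\<dots> = FArr (Cod K \<eta>) e \<cdot> l (Dom D e) \<cdot> \<kappa> $ Dom D e"
        using hD(6)[OF e] h(2) L kd by simp
      finally show "(l (Cod D e) \<cdot> FArr (Cod K \<kappa>) e) \<cdot> \<kappa> $ Dom D e =
        (FArr (Cod K \<eta>) e \<cdot> l (Dom D e)) \<cdot> \<kappa> $ Dom D e" using L E by simp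
    qed (use L E in auto)
  qed (use hD kD l in auto)
  have "Comp K ?l \<kappa> = \<eta>"
    by (rule K_arr_eqI) (use Comp_K[OF k lK] h kd l in auto)
  then show "\<exists>h'. h' \<in> Arr K \<and> Dom K h' = Cod K \<kappa> \<and> Cod K h' = Cod K \<eta> \<and> Comp K h' \<kappa> = \<eta>"
    using lK by (intro exI[of _ ?l]) simp
qed (use assms in auto)

text \<open>The chosen kernels become a functor by lifting along them, and functoriality is the
  uniqueness of lifts.\<close>

lemma ex_pointwise_kernel:
  assumes a: "\<alpha> \<in> Arr K"
  obtains \<kappa> where "\<kappa> \<in> Arr K" "Cod K \<kappa> = Dom K \<alpha>" "\<And>d. d \<in> Obj D \<Longrightarrow> is_kernel A (\<alpha> $ d) (\<kappa> $ d)"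
proof -
  note aD = K_arrD[OF a] note F = functorD[OF aD(1)] and G = functorD[OF aD(2)]
  let ?k = "\<lambda>d. ker A (\<alpha> $ d)"
  let ?u = "\<lambda>e. FArr (Dom K \<alpha>) e \<cdot> ?k (Dom D e)"
  let ?fa = "\<lambda>e. klift (\<alpha> $ Cod D e) (?u e)"
  have k: "?k d \<in> Arr A" "Cod A (?k d) = FObj (Dom K \<alpha>) d" "cyc (\<alpha> $ d) (?k d)"
    "Dom A (?k d) \<in> Obj A" if "d \<in> Obj D" for d
    using ker_arr[OF aD(3)[OF that]] aD that by auto
  have cyc: "cyc (\<alpha> $ Cod D e) (?u e)" if e: "e \<in> Arr D" for e
  proof (rule cyc_map[OF k(3)])
    show "\<alpha> $ Cod D e \<cdot> FArr (Dom K \<alpha>) e = FArr (Cod K \<alpha>) e \<cdot> \<alpha> $ Dom D e" by (rule aD(6)[OF e])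
  qed (use e aD F G in auto)
  have fa: "?fa e \<in> Arr A" "Dom A (?fa e) = Dom A (?k (Dom D e))" "Cod A (?fa e) = Dom A (?k (Cod D e))"
    "?k (Cod D e) \<cdot> ?fa e = ?u e" if e: "e \<in> Arr D" for e
    using klift[OF cyc[OF e]] k[of "Dom D e"] F(2-4)[OF e] e by auto
  let ?Kf = "\<lparr>FObj = restrict (\<lambda>d. Dom A (?k d)) (Obj D), FArr = restrict ?fa (Arr D)\<rparr>"
  have Kf: "is_functor D A ?Kf"
  proof (rule functorI)
    fix d assume d: "d \<in> Obj D"
    have i: "Ident D d \<in> Arr D" "Cod D (Ident D d) = d" "Dom D (Ident D d) = d" using d by auto
    show "?fa (Ident D d) = Ident A (Dom A (?k d))"
      by (rule klift_unique[OF cyc[OF i(1)]]) (use i d k F in auto)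
  next
    fix e e' assume e: "e \<in> Arr D" "e' \<in> Arr D" "Cod D e = Dom D e'"
    have ee: "Comp D e' e \<in> Arr D" "Dom D (Comp D e' e) = Dom D e" "Cod D (Comp D e' e) = Cod D e'"
      using e by auto
    show "?fa (Comp D e' e) = ?fa e' \<cdot> ?fa e"
    proof (rule klift_unique[OF cyc[OF ee(1)]])
      have "?k (Cod D e') \<cdot> ?fa e' \<cdot> ?fa e = (FArr (Dom K \<alpha>) e' \<cdot> ?k (Dom D e')) \<cdot> ?fa e"
        by (rule Comp_eq_extend[OF fa(4)[OF e(2)]]) (use fa[OF e(1)] fa[OF e(2)] e k in auto)
      also have "\<dots> = FArr (Dom K \<alpha>) e' \<cdot> ?k (Cod D e) \<cdot> ?fa e"
        using fa(1-3)[OF e(1)] fa(1-3)[OF e(2)] e k F by simp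
      also have "\<dots> = FArr (Dom K \<alpha>) e' \<cdot> FArr (Dom K \<alpha>) e \<cdot> ?k (Dom D e)"
        using fa(4)[OF e(1)] by simp
      also have "\<dots> = ?u (Comp D e' e)" using e k F by simp
      finally show "?k (Cod D (Comp D e' e)) \<cdot> ?fa e' \<cdot> ?fa e = ?u (Comp D e' e)" using ee by simp
    qed (use e ee fa(1-3)[OF e(1)] fa(1-3)[OF e(2)] k F in auto)
  qed (use k fa in auto)
  let ?\<kappa> = "(?Kf, restrict ?k (Obj D), Dom K \<alpha>)"
  have "?\<kappa> \<in> Arr K"
    by (rule K_arrI[OF Kf aD(1)]) (use k fa in auto)
  then show ?thesis
    using ker_kernel aD(3) by (intro that[of ?\<kappa>]) auto
qed

lemma ex_pointwise_cokernel:
  assumes a: "\<alpha> \<in> Arr K"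
  obtains \<kappa> where "\<kappa> \<in> Arr K" "Dom K \<kappa> = Cod K \<alpha>" "\<And>d. d \<in> Obj D \<Longrightarrow> is_cokernel A (\<alpha> $ d) (\<kappa> $ d)"
proof -
  note aD = K_arrD[OF a] note F = functorD[OF aD(1)] and G = functorD[OF aD(2)]
  let ?k = "\<lambda>d. coker A (\<alpha> $ d)"
  have k: "?k d \<in> Arr A" "Dom A (?k d) = FObj (Cod K \<alpha>) d" "is_cokernel A (\<alpha> $ d) (?k d)"
    "Cod A (?k d) \<in> Obj A" "is_epi A (?k d)" "?k d \<cdot> \<alpha> $ d = Zro A (FObj (Dom K \<alpha>) d) (Cod A (?k d))"
    if "d \<in> Obj D" for d
    using coker_cokernel[OF aD(3)[OF that]] is_cokernelD[OF coker_cokernel[OF aD(3)[OF that]]]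
      cokernel_epi aD that by auto
  have "\<exists>l. l \<in> Arr A \<and> Dom A l = Cod A (?k (Dom D e)) \<and> Cod A l = Cod A (?k (Cod D e)) \<and>
    l \<cdot> ?k (Dom D e) = ?k (Cod D e) \<cdot> FArr (Cod K \<alpha>) e" if e: "e \<in> Arr D" for e
  proof -
    have ed: "Dom D e \<in> Obj D" "Cod D e \<in> Obj D" using e by auto
    let ?u = "?k (Cod D e) \<cdot> FArr (Cod K \<alpha>) e"
    note kk = k[OF ed(1)] k[OF ed(2)] aD(3-5)[OF ed(1)] aD(3-5)[OF ed(2)]
    have "?u \<cdot> \<alpha> $ Dom D e = ?k (Cod D e) \<cdot> \<alpha> $ Cod D e \<cdot> FArr (Dom K \<alpha>) e"
      using aD(6)[OF e] kk F(2-4)[OF e] G(2-4)[OF e] by simp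
    also have "\<dots> = Zro A (FObj (Dom K \<alpha>) (Cod D e)) (Cod A (?k (Cod D e))) \<cdot> FArr (Dom K \<alpha>) e"
      by (rule Comp_eq_extend[OF kk(12)]) (use kk F(2-4)[OF e] in auto)
    also have "\<dots> = Zro A (FObj (Dom K \<alpha>) (Dom D e)) (Cod A ?u)"
      using kk F(2-4)[OF e] G(2-4)[OF e] by simp
    finally show ?thesis
      using cokernel_lift[OF kk(3), of ?u] kk F(2-4)[OF e] G(2-4)[OF e] Comp_arr[of "FArr (Cod K \<alpha>) e" "?k (Cod D e)"]
      by metis
  qed
  then obtain fa where fa: "\<And>e. e \<in> Arr D \<Longrightarrow> fa e \<in> Arr A \<and> Dom A (fa e) = Cod A (?k (Dom D e)) \<and>
    Cod A (fa e) = Cod A (?k (Cod D e)) \<and> fa e \<cdot> ?k (Dom D e) = ?k (Cod D e) \<cdot> FArr (Cod K \<alpha>) e"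
    by metis
  let ?Kf = "\<lparr>FObj = restrict (\<lambda>d. Cod A (?k d)) (Obj D), FArr = restrict fa (Arr D)\<rparr>"
  have Kf: "is_functor D A ?Kf"
  proof (rule functorI)
    fix d assume d: "d \<in> Obj D"
    have i: "Ident D d \<in> Arr D" "Cod D (Ident D d) = d" "Dom D (Ident D d) = d" using d by auto
    show "fa (Ident D d) = Ident A (Cod A (?k d))"
      by (rule is_epiD[OF k(5)[OF d]]) (use fa[OF i(1)] i d k G in auto)
  next
    fix e e' assume e: "e \<in> Arr D" "e' \<in> Arr D" "Cod D e = Dom D e'"
    have ee: "Comp D e' e \<in> Arr D" "Dom D (Comp D e' e) = Dom D e" "Cod D (Comp D e' e) = Cod D e'"
      using e by auto
    have ed: "Dom D e \<in> Obj D" "Cod D e \<in> Obj D" "Cod D e' \<in> Obj D" using e by auto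
    note kk = k[OF ed(1)] k[OF ed(2)] k[OF ed(3)]
    note E = G(2-4)[OF e(1)] G(2-4)[OF e(2)]
    have f1: "fa e \<in> Arr A" "Dom A (fa e) = Cod A (?k (Dom D e))" "Cod A (fa e) = Cod A (?k (Cod D e))"
      "fa e \<cdot> ?k (Dom D e) = ?k (Cod D e) \<cdot> FArr (Cod K \<alpha>) e" using fa[OF e(1)] by auto
    have f2: "fa e' \<in> Arr A" "Dom A (fa e') = Cod A (?k (Cod D e))" "Cod A (fa e') = Cod A (?k (Cod D e'))"
      "fa e' \<cdot> ?k (Cod D e) = ?k (Cod D e') \<cdot> FArr (Cod K \<alpha>) e'" using fa[OF e(2)] e by auto
    have f3: "fa (Comp D e' e) \<in> Arr A" "Dom A (fa (Comp D e' e)) = Cod A (?k (Dom D e))"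
      "Cod A (fa (Comp D e' e)) = Cod A (?k (Cod D e'))"
      "fa (Comp D e' e) \<cdot> ?k (Dom D e) = ?k (Cod D e') \<cdot> FArr (Cod K \<alpha>) e' \<cdot> FArr (Cod K \<alpha>) e"
      using fa[OF ee(1)] ee G(6)[OF e] by auto
    show "fa (Comp D e' e) = fa e' \<cdot> fa e"
    proof (rule is_epiD[OF kk(5)])
      have "fa e' \<cdot> fa e \<cdot> ?k (Dom D e) = fa e' \<cdot> ?k (Cod D e) \<cdot> FArr (Cod K \<alpha>) e" using f1 by simp
      also have "\<dots> = ?k (Cod D e') \<cdot> FArr (Cod K \<alpha>) e' \<cdot> FArr (Cod K \<alpha>) e"
        by (rule square_extend[OF f2(4)]) (use f2 kk E e in auto)
      finally show "fa (Comp D e' e) \<cdot> ?k (Dom D e) = (fa e' \<cdot> fa e) \<cdot> ?k (Dom D e)"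
        using f3(4) f1(1-3) f2(1-3) kk by simp
    qed (use f1 f2 f3 kk in auto)
  qed (use k fa in auto)
  let ?\<kappa> = "(Cod K \<alpha>, restrict ?k (Obj D), ?Kf)"
  have "?\<kappa> \<in> Arr K"
    by (rule K_arrI[OF aD(2) Kf]) (use k fa in auto)
  then show ?thesis
    using k(3) by (intro that[of ?\<kappa>]) auto
qed

text \<open>A kernel in the functor category is isomorphic to the objectwise one, and evaluating
  this isomorphism at an object transports the universal property. This is what turns an abstract
  short exact sequence of functors into short exact sequences in \<open>A\<close>.\<close>

lemma kernel_K_iff:
  assumes a: "\<alpha> \<in> Arr K" and k: "\<kappa> \<in> Arr K" and kd: "Cod K \<kappa> = Dom K \<alpha>"
  shows "is_kernel K \<alpha> \<kappa> \<longleftrightarrow> (\<forall>d\<in>Obj D. is_kernel A (\<alpha> $ d) (\<kappa> $ d))"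
proof
  assume ker: "is_kernel K \<alpha> \<kappa>"
  obtain \<mu> where m: "\<mu> \<in> Arr K" "Cod K \<mu> = Dom K \<alpha>" "\<And>d. d \<in> Obj D \<Longrightarrow> is_kernel A (\<alpha> $ d) (\<mu> $ d)"
    using ex_pointwise_kernel[OF a] by blast
  have mk: "is_kernel K \<alpha> \<mu>" by (rule pointwise_kernel[OF a m])
  obtain i where i: "i \<in> Arr K" "Dom K i = Dom K \<kappa>" "Cod K i = Dom K \<mu>" "Comp K \<mu> i = \<kappa>"
    using K.kernel_lift[OF mk k kd K.is_kernelD(4)[OF ker]] .
  obtain j where j: "j \<in> Arr K" "Dom K j = Dom K \<mu>" "Cod K j = Dom K \<kappa>" "Comp K \<kappa> j = \<mu>"
    using K.kernel_lift[OF ker m(1,2) K.is_kernelD(4)[OF mk]] .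
  note kD = K_arrD[OF k] and mD = K_arrD[OF m(1)] and iD = K_arrD[OF i(1)] and jD = K_arrD[OF j(1)] and aD = K_arrD[OF a]
  show "\<forall>d\<in>Obj D. is_kernel A (\<alpha> $ d) (\<kappa> $ d)"
  proof
    fix d assume d: "d \<in> Obj D"
    note T = kD(3-5)[OF d] mD(3-5)[OF d] iD(3-5)[OF d] jD(3-5)[OF d] aD(3-5)[OF d]
    have mi: "\<mu> $ d \<cdot> i $ d = \<kappa> $ d" using Comp_K(4)[OF i(1) m(1) i(3) d] i(4) by simp
    have kj: "\<kappa> $ d \<cdot> j $ d = \<mu> $ d" using Comp_K(4)[OF j(1) k j(3) d] j(4) by simp
    note ker' = m(3)[OF d]
    have "is_mono K \<kappa>" by (rule K.kernel_mono[OF ker])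
    \<comment> \<open>The comparison with the objectwise kernel is invertible on this side, which
      lets \<open>\<kappa> $ d\<close> inherit that it is a monomorphism from
      \<open>\<mu> $ d\<close>.\<close>
    have "Comp K j i = Ident K (Dom K \<kappa>)"
      by (rule K.is_monoD[OF \<open>is_mono K \<kappa>\<close>])
        (use i j k kD Ident_K[OF kD(1)] K.Comp_eq_extend[OF j(4), of i] in auto)
    then have "(Comp K j i) $ d = Ident A (FObj (Dom K \<kappa>) d)" using Ident_K(4)[OF kD(1) d] by simp
    then have ji: "j $ d \<cdot> i $ d = Ident A (FObj (Dom K \<kappa>) d)"
      using Comp_K(4)[OF i(1) j(1) _ d] i j by simp
    show "is_kernel A (\<alpha> $ d) (\<kappa> $ d)"
    proof (rule is_kernelI)
      show "is_mono A (\<kappa> $ d)"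
      proof (rule is_monoI)
        fix h assume h: "h \<in> Arr A" "Cod A h = Dom A (\<kappa> $ d)" "\<kappa> $ d \<cdot> h = Zro A (Dom A h) (Cod A (\<kappa> $ d))"
        have "\<mu> $ d \<cdot> i $ d \<cdot> h = \<kappa> $ d \<cdot> h"
          by (rule Comp_eq_extend[OF mi]) (use T h i m kd in auto)
        then have "i $ d \<cdot> h = Zro A (Dom A (i $ d \<cdot> h)) (Dom A (\<mu> $ d))"
          by (intro mono_Zro[OF kernel_mono[OF ker']]) (use T h i m kd in auto)
        then have "j $ d \<cdot> i $ d \<cdot> h = Zro A (Dom A h) (Dom A (\<kappa> $ d))"
          using T h i j by simp
        moreover have "j $ d \<cdot> i $ d \<cdot> h = Ident A (FObj (Dom K \<kappa>) d) \<cdot> h"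
          by (rule Comp_eq_extend[OF ji]) (use T h i j in auto)
        ultimately show "h = Zro A (Dom A h) (Dom A (\<kappa> $ d))" using T h by simp
      qed (use T in auto)
      have "\<alpha> $ d \<cdot> \<mu> $ d \<cdot> i $ d = Zro A (Dom A (\<mu> $ d)) (Cod A (\<alpha> $ d)) \<cdot> i $ d"
        by (rule Comp_eq_extend[OF is_kernelD(4)[OF ker']]) (use T i m kd in auto)
      then show "\<alpha> $ d \<cdot> \<kappa> $ d = Zro A (Dom A (\<kappa> $ d)) (Cod A (\<alpha> $ d))"
        using mi T i m kd functorD(1)[OF aD(2) d] by simp
      fix h assume h: "h \<in> Arr A" "Cod A h = Dom A (\<alpha> $ d)" "\<alpha> $ d \<cdot> h = Zro A (Dom A h) (Cod A (\<alpha> $ d))"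
      obtain l where l: "l \<in> Arr A" "Dom A l = Dom A h" "Cod A l = Dom A (\<mu> $ d)" "\<mu> $ d \<cdot> l = h"
        using kernel_lift[OF ker' h] .
      have "\<kappa> $ d \<cdot> j $ d \<cdot> l = \<mu> $ d \<cdot> l"
        by (rule Comp_eq_extend[OF kj]) (use T l j in auto)
      then show "\<exists>h'. h' \<in> Arr A \<and> Dom A h' = Dom A h \<and> Cod A h' = Dom A (\<kappa> $ d) \<and> \<kappa> $ d \<cdot> h' = h"
        using T l j by (intro exI[of _ "j $ d \<cdot> l"]) simp
    qed (use T kd in auto)
  qed
qed (use pointwise_kernel[OF a k kd] in blast)

lemma cokernel_K_iff:
  assumes a: "\<alpha> \<in> Arr K" and k: "\<kappa> \<in> Arr K" and kd: "Dom K \<kappa> = Cod K \<alpha>"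
  shows "is_cokernel K \<alpha> \<kappa> \<longleftrightarrow> (\<forall>d\<in>Obj D. is_cokernel A (\<alpha> $ d) (\<kappa> $ d))"
proof
  assume ck: "is_cokernel K \<alpha> \<kappa>"
  obtain \<mu> where m: "\<mu> \<in> Arr K" "Dom K \<mu> = Cod K \<alpha>" "\<And>d. d \<in> Obj D \<Longrightarrow> is_cokernel A (\<alpha> $ d) (\<mu> $ d)"
    using ex_pointwise_cokernel[OF a] by blast
  have mk: "is_cokernel K \<alpha> \<mu>" by (rule pointwise_cokernel[OF a m])
  obtain i where i: "i \<in> Arr K" "Dom K i = Cod K \<mu>" "Cod K i = Cod K \<kappa>" "Comp K i \<mu> = \<kappa>"
    using K.cokernel_lift[OF mk k kd K.is_cokernelD(4)[OF ck]] .
  obtain j where j: "j \<in> Arr K" "Dom K j = Cod K \<kappa>" "Cod K j = Cod K \<mu>" "Comp K j \<kappa> = \<mu>"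
    using K.cokernel_lift[OF ck m(1,2) K.is_cokernelD(4)[OF mk]] .
  note kD = K_arrD[OF k] and mD = K_arrD[OF m(1)] and iD = K_arrD[OF i(1)] and jD = K_arrD[OF j(1)] and aD = K_arrD[OF a]
  show "\<forall>d\<in>Obj D. is_cokernel A (\<alpha> $ d) (\<kappa> $ d)"
  proof
    fix d assume d: "d \<in> Obj D"
    note T = kD(3-5)[OF d] mD(3-5)[OF d] iD(3-5)[OF d] jD(3-5)[OF d] aD(3-5)[OF d]
    have mi: "i $ d \<cdot> \<mu> $ d = \<kappa> $ d" using Comp_K(4)[OF m(1) i(1) i(2)[symmetric] d] i(4) by simp
    have kj: "j $ d \<cdot> \<kappa> $ d = \<mu> $ d" using Comp_K(4)[OF k j(1) j(2)[symmetric] d] j(4) by simp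
    note ck' = m(3)[OF d]
    have "is_epi K \<kappa>" by (rule K.cokernel_epi[OF ck])
    have "Comp K i j = Ident K (Cod K \<kappa>)"
      by (rule K.is_epiD[OF \<open>is_epi K \<kappa>\<close>]) (use i j k kD Ident_K[OF kD(2)] in auto)
    then have "(Comp K i j) $ d = Ident A (FObj (Cod K \<kappa>) d)" using Ident_K(4)[OF kD(2) d] by simp
    then have ij: "i $ d \<cdot> j $ d = Ident A (FObj (Cod K \<kappa>) d)"
      using Comp_K(4)[OF j(1) i(1) _ d] i j by simp
    show "is_cokernel A (\<alpha> $ d) (\<kappa> $ d)"
    proof (rule is_cokernelI)
      have ep: "is_epi A (i $ d)"
        by (rule epi_right_factor[of _ "j $ d"]) (use ij T i j epi_Ident functorD(1)[OF kD(2) d] in auto)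
      show "is_epi A (\<kappa> $ d)"
        using epi_Comp[OF cokernel_epi[OF ck'] ep] mi T i by simp
      have "\<kappa> $ d \<cdot> \<alpha> $ d = i $ d \<cdot> \<mu> $ d \<cdot> \<alpha> $ d"
        by (rule Comp_eq_extend[OF mi, symmetric]) (use T i m kd in auto)
      then show "\<kappa> $ d \<cdot> \<alpha> $ d = Zro A (Dom A (\<alpha> $ d)) (Cod A (\<kappa> $ d))"
        using is_cokernelD(4)[OF ck'] T i m kd functorD(1)[OF aD(1) d] by simp
      fix h assume h: "h \<in> Arr A" "Dom A h = Cod A (\<alpha> $ d)" "h \<cdot> \<alpha> $ d = Zro A (Dom A (\<alpha> $ d)) (Cod A h)"
      obtain l where l: "l \<in> Arr A" "Dom A l = Cod A (\<mu> $ d)" "Cod A l = Cod A h" "l \<cdot> \<mu> $ d = h"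
        using cokernel_lift[OF ck' h] .
      show "\<exists>h'. h' \<in> Arr A \<and> Dom A h' = Cod A (\<kappa> $ d) \<and> Cod A h' = Cod A h \<and> h' \<cdot> \<kappa> $ d = h"
        using T l j kj by (intro exI[of _ "l \<cdot> j $ d"]) simp
    qed (use T kd in auto)
  qed
qed (use pointwise_cokernel[OF a k kd] in blast)

lemma short_exact_K_D:
  assumes "short_exact K \<phi> \<gamma>"
  shows "\<phi> \<in> Arr K" "\<gamma> \<in> Arr K" "Cod K \<phi> = Dom K \<gamma>"
    "d \<in> Obj D \<Longrightarrow> short_exact A (\<phi> $ d) (\<gamma> $ d)"
proof -
  have kc: "is_kernel K \<gamma> \<phi>" "is_cokernel K \<phi> \<gamma>" using assms by (auto simp: short_exact_def)
  note t = K.is_kernelD(1-3)[OF kc(1)]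
  show "\<phi> \<in> Arr K" "\<gamma> \<in> Arr K" "Cod K \<phi> = Dom K \<gamma>" by (fact t)+
  show "d \<in> Obj D \<Longrightarrow> short_exact A (\<phi> $ d) (\<gamma> $ d)"
    using kc kernel_K_iff[OF t] cokernel_K_iff[OF t(2,1) t(3)[symmetric]] by (simp add: short_exact_def)
qed

text \<open>Supplies the canonical sequences: an objectwise epimorphism is at each object the
  cokernel of its kernel.\<close>

lemma ex_short_exact_K:
  assumes g: "\<gamma> \<in> Arr K" and epi: "\<And>d. d \<in> Obj D \<Longrightarrow> is_epi A (\<gamma> $ d)"
  obtains \<kappa> where "short_exact K \<kappa> \<gamma>"
proof -
  obtain \<kappa> where k: "\<kappa> \<in> Arr K" "Cod K \<kappa> = Dom K \<gamma>" "\<And>d. d \<in> Obj D \<Longrightarrow> is_kernel A (\<gamma> $ d) (\<kappa> $ d)"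
    using ex_pointwise_kernel[OF g] by blast
  have "is_cokernel K \<kappa> \<gamma>"
    by (rule pointwise_cokernel[OF k(1) g k(2)[symmetric]]) (rule epi_cokernel_of_kernel[OF epi k(3)])
  then have "short_exact K \<kappa> \<gamma>" using pointwise_kernel[OF g k] by (simp add: short_exact_def)
  then show ?thesis using that by blast
qed

end

section \<open>Comparison of effaceable and universal partial functors\<close>

context abelian_category
begin

text \<open>The cokernel of \<open>m\<close> kills \<open>y\<close> after \<open>e\<close>, hence
  kills \<open>y\<close>, and \<open>m\<close> is the kernel of its cokernel. This turns a lift that
  exists on a cover into a genuine arrow.\<close>

lemma mono_epi_fill:
  assumes m: "is_mono A m" and e: "is_epi A e" "Cod A e = Dom A y"
    and y: "y \<in> Arr A" "Cod A y = Cod A m"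
    and x: "x \<in> Arr A" "Cod A x = Dom A m" "Dom A x = Dom A e" "m \<cdot> x = y \<cdot> e"
  obtains h where "h \<in> Arr A" "Dom A h = Dom A y" "Cod A h = Dom A m" "m \<cdot> h = y"
proof -
  have ma: "m \<in> Arr A" and ea: "e \<in> Arr A" using m e is_mono_arr is_epi_arr by auto
  let ?q = "coker A m"
  note q = coker_cokernel[OF ma] is_cokernelD[OF coker_cokernel[OF ma]]
  have "(?q \<cdot> y) \<cdot> e = ?q \<cdot> m \<cdot> x" using q ma ea e x(4) y by simp
  also have "\<dots> = Zro A (Dom A m) (Cod A ?q) \<cdot> x"
    by (rule Comp_eq_extend[OF q(5)]) (use q ma x in auto)
  also have "\<dots> = Zro A (Dom A e) (Cod A (?q \<cdot> y))" using q ma x y by simp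
  finally have "?q \<cdot> y = Zro A (Dom A y) (Cod A ?q)"
    using epi_Zro[OF e(1), of "?q \<cdot> y"] q y e by simp
  then show ?thesis
    using kernel_lift[OF mono_kernel_of_cokernel[OF m q(1)], of y] that y q by metis
qed

end

lemma homological_partial_functorD:
  assumes "homological_partial_functor K A T \<delta>"
  shows "is_functor K A (T n)" "is_additive_functor K A (T n)"
    "short_exact K f g \<Longrightarrow> \<delta> n f g \<in> Arr A"
    "short_exact K f g \<Longrightarrow> Dom A (\<delta> n f g) = FObj (T (Suc n)) (Cod K g)"
    "short_exact K f g \<Longrightarrow> Cod A (\<delta> n f g) = FObj (T n) (Dom K f)"
    "short_exact K f g \<Longrightarrow> exact A (FArr (T (Suc n)) g) (\<delta> n f g)"
    "short_exact K f g \<Longrightarrow> exact A (\<delta> n f g) (FArr (T n) f)"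
  using assms unfolding homological_partial_functor_def is_additive_functor_def
  by (auto simp: in_Hom)

lemma homological_partial_functor_natural:
  assumes "homological_partial_functor K A T \<delta>" "short_exact K f g" "short_exact K f' g'"
    "a \<in> Arr K" "Dom K a = Dom K f" "Cod K a = Dom K f'"
    "b \<in> Arr K" "Dom K b = Cod K f" "Cod K b = Cod K f'"
    "c \<in> Arr K" "Dom K c = Cod K g" "Cod K c = Cod K g'"
    "Comp K b f = Comp K f' a" "Comp K c g = Comp K g' b"
  shows "Comp A (\<delta> n f' g') (FArr (T (Suc n)) c) = Comp A (FArr (T n) a) (\<delta> n f g)"
proof -
  have 1: "a \<in> Hom K (Dom K f) (Dom K f')" "b \<in> Hom K (Cod K f) (Cod K f')" "c \<in> Hom K (Cod K g) (Cod K g')"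
    using assms by (auto simp: in_Hom)
  show ?thesis using assms(1)[unfolded homological_partial_functor_def] assms(2,3,13,14) 1 by blast
qed

text \<open>
  If every object \<open>F\<close> is, functorially, a quotient of an \<open>S\<close>-acyclic object, then a morphism into
  \<open>S\<close> can be constructed degree by degree, so \<open>S\<close> is again universal.
\<close>

locale effaceable_partial_functor = E: preadditive_category E + abelian_category A
  for E :: "('p, 'q, 'y) abcat_scheme" and A :: "('o, 'm, 'z) abcat_scheme" +
  fixes S T :: "nat \<Rightarrow> ('p, 'q, 'o, 'm) cfunctor" and \<epsilon> \<delta> :: "nat \<Rightarrow> 'q \<Rightarrow> 'q \<Rightarrow> 'm"
    and \<alpha> :: "('p, 'q, 'o, 'm) nat_trans" and k p :: "'p \<Rightarrow> 'q"
  assumes S: "homological_partial_functor E A S \<epsilon>"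
    and T: "universal_homological_partial_functor E A T \<delta>"
    and \<alpha>: "\<alpha> \<in> Hom (functor_category E A) (S 0) (T 0)"
    and \<alpha>_iso: "F \<in> Obj E \<Longrightarrow> \<exists>b. b \<in> Hom A (FObj (T 0) F) (FObj (S 0) F) \<and>
      b \<cdot> component \<alpha> F = Ident A (FObj (S 0) F) \<and> component \<alpha> F \<cdot> b = Ident A (FObj (T 0) F)"
    and p: "F \<in> Obj E \<Longrightarrow> short_exact E (k F) (p F)" "F \<in> Obj E \<Longrightarrow> Cod E (p F) = F"
    and p_natural: "u \<in> Arr E \<Longrightarrow> \<exists>v. v \<in> Hom E (Dom E (p (Dom E u))) (Dom E (p (Cod E u))) \<and>
      Comp E (p (Cod E u)) v = Comp E u (p (Dom E u))"
    and p_Comp: "short_exact E f g \<Longrightarrow> \<exists>k'. short_exact E k' (Comp E g (p (Dom E g)))"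
    and acyclic: "F \<in> Obj E \<Longrightarrow> a \<in> Arr A \<Longrightarrow> Cod A a = FObj (S (Suc n)) (Dom E (p F)) \<Longrightarrow>
      a = Zro A (Dom A a) (Cod A a)"
begin

notation comp (infixr "\<cdot>" 70)

sublocale W: functors_into_abelian E A ..

abbreviation "Sa n \<equiv> FArr (S n)"
abbreviation "Ta n \<equiv> FArr (T n)"

lemma T': "homological_partial_functor E A T \<delta>"
  using T by (simp add: universal_homological_partial_functor_def)

lemmas SF = W.functorD[OF homological_partial_functorD(1)[OF S]]
lemmas TF = W.functorD[OF homological_partial_functorD(1)[OF T']]
lemmas SD = homological_partial_functorD(3-7)[OF S]
lemmas TD = homological_partial_functorD(3-7)[OF T']

lemma sesD:
  assumes "short_exact E f g"
  shows "is_kernel E g f" "f \<in> Arr E" "g \<in> Arr E" "Cod E f = Dom E g"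
    "Comp E g f = Zro E (Dom E f) (Cod E g)"
  using assms E.is_kernelD[of g f] by (auto simp: short_exact_def)

lemma ses_lift:
  assumes "short_exact E f g" "h \<in> Arr E" "Cod E h = Dom E g" "Comp E g h = Zro E (Dom E h) (Cod E g)"
  obtains a where "a \<in> Arr E" "Dom E a = Dom E h" "Cod E a = Dom E f" "Comp E f a = h"
  using E.kernel_lift[OF sesD(1)[OF assms(1)] assms(2-4)] .

lemmas pses = sesD[OF p(1)]

text \<open>By exactness an element killed by the connecting morphism comes, on a cover, from
  \<open>S (Suc n)\<close> of the middle term, which is acyclic. The epimorphism \<open>g\<close>
  may be any one with such a source; this freedom is used for composites of covers.\<close>

lemma eps_mono:
  assumes fg: "short_exact E f g" and F: "F \<in> Obj E" "Dom E g = Dom E (p F)"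
  shows "is_mono A (\<epsilon> n f g)"
proof (rule is_monoI)
  note s = sesD[OF fg] and e = SD[OF fg, of n]
  fix h assume h: "h \<in> Arr A" "Cod A h = Dom A (\<epsilon> n f g)" "\<epsilon> n f g \<cdot> h = Zro A (Dom A h) (Cod A (\<epsilon> n f g))"
  have "covered (Sa (Suc n) g) h" by (rule exactD_covered[OF e(4) h])
  then obtain e1 x where x: "is_epi A e1" "e1 \<in> Arr A" "Cod A e1 = Dom A h" "x \<in> Arr A" "Dom A x = Dom A e1"
    "Cod A x = Dom A (Sa (Suc n) g)" "Sa (Suc n) g \<cdot> x = h \<cdot> e1" by (rule coveredE)
  note gS = SF(2-4)[OF s(3), of "Suc n"]
  have "x = Zro A (Dom A x) (Cod A x)"
    by (rule acyclic[OF F(1)]) (use x gS F in auto)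
  then have "Sa (Suc n) g \<cdot> x = Sa (Suc n) g \<cdot> Zro A (Dom A x) (Cod A x)" by simp
  also have "\<dots> = Zro A (Dom A x) (Cod A (Sa (Suc n) g))"
    using gS x by (intro Comp_Zro(1)) auto
  finally have "h \<cdot> e1 = Zro A (Dom A e1) (Cod A h)" using x(5,7) gS e h(2) by simp
  then show "h = Zro A (Dom A h) (Dom A (\<epsilon> n f g))"
    using epi_Zro[OF x(1) h(1)] x(3) h(2) by simp
qed (use SD[OF fg] in simp)

text \<open>A natural transformation from \<open>T n\<close> to \<open>S n\<close>, kept as a bare
  family of arrows so that it can be produced by recursion on \<open>n\<close>.\<close>

definition level :: "nat \<Rightarrow> ('p \<Rightarrow> 'm) \<Rightarrow> bool" where
  "level n \<psi> \<longleftrightarrow> (\<forall>F\<in>Obj E. \<psi> F \<in> Hom A (FObj (T n) F) (FObj (S n) F)) \<and>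
     (\<forall>u\<in>Arr E. \<psi> (Cod E u) \<cdot> Ta n u = Sa n u \<cdot> \<psi> (Dom E u))"

lemma levelD:
  assumes "level n \<psi>"
  shows "F \<in> Obj E \<Longrightarrow> \<psi> F \<in> Arr A" "F \<in> Obj E \<Longrightarrow> Dom A (\<psi> F) = FObj (T n) F"
    "F \<in> Obj E \<Longrightarrow> Cod A (\<psi> F) = FObj (S n) F"
    "u \<in> Arr E \<Longrightarrow> \<psi> (Cod E u) \<cdot> Ta n u = Sa n u \<cdot> \<psi> (Dom E u)"
  using assms by (auto simp: level_def in_Hom)

lemma level_lift:
  assumes l: "level n \<psi>" and fg: "short_exact E f g" and F: "F \<in> Obj E" "Dom E g = Dom E (p F)"
  obtains h where "h \<in> Arr A" "Dom A h = FObj (T (Suc n)) (Cod E g)" "Cod A h = FObj (S (Suc n)) (Cod E g)"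
    "\<epsilon> n f g \<cdot> h = \<psi> (Dom E f) \<cdot> \<delta> n f g"
proof -
  note s = sesD[OF fg] and e = SD[OF fg, of n] and d = TD[OF fg, of n] and lD = levelD[OF l]
  note fS = SF(2-4)[OF s(2), of n] and fT = TF(2-4)[OF s(2), of n]
  have o: "Dom E f \<in> Obj E" "Cod E f \<in> Obj E" using s by (auto simp del: s(4))
  let ?y = "\<psi> (Dom E f) \<cdot> \<delta> n f g"
  have y: "?y \<in> Arr A" "Dom A ?y = FObj (T (Suc n)) (Cod E g)" "Cod A ?y = FObj (S n) (Dom E f)"
    using lD(1-3)[OF o(1)] d by auto
  have "Sa n f \<cdot> \<psi> (Dom E f) \<cdot> \<delta> n f g = \<psi> (Cod E f) \<cdot> Ta n f \<cdot> \<delta> n f g"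
    by (rule square_extend[OF lD(4)[OF s(2), symmetric]])
      (use lD(1-3)[OF o(1)] lD(1-3)[OF o(2)] fS fT d in auto)
  also have "\<dots> = \<psi> (Cod E f) \<cdot> Zro A (Dom A (\<delta> n f g)) (Cod A (Ta n f))"
    using exactD(4)[OF d(5)] by simp
  also have "\<dots> = Zro A (Dom A ?y) (Cod A (Sa n f))"
    using lD(1-3)[OF o(2)] fS fT d y Dom_Obj[OF y(1)] by (subst Comp_Zro(1)) auto
  finally have "covered (\<epsilon> n f g) ?y"
    by (intro exactD_covered[OF e(5)]) (use y fS in auto)
  then obtain e1 x where x: "is_epi A e1" "e1 \<in> Arr A" "Cod A e1 = Dom A ?y" "x \<in> Arr A" "Dom A x = Dom A e1"
    "Cod A x = Dom A (\<epsilon> n f g)" "\<epsilon> n f g \<cdot> x = ?y \<cdot> e1" by (rule coveredE)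
  obtain h where "h \<in> Arr A" "Dom A h = Dom A ?y" "Cod A h = Dom A (\<epsilon> n f g)" "\<epsilon> n f g \<cdot> h = ?y"
    by (rule mono_epi_fill[OF eps_mono[OF fg F] x(1,3) y(1) _ x(4,6,5,7)]) (use y e in auto)
  then show ?thesis using that y e by simp
qed

text \<open>Both connecting morphisms and \<psi> are natural, so a lift for one sequence, moved
  along a morphism of sequences, solves the equation of the other. This is how lifts obtained from
  different covers are compared.\<close>

lemma level_transport:
  assumes l: "level n \<psi>" and fg: "short_exact E f g" and fg': "short_exact E f' g'"
    and a: "a \<in> Arr E" "Dom E a = Dom E f" "Cod E a = Dom E f'"
    and b: "b \<in> Arr E" "Dom E b = Dom E g" "Cod E b = Dom E g'"
    and u: "u \<in> Arr E" "Dom E u = Cod E g" "Cod E u = Cod E g'"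
    and sq: "Comp E b f = Comp E f' a" "Comp E u g = Comp E g' b"
    and h: "h \<in> Arr A" "Dom A h = FObj (T (Suc n)) (Cod E g)" "Cod A h = FObj (S (Suc n)) (Cod E g)"
      "\<epsilon> n f g \<cdot> h = \<psi> (Dom E f) \<cdot> \<delta> n f g"
  shows "\<epsilon> n f' g' \<cdot> Sa (Suc n) u \<cdot> h = \<psi> (Dom E f') \<cdot> \<delta> n f' g' \<cdot> Ta (Suc n) u"
proof -
  note s = sesD[OF fg] sesD[OF fg'] and lD = levelD[OF l]
  note e = SD[OF fg, of n] SD[OF fg', of n] and d = TD[OF fg, of n] TD[OF fg', of n]
  have o: "Dom E f \<in> Obj E" "Dom E f' \<in> Obj E" using s by auto
  have nS: "\<epsilon> n f' g' \<cdot> Sa (Suc n) u = Sa n a \<cdot> \<epsilon> n f g"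
    by (rule homological_partial_functor_natural[OF S fg fg' a b(1) _ _ u sq]) (use b s in auto)
  have nT: "\<delta> n f' g' \<cdot> Ta (Suc n) u = Ta n a \<cdot> \<delta> n f g"
    by (rule homological_partial_functor_natural[OF T' fg fg' a b(1) _ _ u sq]) (use b s in auto)
  note aS = SF(2-4)[OF a(1), of n] and aT = TF(2-4)[OF a(1), of n]
    and uS = SF(2-4)[OF u(1), of "Suc n"] and uT = TF(2-4)[OF u(1), of "Suc n"]
  have "\<epsilon> n f' g' \<cdot> Sa (Suc n) u \<cdot> h = Sa n a \<cdot> \<epsilon> n f g \<cdot> h"
    by (rule square_extend[OF nS]) (use aS uS e h a u in auto)
  also have "\<dots> = Sa n a \<cdot> \<psi> (Dom E f) \<cdot> \<delta> n f g" using h by simp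
  also have "\<dots> = \<psi> (Dom E f') \<cdot> Ta n a \<cdot> \<delta> n f g"
    by (rule square_extend[OF lD(4)[OF a(1), symmetric, unfolded a]])
      (use aS aT lD(1-3)[OF o(1)] lD(1-3)[OF o(2)] a d in auto)
  also have "\<dots> = \<psi> (Dom E f') \<cdot> \<delta> n f' g' \<cdot> Ta (Suc n) u" using nT by simp
  finally show ?thesis .
qed

definition next_level :: "nat \<Rightarrow> ('p \<Rightarrow> 'm) \<Rightarrow> 'p \<Rightarrow> 'm" where
  "next_level n \<psi> F = (SOME h. h \<in> Hom A (FObj (T (Suc n)) F) (FObj (S (Suc n)) F) \<and>
     \<epsilon> n (k F) (p F) \<cdot> h = \<psi> (Dom E (k F)) \<cdot> \<delta> n (k F) (p F))"

lemma next_level: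
  assumes l: "level n \<psi>" and F: "F \<in> Obj E"
  shows "next_level n \<psi> F \<in> Arr A" "Dom A (next_level n \<psi> F) = FObj (T (Suc n)) F"
    "Cod A (next_level n \<psi> F) = FObj (S (Suc n)) F"
    "\<epsilon> n (k F) (p F) \<cdot> next_level n \<psi> F = \<psi> (Dom E (k F)) \<cdot> \<delta> n (k F) (p F)"
proof -
  have "\<exists>h. h \<in> Hom A (FObj (T (Suc n)) F) (FObj (S (Suc n)) F) \<and>
     \<epsilon> n (k F) (p F) \<cdot> h = \<psi> (Dom E (k F)) \<cdot> \<delta> n (k F) (p F)"
    using level_lift[OF l p(1)[OF F] F refl] p(2)[OF F] unfolding in_Hom by metis
  from someI_ex[OF this] show "next_level n \<psi> F \<in> Arr A" "Dom A (next_level n \<psi> F) = FObj (T (Suc n)) F"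
    "Cod A (next_level n \<psi> F) = FObj (S (Suc n)) F"
    "\<epsilon> n (k F) (p F) \<cdot> next_level n \<psi> F = \<psi> (Dom E (k F)) \<cdot> \<delta> n (k F) (p F)"
    unfolding next_level_def by (auto simp: in_Hom)
qed

lemma ex_map_to_canonical:
  assumes fg: "short_exact E f g" and u: "u \<in> Arr E" "Dom E u = Cod E g"
    and v: "v \<in> Arr E" "Dom E v = Dom E g" "Cod E v = Dom E g'" "short_exact E f' g'" "Cod E g' = Cod E u"
      "Comp E g' v = Comp E u g"
  obtains a where "a \<in> Arr E" "Dom E a = Dom E f" "Cod E a = Dom E f'" "Comp E f' a = Comp E v f"
proof -
  note s = sesD[OF fg] sesD[OF v(4)]
  have "Comp E g' (Comp E v f) = Comp E u (Comp E g f)"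
    by (rule E.square_extend[OF v(6)]) (use s u v in auto)
  also have "\<dots> = Zro E (Dom E (Comp E v f)) (Cod E g')" using s u v by simp
  finally show ?thesis
    using ses_lift[OF v(4), of "Comp E v f"] that s u v by (metis E.Comp_arr)
qed

text \<open>The middle term of the given sequence need not be acyclic, so its \<epsilon> cannot be
  cancelled. The composite of \<open>g\<close> with the cover of its source has an acyclic source
  and maps, over the identity of \<open>Cod E g\<close>, both to the canonical sequence and to the
  given one. The first map identifies its lift with the canonical one, the second yields the
  equation.\<close>

lemma next_level_compatible:
  assumes l: "level n \<psi>" and fg: "short_exact E f g"
  shows "\<epsilon> n f g \<cdot> next_level n \<psi> (Cod E g) = \<psi> (Dom E f) \<cdot> \<delta> n f g"
proof -
  note s = sesD[OF fg]
  let ?G = "Dom E g" and ?Z = "Cod E g"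
  have o: "?G \<in> Obj E" "?Z \<in> Obj E" using s by auto
  note pG = pses[OF o(1)] p(2)[OF o(1)] and pZ = pses[OF o(2)] p(2)[OF o(2)]
  let ?q = "Comp E g (p ?G)"
  obtain k' where k': "short_exact E k' ?q" using p_Comp[OF fg] by blast
  have q: "?q \<in> Arr E" "Dom E ?q = Dom E (p ?G)" "Cod E ?q = ?Z" using s pG by auto
  let ?i = "Ident E ?Z"
  have i: "?i \<in> Arr E" "Dom E ?i = ?Z" "Cod E ?i = ?Z" "Comp E ?i ?q = ?q" "Comp E ?i g = g"
    using o q s by auto
  obtain h where h: "h \<in> Arr A" "Dom A h = FObj (T (Suc n)) (Cod E ?q)"
    "Cod A h = FObj (S (Suc n)) (Cod E ?q)" "\<epsilon> n k' ?q \<cdot> h = \<psi> (Dom E k') \<cdot> \<delta> n k' ?q"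
    using level_lift[OF l k' o(1) q(2)] .
  note N = next_level[OF l o(2)]
  have iS: "Sa (Suc n) ?i \<cdot> h = h" using SF(5)[OF o(2)] h q by simp
  have iT: "\<delta> n f' g' \<cdot> Ta (Suc n) ?i = \<delta> n f' g'" if "short_exact E f' g'" "Cod E g' = ?Z" for f' g'
    using TF(5)[OF o(2)] TD(1,2)[OF that(1)] that(2) by simp
  have "h = next_level n \<psi> ?Z"
  proof (rule is_monoD[OF eps_mono[OF p(1)[OF o(2)] o(2) refl]])
    obtain v where v: "v \<in> Arr E" "Dom E v = Dom E (p ?G)" "Cod E v = Dom E (p ?Z)"
      "Comp E (p ?Z) v = ?q" using p_natural[OF s(3)] by (auto simp: in_Hom)
    obtain a where a: "a \<in> Arr E" "Dom E a = Dom E k'" "Cod E a = Dom E (k ?Z)" "Comp E (k ?Z) a = Comp E v k'"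
      by (rule ex_map_to_canonical[OF k' i(1) _ v(1) _ v(3) p(1)[OF o(2)]]) (use i v q pZ in auto)
    have "\<epsilon> n (k ?Z) (p ?Z) \<cdot> Sa (Suc n) ?i \<cdot> h = \<psi> (Dom E (k ?Z)) \<cdot> \<delta> n (k ?Z) (p ?Z) \<cdot> Ta (Suc n) ?i"
      by (rule level_transport[OF l k' p(1)[OF o(2)] a(1-3) v(1) _ v(3) i(1) _ _ _ _ h])
        (use i v q pZ a in auto)
    then show "\<epsilon> n (k ?Z) (p ?Z) \<cdot> h = \<epsilon> n (k ?Z) (p ?Z) \<cdot> next_level n \<psi> ?Z"
      using iS iT[OF p(1)[OF o(2)] pZ(6)] N by simp
  qed (use h N SD[OF p(1)[OF o(2)], of n] q pZ in auto)
  moreover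
  obtain a where a: "a \<in> Arr E" "Dom E a = Dom E k'" "Cod E a = Dom E f" "Comp E f a = Comp E (p ?G) k'"
    by (rule ex_map_to_canonical[OF k' i(1) _ pG(3) _ pG(6) fg]) (use i q in auto)
  have "\<epsilon> n f g \<cdot> Sa (Suc n) ?i \<cdot> h = \<psi> (Dom E f) \<cdot> \<delta> n f g \<cdot> Ta (Suc n) ?i"
    by (rule level_transport[OF l k' fg a(1-3) pG(3) _ pG(6) i(1) _ _ _ _ h]) (use i q a in auto)
  ultimately show ?thesis using iS iT[OF fg refl] by simp
qed

text \<open>A morphism of objects induces one of canonical sequences, so both sides of the
  naturality square agree after the \<epsilon> of the target sequence, which is a
  monomorphism.\<close>

lemma level_next:
  assumes l: "level n \<psi>"
  shows "level (Suc n) (next_level n \<psi>)"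
  unfolding level_def
proof (intro conjI ballI)
  fix F assume "F \<in> Obj E" then show "next_level n \<psi> F \<in> Hom A (FObj (T (Suc n)) F) (FObj (S (Suc n)) F)"
    using next_level[OF l] by (auto simp: in_Hom)
next
  fix u assume u: "u \<in> Arr E"
  let ?F = "Dom E u" and ?G = "Cod E u"
  have o: "?F \<in> Obj E" "?G \<in> Obj E" using u by auto
  note pF = pses[OF o(1)] p(2)[OF o(1)] and pG = pses[OF o(2)] p(2)[OF o(2)]
  obtain v where v: "v \<in> Arr E" "Dom E v = Dom E (p ?F)" "Cod E v = Dom E (p ?G)"
    "Comp E (p ?G) v = Comp E u (p ?F)" using p_natural[OF u] by (auto simp: in_Hom)
  obtain a where a: "a \<in> Arr E" "Dom E a = Dom E (k ?F)" "Cod E a = Dom E (k ?G)" "Comp E (k ?G) a = Comp E v (k ?F)"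
    by (rule ex_map_to_canonical[OF p(1)[OF o(1)] u _ v(1) _ v(3) p(1)[OF o(2)]]) (use v pF pG in auto)
  note NF = next_level[OF l o(1)] and NG = next_level[OF l o(2)]
  note uS = SF(2-4)[OF u, of "Suc n"] and uT = TF(2-4)[OF u, of "Suc n"]
  note e = SD(1-3)[OF p(1)[OF o(2)], of n] and d = TD(1-3)[OF p(1)[OF o(2)], of n]
  have "\<epsilon> n (k ?G) (p ?G) \<cdot> Sa (Suc n) u \<cdot> next_level n \<psi> ?F = \<psi> (Dom E (k ?G)) \<cdot> \<delta> n (k ?G) (p ?G) \<cdot> Ta (Suc n) u"
    by (rule level_transport[OF l p(1)[OF o(1)] p(1)[OF o(2)] a(1-3) v(1-3) u])
      (use pF pG v a NF in auto)
  also have "\<dots> = (\<psi> (Dom E (k ?G)) \<cdot> \<delta> n (k ?G) (p ?G)) \<cdot> Ta (Suc n) u"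
    using d uT pG(6) levelD(1-3)[OF l, of "Dom E (k ?G)"] pG(2) by simp
  also have "\<dots> = \<epsilon> n (k ?G) (p ?G) \<cdot> next_level n \<psi> ?G \<cdot> Ta (Suc n) u"
    by (rule Comp_eq_extend[OF NG(4), symmetric]) (use NG e uT pG(6) in auto)
  finally have eq: "\<epsilon> n (k ?G) (p ?G) \<cdot> Sa (Suc n) u \<cdot> next_level n \<psi> ?F =
    \<epsilon> n (k ?G) (p ?G) \<cdot> next_level n \<psi> ?G \<cdot> Ta (Suc n) u" .
  show "next_level n \<psi> ?G \<cdot> Ta (Suc n) u = Sa (Suc n) u \<cdot> next_level n \<psi> ?F"
    by (rule is_monoD[OF eps_mono[OF p(1)[OF o(2)] o(2) refl, of n]])
      (use eq[symmetric] NF NG uS uT e pG(6) in auto)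
qed

text \<open>The recursion starts from the inverse of \<alpha>, so that the composite with \<alpha>
  is an identity in degree 0 and universality applies to it.\<close>

primrec psi :: "nat \<Rightarrow> 'p \<Rightarrow> 'm" where
  "psi 0 = (\<lambda>F. SOME b. b \<in> Hom A (FObj (T 0) F) (FObj (S 0) F) \<and>
      b \<cdot> component \<alpha> F = Ident A (FObj (S 0) F) \<and> component \<alpha> F \<cdot> b = Ident A (FObj (T 0) F))"
| "psi (Suc n) = next_level n (psi n)"

lemma psi_0:
  assumes "F \<in> Obj E"
  shows "psi 0 F \<in> Arr A" "Dom A (psi 0 F) = FObj (T 0) F" "Cod A (psi 0 F) = FObj (S 0) F"
    "psi 0 F \<cdot> component \<alpha> F = Ident A (FObj (S 0) F)"
    "component \<alpha> F \<cdot> psi 0 F = Ident A (FObj (T 0) F)"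
  using someI_ex[OF \<alpha>_iso[OF assms]] by (auto simp: in_Hom)

lemma alphaD:
  "\<alpha> \<in> Arr W.K" "Dom W.K \<alpha> = S 0" "Cod W.K \<alpha> = T 0"
  using \<alpha> by (auto simp: in_Hom)

lemma level_psi: "level n (psi n)"
proof (induction n)
  case 0
  show ?case unfolding level_def
  proof (intro conjI ballI)
    fix F assume "F \<in> Obj E" then show "psi 0 F \<in> Hom A (FObj (T 0) F) (FObj (S 0) F)"
      using psi_0 by (auto simp: in_Hom)
  next
    fix u assume u: "u \<in> Arr E"
    have o: "Dom E u \<in> Obj E" "Cod E u \<in> Obj E" using u by auto
    note P = psi_0[OF o(1)] and Q = psi_0[OF o(2)] and aD = W.K_arrD[OF alphaD(1), unfolded alphaD]
    note uS = SF(2-4)[OF u, of 0] and uT = TF(2-4)[OF u, of 0]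
    note aF = aD(3-5)[OF o(1)] and aG = aD(3-5)[OF o(2)]
    have "Ta 0 u = Ta 0 u \<cdot> component \<alpha> (Dom E u) \<cdot> psi 0 (Dom E u)" using P(5) uT by simp
    also have "\<dots> = component \<alpha> (Cod E u) \<cdot> Sa 0 u \<cdot> psi 0 (Dom E u)"
      by (rule square_extend[OF aD(6)[OF u, symmetric]]) (use uS uT P aF aG in auto)
    finally have "psi 0 (Cod E u) \<cdot> Ta 0 u = psi 0 (Cod E u) \<cdot> component \<alpha> (Cod E u) \<cdot> Sa 0 u \<cdot> psi 0 (Dom E u)"
      by simp
    also have "\<dots> = Ident A (FObj (S 0) (Cod E u)) \<cdot> Sa 0 u \<cdot> psi 0 (Dom E u)"
      by (rule Comp_eq_extend[OF Q(4)]) (use uS uT P(1-3) Q(1-3) aF aG in auto)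
    finally show "psi 0 (Cod E u) \<cdot> Ta 0 u = Sa 0 u \<cdot> psi 0 (Dom E u)" using uS P by simp
  qed
next
  case (Suc n)
  then show ?case using level_next by simp
qed

lemma psi_compatible:
  "short_exact E f g \<Longrightarrow> \<epsilon> n f g \<cdot> psi (Suc n) (Cod E g) = psi n (Dom E f) \<cdot> \<delta> n f g"
  using next_level_compatible[OF level_psi] by simp

theorem isomorphic_satellites:
  assumes F: "F \<in> Obj E"
  shows "isomorphic A (FObj (S n) F) (FObj (T n) F)"
proof -
  have univ: "homological_partial_functor E A R \<rho> \<Longrightarrow> \<beta> \<in> Hom (functor_category E A) (R 0) (T 0) \<Longrightarrow>
        \<exists>!\<phi>. partial_functor_morphism E A R \<rho> T \<delta> \<phi> \<and> \<phi> 0 = \<beta>" for R \<rho> \<beta>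
    using T unfolding universal_homological_partial_functor_def by blast
  from univ[OF S \<alpha>] obtain \<phi> where \<phi>: "partial_functor_morphism E A S \<epsilon> T \<delta> \<phi>" "\<phi> 0 = \<alpha>" by blast
  have \<phi>K: "\<phi> n \<in> Arr W.K" "Dom W.K (\<phi> n) = S n" "Cod W.K (\<phi> n) = T n" for n
    using \<phi>(1) by (auto simp: partial_functor_morphism_def in_Hom)
  have \<phi>c: "\<delta> n f g \<cdot> component (\<phi> (Suc n)) (Cod E g) = component (\<phi> n) (Dom E f) \<cdot> \<epsilon> n f g"
    if "short_exact E f g" for f g n
    using \<phi>(1) that by (auto simp: partial_functor_morphism_def)
  note \<phi>D = W.K_arrD[OF \<phi>K(1), unfolded \<phi>K]
  have l: "F \<in> Obj E \<Longrightarrow> psi n F \<in> Arr A" "F \<in> Obj E \<Longrightarrow> Dom A (psi n F) = FObj (T n) F"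
    "F \<in> Obj E \<Longrightarrow> Cod A (psi n F) = FObj (S n) F"
    "u \<in> Arr E \<Longrightarrow> psi n (Cod E u) \<cdot> Ta n u = Sa n u \<cdot> psi n (Dom E u)" for n u F
    by (rule levelD[OF level_psi]; assumption)+
  have fT: "is_functor E A (T n)" for n by (rule homological_partial_functorD(1)[OF T'])
  \<comment> \<open>The composite of \<open>psi\<close> with \<phi> is an endomorphism of the
    partial functor \<open>T\<close> that is the identity in degree 0; uniqueness in the universal
    property forces the identity in every degree.\<close>
  define \<chi> where "\<chi> n = (T n, \<lambda>F\<in>Obj E. component (\<phi> n) F \<cdot> psi n F, T n)" for n
  have \<chi>K: "\<chi> n \<in> Arr W.K" for n
    unfolding \<chi>_def
  proof (rule W.K_arrI[OF fT fT])
    fix u assume u: "u \<in> Arr E"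
    have o: "Dom E u \<in> Obj E" "Cod E u \<in> Obj E" using u by auto
    note uS = SF(2-4)[OF u, of n] and uT = TF(2-4)[OF u, of n]
    note X = l(1-3)[OF o(1), of n] l(1-3)[OF o(2), of n] \<phi>D(3-5)[OF o(1), of n] \<phi>D(3-5)[OF o(2), of n]
    have "component (\<phi> n) (Cod E u) \<cdot> psi n (Cod E u) \<cdot> Ta n u = component (\<phi> n) (Cod E u) \<cdot> Sa n u \<cdot> psi n (Dom E u)"
      using l(4)[OF u] by simp
    also have "\<dots> = Ta n u \<cdot> component (\<phi> n) (Dom E u) \<cdot> psi n (Dom E u)"
      by (rule square_extend[OF \<phi>D(6)[OF u]]) (use X uS uT in auto)
    finally show "(component (\<phi> n) (Cod E u) \<cdot> psi n (Cod E u)) \<cdot> Ta n u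
      = Ta n u \<cdot> component (\<phi> n) (Dom E u) \<cdot> psi n (Dom E u)" using X uS uT by simp
  qed (use l \<phi>D in auto)
  have \<chi>m: "partial_functor_morphism E A T \<delta> T \<delta> \<chi>"
    unfolding partial_functor_morphism_def
  proof (intro conjI allI impI)
    fix n show "\<chi> n \<in> Hom W.K (T n) (T n)" using \<chi>K by (simp add: in_Hom) (simp add: \<chi>_def)
  next
    fix f g n assume fg: "short_exact E f g"
    note s = sesD[OF fg] and e = SD(1-3)[OF fg, of n] and d = TD(1-3)[OF fg, of n]
    have o: "Dom E f \<in> Obj E" "Cod E g \<in> Obj E" using s by auto
    note X = l(1-3)[OF o(1), of n] l(1-3)[OF o(2), of "Suc n"] \<phi>D(3-5)[OF o(1), of n] \<phi>D(3-5)[OF o(2), of "Suc n"]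
    have "\<delta> n f g \<cdot> component (\<phi> (Suc n)) (Cod E g) \<cdot> psi (Suc n) (Cod E g)
      = component (\<phi> n) (Dom E f) \<cdot> \<epsilon> n f g \<cdot> psi (Suc n) (Cod E g)"
      by (rule square_extend[OF \<phi>c[OF fg]]) (use X e d in auto)
    also have "\<dots> = component (\<phi> n) (Dom E f) \<cdot> psi n (Dom E f) \<cdot> \<delta> n f g"
      using psi_compatible[OF fg] by simp
    also have "\<dots> = (component (\<phi> n) (Dom E f) \<cdot> psi n (Dom E f)) \<cdot> \<delta> n f g" using X d by simp
    finally show "\<delta> n f g \<cdot> component (\<chi> (Suc n)) (Cod E g) = component (\<chi> n) (Dom E f) \<cdot> \<delta> n f g"
      using o by (simp add: \<chi>_def del: psi.simps)
  qed
  have \<iota>m: "partial_functor_morphism E A T \<delta> T \<delta> (\<lambda>n. Ident W.K (T n))"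
    unfolding partial_functor_morphism_def
  proof (intro conjI allI impI)
    fix n show "Ident W.K (T n) \<in> Hom W.K (T n) (T n)" using W.Ident_K[OF fT] by (simp add: in_Hom)
  next
    fix f g n assume fg: "short_exact E f g"
    note s = sesD[OF fg] and d = TD(1-3)[OF fg, of n]
    have o: "Dom E f \<in> Obj E" "Cod E g \<in> Obj E" using s by auto
    show "\<delta> n f g \<cdot> component (Ident W.K (T (Suc n))) (Cod E g) = component (Ident W.K (T n)) (Dom E f) \<cdot> \<delta> n f g"
      using d W.Ident_K(4)[OF fT o(1)] W.Ident_K(4)[OF fT o(2)] by simp
  qed
  have "\<chi> 0 = Ident W.K (T 0)"
    by (rule W.K_arr_eqI[OF \<chi>K]) (use W.Ident_K[OF fT[of 0]] psi_0 \<phi>(2) in \<open>auto simp: \<chi>_def simp del: psi.simps\<close>)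
  moreover have "Ident W.K (T 0) \<in> Hom W.K (T 0) (T 0)" using W.Ident_K[OF fT] by (simp add: in_Hom)
  ultimately have "\<chi> = (\<lambda>n. Ident W.K (T n))" using univ[OF T', of "Ident W.K (T 0)"] \<chi>m \<iota>m by blast
  then have "component (\<chi> n) F = Ident A (FObj (T n) F)" if "F \<in> Obj E" for n F
    using W.Ident_K(4)[OF fT that, of n] by simp
  then have 1: "component (\<phi> n) F \<cdot> psi n F = Ident A (FObj (T n) F)" if "F \<in> Obj E" for n F
    using that by (simp add: \<chi>_def)
  \<comment> \<open>The universal property of \<open>T\<close> does not control endomorphisms of
    \<open>S\<close>. Here the identity propagates upwards in the degree by cancelling the
    monomorphic \<epsilon> of the canonical sequence.\<close>
  have 2: "psi n F \<cdot> component (\<phi> n) F = Ident A (FObj (S n) F)" if "F \<in> Obj E" for n F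
    using that
  proof (induction n arbitrary: F)
    case 0 then show ?case using psi_0(4) \<phi>(2) by simp
  next
    case (Suc n)
    note pF = pses[OF Suc.prems] p(2)[OF Suc.prems]
    have o: "Dom E (k F) \<in> Obj E" using pF by simp
    note e = SD(1-3)[OF p(1)[OF Suc.prems], of n] and d = TD(1-3)[OF p(1)[OF Suc.prems], of n]
    note X = l(1-3)[OF Suc.prems, of "Suc n"] \<phi>D(3-5)[OF Suc.prems, of "Suc n"] l(1-3)[OF o, of n] \<phi>D(3-5)[OF o, of n]
    let ?e = "\<epsilon> n (k F) (p F)"
    show ?case
    proof (rule is_monoD[OF eps_mono[OF p(1)[OF Suc.prems] Suc.prems refl, of n]])
      have "?e \<cdot> psi (Suc n) F \<cdot> component (\<phi> (Suc n)) F = psi n (Dom E (k F)) \<cdot> \<delta> n (k F) (p F) \<cdot> component (\<phi> (Suc n)) F"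
        by (rule square_extend[OF psi_compatible[OF p(1)[OF Suc.prems], unfolded pF]])
          (use X e d pF(6) in \<open>auto simp del: psi.simps\<close>)
      also have "\<dots> = psi n (Dom E (k F)) \<cdot> component (\<phi> n) (Dom E (k F)) \<cdot> ?e"
        using \<phi>c[OF p(1)[OF Suc.prems], of n] pF(6) by simp
      also have "\<dots> = Ident A (FObj (S n) (Dom E (k F))) \<cdot> ?e"
        by (rule Comp_eq_extend[OF Suc.IH[OF o]]) (use X e d in auto)
      finally show "?e \<cdot> psi (Suc n) F \<cdot> component (\<phi> (Suc n)) F = ?e \<cdot> Ident A (FObj (S (Suc n)) F)"
        using e pF(6) by simp
    qed (use X e pF(6) SF(1)[OF Suc.prems, of "Suc n"] in \<open>auto simp del: psi.simps\<close>)
  qed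
  show ?thesis
    unfolding isomorphic_def
    by (rule bexI[of _ "component (\<phi> n) F"], rule bexI[of _ "psi n F"])
      (use 1[OF F, of n] 2[OF F, of n] l(1-3)[OF F, of n] \<phi>D(3-5)[OF F, of n] in \<open>auto simp: in_Hom\<close>)
qed

end

section \<open>Small coproducts and cubes\<close>

lemma small_subset_image:
  fixes U :: "'u itself" and T :: "'b set"
  assumes "inj_on f S" "f ` S \<subseteq> T" "small U T"
  shows "small U S"
proof -
  obtain g :: "'b \<Rightarrow> 'u" where "inj_on g T" using assms(3) unfolding small_def by blast
  then have "inj_on (g \<circ> f) S" using assms(1,2) by (meson comp_inj_on inj_on_subset)
  then show ?thesis unfolding small_def by blast
qed

lemma small_subset: "S \<subseteq> T \<Longrightarrow> small U T \<Longrightarrow> small U S"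
  by (rule small_subset_image[of id]) auto

text \<open>Rests on an infinite type being equipotent to its square.\<close>

lemma small_Times:
  fixes U :: "'u::infinite itself" and S :: "'a set" and T :: "'b set"
  assumes "small U S" "small U T"
  shows "small U (S \<times> T)"
proof -
  obtain f :: "'a \<Rightarrow> 'u" and g :: "'b \<Rightarrow> 'u" where fg: "inj_on f S" "inj_on g T" using assms unfolding small_def by blast
  have "(card_of (UNIV \<times> UNIV :: ('u \<times> 'u) set), card_of (UNIV :: 'u set)) \<in> ordIso"
    by (rule card_of_Times_same_infinite) (simp add: infinite_UNIV)
  then obtain h :: "'u \<times> 'u \<Rightarrow> 'u" where "bij_betw h (UNIV \<times> UNIV) UNIV"
    using card_of_ordIso by blast
  then have "inj h" by (simp add: bij_betw_def)
  then have "inj_on (\<lambda>(x, y). h (f x, g y)) (S \<times> T)"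
    using fg by (intro inj_onI) (auto dest!: injD simp: inj_on_eq_iff)
  then show ?thesis unfolding small_def by blast
qed

lemma small_nat:
  fixes U :: "'u::infinite itself" and S :: "nat set"
  shows "small U S"
proof -
  obtain f :: "nat \<Rightarrow> 'u" where "inj f"
    using infinite_UNIV infinite_iff_countable_subset[of "UNIV :: 'u set"] by auto
  then have "inj_on f S" by (rule inj_on_subset) simp
  then show ?thesis unfolding small_def by blast
qed

lemma small_lists:
  fixes U :: "'u::infinite itself"
  assumes "small U S"
  shows "small U {xs. length xs = n \<and> set xs \<subseteq> S}"
proof (induction n)
  case 0
  show ?case by (auto simp: small_def inj_on_def)
next
  case (Suc n)
  show ?case
  proof (rule small_subset_image[OF _ _ small_Times[OF assms Suc]])
    show "inj_on (\<lambda>xs. (hd xs, tl xs)) {xs. length xs = Suc n \<and> set xs \<subseteq> S}"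
    proof (rule inj_onI)
      fix xs ys assume "xs \<in> {xs. length xs = Suc n \<and> set xs \<subseteq> S}" "ys \<in> {xs. length xs = Suc n \<and> set xs \<subseteq> S}"
        "(hd xs, tl xs) = (hd ys, tl ys)"
      then show "xs = ys" by (cases xs; cases ys) auto
    qed
  qed (auto simp: length_Suc_conv)
qed

section \<open>Coproducts over small index sets\<close>

context category
begin

lemma coproductD:
  assumes "is_coproduct C I X P \<iota>"
  shows "P \<in> Obj C" "i \<in> I \<Longrightarrow> \<iota> i \<in> Arr C" "i \<in> I \<Longrightarrow> Dom C (\<iota> i) = X i" "i \<in> I \<Longrightarrow> Cod C (\<iota> i) = P"
    "i \<in> I \<Longrightarrow> X i \<in> Obj C"
  using assms by (auto simp: is_coproduct_def in_Hom)

lemma coproduct_desc: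
  assumes "is_coproduct C I X P \<iota>" "Y \<in> Obj C"
    "\<And>i. i \<in> I \<Longrightarrow> g i \<in> Arr C \<and> Dom C (g i) = X i \<and> Cod C (g i) = Y"
  obtains h where "h \<in> Arr C" "Dom C h = P" "Cod C h = Y" "\<And>i. i \<in> I \<Longrightarrow> h \<cdot> \<iota> i = g i"
proof -
  have "\<exists>!h. h \<in> Hom C P Y \<and> (\<forall>i\<in>I. h \<cdot> \<iota> i = g i)"
    using assms unfolding is_coproduct_def by (auto simp: in_Hom)
  then show ?thesis using that by (auto simp: in_Hom)
qed

lemma coproduct_ext:
  assumes c: "is_coproduct C I X P \<iota>" and h: "h \<in> Arr C" "h' \<in> Arr C" "Dom C h = P" "Dom C h' = P"
    "Cod C h = Cod C h'" and eq: "\<And>i. i \<in> I \<Longrightarrow> h \<cdot> \<iota> i = h' \<cdot> \<iota> i"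
  shows "h = h'"
proof -
  have t: "\<forall>i\<in>I. h \<cdot> \<iota> i \<in> Hom C (X i) (Cod C h')"
    using coproductD[OF c] h by (auto simp: in_Hom)
  have e: "\<exists>!k. k \<in> Hom C P Y \<and> (\<forall>i\<in>I. k \<cdot> \<iota> i = g i)"
    if "Y \<in> Obj C" "\<forall>i\<in>I. g i \<in> Hom C (X i) Y" for Y g
    using c that unfolding is_coproduct_def by blast
  have "\<exists>!k. k \<in> Hom C P (Cod C h') \<and> (\<forall>i\<in>I. k \<cdot> \<iota> i = h \<cdot> \<iota> i)"
    by (rule e[OF Cod_Obj[OF h(2)] t])
  moreover have "h \<in> Hom C P (Cod C h')" "h' \<in> Hom C P (Cod C h')" using h by (auto simp: in_Hom)
  ultimately show ?thesis using eq by metis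
qed

lemma coproductI:
  assumes "P \<in> Obj C" "\<And>i. i \<in> I \<Longrightarrow> \<iota> i \<in> Arr C \<and> Dom C (\<iota> i) = X i \<and> Cod C (\<iota> i) = P"
    "\<And>Y g. Y \<in> Obj C \<Longrightarrow> (\<And>i. i \<in> I \<Longrightarrow> g i \<in> Arr C \<and> Dom C (g i) = X i \<and> Cod C (g i) = Y) \<Longrightarrow>
      \<exists>h. h \<in> Arr C \<and> Dom C h = P \<and> Cod C h = Y \<and> (\<forall>i\<in>I. h \<cdot> \<iota> i = g i)"
    "\<And>h h'. h \<in> Arr C \<Longrightarrow> h' \<in> Arr C \<Longrightarrow> Dom C h = P \<Longrightarrow> Dom C h' = P \<Longrightarrow> Cod C h = Cod C h' \<Longrightarrow>
      (\<And>i. i \<in> I \<Longrightarrow> h \<cdot> \<iota> i = h' \<cdot> \<iota> i) \<Longrightarrow> h = h'"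
  shows "is_coproduct C I X P \<iota>"
  unfolding is_coproduct_def
proof (intro conjI ballI allI impI)
  fix Y g assume Y: "Y \<in> Obj C" "\<forall>i\<in>I. g i \<in> Hom C (X i) Y"
  obtain h where h: "h \<in> Arr C" "Dom C h = P" "Cod C h = Y" "\<forall>i\<in>I. h \<cdot> \<iota> i = g i"
    using assms(3)[OF Y(1), of g] Y(2) by (auto simp: in_Hom)
  show "\<exists>!h. h \<in> Hom C P Y \<and> (\<forall>i\<in>I. h \<cdot> \<iota> i = g i)"
  proof (rule ex1I[of _ h])
    fix h' assume h': "h' \<in> Hom C P Y \<and> (\<forall>i\<in>I. h' \<cdot> \<iota> i = g i)"
    show "h' = h" by (rule assms(4)) (use h h' in \<open>auto simp: in_Hom\<close>)
  qed (use h in \<open>auto simp: in_Hom\<close>)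
next
  fix i assume "i \<in> I"
  then show "X i \<in> Obj C" using assms(2)[of i] Dom_Obj[of "\<iota> i"] by simp
qed (use assms(1,2) in \<open>auto simp: in_Hom\<close>)

lemma coproduct_reindex:
  assumes c: "is_coproduct C I X P \<iota>" and h: "bij_betw h J I" and X: "\<And>j. j \<in> J \<Longrightarrow> Y j = X (h j)"
    and \<iota>: "\<And>j. j \<in> J \<Longrightarrow> \<kappa> j = \<iota> (h j)"
  shows "is_coproduct C J Y P \<kappa>"
proof (rule coproductI)
  have hI: "h j \<in> I" if "j \<in> J" for j using h that by (auto simp: bij_betw_def)
  have sur: "\<exists>j\<in>J. i = h j" if "i \<in> I" for i using h that by (auto simp: bij_betw_def)
  show "P \<in> Obj C" by (rule coproductD[OF c])
  show "\<kappa> j \<in> Arr C \<and> Dom C (\<kappa> j) = Y j \<and> Cod C (\<kappa> j) = P" if "j \<in> J" for j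
    using coproductD(2-4)[OF c hI[OF that]] X[OF that] \<iota>[OF that] by auto
  fix Z g assume Z: "Z \<in> Obj C" "\<And>j. j \<in> J \<Longrightarrow> g j \<in> Arr C \<and> Dom C (g j) = Y j \<and> Cod C (g j) = Z"
  have inv: "inv_into J h (h j) = j" if "j \<in> J" for j using h that by (auto simp: bij_betw_def)
  have "g (inv_into J h i) \<in> Arr C \<and> Dom C (g (inv_into J h i)) = X i \<and> Cod C (g (inv_into J h i)) = Z"
    if "i \<in> I" for i
    using sur[OF that] Z X inv by auto
  then obtain k where k: "k \<in> Arr C" "Dom C k = P" "Cod C k = Z" "\<And>i. i \<in> I \<Longrightarrow> k \<cdot> \<iota> i = g (inv_into J h i)"
    using coproduct_desc[OF c Z(1), of "\<lambda>i. g (inv_into J h i)"] by blast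
  then show "\<exists>k. k \<in> Arr C \<and> Dom C k = P \<and> Cod C k = Z \<and> (\<forall>j\<in>J. k \<cdot> \<kappa> j = g j)"
    using \<iota> hI inv by (intro exI[of _ k]) auto
next
  fix k k' assume k: "k \<in> Arr C" "k' \<in> Arr C" "Dom C k = P" "Dom C k' = P" "Cod C k = Cod C k'"
    "\<And>j. j \<in> J \<Longrightarrow> k \<cdot> \<kappa> j = k' \<cdot> \<kappa> j"
  show "k = k'"
  proof (rule coproduct_ext[OF c k(1-5)])
    fix i assume "i \<in> I"
    then obtain j where "j \<in> J" "i = h j" using h by (auto simp: bij_betw_def)
    then show "k \<cdot> \<iota> i = k' \<cdot> \<iota> i" using k(6) \<iota> by metis
  qed
qed

text \<open>Coproducts are given over subsets of the universe type; reindexing along an embedding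
  supplies one for every small index set, so the choice in \<open>coproduct\<close> is a genuine
  coproduct.\<close>

lemma small_coproduct:
  fixes U :: "'u itself"
  assumes "has_small_coproducts U C" "small U I" "\<And>i. i \<in> I \<Longrightarrow> X i \<in> Obj C"
  shows "is_coproduct C I X (coproduct_ob C I X) (coproduct_in C I X)"
proof -
  obtain f :: "_ \<Rightarrow> 'u" where f: "inj_on f I" using assms(2) unfolding small_def by blast
  have "\<forall>j\<in>f ` I. X (inv_into I f j) \<in> Obj C" using assms(3) f by auto
  then obtain P \<iota> where P: "is_coproduct C (f ` I) (\<lambda>j. X (inv_into I f j)) P \<iota>"
    using assms(1) unfolding has_small_coproducts_def by metis
  have "is_coproduct C I X P (\<lambda>i. \<iota> (f i))"
    by (rule coproduct_reindex[OF P, of f]) (use f in \<open>auto simp: bij_betw_def\<close>)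
  then have "\<exists>p. case p of (P, \<iota>) \<Rightarrow> is_coproduct C I X P \<iota>" by auto
  then have "case coproduct C I X of (P, \<iota>) \<Rightarrow> is_coproduct C I X P \<iota>"
    unfolding coproduct_def by (rule someI_ex)
  then show ?thesis by (simp add: coproduct_ob_def coproduct_in_def split: prod.splits)
qed

lemma cotuple:
  assumes "is_coproduct C I X (coproduct_ob C I X) (coproduct_in C I X)" "Y \<in> Obj C"
    "\<And>i. i \<in> I \<Longrightarrow> g i \<in> Arr C \<and> Dom C (g i) = X i \<and> Cod C (g i) = Y"
  shows "cotuple C I X Y g \<in> Arr C" "Dom C (cotuple C I X Y g) = coproduct_ob C I X"
    "Cod C (cotuple C I X Y g) = Y" "i \<in> I \<Longrightarrow> cotuple C I X Y g \<cdot> coproduct_in C I X i = g i"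
proof -
  have "\<exists>!h. h \<in> Hom C (coproduct_ob C I X) Y \<and> (\<forall>i\<in>I. h \<cdot> coproduct_in C I X i = g i)"
    using assms unfolding is_coproduct_def by (auto simp: in_Hom)
  from theI'[OF this] show "cotuple C I X Y g \<in> Arr C" "Dom C (cotuple C I X Y g) = coproduct_ob C I X"
    "Cod C (cotuple C I X Y g) = Y" "i \<in> I \<Longrightarrow> cotuple C I X Y g \<cdot> coproduct_in C I X i = g i"
    unfolding cotuple_def by (auto simp: in_Hom)
qed

end

context preadditive_category
begin

notation comp (infixr "\<cdot>" 70)

text \<open>The exactness axiom speaks of index subsets of the universe type; the families are
  transported along an embedding of \<open>I\<close>.\<close>

lemma small_coproduct_short_exact:
  fixes U :: "'u itself"
  assumes U: "small_coproducts_exact U A" "small U I"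
    and fg: "\<And>i. i \<in> I \<Longrightarrow> short_exact A (f i) (g i)"
    and cop: "is_coproduct A I (\<lambda>i. Dom A (f i)) P \<iota>" "is_coproduct A I (\<lambda>i. Dom A (g i)) Q \<kappa>"
      "is_coproduct A I (\<lambda>i. Cod A (g i)) R \<mu>"
    and p: "p \<in> Hom A P Q" "\<And>i. i \<in> I \<Longrightarrow> p \<cdot> \<iota> i = \<kappa> i \<cdot> f i"
    and q: "q \<in> Hom A Q R" "\<And>i. i \<in> I \<Longrightarrow> q \<cdot> \<kappa> i = \<mu> i \<cdot> g i"
  shows "short_exact A p q"
proof -
  obtain h :: "_ \<Rightarrow> 'u" where h: "inj_on h I" using U(2) unfolding small_def by blast
  let ?r = "inv_into I h" let ?J = "h ` I"
  have b: "bij_betw ?r ?J I" using h by (simp add: bij_betw_inv_into inj_on_imp_bij_betw)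
  have rI: "?r j \<in> I" if "j \<in> ?J" for j using that by (rule inv_into_into)
  note re = coproduct_reindex[OF _ b refl refl]
  have "\<forall>j\<in>?J. f (?r j) \<in> Hom A (Dom A (f (?r j))) (Dom A (g (?r j))) \<and>
     g (?r j) \<in> Hom A (Dom A (g (?r j))) (Cod A (g (?r j))) \<and> short_exact A (f (?r j)) (g (?r j))"
    using fg[OF rI] is_kernelD unfolding short_exact_def in_Hom by blast
  then show ?thesis
    using U(1)[unfolded small_coproducts_exact_def, rule_format,
        of ?J "\<lambda>j. f (?r j)" "\<lambda>j. Dom A (f (?r j))" "\<lambda>j. Dom A (g (?r j))" "\<lambda>j. g (?r j)" "\<lambda>j. Cod A (g (?r j))"
          P "\<lambda>j. \<iota> (?r j)" Q "\<lambda>j. \<kappa> (?r j)" R "\<lambda>j. \<mu> (?r j)" p q]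
      re[OF cop(1)] re[OF cop(2)] re[OF cop(3)] p q rI by simp
qed

end

text \<open>This and \<open>del\<close> are the list operations behind \<open>face_map\<close> and
  \<open>degeneracy_map\<close>, with coordinates counted from 1 and without restriction to a cube,
  so that identities between them need only length assumptions.\<close>

definition ins :: "nat \<Rightarrow> bool \<Rightarrow> bool list \<Rightarrow> bool list" where
  "ins i \<epsilon> v = take (i - 1) v @ \<epsilon> # drop (i - 1) v"

definition del :: "nat \<Rightarrow> bool list \<Rightarrow> bool list" where
  "del i v = take (i - 1) v @ drop i v"

abbreviation le :: "bool list \<Rightarrow> bool list \<Rightarrow> bool" where
  "le \<equiv> list_all2 (\<le>)"

lemma le_refl [simp]: "le v v"
  by (simp add: list_all2_refl)

lemma le_trans: "le u v \<Longrightarrow> le v w \<Longrightarrow> le u w"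
  by (rule list_all2_trans[of "(\<le>)" "(\<le>)" "(\<le>)"]) auto

lemma length_ins: "i \<le> Suc (length v) \<Longrightarrow> length (ins i \<epsilon> v) = Suc (length v)"
  by (auto simp: ins_def)

lemma length_del: "1 \<le> i \<Longrightarrow> i \<le> length v \<Longrightarrow> length (del i v) = length v - 1"
  by (auto simp: del_def)

lemma nth_ins:
  assumes "1 \<le> i" "i \<le> Suc (length v)" "l \<le> length v"
  shows "ins i \<epsilon> v ! l = (if l < i - 1 then v ! l else if l = i - 1 then \<epsilon> else v ! (l - 1))"
  using assms by (auto simp: ins_def nth_append min_def nth_Cons')

lemma nth_del:
  assumes "1 \<le> i" "i \<le> length v" "l < length v - 1"
  shows "del i v ! l = (if l < i - 1 then v ! l else v ! Suc l)"
  using assms by (auto simp: del_def nth_append min_def One_nat_def)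

lemma ins_mono: "le v w \<Longrightarrow> le (ins i \<epsilon> v) (ins i \<epsilon> w)"
  by (auto simp: ins_def intro!: list_all2_appendI list_all2_takeI list_all2_dropI)

lemma del_mono: "le v w \<Longrightarrow> le (del i v) (del i w)"
  by (auto simp: del_def intro!: list_all2_appendI list_all2_takeI list_all2_dropI)

lemma del_ins_same: "1 \<le> i \<Longrightarrow> i \<le> Suc (length v) \<Longrightarrow> del i (ins i \<epsilon> v) = v"
  by (cases i) (auto simp: ins_def del_def)

text \<open>The cubical identities between insertion and deletion, and \<open>ins_ins\<close>
  between two insertions, are verified entry by entry; they govern faces of degenerate cubes and
  double faces.\<close>

lemma del_ins_less:
  assumes "1 \<le> i" "i < j" "j \<le> Suc (length v)"
  shows "del j (ins i \<epsilon> v) = ins i \<epsilon> (del (j - 1) v)"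
proof (rule nth_equalityI)
  show "length (del j (ins i \<epsilon> v)) = length (ins i \<epsilon> (del (j - 1) v))"
    using assms by (simp add: length_ins length_del)
  fix l assume "l < length (del j (ins i \<epsilon> v))"
  then have l: "l < length v" using assms by (simp add: length_ins length_del)
  then show "del j (ins i \<epsilon> v) ! l = ins i \<epsilon> (del (j - 1) v) ! l"
    using assms by (auto simp: nth_ins nth_del length_ins length_del)
qed

lemma del_ins_greater:
  assumes "1 \<le> j" "j < i" "i \<le> Suc (length v)"
  shows "del j (ins i \<epsilon> v) = ins (i - 1) \<epsilon> (del j v)"
proof (rule nth_equalityI)
  show "length (del j (ins i \<epsilon> v)) = length (ins (i - 1) \<epsilon> (del j v))"
    using assms by (simp add: length_ins length_del)
  fix l assume "l < length (del j (ins i \<epsilon> v))"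
  then have l: "l < length v" using assms by (simp add: length_ins length_del)
  then show "del j (ins i \<epsilon> v) ! l = ins (i - 1) \<epsilon> (del j v) ! l"
    using assms by (auto simp: nth_ins nth_del length_ins length_del)
qed

lemma ins_ins:
  assumes "1 \<le> j" "j < i" "i \<le> Suc (Suc (length v))"
  shows "ins i \<epsilon> (ins j \<eta> v) = ins j \<eta> (ins (i - 1) \<epsilon> v)"
proof (rule nth_equalityI)
  show "length (ins i \<epsilon> (ins j \<eta> v)) = length (ins j \<eta> (ins (i - 1) \<epsilon> v))"
    using assms by (simp add: length_ins)
  fix l assume "l < length (ins i \<epsilon> (ins j \<eta> v))"
  then have l: "l < Suc (Suc (length v))" using assms by (simp add: length_ins)
  obtain a b where "i = Suc (Suc a)" "j = Suc b"
    using assms by (cases i; cases "i - 1"; cases j) auto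
  then show "ins i \<epsilon> (ins j \<eta> v) ! l = ins j \<eta> (ins (i - 1) \<epsilon> v) ! l"
    using assms l by (cases l) (auto simp: nth_ins length_ins)
qed

lemma cube_simps [simp]: "v \<in> cube n \<longleftrightarrow> length v = n"
  by (simp add: cube_def)

lemma finite_cube: "finite (cube n)"
  using finite_lists_length_eq[of "UNIV :: bool set" n] by (simp add: cube_def)

lemma cube_poset_simps [simp]:
  "Obj (cube_poset n) = cube n"
  "(v, w) \<in> Arr (cube_poset n) \<longleftrightarrow> length v = n \<and> length w = n \<and> le v w"
  "Dom (cube_poset n) (v, w) = v" "Cod (cube_poset n) (v, w) = w"
  "Ident (cube_poset n) v = (v, v)"
  "Comp (cube_poset n) (v', w') (v, w) = (v, w')"
  by (auto simp: cube_poset_def)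

lemma length_top [simp]: "length (top_vertex n) = n"
  by (simp add: top_vertex_def)

lemma le_top [simp]: "length v = n \<Longrightarrow> le v (top_vertex n)"
  by (auto simp: list_all2_conv_all_nth top_vertex_def)

text \<open>A cube in a category can be pulled back along any monotone map. Working with all of
  these allows maps such as appending a coordinate, without deriving them from the generators of
  \<open>cube_maps\<close>.\<close>

definition mono_cube :: "nat \<Rightarrow> nat \<Rightarrow> (bool list \<Rightarrow> bool list) \<Rightarrow> bool" where
  "mono_cube m n \<phi> \<longleftrightarrow> (\<forall>v. length v = m \<longrightarrow> length (\<phi> v) = n) \<and>
     (\<forall>v w. length v = m \<longrightarrow> length w = m \<longrightarrow> le v w \<longrightarrow> le (\<phi> v) (\<phi> w))"

lemma mono_cubeD:
  assumes "mono_cube m n \<phi>"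
  shows "length v = m \<Longrightarrow> length (\<phi> v) = n"
    "length v = m \<Longrightarrow> length w = m \<Longrightarrow> le v w \<Longrightarrow> le (\<phi> v) (\<phi> w)"
  using assms by (auto simp: mono_cube_def)

lemma mono_cube_ins: "1 \<le> i \<Longrightarrow> i \<le> n \<Longrightarrow> mono_cube (n - 1) n (ins i \<epsilon>)"
  by (auto simp: mono_cube_def length_ins ins_mono)

lemma mono_cube_del: "1 \<le> i \<Longrightarrow> i \<le> n \<Longrightarrow> mono_cube n (n - 1) (del i)"
  by (auto simp: mono_cube_def length_del del_mono)

lemma mono_cube_comp: "mono_cube l m \<psi> \<Longrightarrow> mono_cube m n \<phi> \<Longrightarrow> mono_cube l n (\<lambda>v. \<phi> (\<psi> v))"
  by (auto simp: mono_cube_def)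

definition pull :: "nat \<Rightarrow> (bool list \<Rightarrow> bool list) \<Rightarrow> ('o, 'm) cube_diagram \<Rightarrow> ('o, 'm) cube_diagram" where
  "pull m \<phi> x = \<lparr>FObj = \<lambda>v\<in>cube m. FObj x (\<phi> v),
     FArr = \<lambda>(v, w)\<in>Arr (cube_poset m). FArr x (\<phi> v, \<phi> w)\<rparr>"

lemma pull_simps [simp]:
  "length v = m \<Longrightarrow> FObj (pull m \<phi> x) v = FObj x (\<phi> v)"
  "length v = m \<Longrightarrow> length w = m \<Longrightarrow> le v w \<Longrightarrow> FArr (pull m \<phi> x) (v, w) = FArr x (\<phi> v, \<phi> w)"
  by (auto simp: pull_def)

lemma pull_cong:
  assumes "\<And>v. length v = m \<Longrightarrow> \<phi> v = \<psi> v"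
  shows "pull m \<phi> x = pull m \<psi> x"
  using assms by (auto simp: pull_def fun_eq_iff restrict_def)

lemma pull_pull:
  assumes "mono_cube l m \<psi>"
  shows "pull l \<psi> (pull m \<phi> x) = pull l (\<lambda>v. \<phi> (\<psi> v)) x"
  using assms by (auto simp: pull_def mono_cube_def fun_eq_iff restrict_def)

section \<open>Cubes in a category\<close>

context category
begin

abbreviation cubes :: "nat \<Rightarrow> ('o, 'm) cube_diagram set" where
  "cubes n \<equiv> {x. is_functor (cube_poset n) C x}"

lemma cubesD:
  assumes "x \<in> cubes n"
  shows "length v = n \<Longrightarrow> FObj x v \<in> Obj C"
    "length v = n \<Longrightarrow> length w = n \<Longrightarrow> le v w \<Longrightarrow> FArr x (v, w) \<in> Arr C"
    "length v = n \<Longrightarrow> length w = n \<Longrightarrow> le v w \<Longrightarrow> Dom C (FArr x (v, w)) = FObj x v"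
    "length v = n \<Longrightarrow> length w = n \<Longrightarrow> le v w \<Longrightarrow> Cod C (FArr x (v, w)) = FObj x w"
    "length v = n \<Longrightarrow> FArr x (v, v) = Ident C (FObj x v)"
    "length u = n \<Longrightarrow> length v = n \<Longrightarrow> length w = n \<Longrightarrow> le u v \<Longrightarrow> le v w \<Longrightarrow>
       FArr x (v, w) \<cdot> FArr x (u, v) = FArr x (u, w)"
proof -
  have f: "is_functor (cube_poset n) C x" using assms by simp
  show "length v = n \<Longrightarrow> FObj x v \<in> Obj C" using f by (auto simp: is_functor_def)
  show "length v = n \<Longrightarrow> length w = n \<Longrightarrow> le v w \<Longrightarrow> FArr x (v, w) \<in> Arr C"
    "length v = n \<Longrightarrow> length w = n \<Longrightarrow> le v w \<Longrightarrow> Dom C (FArr x (v, w)) = FObj x v"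
    "length v = n \<Longrightarrow> length w = n \<Longrightarrow> le v w \<Longrightarrow> Cod C (FArr x (v, w)) = FObj x w"
    using f unfolding is_functor_def in_Hom by (metis cube_poset_simps(2-4))+
  show "length v = n \<Longrightarrow> FArr x (v, v) = Ident C (FObj x v)"
    using f unfolding is_functor_def by (metis cube_poset_simps(1,5) cube_simps)
  show "length u = n \<Longrightarrow> length v = n \<Longrightarrow> length w = n \<Longrightarrow> le u v \<Longrightarrow> le v w \<Longrightarrow>
       FArr x (v, w) \<cdot> FArr x (u, v) = FArr x (u, w)"
    using f unfolding is_functor_def by (metis cube_poset_simps(2-4,6))
qed

lemma cubesI:
  assumes "\<And>v. length v = n \<Longrightarrow> fo v \<in> Obj C"
    "\<And>v w. length v = n \<Longrightarrow> length w = n \<Longrightarrow> le v w \<Longrightarrow>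
       fa v w \<in> Arr C \<and> Dom C (fa v w) = fo v \<and> Cod C (fa v w) = fo w"
    "\<And>v. length v = n \<Longrightarrow> fa v v = Ident C (fo v)"
    "\<And>u v w. length u = n \<Longrightarrow> length v = n \<Longrightarrow> length w = n \<Longrightarrow> le u v \<Longrightarrow> le v w \<Longrightarrow>
       fa u w = fa v w \<cdot> fa u v"
  shows "\<lparr>FObj = \<lambda>v\<in>cube n. fo v, FArr = \<lambda>(v, w)\<in>Arr (cube_poset n). fa v w\<rparr> \<in> cubes n"
  unfolding mem_Collect_eq is_functor_def
proof (intro conjI ballI impI)
  fix a b assume a: "a \<in> Arr (cube_poset n)" and b: "b \<in> Arr (cube_poset n)"
    and ab: "Cod (cube_poset n) a = Dom (cube_poset n) b"
  obtain u v w z where [simp]: "a = (u, v)" "b = (w, z)" by (cases a; cases b)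
  show "FArr \<lparr>FObj = restrict fo (cube n), FArr = \<lambda>(v, w)\<in>Arr (cube_poset n). fa v w\<rparr> (Comp (cube_poset n) b a) =
    FArr \<lparr>FObj = restrict fo (cube n), FArr = \<lambda>(v, w)\<in>Arr (cube_poset n). fa v w\<rparr> b \<cdot>
    FArr \<lparr>FObj = restrict fo (cube n), FArr = \<lambda>(v, w)\<in>Arr (cube_poset n). fa v w\<rparr> a"
    using a b ab le_trans[of u v z] assms(4)[of u v z] by simp
next
  fix a assume "a \<in> Arr (cube_poset n)"
  then show "FArr \<lparr>FObj = restrict fo (cube n), FArr = \<lambda>(v, w)\<in>Arr (cube_poset n). fa v w\<rparr> a
    \<in> Hom C (FObj \<lparr>FObj = restrict fo (cube n), FArr = \<lambda>(v, w)\<in>Arr (cube_poset n). fa v w\<rparr> (Dom (cube_poset n) a))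
      (FObj \<lparr>FObj = restrict fo (cube n), FArr = \<lambda>(v, w)\<in>Arr (cube_poset n). fa v w\<rparr> (Cod (cube_poset n) a))"
    using assms(2) by (cases a) (simp add: in_Hom)
qed (use assms(1,3) in auto)

lemma cubes_eqI:
  assumes "x \<in> cubes n" "y \<in> cubes n" "\<And>v. length v = n \<Longrightarrow> FObj x v = FObj y v"
    "\<And>v w. length v = n \<Longrightarrow> length w = n \<Longrightarrow> le v w \<Longrightarrow> FArr x (v, w) = FArr y (v, w)"
  shows "x = y"
proof -
  have f: "is_functor (cube_poset n) C x" "is_functor (cube_poset n) C y" using assms by auto
  have "FObj x = FObj y"
    by (rule extensionalityI[of _ "cube n"]) (use f assms(3) in \<open>auto simp: is_functor_def PiE_def\<close>)
  moreover have "FArr x = FArr y"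
    by (rule extensionalityI[of _ "Arr (cube_poset n)"])
      (use f assms(4) in \<open>auto simp: is_functor_def PiE_def\<close>)
  ultimately show ?thesis by simp
qed

lemma pull_cubes:
  assumes "x \<in> cubes n" "mono_cube m n \<phi>"
  shows "pull m \<phi> x \<in> cubes m"
  unfolding pull_def
  by (rule cubesI) (use cubesD[OF assms(1)] mono_cubeD[OF assms(2)] in auto)

lemma pull_ident: "x \<in> cubes n \<Longrightarrow> (\<And>v. length v = n \<Longrightarrow> \<phi> v = v) \<Longrightarrow> pull n \<phi> x = x"
  by (rule cubes_eqI[OF pull_cubes]) (auto simp: mono_cube_def)

text \<open>A cube is determined by its finitely many arrows, so the cubes of a fixed dimension
  embed into lists of arrows of a fixed length.\<close>

lemma small_cubes:
  fixes U :: "'u::infinite itself"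
  assumes "small U (Arr C)"
  shows "small U (cubes n)"
proof -
  have "finite (cube n \<times> cube n)" using finite_cube by simp
  moreover have "Arr (cube_poset n) \<subseteq> cube n \<times> cube n" by (auto simp: cube_poset_def)
  ultimately obtain L where L: "set L = Arr (cube_poset n)" using finite_list finite_subset by metis
  show ?thesis
  proof (rule small_subset_image[OF _ _ small_lists[OF assms, of "length L"]])
    show "inj_on (\<lambda>x. map (FArr x) L) (cubes n)"
    proof (rule inj_onI)
      fix x y assume xy: "x \<in> cubes n" "y \<in> cubes n" "map (FArr x) L = map (FArr y) L"
      then have a: "FArr x (v, w) = FArr y (v, w)" if "length v = n" "length w = n" "le v w" for v w
        using L that by auto
      show "x = y"
      proof (rule cubes_eqI[OF xy(1,2)])
        \<comment> \<open>Vertices are recovered as domains of the arrows at the identity pairs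
          \<open>(v, v)\<close>.\<close>
        fix v :: "bool list" assume "length v = n"
        then show "FObj x v = FObj y v"
          using cubesD(3)[OF xy(1), of v v] cubesD(3)[OF xy(2), of v v] a by simp
      qed (use a in auto)
    qed
    show "(\<lambda>x. map (FArr x) L) ` cubes n \<subseteq> {xs. length xs = length L \<and> set xs \<subseteq> Arr C}"
      using L cubesD(2) by fastforce
  qed
qed

end

section \<open>Alternating sums\<close>

text \<open>The shape agrees with the sum in \<open>chain_differential\<close>, but over an
  arbitrary commutative group, so that homomorphisms can be applied to it.\<close>

definition alt :: "('a, 'b) monoid_scheme \<Rightarrow> (nat \<Rightarrow> bool \<Rightarrow> 'a) \<Rightarrow> nat \<Rightarrow> 'a" where
  "alt G a n = finprod G (\<lambda>i. (a i False \<otimes>\<^bsub>G\<^esub> inv\<^bsub>G\<^esub> a i True) [^]\<^bsub>G\<^esub> ((-1 :: int) ^ i)) {1..n}"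

lemma hom_finprod:
  assumes "comm_group G" "comm_group H" "h \<in> hom G H" "f \<in> A \<rightarrow> carrier G"
  shows "h (finprod G f A) = finprod H (\<lambda>x. h (f x)) A"
proof -
  interpret G: comm_group G by fact
  interpret H: comm_group H by fact
  interpret group_hom G H h by (simp add: group_hom_def group_hom_axioms_def G.group_axioms H.group_axioms assms)
  show ?thesis
    using assms(4)
  proof (induction A rule: infinite_finite_induct)
    case (insert x A)
    then have "f \<in> A \<rightarrow> carrier G" "f x \<in> carrier G" "(\<lambda>x. h (f x)) \<in> A \<rightarrow> carrier H" "h (f x) \<in> carrier H"
      by (auto simp: Pi_iff)
    then show ?case using insert by simp
  qed simp_all
qed

context comm_group
begin

lemma finprod_inv:
  assumes "f \<in> A \<rightarrow> carrier G"
  shows "inv (finprod G f A) = finprod G (\<lambda>x. inv (f x)) A"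
  by (rule hom_finprod[OF _ _ _ assms, where h = "\<lambda>x. inv x"])
    (simp_all add: comm_group_axioms hom_def inv_mult)

lemma finprod_pow:
  assumes "f \<in> A \<rightarrow> carrier G"
  shows "finprod G f A [^] (k :: int) = finprod G (\<lambda>x. f x [^] k) A"
  by (rule hom_finprod[OF _ _ _ assms, where h = "\<lambda>x. x [^] k"])
    (simp_all add: comm_group_axioms hom_def int_pow_distrib)

lemma finprod_cartesian:
  assumes "finite B" "finite A" "f \<in> A \<times> B \<rightarrow> carrier G"
  shows "finprod G (\<lambda>i. finprod G (\<lambda>j. f (i, j)) B) A = finprod G f (A \<times> B)"
  using assms(2,3)
proof (induction A rule: finite_induct)
  case (insert x A)
  have s: "insert x A \<times> B = Pair x ` B \<union> A \<times> B" by auto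
  have fc: "f \<in> A \<times> B \<rightarrow> carrier G" "(\<lambda>j. f (x, j)) \<in> B \<rightarrow> carrier G" "f \<in> Pair x ` B \<rightarrow> carrier G"
    using insert.prems by auto
  have "finprod G f (insert x A \<times> B) = finprod G f (Pair x ` B) \<otimes> finprod G f (A \<times> B)"
    unfolding s using insert.hyps assms(1) fc by (intro finprod_Un_disjoint) auto
  also have "finprod G f (Pair x ` B) = finprod G (\<lambda>j. f (x, j)) B"
    using fc by (intro finprod_reindex) (auto simp: inj_on_def)
  finally have "finprod G f (insert x A \<times> B) = finprod G (\<lambda>j. f (x, j)) B \<otimes> finprod G f (A \<times> B)" .
  moreover have "(\<lambda>i. finprod G (\<lambda>j. f (i, j)) B) \<in> A \<rightarrow> carrier G" using fc by (auto intro!: finprod_closed)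
  moreover have "finprod G (\<lambda>j. f (x, j)) B \<in> carrier G" using fc by (intro finprod_closed)
  ultimately show ?case using insert fc by simp
qed simp

lemma alt_terms:
  assumes "\<And>i \<epsilon>. i \<in> {1..n} \<Longrightarrow> a i \<epsilon> \<in> carrier G"
  shows "(\<lambda>i. (a i False \<otimes> inv a i True) [^] ((-1 :: int) ^ i)) \<in> {1..n} \<rightarrow> carrier G"
  using assms by auto

lemma alt_closed:
  assumes "\<And>i \<epsilon>. i \<in> {1..n} \<Longrightarrow> a i \<epsilon> \<in> carrier G"
  shows "alt G a n \<in> carrier G"
  unfolding alt_def using alt_terms[OF assms] by (rule finprod_closed)

lemma alt_one:
  assumes "\<And>i \<epsilon>. i \<in> {1..n} \<Longrightarrow> a i \<epsilon> \<in> carrier G" "\<And>i. i \<in> {1..n} \<Longrightarrow> a i False = a i True"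
  shows "alt G a n = \<one>"
  unfolding alt_def by (rule finprod_one_eqI) (use assms in auto)

lemma alt_0 [simp]: "alt G a 0 = \<one>"
  by (simp add: alt_def)

lemma alt_Suc:
  assumes "\<And>i \<epsilon>. i \<in> {1..Suc n} \<Longrightarrow> a i \<epsilon> \<in> carrier G"
  shows "alt G a (Suc n) = (a (Suc n) False \<otimes> inv a (Suc n) True) [^] ((-1 :: int) ^ Suc n) \<otimes> alt G a n"
proof -
  have "{1..Suc n} = insert (Suc n) {1..n}" by auto
  then show ?thesis
    unfolding alt_def using alt_terms[of n a] alt_terms[OF assms] assms
    by (simp del: power_Suc)
qed

lemma alt_cong:
  assumes "\<And>i \<epsilon>. i \<in> {1..n} \<Longrightarrow> a i \<epsilon> = b i \<epsilon>" "\<And>i \<epsilon>. i \<in> {1..n} \<Longrightarrow> b i \<epsilon> \<in> carrier G"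
  shows "alt G a n = alt G b n"
  unfolding alt_def by (rule finprod_cong') (use assms alt_terms[of n b] in auto)

text \<open>The combinatorial core of d d = 0: the index pairs with \<open>j < i\<close> are matched
  with the remaining ones by \<open>(i, j) \<mapsto> (j, i - 1)\<close>. By \<open>sym\<close> the
  terms correspond, and the sign is reversed.\<close>

lemma alt_alt:
  assumes b: "\<And>i \<epsilon> j \<eta>. i \<in> {1..Suc n} \<Longrightarrow> j \<in> {1..n} \<Longrightarrow> b i \<epsilon> j \<eta> \<in> carrier G"
    and sym: "\<And>i \<epsilon> j \<eta>. 1 \<le> j \<Longrightarrow> j < i \<Longrightarrow> i \<le> Suc n \<Longrightarrow> b i \<epsilon> j \<eta> = b j \<eta> (i - 1) \<epsilon>"
  shows "alt G (\<lambda>i \<epsilon>. alt G (b i \<epsilon>) n) (Suc n) = \<one>"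
proof -
  \<comment> \<open>The two alternating signs are merged into one exponent, so that each pair of
    indices contributes a single factor.\<close>
  let ?c = "\<lambda>(i, j). ((b i False j False \<otimes> inv b i False j True) \<otimes>
    inv (b i True j False \<otimes> inv b i True j True)) [^] ((-1 :: int) ^ j * (-1) ^ i)"
  have t: "(\<lambda>j. (b i \<epsilon> j False \<otimes> inv b i \<epsilon> j True) [^] ((-1 :: int) ^ j)) \<in> {1..n} \<rightarrow> carrier G"
    if "i \<in> {1..Suc n}" for i \<epsilon> by (rule alt_terms) (rule b[OF that])
  have cc: "?c \<in> {1..Suc n} \<times> {1..n} \<rightarrow> carrier G" using b by auto
  have row: "(alt G (b i False) n \<otimes> inv alt G (b i True) n) [^] ((-1 :: int) ^ i) =
    finprod G (\<lambda>j. ?c (i, j)) {1..n}" if i: "i \<in> {1..Suc n}" for i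
  proof -
    let ?f = "\<lambda>\<epsilon> j. (b i \<epsilon> j False \<otimes> inv b i \<epsilon> j True) [^] ((-1 :: int) ^ j)"
    have inv: "(\<lambda>j. inv (?f True j)) \<in> {1..n} \<rightarrow> carrier G" using b[OF i] by auto
    have "alt G (b i False) n \<otimes> inv alt G (b i True) n = finprod G (\<lambda>j. ?f False j \<otimes> inv (?f True j)) {1..n}"
      unfolding alt_def finprod_inv[OF t[OF i]] by (rule finprod_multf[symmetric, OF t[OF i] inv])
    moreover have "(\<lambda>j. ?f False j \<otimes> inv (?f True j)) \<in> {1..n} \<rightarrow> carrier G" using b[OF i] by auto
    ultimately have "(alt G (b i False) n \<otimes> inv alt G (b i True) n) [^] ((-1 :: int) ^ i) =
      finprod G (\<lambda>j. (?f False j \<otimes> inv (?f True j)) [^] ((-1 :: int) ^ i)) {1..n}"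
      by (simp add: finprod_pow)
    also have "\<dots> = finprod G (\<lambda>j. ?c (i, j)) {1..n}"
    proof (rule finprod_cong')
      fix j assume j: "j \<in> {1..n}"
      let ?x = "b i False j False \<otimes> inv b i False j True" and ?y = "b i True j False \<otimes> inv b i True j True"
      have xy: "?x \<in> carrier G" "?y \<in> carrier G" using b[OF i j] by auto
      then have "?x [^] ((-1 :: int) ^ j) \<otimes> inv (?y [^] ((-1 :: int) ^ j)) = (?x \<otimes> inv ?y) [^] ((-1 :: int) ^ j)"
        by (simp add: int_pow_distrib int_pow_inv)
      then show "(?f False j \<otimes> inv (?f True j)) [^] ((-1 :: int) ^ i) = ?c (i, j)"
        using xy by (simp add: int_pow_pow)
    qed (use b i in auto)
    finally show ?thesis .
  qed
  have "alt G (\<lambda>i \<epsilon>. alt G (b i \<epsilon>) n) (Suc n) = finprod G (\<lambda>i. finprod G (\<lambda>j. ?c (i, j)) {1..n}) {1..Suc n}"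
    unfolding alt_def[of G "\<lambda>i \<epsilon>. alt G (b i \<epsilon>) n"]
    by (rule finprod_cong'[OF refl _ row]) (use b in \<open>auto intro!: finprod_closed\<close>)
  also have "\<dots> = finprod G ?c ({1..Suc n} \<times> {1..n})"
    by (rule finprod_cartesian[OF _ _ cc]) auto
  finally have alt: "alt G (\<lambda>i \<epsilon>. alt G (b i \<epsilon>) n) (Suc n) = finprod G ?c ({1..Suc n} \<times> {1..n})" .
  let ?S = "{(i, j). 1 \<le> j \<and> j < i \<and> i \<le> Suc n}" let ?\<tau> = "\<lambda>(i, j). (j, i - 1)"
  have fin: "finite ?S" by (rule finite_subset[of _ "{1..Suc n} \<times> {1..n}"]) auto
  have split: "{1..Suc n} \<times> {1..n} = ?S \<union> ?\<tau> ` ?S"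
  proof (intro equalityI subsetI)
    fix p assume p: "p \<in> {1..Suc n} \<times> {1..n}"
    obtain i j where ij: "p = (i, j)" by (cases p)
    show "p \<in> ?S \<union> ?\<tau> ` ?S"
    proof (cases "j < i")
      case False
      then have "(Suc j, i) \<in> ?S" "p = ?\<tau> (Suc j, i)" using p ij by auto
      then show ?thesis by blast
    qed (use p ij in auto)
  qed auto
  have disj: "?S \<inter> ?\<tau> ` ?S = {}" by auto
  have inj: "inj_on ?\<tau> ?S" by (auto simp: inj_on_def)
  have cS: "?c \<in> ?S \<rightarrow> carrier G" "?c \<in> ?\<tau> ` ?S \<rightarrow> carrier G" using cc split by auto
  have "finprod G ?c (?\<tau> ` ?S) = finprod G (\<lambda>p. ?c (?\<tau> p)) ?S"
    by (rule finprod_reindex[OF cS(2) inj])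
  also have "\<dots> = finprod G (\<lambda>p. inv (?c p)) ?S"
  proof (rule finprod_cong')
    fix p assume "p \<in> ?S"
    then obtain i j where ij: "p = (i, j)" "1 \<le> j" "j < i" "i \<le> Suc n" by auto
    obtain i' where i': "i = Suc i'" using ij by (cases i) auto
    have s: "b j \<eta> i' \<epsilon> = b i \<epsilon> j \<eta>" for \<epsilon> \<eta> using sym[OF ij(2-4)] i' by simp
    let ?x = "b i False j False" and ?y = "b i False j True" and ?z = "b i True j False" and ?w = "b i True j True"
    have c: "?x \<in> carrier G" "?y \<in> carrier G" "?z \<in> carrier G" "?w \<in> carrier G" using b ij by auto
    have "(?x \<otimes> inv ?z) \<otimes> inv (?y \<otimes> inv ?w) = (?x \<otimes> inv ?y) \<otimes> inv (?z \<otimes> inv ?w)"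
      using c by (simp add: inv_mult m_ac)
    \<comment> \<open>Lowering \<open>i\<close> by one changes the parity of the exponent; this is
      the whole cancellation.\<close>
    moreover have "(-1 :: int) ^ i' * (-1) ^ j = - ((-1) ^ j * (-1) ^ i)" using i' by simp
    ultimately show "?c (?\<tau> p) = inv (?c p)"
      using c ij i' s by (simp add: int_pow_neg del: power_Suc)
  qed (use b in auto)
  also have "\<dots> = inv (finprod G ?c ?S)" by (rule finprod_inv[OF cS(1), symmetric])
  finally have "finprod G ?c (?\<tau> ` ?S) = inv (finprod G ?c ?S)" .
  moreover have "finprod G ?c (?S \<union> ?\<tau> ` ?S) = finprod G ?c ?S \<otimes> finprod G ?c (?\<tau> ` ?S)"
    by (rule finprod_Un_disjoint[OF fin _ disj cS]) (use fin in auto)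
  ultimately show ?thesis
    unfolding alt split using finprod_closed[OF cS(1)] by simp
qed

end

text \<open>Used for composition with a fixed arrow on either side, which is a homomorphism between
  hom groups.\<close>

lemma hom_alt:
  assumes G: "comm_group G" and H: "comm_group H" and h: "h \<in> hom G H"
    and a: "\<And>i \<epsilon>. i \<in> {1..n} \<Longrightarrow> a i \<epsilon> \<in> carrier G"
  shows "h (alt G a n) = alt H (\<lambda>i \<epsilon>. h (a i \<epsilon>)) n"
proof -
  interpret G: comm_group G by fact
  interpret H: comm_group H by fact
  interpret group_hom G H h by (simp add: group_hom_def group_hom_axioms_def G.group_axioms H.group_axioms h)
  have "h (alt G a n) = finprod H (\<lambda>i. h ((a i False \<otimes>\<^bsub>G\<^esub> inv\<^bsub>G\<^esub> a i True) [^]\<^bsub>G\<^esub> ((-1 :: int) ^ i))) {1..n}"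
    unfolding alt_def by (rule hom_finprod[OF G H h G.alt_terms[OF a]])
  also have "\<dots> = alt H (\<lambda>i \<epsilon>. h (a i \<epsilon>)) n"
    unfolding alt_def
    by (rule H.finprod_cong') (use a in \<open>auto simp: hom_int_pow\<close>)
  finally show ?thesis .
qed

context preadditive_category
begin

abbreviation asum :: "'o \<Rightarrow> 'o \<Rightarrow> (nat \<Rightarrow> bool \<Rightarrow> 'm) \<Rightarrow> nat \<Rightarrow> 'm" where
  "asum x y \<equiv> alt (hom_group A x y)"

lemma Comp_asum_left:
  assumes "u \<in> Arr A" "x \<in> Obj A" "Dom A u = y" "Cod A u = z"
    "\<And>i \<epsilon>. i \<in> {1..n} \<Longrightarrow> a i \<epsilon> \<in> Hom A x y"
  shows "u \<cdot> asum x y a n = asum x z (\<lambda>i \<epsilon>. u \<cdot> a i \<epsilon>) n"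
proof (rule hom_alt)
  have o: "y \<in> Obj A" "z \<in> Obj A" using assms by auto
  show "comm_group (hom_group A x y)" "comm_group (hom_group A x z)" using hom_comm_group assms(2) o by auto
  show "(\<cdot>) u \<in> hom (hom_group A x y) (hom_group A x z)"
    using assms by (auto simp: hom_def in_Hom)
qed (use assms in auto)

lemma Comp_asum_right:
  assumes "u \<in> Arr A" "z \<in> Obj A" "Cod A u = y" "Dom A u = x"
    "\<And>i \<epsilon>. i \<in> {1..n} \<Longrightarrow> a i \<epsilon> \<in> Hom A y z"
  shows "asum y z a n \<cdot> u = asum x z (\<lambda>i \<epsilon>. a i \<epsilon> \<cdot> u) n"
proof (rule hom_alt[where h = "\<lambda>f. f \<cdot> u"])
  have o: "y \<in> Obj A" "x \<in> Obj A" using assms by auto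
  show "comm_group (hom_group A y z)" "comm_group (hom_group A x z)" using hom_comm_group assms(2) o by auto
  show "(\<lambda>f. f \<cdot> u) \<in> hom (hom_group A y z) (hom_group A x z)"
    using assms by (auto simp: hom_def in_Hom)
qed (use assms in auto)

lemma asum_arr:
  assumes "x \<in> Obj A" "y \<in> Obj A" "\<And>i \<epsilon>. i \<in> {1..n} \<Longrightarrow> a i \<epsilon> \<in> Hom A x y"
  shows "asum x y a n \<in> Arr A" "Dom A (asum x y a n) = x" "Cod A (asum x y a n) = y"
proof -
  interpret comm_group "hom_group A x y" using hom_comm_group assms by simp
  have "asum x y a n \<in> Hom A x y" using alt_closed[of n a] assms by simp
  then show "asum x y a n \<in> Arr A" "Dom A (asum x y a n) = x" "Cod A (asum x y a n) = y"
    by (auto simp: in_Hom)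
qed

lemma asum_Zro:
  assumes "x \<in> Obj A" "y \<in> Obj A" "\<And>i \<epsilon>. i \<in> {1..n} \<Longrightarrow> a i \<epsilon> \<in> Hom A x y"
    "\<And>i. i \<in> {1..n} \<Longrightarrow> a i False = a i True"
  shows "asum x y a n = Zro A x y"
proof -
  interpret comm_group "hom_group A x y" using hom_comm_group assms by simp
  show ?thesis using alt_one[of n a] assms(3,4) by simp
qed

lemma asum_cong:
  assumes "x \<in> Obj A" "y \<in> Obj A" "\<And>i \<epsilon>. i \<in> {1..n} \<Longrightarrow> a i \<epsilon> = b i \<epsilon>"
    "\<And>i \<epsilon>. i \<in> {1..n} \<Longrightarrow> b i \<epsilon> \<in> Hom A x y"
  shows "asum x y a n = asum x y b n"
proof -
  interpret comm_group "hom_group A x y" using hom_comm_group assms by simp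
  show ?thesis using alt_cong[of n a b] assms(3,4) by simp
qed

lemma asum_asum:
  assumes "x \<in> Obj A" "y \<in> Obj A"
    "\<And>i \<epsilon> j \<eta>. i \<in> {1..Suc n} \<Longrightarrow> j \<in> {1..n} \<Longrightarrow> b i \<epsilon> j \<eta> \<in> Hom A x y"
    "\<And>i \<epsilon> j \<eta>. 1 \<le> j \<Longrightarrow> j < i \<Longrightarrow> i \<le> Suc n \<Longrightarrow> b i \<epsilon> j \<eta> = b j \<eta> (i - 1) \<epsilon>"
  shows "asum x y (\<lambda>i \<epsilon>. asum x y (b i \<epsilon>) n) (Suc n) = Zro A x y"
proof -
  interpret comm_group "hom_group A x y" using hom_comm_group assms by simp
  show ?thesis using alt_alt[of n b] assms(3,4) by simp
qed

end

section \<open>Normalized cubical chains\<close>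

lemma category_op:
  assumes "category C" shows "category (op_cat C)"
proof -
  interpret category C by fact
  show ?thesis
    by unfold_locales (auto simp: op_cat_def in_Hom)
qed

lemma op_cat_simps [simp]:
  "Obj (op_cat C) = Obj C" "Arr (op_cat C) = Arr C" "Dom (op_cat C) = Cod C" "Cod (op_cat C) = Dom C"
  "Ident (op_cat C) = Ident C" "Comp (op_cat C) g f = Comp C f g"
  by (simp_all add: op_cat_def)

lemma face_map_eq: "face_map k i \<epsilon> = (k - 1, \<lambda>x\<in>cube (k - 1). ins i \<epsilon> x, k)"
  by (simp add: face_map_def ins_def)

lemma degeneracy_map_eq: "degeneracy_map k i = (k, \<lambda>x\<in>cube k. del i x, k - 1)"
  by (simp add: degeneracy_map_def del_def)

lemma face_map_in: "1 \<le> i \<Longrightarrow> i \<le> k \<Longrightarrow> (k - 1, \<lambda>x\<in>cube (k - 1). ins i \<epsilon> x, k) \<in> cube_maps"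
  using cube_maps.face[of i k \<epsilon>] by (simp add: face_map_eq)

lemma degeneracy_map_in: "1 \<le> i \<Longrightarrow> i \<le> k \<Longrightarrow> (k, \<lambda>x\<in>cube k. del i x, k - 1) \<in> cube_maps"
  using cube_maps.degeneracy[of i k] by (simp add: degeneracy_map_eq)

lemma cube_category_simps [simp]:
  "Arr cube_category = cube_maps" "Dom cube_category (m, f, n) = m" "Cod cube_category (m, f, n) = n"
  by (simp_all add: cube_category_def)

lemma del_top: "1 \<le> i \<Longrightarrow> i \<le> n \<Longrightarrow> del i (top_vertex n) = top_vertex (n - 1)"
  by (auto simp: del_def top_vertex_def simp flip: replicate_add)

context category
begin

lemma cells_nerve [simp]: "cells (cubical_nerve C) n = cubes n"
  by (simp add: cubical_nerve_def Let_def)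

lemma act_nerve:
  assumes "(m, \<lambda>v\<in>cube m. \<phi> v, n) \<in> cube_maps" "mono_cube m n \<phi>" "x \<in> cubes n"
  shows "act (cubical_nerve C) (m, \<lambda>v\<in>cube m. \<phi> v, n) x = pull m \<phi> x"
proof -
  have "act (cubical_nerve C) (m, \<lambda>v\<in>cube m. \<phi> v, n) x =
    functor_comp (cube_poset m) x (cube_functor (m, \<lambda>v\<in>cube m. \<phi> v, n))"
    using assms by (simp add: act_def cubical_nerve_def Let_def)
  also have "\<dots> = pull m \<phi> x"
    by (auto simp: functor_comp_def cube_functor_def pull_def fun_eq_iff restrict_def)
  finally show ?thesis .
qed

end

locale cubical_coefficients = C: category C + abelian_category A
  for C :: "('c, 'e) cat" and A :: "('o, 'm) abcat" and U :: "'u::infinite itself" +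
  assumes small_Arr: "small U (Arr C)" and coproducts: "has_small_coproducts U A"
    and coproducts_exact: "small_coproducts_exact U A"
begin

no_notation C.comp (infixr "\<cdot>" 70)
notation comp (infixr "\<cdot>" 70)

sublocale D: category "op_cat C" by (rule category_op) (rule C.category_axioms)

sublocale functors_into_abelian "op_cat C" A ..

abbreviation "X \<equiv> cubical_nerve C"

abbreviation GF :: "('c, 'e, 'o, 'm) cfunctor \<Rightarrow> (nat \<times> ('c, 'e) cube_diagram, (nat \<times> ('c, 'e) cube_diagram, cube_map) arrow, 'o, 'm) cfunctor" where
  "GF F \<equiv> functor_comp (op_cat (cubes_over X)) F (boundary_functor C)"

abbreviation vt :: "('c, 'e, 'o, 'm) cfunctor \<Rightarrow> nat \<Rightarrow> ('c, 'e) cube_diagram \<Rightarrow> 'o" where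
  "vt F n x \<equiv> FObj F (FObj x (top_vertex n))"

text \<open>For a cube map \<phi> this is the value of \<open>GF F\<close> on the arrow over \<phi>
  (\<open>GF_arrow_over\<close>); it makes sense for every monotone \<phi>, so composites need no
  membership proof.\<close>

abbreviation wt :: "('c, 'e, 'o, 'm) cfunctor \<Rightarrow> nat \<Rightarrow> (bool list \<Rightarrow> bool list) \<Rightarrow> nat \<Rightarrow> ('c, 'e) cube_diagram \<Rightarrow> 'm" where
  "wt F m \<phi> n x \<equiv> FArr F (FArr x (\<phi> (top_vertex m), top_vertex n))"

lemma contraD:
  assumes "is_functor (op_cat C) A F"
  shows "c \<in> Obj C \<Longrightarrow> FObj F c \<in> Obj A"
    "e \<in> Arr C \<Longrightarrow> FArr F e \<in> Arr A"
    "e \<in> Arr C \<Longrightarrow> Dom A (FArr F e) = FObj F (Cod C e)"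
    "e \<in> Arr C \<Longrightarrow> Cod A (FArr F e) = FObj F (Dom C e)"
    "c \<in> Obj C \<Longrightarrow> FArr F (Ident C c) = Ident A (FObj F c)"
    "e \<in> Arr C \<Longrightarrow> e' \<in> Arr C \<Longrightarrow> Cod C e = Dom C e' \<Longrightarrow>
       FArr F (Comp C e' e) = FArr F e \<cdot> FArr F e'"
  using functorD[OF assms] by simp_all

lemma GF_Obj:
  assumes "x \<in> C.cubes n"
  shows "FObj (GF F) (n, x) = vt F n x"
  using assms by (simp add: functor_comp_def boundary_functor_def cubes_over_def)

lemma GF_arrow_over:
  assumes "(m, \<lambda>v\<in>cube m. \<phi> v, n) \<in> cube_maps" "mono_cube m n \<phi>" "x \<in> C.cubes n"
  shows "FArr (GF F) (arrow_over X (m, \<lambda>v\<in>cube m. \<phi> v, n) x) = wt F m \<phi> n x"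
proof -
  have "pull m \<phi> x \<in> C.cubes m" by (rule C.pull_cubes[OF assms(3,2)])
  then have "((m, pull m \<phi> x), (m, \<lambda>v\<in>cube m. \<phi> v, n), (n, x)) \<in> Arr (cubes_over X)"
    using assms C.act_nerve[OF assms] by (auto simp: cubes_over_def in_Hom)
  then show ?thesis
    using C.act_nerve[OF assms] by (simp add: functor_comp_def arrow_over_def boundary_functor_def)
qed

lemma top_arrow:
  assumes "x \<in> C.cubes n" "mono_cube m n \<phi>"
  shows "FArr x (\<phi> (top_vertex m), top_vertex n) \<in> Arr C"
    "Dom C (FArr x (\<phi> (top_vertex m), top_vertex n)) = FObj (pull m \<phi> x) (top_vertex m)"
    "Cod C (FArr x (\<phi> (top_vertex m), top_vertex n)) = FObj x (top_vertex n)"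
  using C.cubesD[OF assms(1)] mono_cubeD(1)[OF assms(2), of "top_vertex m"] by auto

lemma wt_arr:
  assumes "is_functor (op_cat C) A F" "x \<in> C.cubes n" "mono_cube m n \<phi>"
  shows "wt F m \<phi> n x \<in> Arr A" "Dom A (wt F m \<phi> n x) = vt F n x"
    "Cod A (wt F m \<phi> n x) = vt F m (pull m \<phi> x)"
  using contraD[OF assms(1)] top_arrow[OF assms(2,3)] by auto

text \<open>The arrow of \<open>x\<close> into its top vertex factors through the image of the top
  vertex under \<phi>, and \<open>F\<close> reverses this factorization.\<close>

lemma wt_comp:
  assumes F: "is_functor (op_cat C) A F" and x: "x \<in> C.cubes n" and \<phi>: "mono_cube m n \<phi>" and \<psi>: "mono_cube l m \<psi>"
  shows "wt F l \<psi> m (pull m \<phi> x) \<cdot> wt F m \<phi> n x = wt F l (\<lambda>v. \<phi> (\<psi> v)) n x"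
proof -
  let ?u = "FArr (pull m \<phi> x) (\<psi> (top_vertex l), top_vertex m)" and ?v = "FArr x (\<phi> (top_vertex m), top_vertex n)"
  have l: "length (\<psi> (top_vertex l)) = m" "length (\<phi> (\<psi> (top_vertex l))) = n" "length (\<phi> (top_vertex m)) = n"
    using mono_cubeD(1)[OF \<phi>] mono_cubeD(1)[OF \<psi>] by auto
  have le: "le (\<phi> (\<psi> (top_vertex l))) (\<phi> (top_vertex m))" using mono_cubeD(2)[OF \<phi>] l by simp
  have "Comp C ?v ?u = FArr x (\<phi> (\<psi> (top_vertex l)), top_vertex n)"
    using C.cubesD(6)[OF x l(2,3) length_top le] l by simp
  then show ?thesis
    using contraD(6)[OF F, of ?u ?v] top_arrow[OF x \<phi>] top_arrow[OF C.pull_cubes[OF x \<phi>] \<psi>] by simp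
qed

lemma vt_Obj: "is_functor (op_cat C) A F \<Longrightarrow> x \<in> C.cubes n \<Longrightarrow> vt F n x \<in> Obj A"
  using contraD(1) C.cubesD(1) by simp

lemma chain_coproduct:
  assumes "is_functor (op_cat C) A F"
  shows "is_coproduct A (C.cubes n) (\<lambda>x. FObj (GF F) (n, x)) (chain_ob A X (GF F) n) (chain_in A X (GF F) n)"
  unfolding chain_ob_def chain_in_def C.cells_nerve
  by (rule small_coproduct[OF coproducts C.small_cubes[OF small_Arr]]) (use GF_Obj vt_Obj[OF assms] in simp)

lemma chain_in_arr:
  assumes "is_functor (op_cat C) A F" "x \<in> C.cubes n"
  shows "chain_in A X (GF F) n x \<in> Arr A" "Dom A (chain_in A X (GF F) n x) = vt F n x"
    "Cod A (chain_in A X (GF F) n x) = chain_ob A X (GF F) n"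
  using coproductD(2-4)[OF chain_coproduct[OF assms(1)] assms(2)] GF_Obj[OF assms(2)] by auto

lemma chain_ob_Obj: "is_functor (op_cat C) A F \<Longrightarrow> chain_ob A X (GF F) n \<in> Obj A"
  using coproductD(1)[OF chain_coproduct] .

lemma chain_map:
  assumes F: "is_functor (op_cat C) A F" and \<phi>: "(m, \<lambda>v\<in>cube m. \<phi> v, n) \<in> cube_maps" "mono_cube m n \<phi>"
  defines "h \<equiv> chain_map A X (GF F) (m, \<lambda>v\<in>cube m. \<phi> v, n)"
  shows "h \<in> Arr A" "Dom A h = chain_ob A X (GF F) n" "Cod A h = chain_ob A X (GF F) m"
    "x \<in> C.cubes n \<Longrightarrow> h \<cdot> chain_in A X (GF F) n x = chain_in A X (GF F) m (pull m \<phi> x) \<cdot> wt F m \<phi> n x"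
proof -
  let ?g = "\<lambda>x. chain_in A X (GF F) m (act X (m, \<lambda>v\<in>cube m. \<phi> v, n) x) \<cdot>
    FArr (GF F) (arrow_over X (m, \<lambda>v\<in>cube m. \<phi> v, n) x)"
  have g: "?g x = chain_in A X (GF F) m (pull m \<phi> x) \<cdot> wt F m \<phi> n x" if "x \<in> C.cubes n" for x
    using C.act_nerve[OF \<phi> that] GF_arrow_over[OF \<phi> that] by simp
  have h: "h = cotuple A (C.cubes n) (\<lambda>x. FObj (GF F) (n, x)) (chain_ob A X (GF F) m) ?g"
    by (simp add: h_def chain_map_def)
  have cop: "is_coproduct A (C.cubes n) (\<lambda>x. FObj (GF F) (n, x)) (coproduct_ob A (C.cubes n) (\<lambda>x. FObj (GF F) (n, x)))
    (coproduct_in A (C.cubes n) (\<lambda>x. FObj (GF F) (n, x)))"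
    using chain_coproduct[OF F, of n] unfolding chain_ob_def chain_in_def C.cells_nerve .
  have ty: "?g x \<in> Arr A \<and> Dom A (?g x) = FObj (GF F) (n, x) \<and> Cod A (?g x) = chain_ob A X (GF F) m" if "x \<in> C.cubes n" for x
    using g[OF that] chain_in_arr[OF F C.pull_cubes[OF that \<phi>(2)]] wt_arr[OF F that \<phi>(2)] GF_Obj[OF that] by auto
  note c = cotuple[OF cop chain_ob_Obj[OF F] ty]
  show "h \<in> Arr A" "Dom A h = chain_ob A X (GF F) n" "Cod A h = chain_ob A X (GF F) m"
    unfolding h using c(1-3) by (auto simp: chain_ob_def)
  show "x \<in> C.cubes n \<Longrightarrow> h \<cdot> chain_in A X (GF F) n x = chain_in A X (GF F) m (pull m \<phi> x) \<cdot> wt F m \<phi> n x"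
    unfolding h using c(4) g by (simp add: chain_in_def)
qed

abbreviation Nob :: "('c, 'e, 'o, 'm) cfunctor \<Rightarrow> nat \<Rightarrow> 'o" where
  "Nob F n \<equiv> normalized_chain_ob A X (GF F) n"

definition normalized_in :: "('c, 'e, 'o, 'm) cfunctor \<Rightarrow> nat \<Rightarrow> ('c, 'e) cube_diagram \<Rightarrow> 'm" where
  "normalized_in F n x = normalization A X (GF F) n \<cdot> chain_in A X (GF F) n x"

definition degenerate :: "nat \<Rightarrow> ('c, 'e) cube_diagram set" where
  "degenerate n = (\<Union>i\<in>{1..n}. pull n (del i) ` C.cubes (n - 1))"

abbreviation nondegenerate :: "nat \<Rightarrow> ('c, 'e) cube_diagram set" where
  "nondegenerate n \<equiv> C.cubes n - degenerate n"

lemma degenerate_cubes: "x \<in> degenerate n \<Longrightarrow> x \<in> C.cubes n"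
  using C.pull_cubes mono_cube_del by (fastforce simp: degenerate_def)

lemma degenerateI: "y \<in> C.cubes (n - 1) \<Longrightarrow> 1 \<le> i \<Longrightarrow> i \<le> n \<Longrightarrow> pull n (del i) y \<in> degenerate n"
  by (auto simp: degenerate_def)

lemma wt_del:
  assumes "is_functor (op_cat C) A F" "y \<in> C.cubes (n - 1)" "1 \<le> i" "i \<le> n"
  shows "wt F n (del i) (n - 1) y = Ident A (vt F (n - 1) y)"
  using assms C.cubesD(1,5)[OF assms(2)] contraD(5)[OF assms(1)] by (simp add: del_top)

lemma chain_degeneracy:
  assumes F: "is_functor (op_cat C) A F" and i: "1 \<le> i" "i \<le> n"
  shows "chain_degeneracy A X (GF F) n i \<in> Arr A"
    "Dom A (chain_degeneracy A X (GF F) n i) = chain_ob A X (GF F) (n - 1)"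
    "Cod A (chain_degeneracy A X (GF F) n i) = chain_ob A X (GF F) n"
    "y \<in> C.cubes (n - 1) \<Longrightarrow> chain_degeneracy A X (GF F) n i \<cdot> chain_in A X (GF F) (n - 1) y =
       chain_in A X (GF F) n (pull n (del i) y)"
proof -
  note m = mono_cube_del[OF i] and c = degeneracy_map_in[OF i]
  note h = chain_map[OF F c m]
  show "chain_degeneracy A X (GF F) n i \<in> Arr A"
    "Dom A (chain_degeneracy A X (GF F) n i) = chain_ob A X (GF F) (n - 1)"
    "Cod A (chain_degeneracy A X (GF F) n i) = chain_ob A X (GF F) n"
    using h(1-3) by (auto simp: chain_degeneracy_def degeneracy_map_eq)
  assume y: "y \<in> C.cubes (n - 1)"
  have "vt F n (pull n (del i) y) = vt F (n - 1) y" using del_top[OF i] by simp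
  then show "chain_degeneracy A X (GF F) n i \<cdot> chain_in A X (GF F) (n - 1) y =
       chain_in A X (GF F) n (pull n (del i) y)"
    using h(4)[OF y] wt_del[OF F y i] chain_in_arr[OF F C.pull_cubes[OF y m]]
    by (simp add: chain_degeneracy_def degeneracy_map_eq)
qed

section \<open>The normalized complex of a coefficient functor\<close>

context
  fixes F assumes F: "is_functor (op_cat C) A F"
begin

text \<open>A degeneracy carries the summand of \<open>y\<close> identically onto the summand of a
  degenerate cube. The last claim is therefore the universal property of the cokernel, tested on the
  summands of degenerate cubes only.\<close>

lemma normalization:
  "is_epi A (normalization A X (GF F) n)" "normalization A X (GF F) n \<in> Arr A"
  "Dom A (normalization A X (GF F) n) = chain_ob A X (GF F) n"
  "Cod A (normalization A X (GF F) n) = Nob F n"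
  "y \<in> C.cubes (n - 1) \<Longrightarrow> 1 \<le> i \<Longrightarrow> i \<le> n \<Longrightarrow> normalized_in F n (pull n (del i) y) = Zro A (vt F (n - 1) y) (Nob F n)"
  "\<lbrakk>h \<in> Arr A; Dom A h = chain_ob A X (GF F) n;
    \<And>i y. 1 \<le> i \<Longrightarrow> i \<le> n \<Longrightarrow> y \<in> C.cubes (n - 1) \<Longrightarrow>
      h \<cdot> chain_in A X (GF F) n (pull n (del i) y) = Zro A (vt F (n - 1) y) (Cod A h)\<rbrakk> \<Longrightarrow>
    \<exists>h'. h' \<in> Arr A \<and> Dom A h' = Nob F n \<and> Cod A h' = Cod A h \<and> h' \<cdot> normalization A X (GF F) n = h"
proof -
  let ?q = "normalization A X (GF F) n" and ?ch = "chain_ob A X (GF F)" and ?s = "chain_degeneracy A X (GF F) n"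
  let ?c = "cotuple A {1..n} (\<lambda>_. ?ch (n - 1)) (?ch n) ?s"
  let ?I = "coproduct_in A {1..n} (\<lambda>_. ?ch (n - 1))"
  have cop: "is_coproduct A {1..n} (\<lambda>_. ?ch (n - 1)) (coproduct_ob A {1..n} (\<lambda>_. ?ch (n - 1))) ?I"
    by (rule small_coproduct[OF coproducts small_nat]) (rule chain_ob_Obj[OF F])
  have s: "i \<in> {1..n} \<Longrightarrow> ?s i \<in> Arr A \<and> Dom A (?s i) = ?ch (n - 1) \<and> Cod A (?s i) = ?ch n" for i
    using chain_degeneracy[OF F, of i n] by simp
  note c = cotuple[where g = ?s, OF cop chain_ob_Obj[OF F] s]
  have q: "is_cokernel A ?c ?q" unfolding normalization_def by (rule coker_cokernel[OF c(1)])
  note qD = is_cokernelD[OF q]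
  show "is_epi A ?q" by (rule cokernel_epi[OF q])
  show qa: "?q \<in> Arr A" "Dom A ?q = ?ch n" "Cod A ?q = Nob F n"
    using qD c by (auto simp: normalized_chain_ob_def)
  show "normalized_in F n (pull n (del i) y) = Zro A (vt F (n - 1) y) (Nob F n)"
    if y: "y \<in> C.cubes (n - 1)" and i: "1 \<le> i" "i \<le> n" for i y
  proof -
    have i': "i \<in> {1..n}" using i by simp
    note I = coproductD(2-4)[OF cop i'] and d = chain_degeneracy[OF F i] and yi = chain_in_arr[OF F y]
    have "?c \<cdot> ?I i = ?s i" by (rule c(4)[OF _ i'])
    then have "?q \<cdot> ?s i = ?q \<cdot> ?c \<cdot> ?I i" by simp
    also have "\<dots> = Zro A (Dom A ?c) (Cod A ?q) \<cdot> ?I i"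
      by (rule Comp_eq_extend[OF qD(4)]) (use c qa I in auto)
    also have "\<dots> = Zro A (?ch (n - 1)) (Nob F n)" using c qa I Cod_Obj[OF qa(1)] by simp
    finally have qs: "?q \<cdot> ?s i = Zro A (?ch (n - 1)) (Nob F n)" .
    have "normalized_in F n (pull n (del i) y) = ?q \<cdot> ?s i \<cdot> chain_in A X (GF F) (n - 1) y"
      using d(4)[OF y] by (simp add: normalized_in_def)
    also have "\<dots> = Zro A (?ch (n - 1)) (Nob F n) \<cdot> chain_in A X (GF F) (n - 1) y"
      by (rule Comp_eq_extend[OF qs]) (use d yi qa in auto)
    also have "\<dots> = Zro A (vt F (n - 1) y) (Nob F n)" using yi Cod_Obj[OF qa(1)] qa(3) by simp
    finally show ?thesis .
  qed
  assume h: "h \<in> Arr A" "Dom A h = ?ch n"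
    and hz: "\<And>i y. 1 \<le> i \<Longrightarrow> i \<le> n \<Longrightarrow> y \<in> C.cubes (n - 1) \<Longrightarrow>
      h \<cdot> chain_in A X (GF F) n (pull n (del i) y) = Zro A (vt F (n - 1) y) (Cod A h)"
  have "h \<cdot> ?c = Zro A (Dom A ?c) (Cod A h)"
  proof (rule coproduct_ext[OF cop])
    fix i assume i': "i \<in> {1..n}"
    then have i: "1 \<le> i" "i \<le> n" by auto
    note I = coproductD(2-4)[OF cop i'] and d = chain_degeneracy[OF F i]
    have "h \<cdot> ?s i = Zro A (?ch (n - 1)) (Cod A h)"
    proof (rule coproduct_ext[OF chain_coproduct[OF F, of "n - 1"]])
      fix y assume y: "y \<in> C.cubes (n - 1)"
      have "(h \<cdot> ?s i) \<cdot> chain_in A X (GF F) (n - 1) y = h \<cdot> chain_in A X (GF F) n (pull n (del i) y)"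
        using d h chain_in_arr[OF F y] y by simp
      then show "(h \<cdot> ?s i) \<cdot> chain_in A X (GF F) (n - 1) y =
        Zro A (?ch (n - 1)) (Cod A h) \<cdot> chain_in A X (GF F) (n - 1) y"
        using hz[OF i y] chain_in_arr[OF F y] h by simp
    qed (use d h chain_ob_Obj[OF F] in auto)
    then show "(h \<cdot> ?c) \<cdot> ?I i = Zro A (Dom A ?c) (Cod A h) \<cdot> ?I i"
      using c h I i' by simp
  qed (use c h coproductD(1)[OF cop] in auto)
  then show "\<exists>h'. h' \<in> Arr A \<and> Dom A h' = Nob F n \<and> Cod A h' = Cod A h \<and> h' \<cdot> ?q = h"
    using cokernel_lift[OF q, of h] h c qa by metis
qed

lemma Nob_Obj [simp]: "Nob F n \<in> Obj A"
  using normalization(2,4) Cod_Obj by metis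

lemma normalized_in_arr:
  assumes "x \<in> C.cubes n"
  shows "normalized_in F n x \<in> Arr A" "Dom A (normalized_in F n x) = vt F n x" "Cod A (normalized_in F n x) = Nob F n"
  using chain_in_arr[OF F assms] normalization(2-4)[of n] by (auto simp: normalized_in_def)

lemma normalized_in_degenerate:
  assumes "x \<in> degenerate n"
  shows "normalized_in F n x = Zro A (vt F n x) (Nob F n)"
proof -
  obtain i y where iy: "1 \<le> i" "i \<le> n" "y \<in> C.cubes (n - 1)" "x = pull n (del i) y"
    using assms by (auto simp: degenerate_def)
  then show ?thesis using normalization(5)[OF iy(3,1,2)] by (simp add: del_top)
qed

lemma normalized_coproduct: "is_coproduct A (nondegenerate n) (vt F n) (Nob F n) (normalized_in F n)"
proof (rule coproductI)
  note q = normalization(1-4)[of n] and cc = chain_coproduct[OF F, of n]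
  fix Y g assume Y: "Y \<in> Obj A" "\<And>x. x \<in> nondegenerate n \<Longrightarrow> g x \<in> Arr A \<and> Dom A (g x) = vt F n x \<and> Cod A (g x) = Y"
  \<comment> \<open>Extended by zero over the degenerate cubes, the family defines a morphism on all
    chains that kills the degeneracies and so factors through the quotient.\<close>
  let ?g = "\<lambda>x. if x \<in> degenerate n then Zro A (vt F n x) Y else g x"
  have g: "?g x \<in> Arr A \<and> Dom A (?g x) = FObj (GF F) (n, x) \<and> Cod A (?g x) = Y" if "x \<in> C.cubes n" for x
    using Y GF_Obj[OF that] vt_Obj[OF F that] that by simp
  obtain h where h: "h \<in> Arr A" "Dom A h = chain_ob A X (GF F) n" "Cod A h = Y"
    "\<And>x. x \<in> C.cubes n \<Longrightarrow> h \<cdot> chain_in A X (GF F) n x = ?g x"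
    using coproduct_desc[OF cc Y(1) g] by blast
  have "\<exists>h'. h' \<in> Arr A \<and> Dom A h' = Nob F n \<and> Cod A h' = Cod A h \<and> h' \<cdot> normalization A X (GF F) n = h"
  proof (rule normalization(6)[OF h(1,2)])
    fix i y assume i: "1 \<le> i" "i \<le> n" "y \<in> C.cubes (n - 1)"
    then have d: "pull n (del i) y \<in> degenerate n" using degenerateI by blast
    then show "h \<cdot> chain_in A X (GF F) n (pull n (del i) y) = Zro A (vt F (n - 1) y) (Cod A h)"
      using h(3) h(4)[OF degenerate_cubes[OF d]] i by (simp add: del_top)
  qed
  then obtain h' where h': "h' \<in> Arr A" "Dom A h' = Nob F n" "Cod A h' = Y" "h' \<cdot> normalization A X (GF F) n = h"
    using h(3) by blast
  have "h' \<cdot> normalized_in F n x = g x" if x: "x \<in> nondegenerate n" for x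
  proof -
    have xc: "x \<in> C.cubes n" using x by simp
    have "h' \<cdot> normalized_in F n x = h \<cdot> chain_in A X (GF F) n x"
      unfolding normalized_in_def by (rule Comp_eq_extend[OF h'(4)]) (use h' q chain_in_arr[OF F xc] in auto)
    then show ?thesis using h(4)[OF xc] x by simp
  qed
  then show "\<exists>h. h \<in> Arr A \<and> Dom A h = Nob F n \<and> Cod A h = Y \<and> (\<forall>x\<in>nondegenerate n. h \<cdot> normalized_in F n x = g x)"
    using h' by blast
next
  note q = normalization(1-4)[of n] and cc = chain_coproduct[OF F, of n]
  fix h h' assume h: "h \<in> Arr A" "h' \<in> Arr A" "Dom A h = Nob F n" "Dom A h' = Nob F n" "Cod A h = Cod A h'"
    and eq: "\<And>x. x \<in> nondegenerate n \<Longrightarrow> h \<cdot> normalized_in F n x = h' \<cdot> normalized_in F n x"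
  show "h = h'"
  proof (rule is_epiD[OF q(1)])
    show "h \<cdot> normalization A X (GF F) n = h' \<cdot> normalization A X (GF F) n"
    proof (rule coproduct_ext[OF cc])
      fix x assume x: "x \<in> C.cubes n"
      have "h \<cdot> normalized_in F n x = h' \<cdot> normalized_in F n x"
      proof (cases "x \<in> degenerate n")
        case True
        then show ?thesis using normalized_in_degenerate[OF True] h vt_Obj[OF F x] by simp
      qed (use eq x in auto)
      then show "(h \<cdot> normalization A X (GF F) n) \<cdot> chain_in A X (GF F) n x =
        (h' \<cdot> normalization A X (GF F) n) \<cdot> chain_in A X (GF F) n x"
        using h q chain_in_arr[OF F x] by (simp add: normalized_in_def)
    qed (use h q in auto)
  qed (use h q in auto)
qed (use normalized_in_arr in auto)

lemmas normalized_in_ext = coproduct_ext[OF normalized_coproduct]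

definition face :: "nat \<Rightarrow> ('c, 'e) cube_diagram \<Rightarrow> nat \<Rightarrow> bool \<Rightarrow> 'm" where
  "face n x i \<epsilon> = normalized_in F (n - 1) (pull (n - 1) (ins i \<epsilon>) x) \<cdot> wt F (n - 1) (ins i \<epsilon>) n x"

lemma face_arr:
  assumes "x \<in> C.cubes n" "i \<in> {1..n}"
  shows "face n x i \<epsilon> \<in> Arr A" "Dom A (face n x i \<epsilon>) = vt F n x" "Cod A (face n x i \<epsilon>) = Nob F (n - 1)"
proof -
  have m: "mono_cube (n - 1) n (ins i \<epsilon>)" using assms mono_cube_ins by simp
  show "face n x i \<epsilon> \<in> Arr A" "Dom A (face n x i \<epsilon>) = vt F n x" "Cod A (face n x i \<epsilon>) = Nob F (n - 1)"
    using normalized_in_arr[OF C.pull_cubes[OF assms(1) m]] wt_arr[OF F assms(1) m] by (auto simp: face_def)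
qed

text \<open>In the degenerate direction both faces are the underlying cube, with identity
  coefficient; in any other direction both are again degenerate and vanish in the quotient. Hence
  the alternating sum kills degenerate cubes and descends.\<close>

lemma face_degenerate:
  assumes "x \<in> degenerate n" "i \<in> {1..n}"
  shows "face n x i False = face n x i True"
proof -
  obtain j y where jy: "1 \<le> j" "j \<le> n" "y \<in> C.cubes (n - 1)" "x = pull n (del j) y"
    using assms by (auto simp: degenerate_def)
  have n: "1 \<le> n" "1 \<le> i" "i \<le> n" using jy assms by auto
  have x: "x \<in> C.cubes n" using degenerate_cubes[OF assms(1)] .
  have mi: "mono_cube (n - 1) n (ins i \<epsilon>)" for \<epsilon> using n mono_cube_ins by simp
  have md: "mono_cube n (n - 1) (del j)" using mono_cube_del jy by simp
  have pp: "pull (n - 1) (ins i \<epsilon>) x = pull (n - 1) (\<lambda>v. del j (ins i \<epsilon> v)) y" for \<epsilon>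
    unfolding jy(4) by (rule pull_pull[OF mi])
  show ?thesis
  proof (cases "i = j")
    case True
    have px: "pull (n - 1) (ins i \<epsilon>) x = y" for \<epsilon>
      unfolding pp by (rule C.pull_ident[OF jy(3)]) (use True n del_ins_same in simp)
    have "wt F (n - 1) (ins i \<epsilon>) n x = Ident A (vt F (n - 1) y)" for \<epsilon>
    proof -
      have "FArr x (ins i \<epsilon> (top_vertex (n - 1)), top_vertex n) =
        FArr y (del j (ins i \<epsilon> (top_vertex (n - 1))), del j (top_vertex n))"
        unfolding jy(4) using n by (intro pull_simps(2)) (auto simp: length_ins)
      also have "\<dots> = FArr y (top_vertex (n - 1), top_vertex (n - 1))"
        using True n del_ins_same[of j "top_vertex (n - 1)" \<epsilon>] del_top[OF jy(1,2)] by simp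
      also have "\<dots> = Ident C (FObj y (top_vertex (n - 1)))" using C.cubesD(5)[OF jy(3)] by simp
      finally show ?thesis using contraD(5)[OF F] C.cubesD(1)[OF jy(3)] by simp
    qed
    then show ?thesis by (simp add: face_def px)
  next
    case False
    have "pull (n - 1) (ins i \<epsilon>) x \<in> degenerate (n - 1)" for \<epsilon>
    proof -
      \<comment> \<open>The indices after interchanging deletion and insertion: the larger of the
        two drops by one.\<close>
      define i' where "i' = (if i < j then i else i - 1)"
      define j' where "j' = (if i < j then j - 1 else j)"
      have r: "1 \<le> i'" "i' \<le> n - 1" "1 \<le> j'" "j' \<le> n - 1"
        using False n jy by (auto simp: i'_def j'_def)
      have e: "del j (ins i \<epsilon> v) = ins i' \<epsilon> (del j' v)" if "length v = n - 1" for v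
        using False n jy that del_ins_less[of i j v \<epsilon>] del_ins_greater[of j i v \<epsilon>] by (auto simp: i'_def j'_def)
      have "pull (n - 1) (ins i \<epsilon>) x = pull (n - 1) (\<lambda>v. ins i' \<epsilon> (del j' v)) y"
        unfolding pp by (rule pull_cong) (use e in simp)
      also have "\<dots> = pull (n - 1) (del j') (pull (n - 1 - 1) (ins i' \<epsilon>) y)"
        by (rule pull_pull[symmetric]) (rule mono_cube_del[OF r(3,4)])
      also have "\<dots> \<in> degenerate (n - 1)"
        by (rule degenerateI[OF C.pull_cubes[OF jy(3) mono_cube_ins] r(3,4)]) (use r in auto)
      finally show ?thesis .
    qed
    then have "face n x i \<epsilon> = Zro A (vt F n x) (Nob F (n - 1))" for \<epsilon>
      using normalized_in_degenerate wt_arr[OF F x mi] by (simp add: face_def)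
    then show ?thesis by simp
  qed
qed

lemma chain_differential:
  shows "chain_differential A X (GF F) n \<in> Arr A"
    "Dom A (chain_differential A X (GF F) n) = chain_ob A X (GF F) n"
    "Cod A (chain_differential A X (GF F) n) = chain_ob A X (GF F) (n - 1)"
    "x \<in> C.cubes n \<Longrightarrow> normalization A X (GF F) (n - 1) \<cdot> chain_differential A X (GF F) n \<cdot> chain_in A X (GF F) n x =
      asum (vt F n x) (Nob F (n - 1)) (face n x) n"
proof -
  let ?ch = "chain_ob A X (GF F)" and ?f = "\<lambda>i \<epsilon>. chain_face A X (GF F) n i \<epsilon>"
  have m: "mono_cube (n - 1) n (ins i \<epsilon>)" if "i \<in> {1..n}" for i \<epsilon> using that mono_cube_ins by simp
  have fi: "(n - 1, \<lambda>x\<in>cube (n - 1). ins i \<epsilon> x, n) \<in> cube_maps" if "i \<in> {1..n}" for i \<epsilon>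
    using that face_map_in by simp
  note cf = chain_map[OF F fi m, folded face_map_eq, folded chain_face_def]
  have d: "chain_differential A X (GF F) n = asum (?ch n) (?ch (n - 1)) ?f n"
    by (simp add: chain_differential_def alt_def Let_def)
  have t: "?f i \<epsilon> \<in> Hom A (?ch n) (?ch (n - 1))" if "i \<in> {1..n}" for i \<epsilon>
    using cf[OF that that] by (simp add: in_Hom)
  show "chain_differential A X (GF F) n \<in> Arr A" "Dom A (chain_differential A X (GF F) n) = ?ch n"
    "Cod A (chain_differential A X (GF F) n) = ?ch (n - 1)"
    unfolding d using asum_arr[OF chain_ob_Obj[OF F] chain_ob_Obj[OF F] t] by auto
  assume x: "x \<in> C.cubes n"
  note xi = chain_in_arr[OF F x] and q = normalization(2-4)[of "n - 1"]
  have "chain_differential A X (GF F) n \<cdot> chain_in A X (GF F) n x =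
    asum (vt F n x) (?ch (n - 1)) (\<lambda>i \<epsilon>. ?f i \<epsilon> \<cdot> chain_in A X (GF F) n x) n"
    unfolding d by (rule Comp_asum_right) (use xi t chain_ob_Obj[OF F] in auto)
  then have "normalization A X (GF F) (n - 1) \<cdot> chain_differential A X (GF F) n \<cdot> chain_in A X (GF F) n x =
    normalization A X (GF F) (n - 1) \<cdot> asum (vt F n x) (?ch (n - 1)) (\<lambda>i \<epsilon>. ?f i \<epsilon> \<cdot> chain_in A X (GF F) n x) n"
    by simp
  also have "\<dots> = asum (vt F n x) (Nob F (n - 1)) (\<lambda>i \<epsilon>. normalization A X (GF F) (n - 1) \<cdot> ?f i \<epsilon> \<cdot> chain_in A X (GF F) n x) n"
    by (rule Comp_asum_left) (use vt_Obj[OF F x] q xi t in \<open>auto simp: in_Hom\<close>)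
  also have "\<dots> = asum (vt F n x) (Nob F (n - 1)) (face n x) n"
  proof (rule asum_cong)
    fix i \<epsilon> assume i: "i \<in> {1..n}"
    have "?f i \<epsilon> \<cdot> chain_in A X (GF F) n x = chain_in A X (GF F) (n - 1) (pull (n - 1) (ins i \<epsilon>) x) \<cdot> wt F (n - 1) (ins i \<epsilon>) n x"
      by (rule cf(4)[OF i i x])
    then show "normalization A X (GF F) (n - 1) \<cdot> ?f i \<epsilon> \<cdot> chain_in A X (GF F) n x = face n x i \<epsilon>"
      using q chain_in_arr[OF F C.pull_cubes[OF x m[OF i]]] wt_arr[OF F x m[OF i]] by (simp add: face_def normalized_in_def)
  qed (use vt_Obj[OF F x] face_arr[OF x] in \<open>auto simp: in_Hom\<close>)
  finally show "normalization A X (GF F) (n - 1) \<cdot> chain_differential A X (GF F) n \<cdot> chain_in A X (GF F) n x =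
      asum (vt F n x) (Nob F (n - 1)) (face n x) n" .
qed

abbreviation nd :: "nat \<Rightarrow> 'm" where
  "nd n \<equiv> normalized_differential A X (GF F) n"

text \<open>The alternating sum vanishes on degenerate cubes, which gives the induced arrow; the
  quotient map is an epimorphism, which gives the uniqueness behind
  \<open>normalized_differential\<close>.\<close>

lemma nd:
  "nd n \<in> Arr A" "Dom A (nd n) = Nob F n" "Cod A (nd n) = Nob F (n - 1)"
  "x \<in> C.cubes n \<Longrightarrow> nd n \<cdot> normalized_in F n x = asum (vt F n x) (Nob F (n - 1)) (face n x) n"
proof -
  let ?q = "normalization A X (GF F)" and ?d = "chain_differential A X (GF F) n"
  note d = chain_differential(1-3)[of n] chain_differential(4)[of _ n] and q = normalization(1-4)[of n] and q' = normalization(1-4)[of "n - 1"]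
  let ?h = "?q (n - 1) \<cdot> ?d"
  have h: "?h \<in> Arr A" "Dom A ?h = chain_ob A X (GF F) n" "Cod A ?h = Nob F (n - 1)" using d q' by auto
  have hx: "?h \<cdot> chain_in A X (GF F) n x = asum (vt F n x) (Nob F (n - 1)) (face n x) n" if "x \<in> C.cubes n" for x
    using d(1-3) d(4)[OF that] q' chain_in_arr[OF F that] by simp
  have "\<exists>h'. h' \<in> Arr A \<and> Dom A h' = Nob F n \<and> Cod A h' = Cod A ?h \<and> h' \<cdot> ?q n = ?h"
  proof (rule normalization(6)[OF h(1,2)])
    fix i y assume i: "1 \<le> i" "i \<le> n" "y \<in> C.cubes (n - 1)"
    then have dg: "pull n (del i) y \<in> degenerate n" using degenerateI by blast
    note x = degenerate_cubes[OF dg]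
    have "asum (vt F n (pull n (del i) y)) (Nob F (n - 1)) (face n (pull n (del i) y)) n =
      Zro A (vt F n (pull n (del i) y)) (Nob F (n - 1))"
      by (rule asum_Zro) (use vt_Obj[OF F x] face_arr[OF x] face_degenerate[OF dg] in \<open>auto simp: in_Hom\<close>)
    then show "?h \<cdot> chain_in A X (GF F) n (pull n (del i) y) = Zro A (vt F (n - 1) y) (Cod A ?h)"
      using hx[OF x] i h by (simp add: del_top)
  qed
  then obtain h' where h': "h' \<in> Hom A (Nob F n) (Nob F (n - 1))" "h' \<cdot> ?q n = ?h"
    using h by (auto simp: in_Hom)
  have "\<exists>!d. d \<in> Hom A (Nob F n) (Nob F (n - 1)) \<and> d \<cdot> ?q n = ?h"
  proof (rule ex1I[of _ h'])
    fix k assume k: "k \<in> Hom A (Nob F n) (Nob F (n - 1)) \<and> k \<cdot> ?q n = ?h"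
    show "k = h'" by (rule is_epiD[OF q(1)]) (use k h' q in \<open>auto simp: in_Hom\<close>)
  qed (use h' in auto)
  from theI'[OF this] have n: "nd n \<in> Hom A (Nob F n) (Nob F (n - 1))" "nd n \<cdot> ?q n = ?h"
    unfolding normalized_differential_def by auto
  then show na: "nd n \<in> Arr A" "Dom A (nd n) = Nob F n" "Cod A (nd n) = Nob F (n - 1)" by (auto simp: in_Hom)
  assume x: "x \<in> C.cubes n"
  have "nd n \<cdot> normalized_in F n x = ?h \<cdot> chain_in A X (GF F) n x"
    unfolding normalized_in_def by (rule Comp_eq_extend[OF n(2)]) (use na q chain_in_arr[OF F x] in auto)
  then show "nd n \<cdot> normalized_in F n x = asum (vt F n x) (Nob F (n - 1)) (face n x) n" using hx[OF x] by simp
qed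

text \<open>Applied to a face map \<phi>, this expresses the differential of a face by double faces
  of \<open>x\<close> itself, the form in which \<open>ins_ins\<close> matches them in
  pairs.\<close>

lemma nd_pull:
  assumes x: "x \<in> C.cubes n" and \<phi>: "mono_cube m n \<phi>"
  shows "nd m \<cdot> normalized_in F m (pull m \<phi> x) \<cdot> wt F m \<phi> n x = asum (vt F n x) (Nob F (m - 1))
    (\<lambda>j \<eta>. normalized_in F (m - 1) (pull (m - 1) (\<lambda>v. \<phi> (ins j \<eta> v)) x) \<cdot> wt F (m - 1) (\<lambda>v. \<phi> (ins j \<eta> v)) n x) m"
proof -
  let ?y = "pull m \<phi> x"
  have y: "?y \<in> C.cubes m" by (rule C.pull_cubes[OF x \<phi>])
  note w = wt_arr[OF F x \<phi>] and fy = face_arr[OF y]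
  have "nd m \<cdot> normalized_in F m ?y \<cdot> wt F m \<phi> n x = asum (vt F m ?y) (Nob F (m - 1)) (face m ?y) m \<cdot> wt F m \<phi> n x"
    by (rule Comp_eq_extend[OF nd(4)[OF y]]) (use nd(1-3) normalized_in_arr[OF y] w in auto)
  also have "\<dots> = asum (vt F n x) (Nob F (m - 1)) (\<lambda>j \<eta>. face m ?y j \<eta> \<cdot> wt F m \<phi> n x) m"
    by (rule Comp_asum_right) (use w fy in \<open>auto simp: in_Hom\<close>)
  also have "\<dots> = asum (vt F n x) (Nob F (m - 1))
    (\<lambda>j \<eta>. normalized_in F (m - 1) (pull (m - 1) (\<lambda>v. \<phi> (ins j \<eta> v)) x) \<cdot> wt F (m - 1) (\<lambda>v. \<phi> (ins j \<eta> v)) n x) m"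
  proof (rule asum_cong)
    fix j \<eta> assume j: "j \<in> {1..m}"
    have mj: "mono_cube (m - 1) m (ins j \<eta>)" using j mono_cube_ins by simp
    note wy = wt_arr[OF F y mj] and ky = normalized_in_arr[OF C.pull_cubes[OF y mj]]
    have "face m ?y j \<eta> \<cdot> wt F m \<phi> n x = normalized_in F (m - 1) (pull (m - 1) (ins j \<eta>) ?y) \<cdot> wt F (m - 1) (ins j \<eta>) m ?y \<cdot> wt F m \<phi> n x"
      unfolding face_def using wy ky w by simp
    also have "\<dots> = normalized_in F (m - 1) (pull (m - 1) (\<lambda>v. \<phi> (ins j \<eta> v)) x) \<cdot> wt F (m - 1) (\<lambda>v. \<phi> (ins j \<eta> v)) n x"
      unfolding wt_comp[OF F x \<phi> mj] pull_pull[OF mj] ..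
    finally show "face m ?y j \<eta> \<cdot> wt F m \<phi> n x = normalized_in F (m - 1) (pull (m - 1) (\<lambda>v. \<phi> (ins j \<eta> v)) x) \<cdot> wt F (m - 1) (\<lambda>v. \<phi> (ins j \<eta> v)) n x" .
    have mm: "mono_cube (m - 1) n (\<lambda>v. \<phi> (ins j \<eta> v))" by (rule mono_cube_comp[OF mj \<phi>])
    show "normalized_in F (m - 1) (pull (m - 1) (\<lambda>v. \<phi> (ins j \<eta> v)) x) \<cdot> wt F (m - 1) (\<lambda>v. \<phi> (ins j \<eta> v)) n x
      \<in> Hom A (vt F n x) (Nob F (m - 1))"
      using normalized_in_arr[OF C.pull_cubes[OF x mm]] wt_arr[OF F x mm] by (simp add: in_Hom)
  qed (use vt_Obj[OF F x] in auto)
  finally show ?thesis .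
qed

lemma nd_0: "nd 0 = Zro A (Nob F 0) (Nob F 0)"
proof (rule normalized_in_ext)
  fix x assume x: "x \<in> nondegenerate 0"
  interpret H: comm_group "hom_group A (vt F 0 x) (Nob F 0)"
    using hom_comm_group vt_Obj[OF F] x by simp
  show "nd 0 \<cdot> normalized_in F 0 x = Zro A (Nob F 0) (Nob F 0) \<cdot> normalized_in F 0 x"
    using nd(4)[of x 0] normalized_in_arr[of x 0] x H.alt_0 by simp
qed (use nd(1-3)[of 0] in auto)

lemma cplx_nd: "cplx nd"
  unfolding cplx_def
proof (intro conjI allI)
  fix n
  show "Cod A (nd n) = Dom A (nd (n - 1))" using nd by simp
  have "nd n \<cdot> nd (Suc n) = Zro A (Nob F (Suc n)) (Nob F (n - 1))"
  proof (rule normalized_in_ext)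
    fix x assume "x \<in> nondegenerate (Suc n)"
    then have x: "x \<in> C.cubes (Suc n)" by simp
    have m: "mono_cube n (Suc n) (ins i \<epsilon>)" if "i \<in> {1..Suc n}" for i \<epsilon>
      using mono_cube_ins[of i "Suc n" \<epsilon>] that by simp
    have m2: "mono_cube (n - 1) (Suc n) (\<lambda>v. ins i \<epsilon> (ins j \<eta> v))" if "i \<in> {1..Suc n}" "j \<in> {1..n}" for i \<epsilon> j \<eta>
      by (rule mono_cube_comp[OF mono_cube_ins m]) (use that in auto)
    let ?b = "\<lambda>i \<epsilon> j \<eta>. normalized_in F (n - 1) (pull (n - 1) (\<lambda>v. ins i \<epsilon> (ins j \<eta> v)) x) \<cdot> wt F (n - 1) (\<lambda>v. ins i \<epsilon> (ins j \<eta> v)) (Suc n) x"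
    have b: "?b i \<epsilon> j \<eta> \<in> Hom A (vt F (Suc n) x) (Nob F (n - 1))" if "i \<in> {1..Suc n}" "j \<in> {1..n}" for i \<epsilon> j \<eta>
      using normalized_in_arr[OF C.pull_cubes[OF x m2[OF that]]] wt_arr[OF F x m2[OF that]] by (simp add: in_Hom)
    have "(nd n \<cdot> nd (Suc n)) \<cdot> normalized_in F (Suc n) x = nd n \<cdot> asum (vt F (Suc n) x) (Nob F n) (face (Suc n) x) (Suc n)"
      using nd(1-3)[of n] nd(1-3)[of "Suc n"] nd(4)[OF x] normalized_in_arr[OF x] by simp
    also have "\<dots> = asum (vt F (Suc n) x) (Nob F (n - 1)) (\<lambda>i \<epsilon>. nd n \<cdot> face (Suc n) x i \<epsilon>) (Suc n)"
      by (rule Comp_asum_left) (use nd(1-3)[of n] vt_Obj[OF F x] face_arr[OF x] in \<open>auto simp: in_Hom\<close>)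
    also have "\<dots> = asum (vt F (Suc n) x) (Nob F (n - 1)) (\<lambda>i \<epsilon>. asum (vt F (Suc n) x) (Nob F (n - 1)) (?b i \<epsilon>) n) (Suc n)"
    proof (rule asum_cong)
      fix i \<epsilon> assume i: "i \<in> {1..Suc n}"
      show "nd n \<cdot> face (Suc n) x i \<epsilon> = asum (vt F (Suc n) x) (Nob F (n - 1)) (?b i \<epsilon>) n"
        using nd_pull[OF x m[OF i]] by (simp add: face_def)
      show "asum (vt F (Suc n) x) (Nob F (n - 1)) (?b i \<epsilon>) n \<in> Hom A (vt F (Suc n) x) (Nob F (n - 1))"
        using asum_arr[OF vt_Obj[OF F x] Nob_Obj b[OF i]] by (simp add: in_Hom)
    qed (use vt_Obj[OF F x] in auto)
    also have "\<dots> = Zro A (vt F (Suc n) x) (Nob F (n - 1))"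
    proof (rule asum_asum[OF vt_Obj[OF F x] Nob_Obj b])
      fix i \<epsilon> j \<eta> assume ij: "(1 :: nat) \<le> j" "j < i" "i \<le> Suc n"
      have e: "ins i \<epsilon> (ins j \<eta> v) = ins j \<eta> (ins (i - 1) \<epsilon> v)" if "length v = n - 1" for v
        using ins_ins[OF ij(1,2), of v] ij that by simp
      have p: "pull (n - 1) (\<lambda>v. ins i \<epsilon> (ins j \<eta> v)) x = pull (n - 1) (\<lambda>v. ins j \<eta> (ins (i - 1) \<epsilon> v)) x"
        by (rule pull_cong) (rule e)
      show "?b i \<epsilon> j \<eta> = ?b j \<eta> (i - 1) \<epsilon>" unfolding p e[OF length_top] ..
    qed
    finally show "(nd n \<cdot> nd (Suc n)) \<cdot> normalized_in F (Suc n) x = Zro A (Nob F (Suc n)) (Nob F (n - 1)) \<cdot> normalized_in F (Suc n) x"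
      using normalized_in_arr[OF x] by simp
  qed (use nd(1-3)[of n] nd(1-3)[of "Suc n"] in auto)
  then show "cyc (nd n) (nd (Suc n))" unfolding cyc_def using nd(1-3)[of n] nd(1-3)[of "Suc n"] by simp
next
  show "nd 0 = Zro A (Dom A (nd 0)) (Dom A (nd 0))" using nd_0 nd(2)[of 0] by simp
qed

end

end

section \<open>Cubical homology as a homological partial functor\<close>

context preadditive_category
begin

text \<open>The sign at index 1 is negative, which puts the \<open>True\<close> face first.\<close>

lemma asum_1:
  assumes "\<And>\<epsilon>. a 1 \<epsilon> \<in> Hom A x y"
  shows "asum x y a 1 = sub (a 1 True) (a 1 False)"
proof -
  let ?H = "hom_group A x y"
  have "x \<in> Obj A" "y \<in> Obj A" using assms[of True] by (auto simp: in_Hom)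
  then interpret H: comm_group ?H using hom_comm_group by simp
  have c: "a 1 \<epsilon> \<in> carrier ?H" for \<epsilon> using assms by simp
  have "asum x y a 1 = inv\<^bsub>?H\<^esub> (a 1 False \<otimes>\<^bsub>?H\<^esub> inv\<^bsub>?H\<^esub> a 1 True)"
    using c H.alt_Suc[of 0 a] by (simp add: H.int_pow_neg flip: One_nat_def del: hom_group_simps)
  also have "\<dots> = a 1 True \<otimes>\<^bsub>?H\<^esub> inv\<^bsub>?H\<^esub> a 1 False"
    using c by (simp add: H.inv_mult H.m_comm del: hom_group_simps)
  finally show ?thesis using assms[of False] by (simp add: neg_def in_Hom)
qed

end

context cubical_coefficients
begin

lemma top_Obj: "x \<in> C.cubes n \<Longrightarrow> FObj x (top_vertex n) \<in> Obj (op_cat C)"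
  using C.cubesD(1) by simp

text \<open>The condition ranges over all cubes, so that faces, which may be degenerate, can be
  rewritten; on degenerate cubes both sides vanish, and the summands of nondegenerate cubes
  determine the arrow.\<close>

definition Nmap :: "('c, 'e, 'o, 'm) nat_trans \<Rightarrow> nat \<Rightarrow> 'm" where
  "Nmap \<alpha> n = (THE h. h \<in> Hom A (Nob (Dom K \<alpha>) n) (Nob (Cod K \<alpha>) n) \<and>
     (\<forall>x\<in>C.cubes n. h \<cdot> normalized_in (Dom K \<alpha>) n x = normalized_in (Cod K \<alpha>) n x \<cdot> \<alpha> $ FObj x (top_vertex n)))"

lemma Nmap:
  assumes a: "\<alpha> \<in> Arr K"
  shows "Nmap \<alpha> n \<in> Arr A" "Dom A (Nmap \<alpha> n) = Nob (Dom K \<alpha>) n" "Cod A (Nmap \<alpha> n) = Nob (Cod K \<alpha>) n"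
    "x \<in> C.cubes n \<Longrightarrow> Nmap \<alpha> n \<cdot> normalized_in (Dom K \<alpha>) n x = normalized_in (Cod K \<alpha>) n x \<cdot> \<alpha> $ FObj x (top_vertex n)"
proof -
  let ?F = "Dom K \<alpha>" and ?G = "Cod K \<alpha>"
  note aD = K_arrD[OF a]
  let ?g = "\<lambda>x. normalized_in ?G n x \<cdot> \<alpha> $ FObj x (top_vertex n)"
  have g: "?g x \<in> Arr A \<and> Dom A (?g x) = vt ?F n x \<and> Cod A (?g x) = Nob ?G n" if "x \<in> C.cubes n" for x
    using aD(3-5)[OF top_Obj[OF that]] normalized_in_arr[OF aD(2) that] by simp
  obtain h where h: "h \<in> Arr A" "Dom A h = Nob ?F n" "Cod A h = Nob ?G n"
    "\<And>x. x \<in> nondegenerate n \<Longrightarrow> h \<cdot> normalized_in ?F n x = ?g x"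
    using coproduct_desc[OF normalized_coproduct[OF aD(1), of n] Nob_Obj[OF aD(2)], of ?g] g by blast
  have hx: "h \<cdot> normalized_in ?F n x = ?g x" if x: "x \<in> C.cubes n" for x
  proof (cases "x \<in> degenerate n")
    case True
    then show ?thesis
      using normalized_in_degenerate[OF aD(1) True] normalized_in_degenerate[OF aD(2) True] h vt_Obj[OF aD(1) x]
        aD(3-5)[OF top_Obj[OF x]] Nob_Obj[OF aD(2)] by simp
  qed (use h x in auto)
  have "\<exists>!h. h \<in> Hom A (Nob ?F n) (Nob ?G n) \<and> (\<forall>x\<in>C.cubes n. h \<cdot> normalized_in ?F n x = ?g x)"
  proof (rule ex1I[of _ h])
    fix h' assume h': "h' \<in> Hom A (Nob ?F n) (Nob ?G n) \<and> (\<forall>x\<in>C.cubes n. h' \<cdot> normalized_in ?F n x = ?g x)"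
    show "h' = h" by (rule normalized_in_ext[OF aD(1)]) (use h h' hx in \<open>auto simp: in_Hom\<close>)
  qed (use h hx in \<open>auto simp: in_Hom\<close>)
  from theI'[OF this] show "Nmap \<alpha> n \<in> Arr A" "Dom A (Nmap \<alpha> n) = Nob ?F n" "Cod A (Nmap \<alpha> n) = Nob ?G n"
    "x \<in> C.cubes n \<Longrightarrow> Nmap \<alpha> n \<cdot> normalized_in ?F n x = ?g x"
    unfolding Nmap_def by (auto simp: in_Hom)
qed

lemma Nmap_unique:
  assumes a: "\<alpha> \<in> Arr K" and h: "h \<in> Arr A" "Dom A h = Nob (Dom K \<alpha>) n" "Cod A h = Nob (Cod K \<alpha>) n"
    "\<And>x. x \<in> C.cubes n \<Longrightarrow> h \<cdot> normalized_in (Dom K \<alpha>) n x = normalized_in (Cod K \<alpha>) n x \<cdot> \<alpha> $ FObj x (top_vertex n)"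
  shows "Nmap \<alpha> n = h"
  by (rule normalized_in_ext[OF K_arrD(1)[OF a]]) (use Nmap(1-3)[OF a, of n] Nmap(4)[OF a, of _ n] h in auto)

lemma Nmap_Ident:
  assumes "is_functor (op_cat C) A F"
  shows "Nmap (Ident K F) n = Ident A (Nob F n)"
proof -
  note i = Ident_K[OF assms]
  show ?thesis
    by (rule Nmap_unique[OF i(1)])
      (use i normalized_in_arr[OF assms] Nob_Obj[OF assms] top_Obj in auto)
qed

lemma Nmap_Comp:
  assumes "\<alpha> \<in> Arr K" "\<beta> \<in> Arr K" "Cod K \<alpha> = Dom K \<beta>"
  shows "Nmap (Comp K \<beta> \<alpha>) n = Nmap \<beta> n \<cdot> Nmap \<alpha> n"
proof -
  note ab = Comp_K[OF assms] and a = Nmap(1-3)[OF assms(1), of n] Nmap(4)[OF assms(1), of _ n] and b = Nmap(1-3)[OF assms(2), of n] Nmap(4)[OF assms(2), of _ n]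
  note aD = K_arrD[OF assms(1)] and bD = K_arrD[OF assms(2)]
  show ?thesis
  proof (rule Nmap_unique[OF ab(1)])
    fix x assume x: "x \<in> C.cubes n"
    note t = top_Obj[OF x] and kF = normalized_in_arr[OF aD(1) x] and kG = normalized_in_arr[OF aD(2) x] and kH = normalized_in_arr[OF bD(2) x]
    have "Nmap \<beta> n \<cdot> Nmap \<alpha> n \<cdot> normalized_in (Dom K \<alpha>) n x = Nmap \<beta> n \<cdot> normalized_in (Cod K \<alpha>) n x \<cdot> \<alpha> $ FObj x (top_vertex n)"
      using a(4)[OF x] by simp
    also have "\<dots> = normalized_in (Cod K \<beta>) n x \<cdot> \<beta> $ FObj x (top_vertex n) \<cdot> \<alpha> $ FObj x (top_vertex n)"
      using square_extend[OF b(4)[OF x], of "\<alpha> $ FObj x (top_vertex n)"]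
        kG kH aD(3-5)[OF t] bD(3-5)[OF t] b(1-3) assms(3) by simp
    finally show "(Nmap \<beta> n \<cdot> Nmap \<alpha> n) \<cdot> normalized_in (Dom K (Comp K \<beta> \<alpha>)) n x =
      normalized_in (Cod K (Comp K \<beta> \<alpha>)) n x \<cdot> Comp K \<beta> \<alpha> $ FObj x (top_vertex n)"
      using ab t a(1-3) b(1-3) kF assms(3) by simp
  qed (use a b ab assms in auto)
qed

lemma Nmap_Add:
  assumes "\<alpha> \<in> Arr K" "\<beta> \<in> Arr K" "Dom K \<alpha> = Dom K \<beta>" "Cod K \<alpha> = Cod K \<beta>"
  shows "Nmap (Add K \<alpha> \<beta>) n = Add A (Nmap \<alpha> n) (Nmap \<beta> n)"
proof -
  note ab = Add_K[OF assms] and a = Nmap(1-3)[OF assms(1), of n] Nmap(4)[OF assms(1), of _ n] and b = Nmap(1-3)[OF assms(2), of n] Nmap(4)[OF assms(2), of _ n]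
  note aD = K_arrD[OF assms(1)] and bD = K_arrD[OF assms(2)]
  show ?thesis
  proof (rule Nmap_unique[OF ab(1)])
    fix x assume x: "x \<in> C.cubes n"
    note t = top_Obj[OF x] and kF = normalized_in_arr[OF bD(1) x] and kG = normalized_in_arr[OF bD(2) x]
    show "Add A (Nmap \<alpha> n) (Nmap \<beta> n) \<cdot> normalized_in (Dom K (Add K \<alpha> \<beta>)) n x =
      normalized_in (Cod K (Add K \<alpha> \<beta>)) n x \<cdot> Add K \<alpha> \<beta> $ FObj x (top_vertex n)"
      using ab t a b(1-3) b(4)[OF x] a(4)[OF x] kF kG assms(3,4) aD(3-5)[OF t] bD(3-5)[OF t] by simp
  qed (use a b ab assms in auto)
qed

text \<open>Faces act on coefficients through arrows of \<open>C\<close> between top vertices, and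
  \<alpha> is natural with respect to these.\<close>

lemma cmap_Nmap:
  assumes a: "\<alpha> \<in> Arr K"
  shows "cmap (nd (Dom K \<alpha>)) (nd (Cod K \<alpha>)) (Nmap \<alpha>)"
  unfolding cmap_def
proof (intro allI conjI)
  fix n
  let ?F = "Dom K \<alpha>" and ?G = "Cod K \<alpha>"
  note aD = K_arrD[OF a] and m = Nmap(1-3)[OF a, of n] Nmap(4)[OF a, of _ n] and m' = Nmap(1-3)[OF a, of "n - 1"] Nmap(4)[OF a, of _ "n - 1"]
  note dF = nd(1-3)[OF aD(1), of n] nd(4)[OF aD(1), of _ n] and dG = nd(1-3)[OF aD(2), of n] nd(4)[OF aD(2), of _ n]
  show "Nmap \<alpha> n \<in> Arr A" "Dom A (Nmap \<alpha> n) = Dom A (nd ?F n)" "Cod A (Nmap \<alpha> n) = Dom A (nd ?G n)"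
    using m dF dG by auto
  show "nd ?G n \<cdot> Nmap \<alpha> n = Nmap \<alpha> (n - 1) \<cdot> nd ?F n"
  proof (rule normalized_in_ext[OF aD(1)])
    fix x assume "x \<in> nondegenerate n"
    then have x: "x \<in> C.cubes n" by simp
    note t = top_Obj[OF x] and kF = normalized_in_arr[OF aD(1) x] and kG = normalized_in_arr[OF aD(2) x]
    note ax = aD(3-5)[OF t] and fF = face_arr[OF aD(1) x] and fG = face_arr[OF aD(2) x]
    have "(nd ?G n \<cdot> Nmap \<alpha> n) \<cdot> normalized_in ?F n x = nd ?G n \<cdot> normalized_in ?G n x \<cdot> \<alpha> $ FObj x (top_vertex n)"
      using m(1-3) m(4)[OF x] dG kF by simp
    also have "\<dots> = asum (vt ?G n x) (Nob ?G (n - 1)) (face ?G n x) n \<cdot> \<alpha> $ FObj x (top_vertex n)"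
      by (rule Comp_eq_extend[OF dG(4)[OF x]]) (use dG kG ax in auto)
    also have "\<dots> = asum (vt ?F n x) (Nob ?G (n - 1)) (\<lambda>i \<epsilon>. face ?G n x i \<epsilon> \<cdot> \<alpha> $ FObj x (top_vertex n)) n"
      by (rule Comp_asum_right) (use ax fG Nob_Obj[OF aD(2)] in \<open>auto simp: in_Hom\<close>)
    also have "\<dots> = asum (vt ?F n x) (Nob ?G (n - 1)) (\<lambda>i \<epsilon>. Nmap \<alpha> (n - 1) \<cdot> face ?F n x i \<epsilon>) n"
    proof (rule asum_cong)
      fix i \<epsilon> assume i: "i \<in> {1..n}"
      then have mc: "mono_cube (n - 1) n (ins i \<epsilon>)" using mono_cube_ins by simp
      let ?y = "pull (n - 1) (ins i \<epsilon>) x" and ?u = "FArr x (ins i \<epsilon> (top_vertex (n - 1)), top_vertex n)"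
      have y: "?y \<in> C.cubes (n - 1)" by (rule C.pull_cubes[OF x mc])
      note kFy = normalized_in_arr[OF aD(1) y] and kGy = normalized_in_arr[OF aD(2) y] and ay = aD(3-5)[OF top_Obj[OF y]]
      note wF = wt_arr[OF aD(1) x mc] and wG = wt_arr[OF aD(2) x mc]
      have "Nmap \<alpha> (n - 1) \<cdot> face ?F n x i \<epsilon> = Nmap \<alpha> (n - 1) \<cdot> normalized_in ?F (n - 1) ?y \<cdot> wt ?F (n - 1) (ins i \<epsilon>) n x"
        by (simp add: face_def[OF aD(1)])
      also have "\<dots> = normalized_in ?G (n - 1) ?y \<cdot> \<alpha> $ FObj ?y (top_vertex (n - 1)) \<cdot> wt ?F (n - 1) (ins i \<epsilon>) n x"
        using square_extend[OF m'(4)[OF y], of "wt ?F (n - 1) (ins i \<epsilon>) n x"] m'(1-3) kFy kGy ay wF by simp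
      also have "\<dots> = normalized_in ?G (n - 1) ?y \<cdot> wt ?G (n - 1) (ins i \<epsilon>) n x \<cdot> \<alpha> $ FObj x (top_vertex n)"
        using aD(6)[of ?u] top_arrow[OF x mc] by simp
      also have "\<dots> = face ?G n x i \<epsilon> \<cdot> \<alpha> $ FObj x (top_vertex n)"
        using kGy wG ax by (simp add: face_def[OF aD(2)])
      finally show "face ?G n x i \<epsilon> \<cdot> \<alpha> $ FObj x (top_vertex n) = Nmap \<alpha> (n - 1) \<cdot> face ?F n x i \<epsilon>" ..
    qed (use vt_Obj[OF aD(1) x] Nob_Obj[OF aD(2)] fF m'(1-3) in \<open>auto simp: in_Hom\<close>)
    also have "\<dots> = Nmap \<alpha> (n - 1) \<cdot> asum (vt ?F n x) (Nob ?F (n - 1)) (face ?F n x) n"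
      by (rule Comp_asum_left[symmetric]) (use vt_Obj[OF aD(1) x] fF m'(1-3) in \<open>auto simp: in_Hom\<close>)
    also have "\<dots> = (Nmap \<alpha> (n - 1) \<cdot> nd ?F n) \<cdot> normalized_in ?F n x"
      using dF(1-3) dF(4)[OF x] m'(1-3) kF by simp
    finally show "(nd ?G n \<cdot> Nmap \<alpha> n) \<cdot> normalized_in ?F n x = (Nmap \<alpha> (n - 1) \<cdot> nd ?F n) \<cdot> normalized_in ?F n x" .
  qed (use m(1-3) m'(1-3) dF(1-3) dG(1-3) in auto)
qed

definition cub_homology :: "nat \<Rightarrow> (('c, 'e, 'o, 'm) cfunctor, ('c, 'e, 'o, 'm) nat_trans, 'o, 'm) cfunctor" where
  "cub_homology n = \<lparr>FObj = \<lambda>F\<in>Obj K. cubical_homology A X (GF F) n,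
     FArr = \<lambda>\<alpha>\<in>Arr K. Hmap (nd (Dom K \<alpha>)) (nd (Cod K \<alpha>)) (Nmap \<alpha>) n\<rparr>"

definition cub_connecting :: "nat \<Rightarrow> ('c, 'e, 'o, 'm) nat_trans \<Rightarrow> ('c, 'e, 'o, 'm) nat_trans \<Rightarrow> 'm" where
  "cub_connecting n \<phi> \<gamma> = connecting (nd (Dom K \<phi>)) (nd (Cod K \<phi>)) (nd (Cod K \<gamma>)) (Nmap \<phi>) (Nmap \<gamma>) n"

lemma cub_homology_simps:
  "is_functor (op_cat C) A F \<Longrightarrow> FObj (cub_homology n) F = Hob (nd F) n"
  "\<alpha> \<in> Arr K \<Longrightarrow> FArr (cub_homology n) \<alpha> = Hmap (nd (Dom K \<alpha>)) (nd (Cod K \<alpha>)) (Nmap \<alpha>) n"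
  by (simp_all add: cub_homology_def cubical_homology_def)

lemma cub_homology_additive: "is_additive_functor K A (cub_homology n)"
  unfolding is_additive_functor_def is_functor_def
proof (intro conjI ballI impI)
  show "FObj (cub_homology n) \<in> Obj K \<rightarrow>\<^sub>E Obj A"
    using homology_ob_Obj[OF cplxD(3)[OF cplx_nd]] by (auto simp: cub_homology_def cubical_homology_def)
  show "FArr (cub_homology n) \<in> extensional (Arr K)" by (simp add: cub_homology_def)
next
  fix \<alpha> assume a: "\<alpha> \<in> Arr K"
  note aD = K_arrD[OF a]
  show "FArr (cub_homology n) \<alpha> \<in> Hom A (FObj (cub_homology n) (Dom K \<alpha>)) (FObj (cub_homology n) (Cod K \<alpha>))"
    using Hmap(1-3)[OF cplx_nd[OF aD(1)] cplx_nd[OF aD(2)] cmap_Nmap[OF a]] cub_homology_simps a aD(1,2)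
    by (simp add: in_Hom)
next
  fix F assume "F \<in> Obj K"
  then have F: "is_functor (op_cat C) A F" by simp
  have "Nmap (Ident K F) = (\<lambda>n. Ident A (Dom A (nd F n)))"
    using Nmap_Ident[OF F] nd(2)[OF F] by auto
  then show "FArr (cub_homology n) (Ident K F) = Ident A (FObj (cub_homology n) F)"
    using cub_homology_simps(1)[OF F] cub_homology_simps(2)[OF Ident_K(1)[OF F]] Ident_K[OF F] Hmap_Ident[OF cplx_nd[OF F]] by simp
next
  fix \<alpha> \<beta> assume ab: "\<alpha> \<in> Arr K" "\<beta> \<in> Arr K" "Cod K \<alpha> = Dom K \<beta>"
  note aD = K_arrD[OF ab(1)] and bD = K_arrD[OF ab(2)] and c = Comp_K[OF ab]
  have "Nmap (Comp K \<beta> \<alpha>) = (\<lambda>n. Nmap \<beta> n \<cdot> Nmap \<alpha> n)" using Nmap_Comp[OF ab] by auto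
  then show "FArr (cub_homology n) (Comp K \<beta> \<alpha>) = FArr (cub_homology n) \<beta> \<cdot> FArr (cub_homology n) \<alpha>"
    using cub_homology_simps(2)[OF c(1)] cub_homology_simps(2)[OF ab(1)] cub_homology_simps(2)[OF ab(2)] c ab(3)
      Hmap_Comp[OF cplx_nd[OF aD(1)] cplx_nd[OF aD(2)] cplx_nd[OF bD(2)] cmap_Nmap[OF ab(1)]
        cmap_Nmap[OF ab(2), folded ab(3)], of n] by simp
next
  fix F G \<alpha> \<beta> assume "\<alpha> \<in> Hom K F G" "\<beta> \<in> Hom K F G"
  then have ab: "\<alpha> \<in> Arr K" "\<beta> \<in> Arr K" "Dom K \<alpha> = Dom K \<beta>" "Cod K \<alpha> = Cod K \<beta>" by (auto simp: in_Hom)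
  note bD = K_arrD[OF ab(2)] and c = Add_K[OF ab]
  have "Nmap (Add K \<alpha> \<beta>) = (\<lambda>n. Add A (Nmap \<alpha> n) (Nmap \<beta> n))" using Nmap_Add[OF ab] by auto
  then show "FArr (cub_homology n) (Add K \<alpha> \<beta>) = Add A (FArr (cub_homology n) \<alpha>) (FArr (cub_homology n) \<beta>)"
    using cub_homology_simps(2)[OF c(1)] cub_homology_simps(2)[OF ab(1)] cub_homology_simps(2)[OF ab(2)] c ab(3,4)
      Hmap_Add[OF cplx_nd[OF bD(1)] cplx_nd[OF bD(2)] cmap_Nmap[OF ab(1), unfolded ab(3,4)] cmap_Nmap[OF ab(2)], of n]
    by simp
qed

text \<open>Here exactness of coproducts enters: in each degree the sequence is the coproduct, over
  the one index set of nondegenerate cubes, of the given sequence evaluated at top vertices.\<close>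

lemma short_exact_nd:
  assumes "short_exact K \<phi> \<gamma>"
  shows "short_exact_complexes A (nd (Dom K \<phi>)) (nd (Cod K \<phi>)) (nd (Cod K \<gamma>)) (Nmap \<phi>) (Nmap \<gamma>)"
proof
  note s = short_exact_K_D[OF assms] note pD = K_arrD[OF s(1)] and gD = K_arrD[OF s(2)]
  show "cplx (nd (Dom K \<phi>))" "cplx (nd (Cod K \<phi>))" "cplx (nd (Cod K \<gamma>))"
    using cplx_nd pD(1,2) gD(2) by auto
  show "cmap (nd (Dom K \<phi>)) (nd (Cod K \<phi>)) (Nmap \<phi>)" by (rule cmap_Nmap[OF s(1)])
  show "cmap (nd (Cod K \<phi>)) (nd (Cod K \<gamma>)) (Nmap \<gamma>)" using cmap_Nmap[OF s(2)] s(3) by simp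
  fix n
  let ?f = "\<lambda>x. \<phi> $ FObj x (top_vertex n)" and ?g = "\<lambda>x. \<gamma> $ FObj x (top_vertex n)"
  let ?I = "nondegenerate n"
  have x: "x \<in> C.cubes n" "FObj x (top_vertex n) \<in> Obj (op_cat C)" if "x \<in> ?I" for x
    using that top_Obj by auto
  have sm: "small U ?I" by (rule small_subset[OF _ C.small_cubes[OF small_Arr]]) auto
  have cong: "is_coproduct A ?I Y P \<iota>" if "is_coproduct A ?I Z P \<iota>" "\<And>x. x \<in> ?I \<Longrightarrow> Y x = Z x" for Y Z P \<iota>
    by (rule coproduct_reindex[OF that(1), of id]) (use that(2) in auto)
  show "short_exact A (Nmap \<phi> n) (Nmap \<gamma> n)"
  proof (rule small_coproduct_short_exact[OF coproducts_exact sm, of ?f ?g])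
    show "is_coproduct A ?I (\<lambda>x. Dom A (?f x)) (Nob (Dom K \<phi>) n) (normalized_in (Dom K \<phi>) n)"
      by (rule cong[OF normalized_coproduct[OF pD(1)]]) (use pD x in auto)
    show "is_coproduct A ?I (\<lambda>x. Dom A (?g x)) (Nob (Cod K \<phi>) n) (normalized_in (Cod K \<phi>) n)"
      by (rule cong[OF normalized_coproduct[OF pD(2)]]) (use gD s(3) x in auto)
    show "is_coproduct A ?I (\<lambda>x. Cod A (?g x)) (Nob (Cod K \<gamma>) n) (normalized_in (Cod K \<gamma>) n)"
      by (rule cong[OF normalized_coproduct[OF gD(2)]]) (use gD x in auto)
  qed (use s(4) x Nmap(1-3)[OF s(1), of n] Nmap(4)[OF s(1), of _ n] Nmap(1-3)[OF s(2), of n] Nmap(4)[OF s(2), of _ n] s(3) in \<open>auto simp: in_Hom\<close>)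
qed

lemma cub_homology_partial_functor: "homological_partial_functor K A cub_homology cub_connecting"
  unfolding homological_partial_functor_def
proof (intro conjI allI impI)
  fix n show "is_additive_functor K A (cub_homology n)" by (rule cub_homology_additive)
next
  fix \<phi> \<gamma> n assume s: "short_exact K \<phi> \<gamma>"
  interpret L: short_exact_complexes A "nd (Dom K \<phi>)" "nd (Cod K \<phi>)" "nd (Cod K \<gamma>)" "Nmap \<phi>" "Nmap \<gamma>"
    by (rule short_exact_nd[OF s])
  note t = short_exact_K_D(1-3)[OF s] note pD = K_arrD[OF t(1)] and gD = K_arrD[OF t(2)]
  note h = cub_homology_simps(1)[OF pD(1)] cub_homology_simps(1)[OF gD(2)] cub_homology_simps(2)[OF t(1)] cub_homology_simps(2)[OF t(2), folded t(3)]
  show "cub_connecting n \<phi> \<gamma> \<in> Hom A (FObj (cub_homology (Suc n)) (Cod K \<gamma>)) (FObj (cub_homology n) (Dom K \<phi>))"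
    using L.connecting(1-3)[of n] by (simp add: h cub_connecting_def in_Hom)
  show "exact A (FArr (cub_homology n) \<phi>) (FArr (cub_homology n) \<gamma>)" unfolding h by (rule L.exact_middle)
  show "exact A (FArr (cub_homology (Suc n)) \<gamma>) (cub_connecting n \<phi> \<gamma>)" unfolding h cub_connecting_def by (rule L.exact_connecting_left)
  show "exact A (cub_connecting n \<phi> \<gamma>) (FArr (cub_homology n) \<phi>)" unfolding h cub_connecting_def by (rule L.exact_connecting_right)
  show "is_epi A (FArr (cub_homology 0) \<gamma>)" unfolding h by (rule L.epi_degree_0)
next
  fix \<phi> \<gamma> \<phi>' \<gamma>' a b c n
  assume h: "short_exact K \<phi> \<gamma> \<and> short_exact K \<phi>' \<gamma>' \<and> a \<in> Hom K (Dom K \<phi>) (Dom K \<phi>') \<and>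
    b \<in> Hom K (Cod K \<phi>) (Cod K \<phi>') \<and> c \<in> Hom K (Cod K \<gamma>) (Cod K \<gamma>') \<and>
    Comp K b \<phi> = Comp K \<phi>' a \<and> Comp K c \<gamma> = Comp K \<gamma>' b"
  then have s: "short_exact K \<phi> \<gamma>" "short_exact K \<phi>' \<gamma>'" by auto
  note t = short_exact_K_D(1-3)[OF s(1)] and t' = short_exact_K_D(1-3)[OF s(2)]
  have abc: "a \<in> Arr K" "Dom K a = Dom K \<phi>" "Cod K a = Dom K \<phi>'" "b \<in> Arr K" "Dom K b = Cod K \<phi>" "Cod K b = Cod K \<phi>'"
    "c \<in> Arr K" "Dom K c = Cod K \<gamma>" "Cod K c = Cod K \<gamma>'" using h by (auto simp: in_Hom)
  have sq: "Nmap b n \<cdot> Nmap \<phi> n = Nmap \<phi>' n \<cdot> Nmap a n" "Nmap c n \<cdot> Nmap \<gamma> n = Nmap \<gamma>' n \<cdot> Nmap b n" for n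
    using Nmap_Comp[of \<phi> b n] Nmap_Comp[of a \<phi>' n] Nmap_Comp[of \<gamma> c n] Nmap_Comp[of b \<gamma>' n] h abc t t' by auto
  show "cub_connecting n \<phi>' \<gamma>' \<cdot> FArr (cub_homology (Suc n)) c = FArr (cub_homology n) a \<cdot> cub_connecting n \<phi> \<gamma>"
    unfolding cub_homology_simps(2)[OF abc(7)] cub_homology_simps(2)[OF abc(1)] cub_connecting_def abc
    by (rule connecting_natural[OF short_exact_nd[OF s(1)] short_exact_nd[OF s(2)], where b = "Nmap b"])
      (use cmap_Nmap[OF abc(1)] cmap_Nmap[OF abc(4)] cmap_Nmap[OF abc(7)] abc sq in auto)
qed

section \<open>Degree 0: cubical homology is the colimit\<close>

definition point :: "'c \<Rightarrow> ('c, 'e) cube_diagram" where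
  "point c = \<lparr>FObj = \<lambda>v\<in>cube 0. c, FArr = \<lambda>(v, w)\<in>Arr (cube_poset 0). Ident C c\<rparr>"

definition edge :: "'e \<Rightarrow> ('c, 'e) cube_diagram" where
  "edge e = \<lparr>FObj = \<lambda>v\<in>cube 1. if hd v then Cod C e else Dom C e,
     FArr = \<lambda>(v, w)\<in>Arr (cube_poset 1). if hd v then Ident C (Cod C e) else if hd w then e else Ident C (Dom C e)\<rparr>"

lemma point_cubes: "c \<in> Obj C \<Longrightarrow> point c \<in> C.cubes 0"
  unfolding point_def by (rule C.cubesI) auto

lemma le_hd: "length v = 1 \<Longrightarrow> length w = 1 \<Longrightarrow> le v w \<Longrightarrow> hd v \<Longrightarrow> hd w"
  by (cases v; cases w) auto

lemma edge_cubes: "e \<in> Arr C \<Longrightarrow> edge e \<in> C.cubes 1"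
  unfolding edge_def by (rule C.cubesI) (auto dest: le_hd)

lemma cube_0_eq:
  assumes "x \<in> C.cubes 0" shows "x = point (FObj x (top_vertex 0))"
proof -
  have o: "FObj x (top_vertex 0) \<in> Obj C" using C.cubesD(1)[OF assms length_top] .
  have "FArr x ([], []) = Ident C (FObj x [])" using C.cubesD(5)[OF assms, of "[]"] by simp
  then show ?thesis
    by (intro C.cubes_eqI[OF assms point_cubes[OF o]]) (auto simp: point_def top_vertex_def)
qed

lemma nondegenerate_0: "nondegenerate 0 = C.cubes 0"
  by (auto simp: degenerate_def)

definition H0_in :: "('c, 'e, 'o, 'm) cfunctor \<Rightarrow> 'c \<Rightarrow> 'm" where
  "H0_in F c = hcl (nd F) 0 (normalized_in F 0 (point c))"

lemma vt_point [simp]: "vt F 0 (point c) = FObj F c"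
  by (simp add: point_def)

context
  fixes F assumes F: "is_functor (op_cat C) A F"
begin

lemma cyc_0: "u \<in> Arr A \<Longrightarrow> Cod A u = Nob F 0 \<Longrightarrow> cyc (nd F 0) u"
  using cyc_cplx0[OF cplx_nd[OF F]] nd(2)[OF F, of 0] by simp

lemma H0_in:
  assumes "c \<in> Obj C"
  shows "H0_in F c \<in> Arr A" "Dom A (H0_in F c) = FObj F c" "Cod A (H0_in F c) = Hob (nd F) 0"
proof -
  note k = normalized_in_arr[OF F point_cubes[OF assms]]
  show "H0_in F c \<in> Arr A" "Dom A (H0_in F c) = FObj F c" "Cod A (H0_in F c) = Hob (nd F) 0"
    unfolding H0_in_def using cls_arr[OF cplxD(3)[OF cplx_nd[OF F]] cyc_0[OF k(1,3)]] k by auto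
qed

text \<open>All chains of degree 0 are cycles, so the identity can take the place of the universal
  cycle; its class \<open>i\<close> is the quotient map from chains to homology.\<close>

lemma H0_id:
  defines "i \<equiv> hcl (nd F) 0 (Ident A (Nob F 0))"
  shows "i \<in> Arr A" "Dom A i = Nob F 0" "Cod A i = Hob (nd F) 0" "is_epi A i"
    "c \<in> Obj C \<Longrightarrow> i \<cdot> normalized_in F 0 (point c) = H0_in F c"
    "u \<in> Arr A \<Longrightarrow> Cod A u = Nob F 0 \<Longrightarrow> hcl (nd F) 0 u = i \<cdot> u"
proof -
  note X = cplxD(3)[OF cplx_nd[OF F], of 0]
  have j: "Ident A (Nob F 0) \<in> Arr A" "Dom A (Ident A (Nob F 0)) = Nob F 0" "Cod A (Ident A (Nob F 0)) = Nob F 0"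
    using Nob_Obj[OF F] by auto
  note cy = cyc_0[OF j(1,3)]
  show i: "i \<in> Arr A" "Dom A i = Nob F 0" "Cod A i = Hob (nd F) 0"
    unfolding i_def using cls_arr[OF X cy] j by auto
  have u: "hcl (nd F) 0 u = i \<cdot> u" if "u \<in> Arr A" "Cod A u = Nob F 0" for u
    unfolding i_def using cls_Comp[OF X cy that(1)] that j by simp
  then show "u \<in> Arr A \<Longrightarrow> Cod A u = Nob F 0 \<Longrightarrow> hcl (nd F) 0 u = i \<cdot> u" .
  show "c \<in> Obj C \<Longrightarrow> i \<cdot> normalized_in F 0 (point c) = H0_in F c"
    unfolding H0_in_def using u normalized_in_arr[OF F point_cubes] by simp
  note n = nd(1-3)[OF F, of 0]
  have "hcl (nd F) 0 (ker A (nd F 0)) = i \<cdot> ker A (nd F 0)"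
    by (rule u) (use n ker_arr in auto)
  then show "is_epi A i"
    using cls_ker_epi[OF X] i n by (intro epi_right_factor[of i "ker A (nd F 0)"]) auto
qed

lemma H0_ext:
  assumes "h \<in> Arr A" "h' \<in> Arr A" "Dom A h = Hob (nd F) 0" "Dom A h' = Hob (nd F) 0" "Cod A h = Cod A h'"
    "\<And>c. c \<in> Obj C \<Longrightarrow> h \<cdot> H0_in F c = h' \<cdot> H0_in F c"
  shows "h = h'"
proof (rule is_epiD[OF H0_id(4)])
  note i = H0_id
  show "h \<cdot> hcl (nd F) 0 (Ident A (Nob F 0)) = h' \<cdot> hcl (nd F) 0 (Ident A (Nob F 0))"
  proof (rule normalized_in_ext[OF F])
    fix x assume "x \<in> nondegenerate 0"
    then have x: "x \<in> C.cubes 0" by simp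
    then have c: "FObj x (top_vertex 0) \<in> Obj C" using top_Obj by simp
    show "(h \<cdot> hcl (nd F) 0 (Ident A (Nob F 0))) \<cdot> normalized_in F 0 x = (h' \<cdot> hcl (nd F) 0 (Ident A (Nob F 0))) \<cdot> normalized_in F 0 x"
      using assms(6)[OF c] i(1-3) i(5)[OF c] assms(1-5) normalized_in_arr[OF F x] cube_0_eq[OF x] by simp
  qed (use assms i(1-3) in auto)
qed (use assms H0_id(1-3) in auto)

text \<open>Cubes of dimension 0 and 1 give the usual presentation of a colimit: a summand for each
  object and a relation for each arrow. Edges make the classes a cocone; conversely a cocone takes
  the same value on both faces of a 1-cube, hence kills boundaries.\<close>

lemma H0_colimit: "is_colimit (op_cat C) A F (Hob (nd F) 0) (H0_in F)"
  unfolding is_colimit_def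
proof (intro conjI ballI allI impI)
  note X = cplxD(3)[OF cplx_nd[OF F], of 0] and d1 = nd(1-3)[OF F, of 1] nd(4)[OF F, of _ 1]
  show "Hob (nd F) 0 \<in> Obj A" by (rule homology_ob_Obj[OF X])
  show "c \<in> Obj (op_cat C) \<Longrightarrow> H0_in F c \<in> Hom A (FObj F c) (Hob (nd F) 0)" for c
    using H0_in by (simp add: in_Hom)
  have nd1: "nd F (Suc 0) = nd F 1" by (simp add: One_nat_def)
  {
    fix e assume "e \<in> Arr (op_cat C)"
    then have e: "e \<in> Arr C" by simp
    have de: "Dom C e \<in> Obj C" "Cod C e \<in> Obj C" using e by auto
    let ?x = "edge e"
    have x: "?x \<in> C.cubes 1" by (rule edge_cubes[OF e])
    have top1: "top_vertex 1 = [True]" "top_vertex 0 = []" by (auto simp: top_vertex_def One_nat_def)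
    have ins1: "ins 1 \<epsilon> v = \<epsilon> # v" for \<epsilon> v by (simp add: ins_def)
    have p: "pull 0 (ins 1 \<epsilon>) ?x = point (if \<epsilon> then Cod C e else Dom C e)" for \<epsilon>
    proof -
      have "mono_cube 0 1 (ins 1 \<epsilon>)" using mono_cube_ins[of 1 1 \<epsilon>] by simp
      from C.pull_cubes[OF x this] have m: "pull 0 (ins 1 \<epsilon>) ?x \<in> C.cubes 0" .
      have v: "FObj (pull 0 (ins 1 \<epsilon>) ?x) (top_vertex 0) = (if \<epsilon> then Cod C e else Dom C e)"
        by (simp add: edge_def ins1)
      show ?thesis using cube_0_eq[OF m] unfolding v .
    qed
    have w: "wt F 0 (ins 1 \<epsilon>) 1 ?x = (if \<epsilon> then Ident A (FObj F (Cod C e)) else FArr F e)" for \<epsilon>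
      using contraD(5)[OF F de(2)] by (simp add: edge_def ins1 top1)
    let ?k0 = "normalized_in F 0 (point (Dom C e))" and ?k1 = "normalized_in F 0 (point (Cod C e))"
    note k0 = normalized_in_arr[OF F point_cubes[OF de(1)]] and k1 = normalized_in_arr[OF F point_cubes[OF de(2)]]
    note Fe = contraD(2-4)[OF F e]
    have f: "face F 1 ?x 1 False = ?k0 \<cdot> FArr F e" "face F 1 ?x 1 True = ?k1"
      using p w k1 by (simp_all add: face_def[OF F])
    have vt1: "vt F 1 ?x = FObj F (Cod C e)" by (simp add: edge_def top1)
    have "nd F 1 \<cdot> normalized_in F 1 ?x = asum (FObj F (Cod C e)) (Nob F 0) (face F 1 ?x) 1"
      using d1(4)[OF x] vt1 by simp
    also have "\<dots> = sub (face F 1 ?x 1 True) (face F 1 ?x 1 False)"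
      by (rule asum_1) (use face_arr[OF F x] vt1 in \<open>auto simp: in_Hom\<close>)
    also have "\<dots> = sub ?k1 (?k0 \<cdot> FArr F e)" using f by simp
    \<comment> \<open>The boundary of the edge identifies the summand at the codomain of
      \<open>e\<close> with its image under \<open>FArr F e\<close> in the summand at the
      domain.\<close>
    finally have "covered (nd F 1) (sub ?k1 (?k0 \<cdot> FArr F e))"
      using k0 k1 Fe d1(1-3) normalized_in_arr[OF F x] vt1 by (intro coveredI'[of _ "normalized_in F 1 ?x"]) auto
    then have "hcl (nd F) 0 ?k1 = hcl (nd F) 0 (?k0 \<cdot> FArr F e)"
      unfolding nd1 using k0 k1 Fe
      by (intro cls_eqI[OF X[unfolded nd1]] cyc_0) auto
    also have "\<dots> = hcl (nd F) 0 ?k0 \<cdot> FArr F e"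
      using cls_Comp[OF X cyc_0[OF k0(1,3)], of "FArr F e"] k0 Fe by simp
    finally show "H0_in F (Cod (op_cat C) e) \<cdot> FArr F e = H0_in F (Dom (op_cat C) e)"
      by (simp add: H0_in_def)
  }
  fix Y g assume Y: "Y \<in> Obj A" and "(\<forall>c\<in>Obj (op_cat C). g c \<in> Hom A (FObj F c) Y) \<and>
    (\<forall>e\<in>Arr (op_cat C). g (Cod (op_cat C) e) \<cdot> FArr F e = g (Dom (op_cat C) e))"
  then have g: "\<And>c. c \<in> Obj C \<Longrightarrow> g c \<in> Arr A \<and> Dom A (g c) = FObj F c \<and> Cod A (g c) = Y"
    "\<And>e. e \<in> Arr C \<Longrightarrow> g (Dom C e) \<cdot> FArr F e = g (Cod C e)" by (auto simp: in_Hom)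
  obtain h where h: "h \<in> Arr A" "Dom A h = Nob F 0" "Cod A h = Y"
    "\<And>x. x \<in> C.cubes 0 \<Longrightarrow> h \<cdot> normalized_in F 0 x = g (FObj x (top_vertex 0))"
    using coproduct_desc[OF normalized_coproduct[OF F, of 0] Y, of "\<lambda>x. g (FObj x (top_vertex 0))"]
      g(1) C.cubesD(1) unfolding nondegenerate_0 by auto
  have hd: "h \<cdot> nd F 1 = Zro A (Nob F 1) Y"
  proof (rule normalized_in_ext[OF F])
    fix x assume "x \<in> nondegenerate 1"
    then have x: "x \<in> C.cubes 1" by simp
    \<comment> \<open>The cocone property along the arrow from the vertex of the face to the top
      vertex makes the value independent of the face, so the alternating sum vanishes.\<close>
    have hf: "h \<cdot> face F 1 x i \<epsilon> = g (FObj x (top_vertex 1))" if "i \<in> {1..1}" for i \<epsilon>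
    proof -
      have m: "mono_cube 0 1 (ins i \<epsilon>)" using mono_cube_ins[of i 1 \<epsilon>] that by simp
      let ?y = "pull 0 (ins i \<epsilon>) x"
      have y: "?y \<in> C.cubes 0" by (rule C.pull_cubes[OF x m])
      have "h \<cdot> face F 1 x i \<epsilon> = h \<cdot> normalized_in F 0 ?y \<cdot> wt F 0 (ins i \<epsilon>) 1 x" by (simp add: face_def[OF F])
      also have "\<dots> = g (FObj ?y (top_vertex 0)) \<cdot> wt F 0 (ins i \<epsilon>) 1 x"
        by (rule Comp_eq_extend[OF h(4)[OF y]]) (use h normalized_in_arr[OF F y] wt_arr[OF F x m] in auto)
      also have "\<dots> = g (FObj x (top_vertex 1))"
        using g(2)[OF top_arrow(1)[OF x m]] top_arrow[OF x m] by simp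
      finally show ?thesis .
    qed
    note kx = normalized_in_arr[OF F x] and fx = face_arr[OF F x]
    have "(h \<cdot> nd F 1) \<cdot> normalized_in F 1 x = h \<cdot> asum (vt F 1 x) (Nob F 0) (face F 1 x) 1"
      using h d1(1-3) d1(4)[OF x] kx by simp
    also have "\<dots> = asum (vt F 1 x) Y (\<lambda>i \<epsilon>. h \<cdot> face F 1 x i \<epsilon>) 1"
      by (rule Comp_asum_left) (use h vt_Obj[OF F x] fx in \<open>auto simp: in_Hom\<close>)
    also have "\<dots> = Zro A (vt F 1 x) Y"
      by (rule asum_Zro) (use h(1-3) fx hf g(1)[of "FObj x (top_vertex 1)"] top_Obj[OF x] vt_Obj[OF F x] Y in \<open>auto simp: in_Hom\<close>)
    finally show "(h \<cdot> nd F 1) \<cdot> normalized_in F 1 x = Zro A (Nob F 1) Y \<cdot> normalized_in F 1 x" using kx Y by simp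
  qed (use h d1(1-3) Y Nob_Obj[OF F] in auto)
  have j: "Ident A (Nob F 0) \<in> Arr A" "Dom A (Ident A (Nob F 0)) = Nob F 0" "Cod A (Ident A (Nob F 0)) = Nob F 0"
    using Nob_Obj[OF F] by auto
  obtain k where k: "k \<in> Arr A" "Dom A k = Hob (nd F) 0" "Cod A k = Cod A h"
    "k \<cdot> hcl (nd F) 0 (Ident A (Nob F 0)) = h"
  proof (rule homology_desc[OF X cyc_0[OF j(1,3)] H0_id(4) h(1)])
    show "Dom A h = Dom A (Ident A (Nob F 0))" using h j by simp
    fix v assume v: "v \<in> Arr A" "Cod A v = Dom A (Ident A (Nob F 0))" "covered (nd F (Suc 0)) (Ident A (Nob F 0) \<cdot> v)"
    then have "covered (nd F 1) v" using j by (simp add: nd1)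
    then obtain e x where e: "is_epi A e" "e \<in> Arr A" "Cod A e = Dom A v" "x \<in> Arr A"
      "Dom A x = Dom A e" "Cod A x = Dom A (nd F 1)" "nd F 1 \<cdot> x = v \<cdot> e" by (rule coveredE)
    have "(h \<cdot> v) \<cdot> e = h \<cdot> nd F 1 \<cdot> x" using e v h j by simp
    also have "\<dots> = Zro A (Nob F 1) Y \<cdot> x"
      by (rule Comp_eq_extend[OF hd]) (use e h d1(1-3) in auto)
    also have "\<dots> = Zro A (Dom A e) Y" using e d1(1-3) Y by simp
    finally show "h \<cdot> v = Zro A (Dom A v) (Cod A h)"
      using epi_Zro[OF e(1), of "h \<cdot> v"] e v h j by simp
  qed
  have kc: "k \<cdot> H0_in F c = g c" if c: "c \<in> Obj C" for c
  proof -
    note i = H0_id and kp = normalized_in_arr[OF F point_cubes[OF c]]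
    have "k \<cdot> H0_in F c = k \<cdot> hcl (nd F) 0 (Ident A (Nob F 0)) \<cdot> normalized_in F 0 (point c)" using i(5)[OF c] by simp
    also have "\<dots> = h \<cdot> normalized_in F 0 (point c)"
      by (rule Comp_eq_extend[OF k(4)]) (use k i(1-3) kp in auto)
    also have "\<dots> = g c" using h(4)[OF point_cubes[OF c]] by (simp add: point_def)
    finally show ?thesis .
  qed
  show "\<exists>!k. k \<in> Hom A (Hob (nd F) 0) Y \<and> (\<forall>c\<in>Obj (op_cat C). k \<cdot> H0_in F c = g c)"
  proof (rule ex1I[of _ k])
    fix k' assume k': "k' \<in> Hom A (Hob (nd F) 0) Y \<and> (\<forall>c\<in>Obj (op_cat C). k' \<cdot> H0_in F c = g c)"
    show "k' = k" by (rule H0_ext) (use k k' kc h in \<open>auto simp: in_Hom\<close>)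
  qed (use k kc h in \<open>auto simp: in_Hom\<close>)
qed

end

lemma H0_natural:
  assumes a: "\<alpha> \<in> Arr K" and c: "c \<in> Obj C"
  shows "FArr (cub_homology 0) \<alpha> \<cdot> H0_in (Dom K \<alpha>) c = H0_in (Cod K \<alpha>) c \<cdot> \<alpha> $ c"
proof -
  let ?F = "Dom K \<alpha>" and ?G = "Cod K \<alpha>"
  note aD = K_arrD[OF a] note aF = aD(1) and aG = aD(2) and p = point_cubes[OF c]
  note kF = normalized_in_arr[OF aF p] and kG = normalized_in_arr[OF aG p]
  have ac: "\<alpha> $ c \<in> Arr A" "Dom A (\<alpha> $ c) = FObj ?F c" "Cod A (\<alpha> $ c) = FObj ?G c" using aD(3-5) c by auto
  have pc: "FObj (point c) (top_vertex 0) = c" by (simp add: point_def)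
  have "FArr (cub_homology 0) \<alpha> \<cdot> H0_in ?F c = hcl (nd ?G) 0 (Nmap \<alpha> 0 \<cdot> normalized_in ?F 0 (point c))"
    unfolding cub_homology_simps(2)[OF a] H0_in_def
    by (rule Hmap(4)[OF cplx_nd[OF aF] cplx_nd[OF aG] cmap_Nmap[OF a] cyc_0[OF aF kF(1,3)]])
  also have "\<dots> = hcl (nd ?G) 0 (normalized_in ?G 0 (point c) \<cdot> \<alpha> $ c)" using Nmap(4)[OF a p] pc by simp
  also have "\<dots> = H0_in ?G c \<cdot> \<alpha> $ c"
    unfolding H0_in_def using cls_Comp[OF cplxD(3)[OF cplx_nd[OF aG]] cyc_0[OF aG kG(1,3)], of "\<alpha> $ c"] ac kG by simp
  finally show ?thesis .
qed

end

section \<open>Acyclic resolutions\<close>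

lemma le_snoc: "length u = length w \<Longrightarrow> le (u @ [a]) (w @ [b]) \<longleftrightarrow> le u w \<and> a \<le> b"
  by (simp add: list_all2_append)

lemma ins_snoc: "i \<le> Suc (length u) \<Longrightarrow> ins i \<epsilon> (u @ [b]) = ins i \<epsilon> u @ [b]"
  by (simp add: ins_def)

lemma ins_last: "ins (Suc (length u)) \<epsilon> u = u @ [\<epsilon>]"
  by (simp add: ins_def)

lemma del_snoc: "1 \<le> i \<Longrightarrow> i \<le> length u \<Longrightarrow> del i (u @ [b]) = del i u @ [b]"
  by (simp add: del_def)

lemma top_snoc: "top_vertex (Suc n) = top_vertex n @ [True]"
  by (simp add: top_vertex_def replicate_append_same)

lemma length_SucE:
  assumes "length v = Suc n" obtains u b where "v = u @ [b]" "length u = n"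
  using assms by (metis length_Suc_conv_rev)

context category
begin

text \<open>
  The cone joins the cube \<open>x\<close> along \<open>f\<close> to the constant cube at the codomain of \<open>f\<close>; it is the
  contracting homotopy of the slice over that object.
\<close>

definition cone :: "nat \<Rightarrow> ('o, 'm) cube_diagram \<Rightarrow> 'm \<Rightarrow> ('o, 'm) cube_diagram" where
  "cone n x f = \<lparr>FObj = \<lambda>v\<in>cube (Suc n). if last v then Cod C f else FObj x (butlast v),
     FArr = \<lambda>(v, w)\<in>Arr (cube_poset (Suc n)). if last v then Ident C (Cod C f)
       else if last w then f \<cdot> FArr x (butlast v, top_vertex n) else FArr x (butlast v, butlast w)\<rparr>"

lemma cone_cubes:
  assumes x: "x \<in> cubes n" and f: "f \<in> Arr C" "Dom C f = FObj x (top_vertex n)"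
  shows "cone n x f \<in> cubes (Suc n)"
  unfolding cone_def
proof (rule cubesI)
  note xD = cubesD[OF x]
  note tp = le_top[of _ n] length_top
  fix v w assume vw: "length v = Suc n" "length w = Suc n" "le v w"
  obtain u a u' b where v: "v = u @ [a]" "length u = n" and w: "w = u' @ [b]" "length u' = n"
    using vw by (metis length_SucE)
  have l: "le u u'" "a \<le> b" using vw v w by (auto simp: le_snoc)
  show "(if last v then Ident C (Cod C f) else if last w then f \<cdot> FArr x (butlast v, top_vertex n)
      else FArr x (butlast v, butlast w)) \<in> Arr C \<and>
    Dom C (if last v then Ident C (Cod C f) else if last w then f \<cdot> FArr x (butlast v, top_vertex n)
      else FArr x (butlast v, butlast w)) = (if last v then Cod C f else FObj x (butlast v)) \<and>
    Cod C (if last v then Ident C (Cod C f) else if last w then f \<cdot> FArr x (butlast v, top_vertex n)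
      else FArr x (butlast v, butlast w)) = (if last w then Cod C f else FObj x (butlast w))"
    using v w l f xD(2-4)[OF v(2) length_top le_top[OF v(2)]] xD(2-4)[OF v(2) w(2) l(1)] by auto
next
  note xD = cubesD[OF x]
  fix t v w assume tvw: "length t = Suc n" "length v = Suc n" "length w = Suc n" "le t v" "le v w"
  obtain s c u a u' b where t: "t = s @ [c]" "length s = n" and v: "v = u @ [a]" "length u = n"
    and w: "w = u' @ [b]" "length u' = n"
    using tvw by (metis length_SucE)
  have l: "le s u" "c \<le> a" "le u u'" "a \<le> b" using tvw t v w by (auto simp: le_snoc)
  show "(if last t then Ident C (Cod C f) else if last w then f \<cdot> FArr x (butlast t, top_vertex n)
      else FArr x (butlast t, butlast w)) =
    (if last v then Ident C (Cod C f) else if last w then f \<cdot> FArr x (butlast v, top_vertex n)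
      else FArr x (butlast v, butlast w)) \<cdot>
    (if last t then Ident C (Cod C f) else if last v then f \<cdot> FArr x (butlast t, top_vertex n)
      else FArr x (butlast t, butlast v))"
    using t v w l f xD(2-4)[OF t(2) length_top le_top[OF t(2)]] xD(2-4)[OF v(2) length_top le_top[OF v(2)]]
      xD(2-4)[OF t(2) v(2) l(1)] xD(6)[OF t(2) v(2) w(2) l(1,3)]
      xD(6)[OF t(2) v(2) length_top l(1) le_top[OF v(2)]] by auto
next
  note xD = cubesD[OF x]
  fix v :: "bool list" assume v': "length v = Suc n"
  then obtain u a where v: "v = u @ [a]" "length u = n" by (metis length_SucE)
  show "(if last v then Cod C f else FObj x (butlast v)) \<in> Obj C" using v f xD(1)[OF v(2)] by simp
  show "(if last v then Ident C (Cod C f) else if last v then f \<cdot> FArr x (butlast v, top_vertex n)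
      else FArr x (butlast v, butlast v)) = Ident C (if last v then Cod C f else FObj x (butlast v))"
    using v xD(5)[OF v(2)] by simp
qed

lemma cone_simps [simp]:
  "length u = n \<Longrightarrow> FObj (cone n x f) (u @ [b]) = (if b then Cod C f else FObj x u)"
  "length u = n \<Longrightarrow> length w = n \<Longrightarrow> le u w \<Longrightarrow> a \<le> b \<Longrightarrow> FArr (cone n x f) (u @ [a], w @ [b]) =
     (if a then Ident C (Cod C f) else if b then f \<cdot> FArr x (u, top_vertex n) else FArr x (u, w))"
  by (auto simp: cone_def le_snoc)

text \<open>\<Phi> acts as \<phi> on the old coordinates and as the identity on the new one. So
  faces and degeneracies of a cone in an old direction are cones again, with \<open>f\<close>
  precomposed so as to start at the new top vertex.\<close>

lemma pull_cone:
  assumes x: "x \<in> cubes n" and f: "f \<in> Arr C" "Dom C f = FObj x (top_vertex n)"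
    and \<phi>: "mono_cube m n \<phi>" and \<Phi>: "mono_cube (Suc m) (Suc n) \<Phi>"
      "\<And>u b. length u = m \<Longrightarrow> \<Phi> (u @ [b]) = \<phi> u @ [b]"
  shows "pull (Suc m) \<Phi> (cone n x f) = cone m (pull m \<phi> x) (f \<cdot> FArr x (\<phi> (top_vertex m), top_vertex n))"
proof (rule cubes_eqI)
  note xD = cubesD[OF x] and l = mono_cubeD(1)[OF \<phi>]
  let ?e = "FArr x (\<phi> (top_vertex m), top_vertex n)"
  have e: "?e \<in> Arr C" "Dom C ?e = FObj x (\<phi> (top_vertex m))" "Cod C ?e = FObj x (top_vertex n)"
    using xD(2-4)[of "\<phi> (top_vertex m)" "top_vertex n"] l by auto
  have fe: "f \<cdot> ?e \<in> Arr C" "Dom C (f \<cdot> ?e) = FObj (pull m \<phi> x) (top_vertex m)" "Cod C (f \<cdot> ?e) = Cod C f"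
    using e f by auto
  show "pull (Suc m) \<Phi> (cone n x f) \<in> cubes (Suc m)" by (rule pull_cubes[OF cone_cubes[OF x f] \<Phi>(1)])
  show "cone m (pull m \<phi> x) (f \<cdot> ?e) \<in> cubes (Suc m)" by (rule cone_cubes[OF pull_cubes[OF x \<phi>] fe(1,2)])
  {
    fix v :: "bool list" assume "length v = Suc m"
    then obtain u a where v: "v = u @ [a]" "length u = m" by (metis length_SucE)
    then show "FObj (pull (Suc m) \<Phi> (cone n x f)) v = FObj (cone m (pull m \<phi> x) (f \<cdot> ?e)) v"
      using \<Phi>(2)[OF v(2)] l fe by simp
  }
  fix v w assume vw: "length v = Suc m" "length w = Suc m" "le v w"
  obtain u a u' b where v: "v = u @ [a]" "length u = m" and w: "w = u' @ [b]" "length u' = m"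
    using vw by (metis length_SucE)
  have le: "le u u'" "a \<le> b" using vw v w by (auto simp: le_snoc)
  have le': "le (\<phi> u) (\<phi> u')" "le (\<phi> u) (\<phi> (top_vertex m))" using mono_cubeD(2)[OF \<phi>] v w le by auto
  have u: "length (\<phi> u) = n" "length (\<phi> u') = n" "length (\<phi> (top_vertex m)) = n" using l v w by auto
  have "?e \<cdot> FArr x (\<phi> u, \<phi> (top_vertex m)) = FArr x (\<phi> u, top_vertex n)"
    using xD(6)[OF u(1,3) length_top le'(2)] u by simp
  moreover have "FArr x (\<phi> u, \<phi> (top_vertex m)) \<in> Arr C" "Cod C (FArr x (\<phi> u, \<phi> (top_vertex m))) = FObj x (\<phi> (top_vertex m))"
    using xD(2,4)[OF u(1,3) le'(2)] by auto
  ultimately have "(f \<cdot> ?e) \<cdot> FArr x (\<phi> u, \<phi> (top_vertex m)) = f \<cdot> FArr x (\<phi> u, top_vertex n)" using e f by simp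
  then show "FArr (pull (Suc m) \<Phi> (cone n x f)) (v, w) = FArr (cone m (pull m \<phi> x) (f \<cdot> ?e)) (v, w)"
    using vw v w le le' u fe(3) \<Phi>(2)[OF v(2)] \<Phi>(2)[OF w(2)] by simp
qed

end

context cubical_coefficients
begin

section \<open>The covering functor\<close>

abbreviation slice :: "'c \<Rightarrow> 'e set" where
  "slice c \<equiv> {f \<in> Arr C. Dom C f = c}"

abbreviation cover_ob :: "('c, 'e, 'o, 'm) cfunctor \<Rightarrow> 'c \<Rightarrow> 'o" where
  "cover_ob F c \<equiv> coproduct_ob A (slice c) (\<lambda>f. FObj F (Cod C f))"

abbreviation cover_in :: "('c, 'e, 'o, 'm) cfunctor \<Rightarrow> 'c \<Rightarrow> 'e \<Rightarrow> 'm" where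
  "cover_in F c \<equiv> coproduct_in A (slice c) (\<lambda>f. FObj F (Cod C f))"

abbreviation cover_arr :: "('c, 'e, 'o, 'm) cfunctor \<Rightarrow> 'e \<Rightarrow> 'm" where
  "cover_arr F u \<equiv> cotuple A (slice (Cod C u)) (\<lambda>f. FObj F (Cod C f)) (cover_ob F (Dom C u)) (\<lambda>f. cover_in F (Dom C u) (Comp C f u))"

text \<open>The left Kan extension, along the inclusion of the objects as a discrete category, of
  the restriction of \<open>F\<close>; \<open>cover\<close> is the counit. An arrow \<open>u\<close>
  moves the summand of \<open>f\<close> to that of \<open>Comp C f u\<close> by the
  identity.\<close>

definition Cover :: "('c, 'e, 'o, 'm) cfunctor \<Rightarrow> ('c, 'e, 'o, 'm) cfunctor" where
  "Cover F = \<lparr>FObj = \<lambda>c\<in>Obj C. cover_ob F c, FArr = \<lambda>u\<in>Arr C. cover_arr F u\<rparr>"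

definition cover :: "('c, 'e, 'o, 'm) cfunctor \<Rightarrow> ('c, 'e, 'o, 'm) nat_trans" where
  "cover F = (Cover F, \<lambda>c\<in>Obj C. cotuple A (slice c) (\<lambda>f. FObj F (Cod C f)) (FObj F c) (FArr F), F)"

definition cover_map :: "('c, 'e, 'o, 'm) nat_trans \<Rightarrow> ('c, 'e, 'o, 'm) nat_trans" where
  "cover_map \<alpha> = (Cover (Dom K \<alpha>), \<lambda>c\<in>Obj C. cotuple A (slice c) (\<lambda>f. FObj (Dom K \<alpha>) (Cod C f))
     (cover_ob (Cod K \<alpha>) c) (\<lambda>f. cover_in (Cod K \<alpha>) c f \<cdot> \<alpha> $ Cod C f), Cover (Cod K \<alpha>))"

lemma cover_ob_coproduct:
  assumes "is_functor (op_cat C) A F"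
  shows "is_coproduct A (slice c) (\<lambda>f. FObj F (Cod C f)) (cover_ob F c) (cover_in F c)"
  by (rule small_coproduct[OF coproducts small_subset[OF _ small_Arr]]) (use contraD(1)[OF assms] in auto)

lemma cover_in_arr:
  assumes "is_functor (op_cat C) A F" "f \<in> Arr C" "Dom C f = c"
  shows "cover_in F c f \<in> Arr A" "Dom A (cover_in F c f) = FObj F (Cod C f)" "Cod A (cover_in F c f) = cover_ob F c"
  using coproductD(2-4)[OF cover_ob_coproduct[OF assms(1), of c], of f] assms by auto

lemma cover_ob_Obj: "is_functor (op_cat C) A F \<Longrightarrow> cover_ob F c \<in> Obj A"
  using coproductD(1)[OF cover_ob_coproduct] .

lemma cover_arr:
  assumes F: "is_functor (op_cat C) A F" and u: "u \<in> Arr C"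
  shows "cover_arr F u \<in> Arr A" "Dom A (cover_arr F u) = cover_ob F (Cod C u)" "Cod A (cover_arr F u) = cover_ob F (Dom C u)"
    "f \<in> Arr C \<Longrightarrow> Dom C f = Cod C u \<Longrightarrow> cover_arr F u \<cdot> cover_in F (Cod C u) f = cover_in F (Dom C u) (Comp C f u)"
proof -
  have "cover_in F (Dom C u) (Comp C f u) \<in> Arr A \<and> Dom A (cover_in F (Dom C u) (Comp C f u)) = FObj F (Cod C f) \<and>
    Cod A (cover_in F (Dom C u) (Comp C f u)) = cover_ob F (Dom C u)" if "f \<in> slice (Cod C u)" for f
    using cover_in_arr[OF F, of "Comp C f u" "Dom C u"] u that by simp
  note c = cotuple[OF cover_ob_coproduct[OF F, of "Cod C u"] cover_ob_Obj[OF F] this]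
  show "cover_arr F u \<in> Arr A" "Dom A (cover_arr F u) = cover_ob F (Cod C u)" "Cod A (cover_arr F u) = cover_ob F (Dom C u)"
    using c(1-3) by auto
  show "f \<in> Arr C \<Longrightarrow> Dom C f = Cod C u \<Longrightarrow> cover_arr F u \<cdot> cover_in F (Cod C u) f = cover_in F (Dom C u) (Comp C f u)"
    using c(4) by simp
qed

lemma Cover:
  assumes F: "is_functor (op_cat C) A F"
  shows "is_functor (op_cat C) A (Cover F)"
proof -
  have "is_functor (op_cat C) A \<lparr>FObj = restrict (cover_ob F) (Obj (op_cat C)), FArr = restrict (cover_arr F) (Arr (op_cat C))\<rparr>"
  proof (rule functorI)
    fix c assume "c \<in> Obj (op_cat C)"
    then have c: "c \<in> Obj C" by simp
    note i = cover_arr[OF F, of "Ident C c"]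
    show "cover_arr F (Ident (op_cat C) c) = Ident A (cover_ob F c)"
      by (rule coproduct_ext[OF cover_ob_coproduct[OF F, of c]]) (use i c cover_in_arr[OF F] cover_ob_Obj[OF F] in auto)
  next
    fix e e' assume "e \<in> Arr (op_cat C)" "e' \<in> Arr (op_cat C)" "Cod (op_cat C) e = Dom (op_cat C) e'"
    then have e: "e \<in> Arr C" "e' \<in> Arr C" "Dom C e = Cod C e'" by auto
    have ee: "Comp C e e' \<in> Arr C" "Dom C (Comp C e e') = Dom C e'" "Cod C (Comp C e e') = Cod C e"
      using e by auto
    note P = cover_arr[OF F e(1)] and P' = cover_arr[OF F e(2)] and Q = cover_arr[OF F ee(1)]
    have "cover_arr F (Comp C e e') = cover_arr F e' \<cdot> cover_arr F e"
    proof (rule coproduct_ext[OF cover_ob_coproduct[OF F, of "Cod C e"]])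
      fix f assume "f \<in> slice (Cod C e)"
      then have f: "f \<in> Arr C" "Dom C f = Cod C e" by auto
      show "cover_arr F (Comp C e e') \<cdot> cover_in F (Cod C e) f = (cover_arr F e' \<cdot> cover_arr F e) \<cdot> cover_in F (Cod C e) f"
        using P(1-3) P(4)[OF f] P'(1-3) P'(4)[of "Comp C f e"] Q(4)[OF f(1)] f e ee cover_in_arr[OF F f] by simp
    qed (use P(1-3) P'(1-3) Q(1-3) e ee in auto)
    then show "cover_arr F (Comp (op_cat C) e' e) = cover_arr F e' \<cdot> cover_arr F e" by simp
  qed (use cover_ob_Obj[OF F] cover_arr(1-3)[OF F] in auto)
  then show ?thesis by (simp add: Cover_def)
qed

lemma Cover_simps:
  "c \<in> Obj C \<Longrightarrow> FObj (Cover F) c = cover_ob F c" "u \<in> Arr C \<Longrightarrow> FArr (Cover F) u = cover_arr F u"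
  by (simp_all add: Cover_def)

lemma cover:
  assumes F: "is_functor (op_cat C) A F"
  shows "cover F \<in> Arr K" "Dom K (cover F) = Cover F" "Cod K (cover F) = F"
    "c \<in> Obj C \<Longrightarrow> f \<in> Arr C \<Longrightarrow> Dom C f = c \<Longrightarrow> cover F $ c \<cdot> cover_in F c f = FArr F f"
    "c \<in> Obj C \<Longrightarrow> is_epi A (cover F $ c)"
proof -
  let ?p = "\<lambda>c. cotuple A (slice c) (\<lambda>f. FObj F (Cod C f)) (FObj F c) (FArr F)"
  have p: "?p c \<in> Arr A" "Dom A (?p c) = cover_ob F c" "Cod A (?p c) = FObj F c"
    "f \<in> Arr C \<Longrightarrow> Dom C f = c \<Longrightarrow> ?p c \<cdot> cover_in F c f = FArr F f" if c: "c \<in> Obj C" for c f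
  proof -
    have "FArr F f \<in> Arr A \<and> Dom A (FArr F f) = FObj F (Cod C f) \<and> Cod A (FArr F f) = FObj F c" if "f \<in> slice c" for f
      using that contraD[OF F] by simp
    note k = cotuple[OF cover_ob_coproduct[OF F, of c] contraD(1)[OF F c] this]
    show "?p c \<in> Arr A" "Dom A (?p c) = cover_ob F c" "Cod A (?p c) = FObj F c"
      "f \<in> Arr C \<Longrightarrow> Dom C f = c \<Longrightarrow> ?p c \<cdot> cover_in F c f = FArr F f" using k by auto
  qed
  have "(Cover F, restrict ?p (Obj (op_cat C)), F) \<in> Arr K"
  proof (rule K_arrI[OF Cover[OF F] F])
    fix u assume "u \<in> Arr (op_cat C)"
    then have u: "u \<in> Arr C" by simp
    have o: "Dom C u \<in> Obj C" "Cod C u \<in> Obj C" using u by auto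
    note P = cover_arr[OF F u] and p1 = p[OF o(1)] and p2 = p[OF o(2)] and Fu = contraD(2-4)[OF F u]
    have "?p (Dom C u) \<cdot> cover_arr F u = FArr F u \<cdot> ?p (Cod C u)"
    proof (rule coproduct_ext[OF cover_ob_coproduct[OF F, of "Cod C u"]])
      fix f assume "f \<in> slice (Cod C u)"
      then have f: "f \<in> Arr C" "Dom C f = Cod C u" by auto
      show "(?p (Dom C u) \<cdot> cover_arr F u) \<cdot> cover_in F (Cod C u) f = (FArr F u \<cdot> ?p (Cod C u)) \<cdot> cover_in F (Cod C u) f"
        using P(1-3) P(4)[OF f] p1(1-3) p1(4)[of "Comp C f u"] p2(1-3) p2(4)[OF f] Fu f u cover_in_arr[OF F f]
          contraD(6)[OF F u f(1)] by simp
    qed (use P(1-3) p1(1-3) p2(1-3) Fu in auto)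
    then show "?p (Cod (op_cat C) u) \<cdot> FArr (Cover F) u = FArr F u \<cdot> ?p (Dom (op_cat C) u)"
      using u by (simp add: Cover_simps)
  qed (use p Cover_simps in auto)
  then show "cover F \<in> Arr K" by (simp add: cover_def)
  show "Dom K (cover F) = Cover F" "Cod K (cover F) = F" by (simp_all add: cover_def)
  show *: "c \<in> Obj C \<Longrightarrow> f \<in> Arr C \<Longrightarrow> Dom C f = c \<Longrightarrow> cover F $ c \<cdot> cover_in F c f = FArr F f" for c f
    using p(4) by (simp add: cover_def)
  assume c: "c \<in> Obj C"
  have i: "Ident C c \<in> Arr C" "Dom C (Ident C c) = c" "Cod C (Ident C c) = c" using c by auto
  \<comment> \<open>The summand at the identity arrow maps identically to \<open>FObj F c\<close>,
    so the counit is split at each object.\<close>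
  have "is_epi A (cover F $ c \<cdot> cover_in F c (Ident C c))"
    using *[OF c i(1,2)] contraD(1,5)[OF F c] epi_Ident by simp
  then show "is_epi A (cover F $ c)"
    by (rule epi_right_factor) (use p[OF c] c cover_in_arr[OF F i(1,2)] in \<open>auto simp: cover_def\<close>)
qed

text \<open>\<alpha> acts on the summand of \<open>f\<close> through its component at the codomain
  of \<open>f\<close>; naturality of \<alpha> at \<open>f\<close> makes the square with the two
  counits commute.\<close>

lemma cover_map:
  assumes a: "\<alpha> \<in> Arr K"
  shows "cover_map \<alpha> \<in> Hom K (Cover (Dom K \<alpha>)) (Cover (Cod K \<alpha>))" "Comp K (cover (Cod K \<alpha>)) (cover_map \<alpha>) = Comp K \<alpha> (cover (Dom K \<alpha>))"
proof -
  note aD = K_arrD[OF a] note F = aD(1) and G = aD(2)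
  let ?F = "Dom K \<alpha>" and ?G = "Cod K \<alpha>"
  let ?p = "\<lambda>c. cotuple A (slice c) (\<lambda>f. FObj ?F (Cod C f)) (cover_ob ?G c) (\<lambda>f. cover_in ?G c f \<cdot> \<alpha> $ Cod C f)"
  have p: "?p c \<in> Arr A" "Dom A (?p c) = cover_ob ?F c" "Cod A (?p c) = cover_ob ?G c"
    "f \<in> Arr C \<Longrightarrow> Dom C f = c \<Longrightarrow> ?p c \<cdot> cover_in ?F c f = cover_in ?G c f \<cdot> \<alpha> $ Cod C f" for c f
  proof -
    have "cover_in ?G c f \<cdot> \<alpha> $ Cod C f \<in> Arr A \<and> Dom A (cover_in ?G c f \<cdot> \<alpha> $ Cod C f) = FObj ?F (Cod C f) \<and>
      Cod A (cover_in ?G c f \<cdot> \<alpha> $ Cod C f) = cover_ob ?G c" if "f \<in> slice c" for f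
      using that cover_in_arr[OF G, of f c] aD(3-5)[of "Cod C f"] by simp
    note k = cotuple[OF cover_ob_coproduct[OF F, of c] cover_ob_Obj[OF G] this]
    show "?p c \<in> Arr A" "Dom A (?p c) = cover_ob ?F c" "Cod A (?p c) = cover_ob ?G c"
      "f \<in> Arr C \<Longrightarrow> Dom C f = c \<Longrightarrow> ?p c \<cdot> cover_in ?F c f = cover_in ?G c f \<cdot> \<alpha> $ Cod C f" using k by auto
  qed
  have "(Cover ?F, restrict ?p (Obj (op_cat C)), Cover ?G) \<in> Arr K"
  proof (rule K_arrI[OF Cover[OF F] Cover[OF G]])
    fix u assume "u \<in> Arr (op_cat C)"
    then have u: "u \<in> Arr C" by simp
    note P = cover_arr[OF F u] and Q = cover_arr[OF G u] and p1 = p(1-3)[of "Dom C u"] p(4)[of _ "Dom C u"] and p2 = p(1-3)[of "Cod C u"] p(4)[of _ "Cod C u"]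
    have "?p (Dom C u) \<cdot> cover_arr ?F u = cover_arr ?G u \<cdot> ?p (Cod C u)"
    proof (rule coproduct_ext[OF cover_ob_coproduct[OF F, of "Cod C u"]])
      fix f assume "f \<in> slice (Cod C u)"
      then have f: "f \<in> Arr C" "Dom C f = Cod C u" by auto
      have af: "\<alpha> $ Cod C f \<in> Arr A" "Dom A (\<alpha> $ Cod C f) = FObj ?F (Cod C f)" "Cod A (\<alpha> $ Cod C f) = FObj ?G (Cod C f)"
        using aD(3-5)[of "Cod C f"] f by auto
      note pf = cover_in_arr[OF F f] and pg = cover_in_arr[OF G f]
      have "cover_arr ?G u \<cdot> cover_in ?G (Cod C u) f \<cdot> \<alpha> $ Cod C f = cover_in ?G (Dom C u) (Comp C f u) \<cdot> \<alpha> $ Cod C f"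
        by (rule Comp_eq_extend[OF Q(4)[OF f]]) (use af pg Q(1-3) in auto)
      then show "(?p (Dom C u) \<cdot> cover_arr ?F u) \<cdot> cover_in ?F (Cod C u) f = (cover_arr ?G u \<cdot> ?p (Cod C u)) \<cdot> cover_in ?F (Cod C u) f"
        using P(1-3) P(4)[OF f] Q(1-3) p1(1-3) p1(4)[of "Comp C f u"] p2(1-3) p2(4)[OF f] f u pf by simp
    qed (use P(1-3) Q(1-3) p1(1-3) p2(1-3) in auto)
    then show "?p (Cod (op_cat C) u) \<cdot> FArr (Cover ?F) u = FArr (Cover ?G) u \<cdot> ?p (Dom (op_cat C) u)"
      using u by (simp add: Cover_simps)
  qed (use p Cover_simps in auto)
  then have mK: "cover_map \<alpha> \<in> Arr K" by (simp add: cover_map_def)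
  have md: "Dom K (cover_map \<alpha>) = Cover ?F" "Cod K (cover_map \<alpha>) = Cover ?G" by (simp_all add: cover_map_def)
  show "cover_map \<alpha> \<in> Hom K (Cover ?F) (Cover ?G)" using mK md by (simp add: in_Hom)
  note pF = cover[OF F] and pG = cover[OF G]
  note c1 = Comp_K[OF mK pG(1)] and c2 = Comp_K[OF pF(1) a]
  show "Comp K (cover ?G) (cover_map \<alpha>) = Comp K \<alpha> (cover ?F)"
  proof (rule K_arr_eqI)
    fix c assume c': "c \<in> Obj (op_cat C)"
    then have c: "c \<in> Obj C" by simp
    have mc: "cover_map \<alpha> $ c = ?p c" using c by (simp add: cover_map_def)
    have g: "cover ?G $ c \<in> Arr A" "Dom A (cover ?G $ c) = cover_ob ?G c" "Cod A (cover ?G $ c) = FObj ?G c"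
      using K_arrD(3-5)[OF pG(1)] pG(2,3) c Cover_simps by auto
    have h: "cover ?F $ c \<in> Arr A" "Dom A (cover ?F $ c) = cover_ob ?F c" "Cod A (cover ?F $ c) = FObj ?F c"
      using K_arrD(3-5)[OF pF(1)] pF(2,3) c Cover_simps by auto
    have ac: "\<alpha> $ c \<in> Arr A" "Dom A (\<alpha> $ c) = FObj ?F c" "Cod A (\<alpha> $ c) = FObj ?G c" using aD(3-5) c by auto
    have "cover ?G $ c \<cdot> ?p c = \<alpha> $ c \<cdot> cover ?F $ c"
    proof (rule coproduct_ext[OF cover_ob_coproduct[OF F, of c]])
      fix f assume "f \<in> slice c"
      then have f: "f \<in> Arr C" "Dom C f = c" by auto
      have af: "\<alpha> $ Cod C f \<in> Arr A" "Dom A (\<alpha> $ Cod C f) = FObj ?F (Cod C f)" "Cod A (\<alpha> $ Cod C f) = FObj ?G (Cod C f)"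
        using aD(3-5)[of "Cod C f"] f by auto
      note qf = cover_in_arr[OF F f] and qg = cover_in_arr[OF G f]
      have "cover ?G $ c \<cdot> cover_in ?G c f \<cdot> \<alpha> $ Cod C f = FArr ?G f \<cdot> \<alpha> $ Cod C f"
        by (rule Comp_eq_extend[OF pG(4)[OF c f]]) (use af qg g in auto)
      also have "\<dots> = \<alpha> $ c \<cdot> FArr ?F f" using aD(6)[of f] f by simp
      finally show "(cover ?G $ c \<cdot> ?p c) \<cdot> cover_in ?F c f = (\<alpha> $ c \<cdot> cover ?F $ c) \<cdot> cover_in ?F c f"
        using p(1-3)[of c] p(4)[OF f] g h ac qf pF(4)[OF c f] by simp
    qed (use p(1-3)[of c] g h ac in auto)
    then show "Comp K (cover ?G) (cover_map \<alpha>) $ c = Comp K \<alpha> (cover ?F) $ c"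
      using c1(4)[OF _ c'] c2(4)[OF _ c'] md pF(2,3) pG(2,3) mc by simp
  qed (use c1 c2 md pF(2,3) pG(2,3) in auto)
qed

section \<open>Contraction of the chains of a cover\<close>

context
  fixes F assumes F: "is_functor (op_cat C) A F"
begin

text \<open>The pairs \<open>(x, f)\<close> are the cubes of slice categories; the chains of the
  cover have one generator, with coefficients at the codomain of \<open>f\<close>, for each of
  them.\<close>

abbreviation "gen n x f \<equiv> normalized_in (Cover F) n x \<cdot> cover_in F (FObj x (top_vertex n)) f"

lemma gen_arr:
  assumes "x \<in> C.cubes n" "f \<in> Arr C" "Dom C f = FObj x (top_vertex n)"
  shows "gen n x f \<in> Arr A" "Dom A (gen n x f) = FObj F (Cod C f)" "Cod A (gen n x f) = Nob (Cover F) n"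
  using normalized_in_arr[OF Cover[OF F] assms(1)] cover_in_arr[OF F assms(2,3)] C.cubesD(1)[OF assms(1) length_top] Cover_simps by auto

lemma gen_ext:
  assumes h: "h \<in> Arr A" "h' \<in> Arr A" "Dom A h = Nob (Cover F) n" "Dom A h' = Nob (Cover F) n" "Cod A h = Cod A h'"
    and eq: "\<And>x f. x \<in> C.cubes n \<Longrightarrow> f \<in> Arr C \<Longrightarrow> Dom C f = FObj x (top_vertex n) \<Longrightarrow> h \<cdot> gen n x f = h' \<cdot> gen n x f"
  shows "h = h'"
proof (rule normalized_in_ext[OF Cover[OF F] h])
  fix x assume "x \<in> nondegenerate n"
  then have x: "x \<in> C.cubes n" by simp
  let ?c = "FObj x (top_vertex n)"
  have c: "?c \<in> Obj C" using C.cubesD(1)[OF x length_top] .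
  note k = normalized_in_arr[OF Cover[OF F] x, unfolded Cover_simps(1)[OF c]]
  show "h \<cdot> normalized_in (Cover F) n x = h' \<cdot> normalized_in (Cover F) n x"
  proof (rule coproduct_ext[OF cover_ob_coproduct[OF F, of ?c]])
    fix f assume f: "f \<in> slice ?c"
    then show "(h \<cdot> normalized_in (Cover F) n x) \<cdot> cover_in F ?c f = (h' \<cdot> normalized_in (Cover F) n x) \<cdot> cover_in F ?c f"
      using eq[OF x, of f] k h cover_in_arr[OF F, of f ?c] by simp
  qed (use k h in auto)
qed

lemma gen_Zro:
  assumes "x \<in> degenerate n" "f \<in> Arr C" "Dom C f = FObj x (top_vertex n)"
  shows "gen n x f = Zro A (FObj F (Cod C f)) (Nob (Cover F) n)"
proof -
  have x: "x \<in> C.cubes n" by (rule degenerate_cubes[OF assms(1)])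
  have c: "FObj x (top_vertex n) \<in> Obj C" using C.cubesD(1)[OF x length_top] .
  show ?thesis
    using normalized_in_degenerate[OF Cover[OF F] assms(1)] cover_in_arr[OF F assms(2,3)] Cover_simps(1)[OF c] Nob_Obj[OF Cover[OF F]] by simp
qed

text \<open>A face leaves the codomain of \<open>f\<close> and the coefficient unchanged and
  composes \<open>f\<close> with the arrow between top vertices. Generators thus behave like cubes
  of a slice with constant coefficients.\<close>

lemma gen_face:
  assumes x: "x \<in> C.cubes n" and f: "f \<in> Arr C" "Dom C f = FObj x (top_vertex n)" and i: "i \<in> {1..n}"
  shows "face (Cover F) n x i \<epsilon> \<cdot> cover_in F (FObj x (top_vertex n)) f =
    gen (n - 1) (pull (n - 1) (ins i \<epsilon>) x) (Comp C f (FArr x (ins i \<epsilon> (top_vertex (n - 1)), top_vertex n)))"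
proof -
  have m: "mono_cube (n - 1) n (ins i \<epsilon>)" using i mono_cube_ins by simp
  note u = top_arrow[OF x m] and y = C.pull_cubes[OF x m] and w = wt_arr[OF Cover[OF F] x m]
  have c: "FObj x (top_vertex n) \<in> Obj C" using C.cubesD(1)[OF x length_top] .
  note k = normalized_in_arr[OF Cover[OF F] y]
  have "wt (Cover F) (n - 1) (ins i \<epsilon>) n x \<cdot> cover_in F (FObj x (top_vertex n)) f =
    cover_in F (FObj (pull (n - 1) (ins i \<epsilon>) x) (top_vertex (n - 1))) (Comp C f (FArr x (ins i \<epsilon> (top_vertex (n - 1)), top_vertex n)))"
    using cover_arr(4)[OF F u(1), of f] u f Cover_simps(2)[OF u(1)] by simp
  then show ?thesis
    using k w cover_in_arr[OF F f] Cover_simps(1)[OF c] by (simp add: face_def[OF Cover[OF F]])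
qed

text \<open>\<open>s\<close> is coning in the slice over the codomain of \<open>f\<close>, whose
  terminal object is the identity. It is constructed on nondegenerate cubes, so the formula on
  degenerate ones needs an argument of its own.\<close>

lemma homotopy_ex:
  obtains s where "s \<in> Arr A" "Dom A s = Nob (Cover F) n" "Cod A s = Nob (Cover F) (Suc n)"
    "\<And>x f. x \<in> C.cubes n \<Longrightarrow> f \<in> Arr C \<Longrightarrow> Dom C f = FObj x (top_vertex n) \<Longrightarrow>
       s \<cdot> gen n x f = gen (Suc n) (C.cone n x f) (Ident C (Cod C f))"
proof -
  let ?q = "\<lambda>x f. gen (Suc n) (C.cone n x f) (Ident C (Cod C f))"
  have top: "FObj (C.cone n x f) (top_vertex (Suc n)) = Cod C f" for x f
    by (simp add: top_snoc)
  have q: "?q x f \<in> Arr A \<and> Dom A (?q x f) = FObj F (Cod C f) \<and> Cod A (?q x f) = Nob (Cover F) (Suc n)"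
    if "x \<in> C.cubes n" "f \<in> Arr C" "Dom C f = FObj x (top_vertex n)" for x f
    using gen_arr[OF C.cone_cubes[OF that], of "Ident C (Cod C f)"] top that by simp
  let ?T = "\<lambda>x t. t \<in> Arr A \<and> Dom A t = vt (Cover F) n x \<and> Cod A t = Nob (Cover F) (Suc n) \<and>
      (\<forall>f\<in>slice (FObj x (top_vertex n)). t \<cdot> cover_in F (FObj x (top_vertex n)) f = ?q x f)"
  have "\<exists>t. ?T x t" if x: "x \<in> C.cubes n" for x
  proof -
    have c: "FObj x (top_vertex n) \<in> Obj C" using C.cubesD(1)[OF x length_top] .
    obtain t where t: "t \<in> Arr A" "Dom A t = cover_ob F (FObj x (top_vertex n))" "Cod A t = Nob (Cover F) (Suc n)"
      "\<And>f. f \<in> slice (FObj x (top_vertex n)) \<Longrightarrow> t \<cdot> cover_in F (FObj x (top_vertex n)) f = ?q x f"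
    proof (rule coproduct_desc[OF cover_ob_coproduct[OF F, of "FObj x (top_vertex n)"] Nob_Obj[OF Cover[OF F], of "Suc n"]])
      fix f assume "f \<in> slice (FObj x (top_vertex n))"
      then show "?q x f \<in> Arr A \<and> Dom A (?q x f) = FObj F (Cod C f) \<and> Cod A (?q x f) = Nob (Cover F) (Suc n)"
        by (intro q[OF x]) auto
    qed (rule that)
    then show ?thesis using Cover_simps(1)[OF c] by (intro exI[of _ t]) simp
  qed
  then have "\<forall>x\<in>C.cubes n. \<exists>t. ?T x t" by blast
  then obtain t where "\<forall>x\<in>C.cubes n. ?T x (t x)" by (rule exE[OF bchoice])
  then have t: "?T x (t x)" if "x \<in> C.cubes n" for x using that by blast
  obtain s where s: "s \<in> Arr A" "Dom A s = Nob (Cover F) n" "Cod A s = Nob (Cover F) (Suc n)"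
    "\<And>x. x \<in> nondegenerate n \<Longrightarrow> s \<cdot> normalized_in (Cover F) n x = t x"
    using coproduct_desc[OF normalized_coproduct[OF Cover[OF F], of n] Nob_Obj[OF Cover[OF F], of "Suc n"], of t] t by auto
  have "s \<cdot> gen n x f = ?q x f" if x: "x \<in> C.cubes n" and f: "f \<in> Arr C" "Dom C f = FObj x (top_vertex n)" for x f
  proof (cases "x \<in> degenerate n")
    case True
    then obtain i y where iy: "1 \<le> i" "i \<le> n" "y \<in> C.cubes (n - 1)" "x = pull n (del i) y"
      by (auto simp: degenerate_def)
    then obtain m where n: "n = Suc m" by (cases n) auto
    have md: "mono_cube n m (del i)" using mono_cube_del[OF iy(1,2)] n by simp
    have y: "y \<in> C.cubes m" using iy n by simp
    have fy: "Dom C f = FObj y (top_vertex m)" using f iy n del_top[of i n] by simp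
    \<comment> \<open>A cube degenerate in direction \<open>i\<close> has a cone degenerate in the
      same direction, so both sides of the formula vanish.\<close>
    have "pull (Suc n) (del i) (C.cone m y f) = C.cone n (pull n (del i) y) (Comp C f (FArr y (del i (top_vertex n), top_vertex m)))"
    proof (rule C.pull_cone[OF y f(1) fy md])
      show "mono_cube (Suc n) (Suc m) (del i)" using mono_cube_del[of i "Suc n"] iy n by simp
    qed (use iy n del_snoc in auto)
    also have "Comp C f (FArr y (del i (top_vertex n), top_vertex m)) = f"
      using C.cubesD(1,5)[OF y length_top] del_top[of i n] iy n f(1) fy by simp
    finally have "C.cone n x f = pull (Suc n) (del i) (C.cone m y f)" using iy by simp
    then have "C.cone n x f \<in> degenerate (Suc n)"
      using degenerateI[of "C.cone m y f" "Suc n" i] C.cone_cubes[OF y f(1) fy] iy n by simp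
    then have "?q x f = Zro A (FObj F (Cod C f)) (Nob (Cover F) (Suc n))"
      using gen_Zro[of "C.cone n x f" "Suc n" "Ident C (Cod C f)"] top f by simp
    then show ?thesis using gen_Zro[OF True f] s(1-3) contraD(1)[OF F, of "Cod C f"] f by simp
  next
    case False
    have c: "FObj x (top_vertex n) \<in> Obj C" using C.cubesD(1)[OF x length_top] .
    have "s \<cdot> normalized_in (Cover F) n x \<cdot> cover_in F (FObj x (top_vertex n)) f = t x \<cdot> cover_in F (FObj x (top_vertex n)) f"
      by (rule Comp_eq_extend[OF s(4)])
        (use False x s(1-3) normalized_in_arr[OF Cover[OF F] x] cover_in_arr[OF F f] Cover_simps(1)[OF c] in auto)
    then show ?thesis using t[OF x] f by simp
  qed
  then show ?thesis using that s(1-3) by blast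
qed

text \<open>Coning in two adjacent degrees gives \<open>d s = sg 1 + r d\<close>: the old faces of a
  cone contribute \<open>r d\<close>, the new faces contribute the cube with a sign and a degenerate
  cube. So a cycle \<open>c\<close> is, up to sign, the boundary of
  \<open>s \<cdot> c\<close>.\<close>

lemma cub_homology_acyclic:
  assumes a: "a \<in> Arr A" "Cod A a = FObj (cub_homology (Suc n)) (Cover F)"
  shows "a = Zro A (Dom A a) (Cod A a)"
proof -
  let ?P = "Cover F" let ?m = "Suc n"
  note P = Cover[OF F] note X = cplxD(3)[OF cplx_nd[OF P], of ?m]
  have ca: "Cod A a = Hob (nd ?P) ?m" using a cub_homology_simps(1)[OF P] by simp
  obtain s where s: "s \<in> Arr A" "Dom A s = Nob ?P ?m" "Cod A s = Nob ?P (Suc ?m)"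
    "\<And>x f. x \<in> C.cubes ?m \<Longrightarrow> f \<in> Arr C \<Longrightarrow> Dom C f = FObj x (top_vertex ?m) \<Longrightarrow>
       s \<cdot> gen ?m x f = gen (Suc ?m) (C.cone ?m x f) (Ident C (Cod C f))" using homotopy_ex by blast
  obtain r where r: "r \<in> Arr A" "Dom A r = Nob ?P n" "Cod A r = Nob ?P ?m"
    "\<And>x f. x \<in> C.cubes n \<Longrightarrow> f \<in> Arr C \<Longrightarrow> Dom C f = FObj x (top_vertex n) \<Longrightarrow>
       r \<cdot> gen n x f = gen ?m (C.cone n x f) (Ident C (Cod C f))" using homotopy_ex by blast
  note d1 = nd(1-3)[OF P, of "Suc ?m"] nd(4)[OF P, of _ "Suc ?m"] and d0 = nd(1-3)[OF P, of ?m] nd(4)[OF P, of _ ?m]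
  \<comment> \<open>The last face of a cone of dimension \<open>Suc ?m\<close> carries the sign
    \<open>(-1) ^ Suc ?m\<close>; as \<open>?m\<close> is \<open>Suc n\<close>, its parity is that
    of \<open>n\<close>.\<close>
  define sg where "sg = (\<lambda>h. if even n then h else neg h)"
  have sg: "h \<in> Arr A \<Longrightarrow> sg h \<in> Arr A \<and> Dom A (sg h) = Dom A h \<and> Cod A (sg h) = Cod A h"
    "h \<in> Arr A \<Longrightarrow> u \<in> Arr A \<Longrightarrow> Cod A u = Dom A h \<Longrightarrow> sg h \<cdot> u = sg (h \<cdot> u)"
    "h \<in> Arr A \<Longrightarrow> u \<in> Arr A \<Longrightarrow> Cod A h = Dom A u \<Longrightarrow> u \<cdot> sg h = sg (u \<cdot> h)" for h u
    by (auto simp: sg_def)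
  have htpy: "nd ?P (Suc ?m) \<cdot> s = Add A (sg (Ident A (Nob ?P ?m))) (r \<cdot> nd ?P ?m)"
  proof (rule gen_ext)
    fix x f assume x: "x \<in> C.cubes ?m" and f: "f \<in> Arr C" "Dom C f = FObj x (top_vertex ?m)"
    let ?z = "C.cone ?m x f" and ?c = "FObj x (top_vertex ?m)" and ?c' = "Cod C f"
    let ?i = "Ident C ?c'" and ?Y = "FObj F ?c'"
    have c: "?c \<in> Obj C" "?c' \<in> Obj C" using C.cubesD(1)[OF x length_top] f by auto
    have i: "?i \<in> Arr C" "Dom C ?i = ?c'" "Cod C ?i = ?c'" using c by auto
    have z: "?z \<in> C.cubes (Suc ?m)" by (rule C.cone_cubes[OF x f])
    have zt: "FObj ?z (top_vertex (Suc ?m)) = ?c'" by (simp add: top_snoc[of ?m])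
    note gx = gen_arr[OF x f] and gz = gen_arr[OF z i(1), unfolded zt, OF i(2)]
    note kz = normalized_in_arr[OF P z, unfolded zt Cover_simps(1)[OF c(2)]] and kx = normalized_in_arr[OF P x, unfolded Cover_simps(1)[OF c(1)]]
    note pz = cover_in_arr[OF F i(1,2)] and px = cover_in_arr[OF F f]
    have mi: "mono_cube (Suc n) (Suc ?m) (ins j \<epsilon>)" if "j \<in> {1..Suc ?m}" for j \<epsilon>
      using mono_cube_ins[of j "Suc ?m" \<epsilon>] that by simp
    let ?D = "\<lambda>j \<epsilon>. face ?P (Suc ?m) ?z j \<epsilon> \<cdot> cover_in F ?c' ?i"
    have D: "?D j \<epsilon> = gen ?m (pull ?m (ins j \<epsilon>) ?z) (Comp C ?i (FArr ?z (ins j \<epsilon> (top_vertex ?m), top_vertex (Suc ?m))))"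
      if "j \<in> {1..Suc ?m}" for j \<epsilon>
      using gen_face[OF z i(1) _ that, of \<epsilon>] zt i(2) by simp
    have Dc: "?D j \<epsilon> \<in> Hom A ?Y (Nob ?P ?m)" if "j \<in> {1..Suc ?m}" for j \<epsilon>
      using face_arr[OF P z that, of \<epsilon>] pz i(3) zt Cover_simps(1)[OF c(2)] by (simp add: in_Hom)
    \<comment> \<open>In an old direction the face of the cone is the cone of the face, and the
      index \<open>j\<close> with its sign is unchanged.\<close>
    have E: "?D j \<epsilon> = r \<cdot> face ?P ?m x j \<epsilon> \<cdot> cover_in F ?c f" if j: "j \<in> {1..?m}" for j \<epsilon>
    proof -
      have j': "j \<in> {1..Suc ?m}" using j by simp
      have mj: "mono_cube n ?m (ins j \<epsilon>)" using mono_cube_ins[of j ?m \<epsilon>] j by simp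
      let ?y = "pull n (ins j \<epsilon>) x" and ?u = "FArr x (ins j \<epsilon> (top_vertex n), top_vertex ?m)"
      note u = top_arrow[OF x mj] and y = C.pull_cubes[OF x mj]
      have fu: "Comp C f ?u \<in> Arr C" "Dom C (Comp C f ?u) = FObj ?y (top_vertex n)" "Cod C (Comp C f ?u) = ?c'"
        using u f by auto
      have pz: "pull ?m (ins j \<epsilon>) ?z = C.cone n ?y (Comp C f ?u)"
        by (rule C.pull_cone[OF x f mj mi[OF j']]) (use j ins_snoc in auto)
      have "ins j \<epsilon> (top_vertex ?m) = ins j \<epsilon> (top_vertex n) @ [True]"
        unfolding top_snoc by (rule ins_snoc) (use j in simp)
      then have hh: "FArr ?z (ins j \<epsilon> (top_vertex ?m), top_vertex (Suc ?m)) = ?i"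
        using mono_cubeD(1)[OF mj, of "top_vertex n"] by (simp add: top_snoc[of ?m])
      have "?D j \<epsilon> = gen ?m (C.cone n ?y (Comp C f ?u)) ?i"
        unfolding D[OF j'] pz hh using i by simp
      also have "\<dots> = r \<cdot> gen n ?y (Comp C f ?u)" using r(4)[OF y fu(1,2)] fu(3) by simp
      also have "\<dots> = r \<cdot> face ?P ?m x j \<epsilon> \<cdot> cover_in F ?c f" using gen_face[OF x f j, of \<epsilon>] by simp
      finally show ?thesis .
    qed
    have il: "ins (Suc ?m) \<epsilon> v = v @ [\<epsilon>]" if "length v = ?m" for \<epsilon> v using ins_last[of v \<epsilon>] that by simp
    have l: "Suc ?m \<in> {1..Suc ?m}" by simp
    have DF: "?D (Suc ?m) False = gen ?m x f"
    proof -
      have "pull ?m (ins (Suc ?m) False) ?z = x"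
      proof (rule C.cubes_eqI[OF C.pull_cubes[OF z mi[OF l]] x])
      qed (use il in auto)
      moreover have "FArr ?z (ins (Suc ?m) False (top_vertex ?m), top_vertex (Suc ?m)) = f"
        unfolding il[OF length_top] top_snoc[of ?m]
        using C.cubesD(5)[OF x length_top] f by simp
      ultimately show ?thesis using D[OF l, of False] f by simp
    qed
    \<comment> \<open>This face is constant at the codomain of \<open>f\<close>. Its dimension
      \<open>?m\<close> is positive, so it is degenerate in direction 1; for this the acyclicity is
      restricted to degrees \<open>Suc n\<close>.\<close>
    have DT: "?D (Suc ?m) True = Zro A ?Y (Nob ?P ?m)"
    proof -
      let ?w = "pull ?m (ins (Suc ?m) True) ?z"
      have w: "?w \<in> C.cubes ?m" by (rule C.pull_cubes[OF z mi[OF l]])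
      have d: "mono_cube ?m n (del 1)" using mono_cube_del[of 1 ?m] by simp
      \<comment> \<open>All vertices of \<open>?w\<close> agree, so a restriction of it to one
        dimension less serves as the cube of which it is the degeneracy.\<close>
      let ?base = "pull n (\<lambda>v. v @ [False]) ?w"
      have a0: "mono_cube n ?m (\<lambda>v. v @ [False])" by (auto simp: mono_cube_def le_snoc)
      have w0: "?base \<in> C.cubes n" by (rule C.pull_cubes[OF w a0])
      have "?w = pull ?m (del 1) ?base"
      proof (rule C.cubes_eqI[OF w C.pull_cubes[OF w0 d]])
        fix v :: "bool list" assume v: "length v = ?m"
        have "length (del 1 v) = n" using v by (simp add: length_del)
        then show "FObj ?w v = FObj (pull ?m (del 1) ?base) v" using v il by (simp del: append_assoc)
      next
        fix v w' :: "bool list" assume v: "length v = ?m" "length w' = ?m" "le v w'"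
        have "length (del 1 v) = n" "length (del 1 w') = n" "le (del 1 v) (del 1 w')"
          using v by (simp_all add: length_del del_mono)
        then show "FArr ?w (v, w') = FArr (pull ?m (del 1) ?base) (v, w')" using v il by (simp add: le_snoc del: append_assoc)
      qed
      then have "?w \<in> degenerate ?m" using degenerateI[of ?base ?m 1] w0 by simp
      moreover have "FArr ?z (ins (Suc ?m) True (top_vertex ?m), top_vertex (Suc ?m)) = ?i"
        unfolding il[OF length_top] top_snoc[of ?m] by simp
      moreover have "FObj ?w (top_vertex ?m) = ?c'" using il by simp
      ultimately show ?thesis using D[OF l, of True] gen_Zro[of ?w ?m ?i] i by simp
    qed
    let ?H = "hom_group A ?Y (Nob ?P ?m)"
    have Y: "?Y \<in> Obj A" using contraD(1)[OF F c(2)] .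
    interpret H: comm_group ?H using hom_comm_group Y Nob_Obj[OF P] by simp
    have zP: "vt ?P (Suc ?m) ?z = cover_ob F ?c'" unfolding zt by (rule Cover_simps(1)[OF c(2)])
    have xP: "vt ?P ?m x = cover_ob F ?c" by (rule Cover_simps(1)[OF c(1)])
    note fz = face_arr[OF P z, unfolded zP] and fx = face_arr[OF P x, unfolded xP]
    have "(nd ?P (Suc ?m) \<cdot> s) \<cdot> gen ?m x f = nd ?P (Suc ?m) \<cdot> s \<cdot> gen ?m x f"
      by (rule Comp_assoc') (use s(1-3) d1(1-3) gx in auto)
    also have "\<dots> = nd ?P (Suc ?m) \<cdot> normalized_in ?P (Suc ?m) ?z \<cdot> cover_in F ?c' ?i"
      unfolding s(4)[OF x f] zt ..
    also have "\<dots> = asum (cover_ob F ?c') (Nob ?P ?m) (face ?P (Suc ?m) ?z) (Suc ?m) \<cdot> cover_in F ?c' ?i"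
      by (rule Comp_eq_extend) (use d1(4)[OF z, unfolded zP] kz d1(1-3) pz i(3) in auto)
    also have "\<dots> = asum ?Y (Nob ?P ?m) ?D (Suc ?m)"
      by (rule Comp_asum_right) (use pz i(3) fz Nob_Obj[OF P] in \<open>auto simp: in_Hom\<close>)
    also have "\<dots> = Add A ((?D (Suc ?m) False \<otimes>\<^bsub>?H\<^esub> inv\<^bsub>?H\<^esub> ?D (Suc ?m) True) [^]\<^bsub>?H\<^esub> ((-1 :: int) ^ Suc ?m)) (asum ?Y (Nob ?P ?m) ?D ?m)"
      using H.alt_Suc[of ?m ?D] Dc by simp
    also have "(?D (Suc ?m) False \<otimes>\<^bsub>?H\<^esub> inv\<^bsub>?H\<^esub> ?D (Suc ?m) True) [^]\<^bsub>?H\<^esub> ((-1 :: int) ^ Suc ?m) = sg (gen ?m x f)"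
    proof -
      have g: "gen ?m x f \<in> carrier ?H" using gx by (simp add: in_Hom)
      have "?D (Suc ?m) False \<otimes>\<^bsub>?H\<^esub> inv\<^bsub>?H\<^esub> ?D (Suc ?m) True = gen ?m x f \<otimes>\<^bsub>?H\<^esub> inv\<^bsub>?H\<^esub> \<one>\<^bsub>?H\<^esub>"
        unfolding DF DT by simp
      also have "\<dots> = gen ?m x f" using g by (simp del: hom_group_simps)
      finally have "(?D (Suc ?m) False \<otimes>\<^bsub>?H\<^esub> inv\<^bsub>?H\<^esub> ?D (Suc ?m) True) [^]\<^bsub>?H\<^esub> ((-1 :: int) ^ Suc ?m) =
        gen ?m x f [^]\<^bsub>?H\<^esub> ((-1 :: int) ^ Suc ?m)" by (rule arg_cong)
      also have "\<dots> = sg (gen ?m x f)"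
      proof (cases "even n")
        case True
        then have "(-1 :: int) ^ Suc ?m = 1" by simp
        then show ?thesis using True g by (simp add: sg_def del: hom_group_simps power_Suc)
      next
        case False
        then have "(-1 :: int) ^ Suc ?m = - 1" by simp
        then have "gen ?m x f [^]\<^bsub>?H\<^esub> ((-1 :: int) ^ Suc ?m) = inv\<^bsub>?H\<^esub> gen ?m x f"
          using g H.int_pow_neg[OF g, of 1] by (simp del: hom_group_simps power_Suc)
        then show ?thesis using False gx by (simp add: sg_def neg_def del: power_Suc)
      qed
      finally show ?thesis .
    qed
    also have "asum ?Y (Nob ?P ?m) ?D ?m = r \<cdot> nd ?P ?m \<cdot> gen ?m x f"
    proof -
      have "asum ?Y (Nob ?P ?m) ?D ?m = asum ?Y (Nob ?P ?m) (\<lambda>j \<epsilon>. r \<cdot> face ?P ?m x j \<epsilon> \<cdot> cover_in F ?c f) ?m"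
        by (rule asum_cong) (use Y Nob_Obj[OF P] E fx px r(1-3) in \<open>auto simp: in_Hom\<close>)
      also have "\<dots> = r \<cdot> asum ?Y (Nob ?P n) (\<lambda>j \<epsilon>. face ?P ?m x j \<epsilon> \<cdot> cover_in F ?c f) ?m"
        by (rule Comp_asum_left[symmetric]) (use Y fx px r(1-3) in \<open>auto simp: in_Hom\<close>)
      also have "asum ?Y (Nob ?P n) (\<lambda>j \<epsilon>. face ?P ?m x j \<epsilon> \<cdot> cover_in F ?c f) ?m =
        asum (cover_ob F ?c) (Nob ?P n) (face ?P ?m x) ?m \<cdot> cover_in F ?c f"
        by (rule Comp_asum_right[symmetric]) (use px fx Nob_Obj[OF P] in \<open>auto simp: in_Hom\<close>)
      also have "\<dots> = nd ?P ?m \<cdot> normalized_in ?P ?m x \<cdot> cover_in F ?c f"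
        by (rule Comp_eq_extend[symmetric]) (use d0(4)[OF x, unfolded xP] kx d0(1-3) px in auto)
      finally show ?thesis .
    qed
    finally have lhs: "(nd ?P (Suc ?m) \<cdot> s) \<cdot> gen ?m x f = Add A (sg (gen ?m x f)) (r \<cdot> nd ?P ?m \<cdot> gen ?m x f)" .
    have t1: "sg (Ident A (Nob ?P ?m)) \<cdot> gen ?m x f = sg (gen ?m x f)"
      using sg(2)[of "Ident A (Nob ?P ?m)" "gen ?m x f"] gx Nob_Obj[OF P] by simp
    have t2: "(r \<cdot> nd ?P ?m) \<cdot> gen ?m x f = r \<cdot> nd ?P ?m \<cdot> gen ?m x f"
      by (rule Comp_assoc') (use gx r(1-3) d0(1-3) in auto)
    have "Add A (sg (Ident A (Nob ?P ?m))) (r \<cdot> nd ?P ?m) \<cdot> gen ?m x f =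
      Add A (sg (Ident A (Nob ?P ?m)) \<cdot> gen ?m x f) ((r \<cdot> nd ?P ?m) \<cdot> gen ?m x f)"
      by (rule Comp_Add(1)) (use gx sg(1)[of "Ident A (Nob ?P ?m)"] r(1-3) d0(1-3) Nob_Obj[OF P] in auto)
    then show "(nd ?P (Suc ?m) \<cdot> s) \<cdot> gen ?m x f = Add A (sg (Ident A (Nob ?P ?m))) (r \<cdot> nd ?P ?m) \<cdot> gen ?m x f"
      unfolding lhs t1 t2 by (rule sym)
  qed (use s(1-3) r(1-3) d1(1-3) d0(1-3) sg(1)[of "Ident A (Nob ?P ?m)"] Nob_Obj[OF P] in auto)
  obtain e c where e: "is_epi A e" "e \<in> Arr A" "Cod A e = Dom A a" "cyc (nd ?P ?m) c" "Dom A c = Dom A e"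
    "hcl (nd ?P) ?m c = a \<cdot> e" using cls_cover[OF X a(1) ca] .
  note c = cycD[OF e(4), unfolded d0(2,3)]
  have "nd ?P (Suc ?m) \<cdot> s \<cdot> c = Add A (sg (Ident A (Nob ?P ?m))) (r \<cdot> nd ?P ?m) \<cdot> c"
    by (rule Comp_eq_extend[OF htpy]) (use c s(1-3) d1(1-3) in auto)
  also have "\<dots> = Add A (sg (Ident A (Nob ?P ?m)) \<cdot> c) ((r \<cdot> nd ?P ?m) \<cdot> c)"
    by (rule Comp_Add(1)) (use c sg(1)[of "Ident A (Nob ?P ?m)"] r(1-3) d0(1-3) Nob_Obj[OF P] in auto)
  also have "(r \<cdot> nd ?P ?m) \<cdot> c = Zro A (Dom A c) (Nob ?P ?m)"
    using c r(1-3) d0(1-3) by simp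
  also have "sg (Ident A (Nob ?P ?m)) \<cdot> c = sg c"
    using sg(2)[of "Ident A (Nob ?P ?m)" c] c Nob_Obj[OF P] by simp
  also have "Add A (sg c) (Zro A (Dom A c) (Nob ?P ?m)) = sg c" using sg(1)[OF c(2)] c by simp
  finally have dsc: "nd ?P (Suc ?m) \<cdot> s \<cdot> c = sg c" .
  have sc: "s \<cdot> c \<in> Arr A" "Dom A (s \<cdot> c) = Dom A c" "Cod A (s \<cdot> c) = Nob ?P (Suc ?m)" using s(1-3) c by auto
  have "neg (neg c) = c"
    by (rule neg_unique[symmetric, of _ _ "Dom A c" "Cod A c"]) (use c in simp_all)
  then have "sg (sg c) = c" by (simp add: sg_def)
  \<comment> \<open>Since \<open>sg\<close> is an involution, the sign can be moved to the bounding
    chain.\<close>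
  then have "nd ?P (Suc ?m) \<cdot> sg (s \<cdot> c) = c"
    using sg(3)[OF sc(1) d1(1)] sc d1(2) dsc by simp
  then have "covered (nd ?P (Suc ?m)) c"
    using sg(1)[OF sc(1)] sc c d1(2) by (intro coveredI'[of _ "sg (s \<cdot> c)"]) auto
  then have "a \<cdot> e = Zro A (Dom A e) (Cod A a)"
    using cls_Zro_iff[OF X e(4)] e ca by simp
  then show ?thesis using epi_Zro[OF e(1) a(1)] e(3) by simp
qed

end

end

section \<open>The comparison theorem\<close>

context category
begin

lemma colimitD:
  assumes "is_colimit D C F L \<iota>"
  shows "L \<in> Obj C" "d \<in> Obj D \<Longrightarrow> \<iota> d \<in> Arr C" "d \<in> Obj D \<Longrightarrow> Dom C (\<iota> d) = FObj F d"
    "d \<in> Obj D \<Longrightarrow> Cod C (\<iota> d) = L"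
    "e \<in> Arr D \<Longrightarrow> \<iota> (Cod D e) \<cdot> FArr F e = \<iota> (Dom D e)"
  using assms by (auto simp: is_colimit_def in_Hom)

lemma colimit_desc:
  assumes c: "is_colimit D C F L \<iota>" and Y: "Y \<in> Obj C"
    and g: "\<And>d. d \<in> Obj D \<Longrightarrow> g d \<in> Arr C \<and> Dom C (g d) = FObj F d \<and> Cod C (g d) = Y"
      "\<And>e. e \<in> Arr D \<Longrightarrow> g (Cod D e) \<cdot> FArr F e = g (Dom D e)"
  shows "\<exists>!h. h \<in> Hom C L Y \<and> (\<forall>d\<in>Obj D. h \<cdot> \<iota> d = g d)"
proof -
  have "(\<forall>d\<in>Obj D. g d \<in> Hom C (FObj F d) Y) \<and> (\<forall>e\<in>Arr D. g (Cod D e) \<cdot> FArr F e = g (Dom D e))"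
    using g by (auto simp: in_Hom)
  then show ?thesis using c Y unfolding is_colimit_def by blast
qed

lemma colimit_ext:
  assumes c: "is_colimit D C F L \<iota>" and D: "\<And>e. e \<in> Arr D \<Longrightarrow> Dom D e \<in> Obj D \<and> Cod D e \<in> Obj D"
    and F: "\<And>e. e \<in> Arr D \<Longrightarrow> FArr F e \<in> Arr C \<and> Cod C (FArr F e) = FObj F (Cod D e)"
    and h: "h \<in> Arr C" "h' \<in> Arr C" "Dom C h = L" "Dom C h' = L" "Cod C h = Cod C h'"
      "\<And>d. d \<in> Obj D \<Longrightarrow> h \<cdot> \<iota> d = h' \<cdot> \<iota> d"
  shows "h = h'"
proof -
  note cD = colimitD[OF c]
  have "\<exists>!k. k \<in> Hom C L (Cod C h') \<and> (\<forall>d\<in>Obj D. k \<cdot> \<iota> d = h' \<cdot> \<iota> d)"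
  proof (rule colimit_desc[OF c])
    fix e assume e: "e \<in> Arr D"
    have "h' \<cdot> \<iota> (Cod D e) \<cdot> FArr F e = h' \<cdot> \<iota> (Dom D e)" using cD(5)[OF e] by simp
    then show "(h' \<cdot> \<iota> (Cod D e)) \<cdot> FArr F e = h' \<cdot> \<iota> (Dom D e)"
      using D[OF e] F[OF e] cD(2-4)[of "Cod D e"] h by simp
  qed (use h cD in auto)
  moreover have "h \<in> Hom C L (Cod C h')" "h' \<in> Hom C L (Cod C h')" using h by (auto simp: in_Hom)
  ultimately show ?thesis using h(6) by blast
qed

end

context cubical_coefficients
begin

text \<open>Cubical homology takes the role of the effaceable partial functor, with the counits of
  the Kan extension as covers and the comparison of two colimits in degree 0.\<close>

theorem cubical_homology_satellites:
  assumes T: "left_satellites_of_colimit (op_cat C) A T \<delta>" and F: "is_functor (op_cat C) A F"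
  shows "isomorphic A (cubical_homology A X (GF F) n) (FObj (T n) F)"
proof -
  \<comment> \<open>The comparison in degree 0 is a natural transformation between functors from
    \<open>K\<close> to \<open>A\<close>, so it lives in this second functor category.\<close>
  interpret W: functors_into_abelian K A ..
  have Tu: "universal_homological_partial_functor K A T \<delta>" and Tc: "is_colimit_functor (op_cat C) A (T 0)"
    using T by (auto simp: left_satellites_of_colimit_def)
  obtain \<iota> where \<iota>: "\<And>F. is_functor (op_cat C) A F \<Longrightarrow> is_colimit (op_cat C) A F (FObj (T 0) F) (\<iota> F)"
    "\<And>F \<eta> G d. is_nat_trans (op_cat C) A (F, \<eta>, G) \<Longrightarrow> d \<in> Obj (op_cat C) \<Longrightarrow>
       FArr (T 0) (F, \<eta>, G) \<cdot> \<iota> F d = \<iota> G d \<cdot> \<eta> d"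
    using Tc unfolding is_colimit_functor_def by blast
  have T0: "is_functor K A (T 0)" using Tc by (simp add: is_colimit_functor_def)
  have H0: "is_functor K A (cub_homology 0)" using cub_homology_additive by (simp add: is_additive_functor_def)
  have \<iota>n: "FArr (T 0) \<alpha> \<cdot> \<iota> (Dom K \<alpha>) c = \<iota> (Cod K \<alpha>) c \<cdot> \<alpha> $ c" if "\<alpha> \<in> Arr K" "c \<in> Obj C" for \<alpha> c
  proof -
    obtain F \<eta> G where a: "\<alpha> = (F, \<eta>, G)" by (rule prod_cases3)
    show ?thesis using \<iota>(2)[of F \<eta> G c] that unfolding a K_triple K_arr_triple by simp
  qed
  have Hcol: "is_colimit (op_cat C) A F (FObj (cub_homology 0) F) (H0_in F)" if "is_functor (op_cat C) A F" for F
    using H0_colimit[OF that] cub_homology_simps(1)[OF that] by simp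
  have Fe: "\<And>e. e \<in> Arr (op_cat C) \<Longrightarrow> FArr F e \<in> Arr A \<and> Cod A (FArr F e) = FObj F (Cod (op_cat C) e)"
    if "is_functor (op_cat C) A F" for F
    using functorD(2,4)[OF that] by blast
  note De = D.Dom_Obj D.Cod_Obj
  \<comment> \<open>Degree 0 homology and \<open>T 0\<close> are both colimits of \<open>F\<close>,
    with cocones \<open>H0_in F\<close> and \<open>\<iota> F\<close>. \<open>a F\<close> is the
    induced comparison; its naturality and invertibility follow from uniqueness out of a
    colimit.\<close>
  define a where "a F = (THE h. h \<in> Hom A (FObj (cub_homology 0) F) (FObj (T 0) F) \<and>
     (\<forall>c\<in>Obj (op_cat C). h \<cdot> H0_in F c = \<iota> F c))" for F
  have a: "a F \<in> Arr A" "Dom A (a F) = FObj (cub_homology 0) F" "Cod A (a F) = FObj (T 0) F"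
    "\<And>c. c \<in> Obj C \<Longrightarrow> a F \<cdot> H0_in F c = \<iota> F c" if F: "is_functor (op_cat C) A F" for F
  proof -
    have "\<exists>!h. h \<in> Hom A (FObj (cub_homology 0) F) (FObj (T 0) F) \<and> (\<forall>c\<in>Obj (op_cat C). h \<cdot> H0_in F c = \<iota> F c)"
      by (rule colimit_desc[OF Hcol[OF F]]) (use colimitD[OF \<iota>(1)[OF F]] in auto)
    from theI'[OF this] show "a F \<in> Arr A" "Dom A (a F) = FObj (cub_homology 0) F" "Cod A (a F) = FObj (T 0) F"
      "\<And>c. c \<in> Obj C \<Longrightarrow> a F \<cdot> H0_in F c = \<iota> F c"
      unfolding a_def[symmetric] by (auto simp: in_Hom)
  qed
  let ?\<alpha> = "(cub_homology 0, restrict a (Obj K), T 0)"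
  have \<alpha>: "?\<alpha> \<in> Arr W.K"
  proof (rule W.K_arrI[OF H0 T0])
    fix \<beta> assume b: "\<beta> \<in> Arr K"
    note bD = K_arrD[OF b] note F = bD(1) and G = bD(2)
    note HD = W.functorD(2-4)[OF H0 b] and TD = W.functorD(2-4)[OF T0 b]
    show "a (Cod K \<beta>) \<cdot> FArr (cub_homology 0) \<beta> = FArr (T 0) \<beta> \<cdot> a (Dom K \<beta>)"
    proof (rule colimit_ext[OF Hcol[OF F] _ Fe[OF F]])
      fix c assume "c \<in> Obj (op_cat C)"
      then have c: "c \<in> Obj C" by simp
      note hF = colimitD(2-4)[OF Hcol[OF F], of c] and hG = colimitD(2-4)[OF Hcol[OF G], of c]
      have bc: "\<beta> $ c \<in> Arr A" "Cod A (\<beta> $ c) = FObj (Cod K \<beta>) c" using bD(3,5) c by auto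
      have "(a (Cod K \<beta>) \<cdot> FArr (cub_homology 0) \<beta>) \<cdot> H0_in (Dom K \<beta>) c = a (Cod K \<beta>) \<cdot> H0_in (Cod K \<beta>) c \<cdot> \<beta> $ c"
        using H0_natural[OF b c] a(1-3)[OF G] HD hF c by simp
      also have "\<dots> = \<iota> (Cod K \<beta>) c \<cdot> \<beta> $ c"
        by (rule Comp_eq_extend[OF a(4)[OF G c]]) (use a(1-3)[OF G] hG c bc in auto)
      also have "\<dots> = FArr (T 0) \<beta> \<cdot> a (Dom K \<beta>) \<cdot> H0_in (Dom K \<beta>) c"
        using \<iota>n[OF b c] a(4)[OF F c] by simp
      finally show "(a (Cod K \<beta>) \<cdot> FArr (cub_homology 0) \<beta>) \<cdot> H0_in (Dom K \<beta>) c = (FArr (T 0) \<beta> \<cdot> a (Dom K \<beta>)) \<cdot> H0_in (Dom K \<beta>) c"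
        using a(1-3)[OF F] TD hF c by simp
    qed (use De a(1-3)[OF F] a(1-3)[OF G] HD TD in auto)
  qed (use a in auto)
  have iso: "\<exists>b. b \<in> Hom A (FObj (T 0) F) (FObj (cub_homology 0) F) \<and>
      b \<cdot> component ?\<alpha> F = Ident A (FObj (cub_homology 0) F) \<and> component ?\<alpha> F \<cdot> b = Ident A (FObj (T 0) F)"
    if "F \<in> Obj K" for F
  proof -
    have F: "is_functor (op_cat C) A F" using that by simp
    note H = Hcol[OF F] and L = \<iota>(1)[OF F]
    have "\<exists>!h. h \<in> Hom A (FObj (T 0) F) (FObj (cub_homology 0) F) \<and> (\<forall>c\<in>Obj (op_cat C). h \<cdot> \<iota> F c = H0_in F c)"
      by (rule colimit_desc[OF L]) (use colimitD[OF H] in auto)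
    then obtain b where b: "b \<in> Arr A" "Dom A b = FObj (T 0) F" "Cod A b = FObj (cub_homology 0) F"
      "\<And>c. c \<in> Obj C \<Longrightarrow> b \<cdot> \<iota> F c = H0_in F c" by (auto simp: in_Hom)
    note aF = a[OF F]
    have "b \<cdot> a F = Ident A (FObj (cub_homology 0) F)"
      by (rule colimit_ext[OF H _ Fe[OF F]]) (use De aF b colimitD[OF H] in auto)
    moreover have "a F \<cdot> b = Ident A (FObj (T 0) F)"
      by (rule colimit_ext[OF L _ Fe[OF F]]) (use De aF b colimitD[OF L] in auto)
    moreover have "component ?\<alpha> F = a F" using that by (simp add: component_def)
    ultimately show ?thesis using b by (intro exI[of _ b]) (simp add: in_Hom)
  qed
  \<comment> \<open>Kernels of the counits, chosen once for each functor, complete the covers to the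
    canonical short exact sequences.\<close>
  define k where "k F = (SOME \<kappa>. short_exact K \<kappa> (cover F))" for F
  have k: "short_exact K (k F) (cover F)" if "F \<in> Obj K" for F
  proof -
    have F: "is_functor (op_cat C) A F" using that by simp
    have "\<exists>\<kappa>. short_exact K \<kappa> (cover F)"
      using ex_short_exact_K[OF cover(1)[OF F]] cover(5)[OF F] by (metis op_cat_simps(1))
    then show ?thesis unfolding k_def by (rule someI_ex)
  qed
  interpret E: effaceable_partial_functor K A cub_homology T cub_connecting \<delta> ?\<alpha> k cover
  proof
    show "homological_partial_functor K A cub_homology cub_connecting" by (rule cub_homology_partial_functor)
    show "universal_homological_partial_functor K A T \<delta>" by (rule Tu)
    show "?\<alpha> \<in> Hom (functor_category K A) (cub_homology 0) (T 0)" using \<alpha> by (simp add: in_Hom)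
    fix F assume FK: "F \<in> Obj K"
    then have F: "is_functor (op_cat C) A F" by simp
    show "\<exists>b. b \<in> Hom A (FObj (T 0) F) (FObj (cub_homology 0) F) \<and>
      b \<cdot> component ?\<alpha> F = Ident A (FObj (cub_homology 0) F) \<and> component ?\<alpha> F \<cdot> b = Ident A (FObj (T 0) F)"
      by (rule iso[OF FK])
    show "short_exact K (k F) (cover F)" by (rule k[OF FK])
    show "Cod K (cover F) = F" by (rule cover(3)[OF F])
    fix b n assume "b \<in> Arr A" "Cod A b = FObj (cub_homology (Suc n)) (Dom K (cover F))"
    then show "b = Zro A (Dom A b) (Cod A b)" using cub_homology_acyclic[OF F] cover(2)[OF F] by simp
  next
    fix u assume u: "u \<in> Arr K"
    note uD = K_arrD[OF u]
    show "\<exists>v. v \<in> Hom K (Dom K (cover (Dom K u))) (Dom K (cover (Cod K u))) \<and>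
      Comp K (cover (Cod K u)) v = Comp K u (cover (Dom K u))"
      using cover_map[OF u] cover(2)[OF uD(1)] cover(2)[OF uD(2)] by (intro exI[of _ "cover_map u"]) simp
  next
    fix f g assume s: "short_exact K f g"
    note t = short_exact_K_D(1-3)[OF s] note gD = K_arrD[OF t(2)]
    note P = cover[OF gD(1)] note c = Comp_K[OF P(1) t(2) P(3)]
    \<comment> \<open>At each object both \<open>g\<close> and the counit are epimorphisms, hence so
      is their composite, and its objectwise kernel completes it to a short exact sequence.\<close>
    have "is_epi A (Comp K g (cover (Dom K g)) $ d)" if d: "d \<in> Obj (op_cat C)" for d
    proof -
      have "is_epi A (g $ d)"
        using short_exact_K_D(4)[OF s d] cokernel_epi by (auto simp: short_exact_def)
      then show ?thesis
        unfolding c(4)[OF d] using P(5) d gD(4)[OF d] K_arrD(5)[OF P(1) d] P(3)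
        by (intro epi_Comp) auto
    qed
    then show "\<exists>k'. short_exact K k' (Comp K g (cover (Dom K g)))"
      using ex_short_exact_K[OF c(1)] by blast
  qed
  have "F \<in> Obj K" using F by simp
  from E.isomorphic_satellites[OF this, of n]
  show ?thesis using cub_homology_simps(1)[OF F, of n] by (simp add: cubical_homology_def)
qed

end

theorem corollary5p6:
  fixes C :: "('c, 'e) cat" and A :: "('o, 'm) abcat"
    and F :: "('c, 'e, 'o, 'm) cfunctor"
  assumes "small_category TYPE('u::infinite) C"
    and "AB4_category TYPE('u) A"
    and "left_satellites_of_colimit (op_cat C) A T \<delta>"
    and "is_functor (op_cat C) A F"
  shows "\<forall>n. isomorphic A
    (cubical_homology A (cubical_nerve C)
      (functor_comp (op_cat (cubes_over (cubical_nerve C))) F (boundary_functor C)) n)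
    (FObj (T n) F)"
proof -
  have C: "category C" "small TYPE('u) (Arr C)" using assms(1) by (auto simp: small_category_def)
  have A: "abelian_category A" "has_small_coproducts TYPE('u) A" "small_coproducts_exact TYPE('u) A"
    using assms(2) by (auto simp: AB4_category_def)
  interpret cubical_coefficients C A "TYPE('u)"
    using C A by (simp add: cubical_coefficients_def cubical_coefficients_axioms_def)
  show ?thesis using cubical_homology_satellites[OF assms(3,4)] by blast
qed

end
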